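(* Let $M$ and $F$ be compact manifolds, and let $h:\pi_1(M)\to \operatorname{Homeo}(F)$ be a homomorphism. Suppose that $h(\pi_1(M))$ is a Rohlin group, that the induced action of $\pi_1(M)$ on $F$ is free, and that there exists an invariant regular probability measure $\Lambda$ on $F$. Let $\widetilde M\times_h F$ denote also the suspension lamination with the transverse invariant measure $\Lambda$, and assume that its $\Lambda$-category $\operatorname{Cat}(\widetilde M\times_h F,\Lambda)$ is zero (so that the secondary $\Lambda$-category is defined). Then $$\operatorname{Cat}_{\mathrm{II}}(\widetilde{M}\times_h F,\Lambda)=\operatorname{growth}(h(\pi_1(M))).$$
   Context: **Suspension.** $\widetilde M$ is the universal cover of $M$; $\widetilde M\times_hF$ is the quotient of $\widetilde M\times F$ by the diagonal action of $\pi_1(M)$ (deck transformations on $\widetilde M$, $h$ on $F$), foliated by the images of the sets $\widetilde M\times\{y\}$, $y\in F$. Each fiber over $M$ is a complete transversal homeomorphic to $F$, on which the holonomy is given by $h(\pi_1(M))$; hence an invariant measure on $F$ is a transverse invariant measure. **Rohlin groups.** Let $G$ be a locally compact, second countable, Hausdorff topological group acting on a standard Borel space $Y$ with an invariant probability measure $\Lambda$, and let $E\subset G$ be Borel. A Borel set $V\subset Y$ is an $E$-base if $EV=\bigcup_{f\in E}f(V)$ is Borel, $\Lambda(EV)>0$ and the sets $f(V)$, $f\in E$, are pairwise disjoint; then $EV$ is called an $E$-tower. A relatively compact set $E\subset G$ is a Rohlin set if, for every free action of $G$ on a standard Borel space $Y$ with an invariant probability measure $\Lambda$ and every $\varepsilon>0$,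 there is an $E$-tower $EV\subset Y$ with $\Lambda(EV)>1-\varepsilon$. $G$ is a Rohlin group if every compact $K\subset G$ is contained in a Rohlin set. Here $h(\pi_1(M))$ is considered as a discrete group. **Laminations.** A foliated chart of a Polish space $X$ is a pair $(U,\varphi)$ with $U\subset X$ open and $\varphi:U\to B^n\times S$ a homeomorphism, where $B^n$ is an open ball of $\mathbb R^n$ and $S$ is Polish; its plaques are the sets corresponding to $B^n\times\{s\}$. A foliated atlas is a family of foliated charts $(U_i,\varphi_i)$ covering $X$ whose changes of coordinates are locally of the form $(x,s)\mapsto(f_{ij}(x,s),g_{ij}(s))$; a lamination $\mathcal F$ is a maximal foliated atlas. The plaques form a base of the leaf topology, whose connected components are the leaves. A foliated atlas is regular if: (a) it is locally finite; (b) if a plaque $P$ of a chart $U_i$ meets another chart $U_j$, then $P\cap U_j$ is contained in only one plaque of $U_j$; (c) if $U_i\cap U_j\ne\emptyset$, there is a foliated chart $(V,\psi)$ with $U_i\cup U_j\subset V$, $\varphi_i=\psi|_{U_i}$, $\varphi_j=\psi|_{U_j}$. A transverse invariant measure is a measure on a complete transversal invariant by holonomy; it extends to all transverse sets (measurable sets meeting each leaf in a countable set), invariantly under measurable transformations keeping each point in its leaf. A measure is regular if the measure of each measurable set $B$ is the infimum of the measures of open sets containing $B$ and the supremum of the measures of compact sets contained in $B$. **$\Lambda$-category.** For $U\subset X$ open, $\mathcal F_U$ is the restriction of $\mathcal F$ to $U$, and $U\times\mathbb R$ is foliated by the products of leaves of $\mathcal F_U$ with $\mathbb R$. A tangential deformation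 of $U$ is a continuous foliated map (taking leaves into leaves) $H:U\times\mathbb R\to X$ with $H(-,0)$ the inclusion. It is a tangential contraction if $H(-,1)$ is constant on each leaf of $\mathcal F_U$; then $U$ is called tangentially categorical, and $H(U\times\{1\})$ is a transverse set. Put $\tau_\Lambda(U)=\inf_H\Lambda(H(U\times\{1\}))$ over tangential contractions $H$ of $U$, and $\operatorname{Cat}(\mathcal F,\Lambda)=\inf_{\mathcal V}\sum_{U\in\mathcal V}\tau_\Lambda(U)$ over coverings $\mathcal V$ of $X$ by tangentially categorical open sets. **Secondary $\Lambda$-category** ($X$ compact, $\Lambda$ regular and finite on compact sets, $\operatorname{Cat}(\mathcal F,\Lambda)=0$). Fix a finite regular atlas $\mathcal U$. A chain of plaques is a finite sequence of plaques of charts of $\mathcal U$, each meeting the next one; its length is its number of elements plus one. The length of a path in a leaf is the minimum length of a chain of plaques covering it; the length of a tangential deformation is the supremum of the lengths of the leafwise paths $t\mapsto H(x,t)$, $t\in[0,1]$. $\operatorname{Cat}(\mathcal F,\Lambda,n,\mathcal U)$ is defined like $\operatorname{Cat}(\mathcal F,\Lambda)$ using only tangential contractions of length $\le n$; it is regarded as a non-increasing sequence of positive numbers converging to $0$ (with $1/\infty=0$). **Growth types.** For non-decreasing $g,k:\mathbb N\to[0,\infty)$, $\mathbb N=\{1,2,\dots\}$, write $g\preceq k$ if there are $B\in\mathbb N$, $A>0$ with $g(n)\le A\,k(Bn)$ for all $n$; $g\simeq k$ means $g\preceq k\preceq g$. Classes $[g]$ are growth types. $\operatorname{Cat}_{\mathrm{II}}(\mathcal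 F,\Lambda)=[1/\operatorname{Cat}(\mathcal F,\Lambda,n,\mathcal U)]$, which does not depend on the finite regular atlas $\mathcal U$. For a finitely generated group $G$ with finite symmetric generating set $S$ (containing the identity and closed under inverses), $S_n$ is the set of products of at most $n$ elements of $S$, and $\operatorname{growth}(G)=[\#S_n]$, independent of $S$.
   Formalization: In condition (c) of a regular atlas, φ_i = ψ|U_i is read up to leafwise change of coordinates (plaques of U_i are traces on U_i of plaques of V); literally, no finite regular atlas exists on a compact lamination of positive dimension. *)

theory Defs
  imports "HOL-Analysis.Analysis" "HOL-Probability.Probability" "HOL-Algebra.Group_Action"
    "HOL-Algebra.Generated_Groups"
begin

section \<open>Topological and measure-theoretic preliminaries\<close>

text \<open>Spaces are topologies on carriers (type \<^typ>\<open>'a topology\<close>), so that dimensions of manifolds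
  are ordinary natural numbers and quotients need no new types.\<close>

definition topological_manifold :: "nat \<Rightarrow> 'a topology \<Rightarrow> bool" where
  "topological_manifold n M \<longleftrightarrow>
     Hausdorff_space M \<and> second_countable M \<and>
     (\<forall>x\<in>topspace M. \<exists>U V. openin M U \<and> x \<in> U \<and> openin (Euclidean_space n) V \<and>
        subtopology M U homeomorphic_space subtopology (Euclidean_space n) V)"

definition compact_manifold :: "nat \<Rightarrow> 'a topology \<Rightarrow> bool" where
  "compact_manifold n M \<longleftrightarrow> topological_manifold n M \<and> compact_space M"

definition polish_topology :: "'a topology \<Rightarrow> bool" where
  "polish_topology T \<longleftrightarrow> completely_metrizable_space T \<and> second_countable T"

definition borel_of :: "'a topology \<Rightarrow> 'a measure" where
  "borel_of T = sigma (topspace T) {U. openin T U}"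

definition standard_borel :: "'a measure \<Rightarrow> bool" where
  "standard_borel Y \<longleftrightarrow>
     (\<exists>T. polish_topology T \<and> topspace T = space Y \<and> sets Y = sets (borel_of T))"

definition regular_measure :: "'a topology \<Rightarrow> 'a measure \<Rightarrow> bool" where
  "regular_measure T \<mu> \<longleftrightarrow>
     (\<forall>B\<in>sets \<mu>.
        emeasure \<mu> B = (INF U\<in>{U. openin T U \<and> B \<subseteq> U}. emeasure \<mu> U) \<and>
        emeasure \<mu> B = (SUP K\<in>{K. compactin T K \<and> K \<subseteq> B}. emeasure \<mu> K))"

definition quotient_topology :: "'a topology \<Rightarrow> ('a \<Rightarrow> 'b) \<Rightarrow> 'b topology" where
  "quotient_topology T q =
     topology (\<lambda>U. U \<subseteq> q ` topspace T \<and> openin T {z \<in> topspace T. q z \<in> U})"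

lemma openin_quotient_topology:
  "openin (quotient_topology T q) U \<longleftrightarrow>
     U \<subseteq> q ` topspace T \<and> openin T {z \<in> topspace T. q z \<in> U}"
proof -
  have "istopology (\<lambda>U. U \<subseteq> q ` topspace T \<and> openin T {z \<in> topspace T. q z \<in> U})"
    unfolding istopology_def
  proof (intro conjI allI impI)
    fix U V
    assume U: "U \<subseteq> q ` topspace T \<and> openin T {z \<in> topspace T. q z \<in> U}"
      and V: "V \<subseteq> q ` topspace T \<and> openin T {z \<in> topspace T. q z \<in> V}"
    show "U \<inter> V \<subseteq> q ` topspace T" using U by blast
    have "{z \<in> topspace T. q z \<in> U \<inter> V} =
        {z \<in> topspace T. q z \<in> U} \<inter> {z \<in> topspace T. q z \<in> V}" by blast
    then show "openin T {z \<in> topspace T. q z \<in> U \<inter> V}" using U V by (simp add: openin_Int)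
  next
    fix \<K>
    assume K: "\<forall>K\<in>\<K>. K \<subseteq> q ` topspace T \<and> openin T {z \<in> topspace T. q z \<in> K}"
    show "\<Union>\<K> \<subseteq> q ` topspace T" using K by blast
    have "{z \<in> topspace T. q z \<in> \<Union>\<K>} = (\<Union>K\<in>\<K>. {z \<in> topspace T. q z \<in> K})" by blast
    then show "openin T {z \<in> topspace T. q z \<in> \<Union>\<K>}" using K by auto
  qed
  then show ?thesis unfolding quotient_topology_def by (simp add: topology_inverse')
qed

lemma topspace_quotient_topology: "topspace (quotient_topology T q) = q ` topspace T"
proof -
  have "{z \<in> topspace T. q z \<in> q ` topspace T} = topspace T" by blast
  then have "openin (quotient_topology T q) (q ` topspace T)"
    by (simp add: openin_quotient_topology)
  then show ?thesis by (meson openin_quotient_topology openin_subset openin_topspace subset_antisym)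
qed

section \<open>Fundamental group, universal cover, deck transformations\<close>

definition path_homotopic :: "'a topology \<Rightarrow> (real \<Rightarrow> 'a) \<Rightarrow> (real \<Rightarrow> 'a) \<Rightarrow> bool" where
  "path_homotopic X f g \<longleftrightarrow>
     homotopic_with (\<lambda>r. r 0 = f 0 \<and> r 1 = f 1) (top_of_set {0..1}) X f g"

definition path_join :: "(real \<Rightarrow> 'a) \<Rightarrow> (real \<Rightarrow> 'a) \<Rightarrow> real \<Rightarrow> 'a" where
  "path_join f g = (\<lambda>t. if t \<le> 1/2 then f (2 * t) else g (2 * t - 1))"

definition loops :: "'a topology \<Rightarrow> 'a \<Rightarrow> (real \<Rightarrow> 'a) set" where
  "loops X x0 = {f. pathin X f \<and> f 0 = x0 \<and> f 1 = x0}"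

definition fundamental_group :: "'a topology \<Rightarrow> 'a \<Rightarrow> (real \<Rightarrow> 'a) set monoid" where
  "fundamental_group X x0 =
     \<lparr>carrier = loops X x0 // {(f, g). f \<in> loops X x0 \<and> g \<in> loops X x0 \<and> path_homotopic X f g},
      mult = (\<lambda>a b. {k \<in> loops X x0. \<exists>f\<in>a. \<exists>g\<in>b. path_homotopic X (path_join f g) k}),
      one = {k \<in> loops X x0. path_homotopic X (\<lambda>_. x0) k}\<rparr>"

definition simply_connected_space :: "'a topology \<Rightarrow> bool" where
  "simply_connected_space X \<longleftrightarrow>
     path_connected_space X \<and>
     (\<forall>x\<in>topspace X. \<forall>f\<in>loops X x. path_homotopic X f (\<lambda>_. x))"

definition covering_projection :: "'e topology \<Rightarrow> 'a topology \<Rightarrow> ('e \<Rightarrow> 'a) \<Rightarrow> bool" where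
  "covering_projection E M p \<longleftrightarrow>
     continuous_map E M p \<and> p ` topspace E = topspace M \<and>
     (\<forall>x\<in>topspace M. \<exists>T. openin M T \<and> x \<in> T \<and>
        (\<exists>\<V>. \<Union>\<V> = {e \<in> topspace E. p e \<in> T} \<and> (\<forall>V\<in>\<V>. openin E V) \<and> pairwise disjnt \<V> \<and>
             (\<forall>V\<in>\<V>. homeomorphic_map (subtopology E V) (subtopology M T) p)))"

definition universal_cover :: "'e topology \<Rightarrow> 'a topology \<Rightarrow> ('e \<Rightarrow> 'a) \<Rightarrow> bool" where
  "universal_cover E M p \<longleftrightarrow> covering_projection E M p \<and> simply_connected_space E"

text \<open>The action of the fundamental group of \<open>M\<close> at \<open>p e0\<close> on a universal cover: the class \<open>a\<close> acts
  as the unique deck transformation sending \<open>e0\<close> to the end point of the lifts, starting at \<open>e0\<close>, of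
  the loops in \<open>a\<close>. With the above order of concatenation this is a left action.\<close>

definition deck_action :: "'e topology \<Rightarrow> ('e \<Rightarrow> 'a) \<Rightarrow> 'e \<Rightarrow> (real \<Rightarrow> 'a) set \<Rightarrow> 'e \<Rightarrow> 'e" where
  "deck_action E p e0 a =
     (THE d. d \<in> extensional (topspace E) \<and> homeomorphic_map E E d \<and>
        (\<forall>e\<in>topspace E. p (d e) = p e) \<and>
        (\<exists>f\<in>a. \<exists>c. pathin E c \<and> c 0 = e0 \<and> (\<forall>t\<in>{0..1}. p (c t) = f t) \<and> c 1 = d e0))"

definition homeo_group :: "'a topology \<Rightarrow> ('a \<Rightarrow> 'a) monoid" where
  "homeo_group F =
     (BijGroup (topspace F))\<lparr>carrier := {f \<in> Bij (topspace F). homeomorphic_map F F f}\<rparr>"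

section \<open>Rohlin groups\<close>

definition lcsc_group :: "('g, 'b) monoid_scheme \<Rightarrow> 'g topology \<Rightarrow> bool" where
  "lcsc_group G T \<longleftrightarrow>
     group G \<and> topspace T = carrier G \<and>
     continuous_map (prod_topology T T) T (\<lambda>(x, y). x \<otimes>\<^bsub>G\<^esub> y) \<and>
     continuous_map T T (\<lambda>x. inv\<^bsub>G\<^esub> x) \<and>
     locally_compact_space T \<and> second_countable T \<and> Hausdorff_space T"

definition free_action :: "('g, 'b) monoid_scheme \<Rightarrow> 'y set \<Rightarrow> ('g \<Rightarrow> 'y \<Rightarrow> 'y) \<Rightarrow> bool" where
  "free_action G Y \<phi> \<longleftrightarrow> (\<forall>y\<in>Y. stabilizer G \<phi> y = {\<one>\<^bsub>G\<^esub>})"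

definition invariant_measure :: "('g, 'b) monoid_scheme \<Rightarrow> ('g \<Rightarrow> 'y \<Rightarrow> 'y) \<Rightarrow> 'y measure \<Rightarrow> bool" where
  "invariant_measure G \<phi> \<mu> \<longleftrightarrow>
     (\<forall>g\<in>carrier G. \<forall>B\<in>sets \<mu>. \<phi> g ` B \<in> sets \<mu> \<and> emeasure \<mu> (\<phi> g ` B) = emeasure \<mu> B)"

definition borel_action ::
  "('g, 'b) monoid_scheme \<Rightarrow> 'g topology \<Rightarrow> 'y measure \<Rightarrow> ('g \<Rightarrow> 'y \<Rightarrow> 'y) \<Rightarrow> bool" where
  "borel_action G T Y \<phi> \<longleftrightarrow>
     group_action G (space Y) \<phi> \<and> (\<lambda>(g, y). \<phi> g y) \<in> measurable (borel_of T \<Otimes>\<^sub>M Y) Y"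

definition tower :: "('g \<Rightarrow> 'y \<Rightarrow> 'y) \<Rightarrow> 'g set \<Rightarrow> 'y set \<Rightarrow> 'y set" where
  "tower \<phi> E V = (\<Union>f\<in>E. \<phi> f ` V)"

definition tower_base :: "'y measure \<Rightarrow> ('g \<Rightarrow> 'y \<Rightarrow> 'y) \<Rightarrow> 'g set \<Rightarrow> 'y set \<Rightarrow> bool" where
  "tower_base Y \<phi> E V \<longleftrightarrow>
     V \<in> sets Y \<and> tower \<phi> E V \<in> sets Y \<and> emeasure Y (tower \<phi> E V) > 0 \<and>
     disjoint_family_on (\<lambda>f. \<phi> f ` V) E"

text \<open>Every standard Borel space is isomorphic to one carried by a set of real numbers, so it is no
  restriction to let \<open>Y\<close> range over the standard Borel spaces whose points are reals.\<close>

definition rohlin_set :: "('g, 'b) monoid_scheme \<Rightarrow> 'g topology \<Rightarrow> 'g set \<Rightarrow> bool" where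
  "rohlin_set G T E \<longleftrightarrow>
     E \<in> sets (borel_of T) \<and> compactin T (T closure_of E) \<and>
     (\<forall>(Y :: real measure) \<phi> (\<epsilon>::real).
        standard_borel Y \<longrightarrow> prob_space Y \<longrightarrow> borel_action G T Y \<phi> \<longrightarrow>
        free_action G (space Y) \<phi> \<longrightarrow> invariant_measure G \<phi> Y \<longrightarrow> \<epsilon> > 0 \<longrightarrow>
        (\<exists>V. tower_base Y \<phi> E V \<and> measure Y (tower \<phi> E V) > 1 - \<epsilon>))"

definition rohlin_group :: "('g, 'b) monoid_scheme \<Rightarrow> 'g topology \<Rightarrow> bool" where
  "rohlin_group G T \<longleftrightarrow>
     lcsc_group G T \<and> (\<forall>K. compactin T K \<longrightarrow> (\<exists>E. rohlin_set G T E \<and> K \<subseteq> E))"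

section \<open>Laminations\<close>

text \<open>A chart maps \<open>chart_dom\<close> onto \<open>chart_ball \<times> chart_trans\<close>. Every Polish space has at most
  continuum many points, so up to renaming of points the transverse models are the Polish topologies
  on sets of real numbers.\<close>

record 'x fol_chart =
  chart_dom :: "'x set"
  chart_map :: "'x \<Rightarrow> (nat \<Rightarrow> real) \<times> real"
  chart_ball :: "(nat \<Rightarrow> real) set"
  chart_trans :: "real topology"

definition open_ball_of_dim :: "nat \<Rightarrow> (nat \<Rightarrow> real) set \<Rightarrow> bool" where
  "open_ball_of_dim n B \<longleftrightarrow>
     (\<exists>c r. c \<in> topspace (Euclidean_space n) \<and> r > 0 \<and>
        B = {x \<in> topspace (Euclidean_space n). sqrt (\<Sum>i<n. (x i - c i)\<^sup>2) < r})"

definition foliated_chart :: "nat \<Rightarrow> 'x topology \<Rightarrow> 'x fol_chart \<Rightarrow> bool" where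
  "foliated_chart n X c \<longleftrightarrow>
     openin X (chart_dom c) \<and> open_ball_of_dim n (chart_ball c) \<and> polish_topology (chart_trans c) \<and>
     homeomorphic_map (subtopology X (chart_dom c))
       (prod_topology (subtopology (Euclidean_space n) (chart_ball c)) (chart_trans c)) (chart_map c)"

definition plaques :: "'x fol_chart \<Rightarrow> 'x set set" where
  "plaques c = {{x \<in> chart_dom c. snd (chart_map c x) = s} | s. s \<in> topspace (chart_trans c)}"

text \<open>The coordinate change from \<open>c\<close> to \<open>d\<close> is locally of the form \<open>(x, s) \<mapsto> (f (x, s), g s)\<close>,
  i.e. locally the transverse coordinate in \<open>d\<close> is a function of the one in \<open>c\<close>.\<close>

definition foliated_change :: "'x topology \<Rightarrow> 'x fol_chart \<Rightarrow> 'x fol_chart \<Rightarrow> bool" where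
  "foliated_change X c d \<longleftrightarrow>
     (\<forall>u \<in> chart_dom c \<inter> chart_dom d. \<exists>W g. openin X W \<and> u \<in> W \<and> W \<subseteq> chart_dom c \<inter> chart_dom d \<and>
        (\<forall>v\<in>W. snd (chart_map d v) = g (snd (chart_map c v))))"

definition compatible_charts :: "'x topology \<Rightarrow> 'x fol_chart \<Rightarrow> 'x fol_chart \<Rightarrow> bool" where
  "compatible_charts X c d \<longleftrightarrow> foliated_change X c d \<and> foliated_change X d c"

definition foliated_atlas :: "nat \<Rightarrow> 'x topology \<Rightarrow> 'x fol_chart set \<Rightarrow> bool" where
  "foliated_atlas n X \<U> \<longleftrightarrow>
     (\<forall>c\<in>\<U>. foliated_chart n X c) \<and> (\<Union>c\<in>\<U>. chart_dom c) = topspace X \<and>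
     (\<forall>c\<in>\<U>. \<forall>d\<in>\<U>. compatible_charts X c d)"

definition maximal_atlas :: "nat \<Rightarrow> 'x topology \<Rightarrow> 'x fol_chart set \<Rightarrow> 'x fol_chart set" where
  "maximal_atlas n X \<U> = {c. foliated_chart n X c \<and> (\<forall>d\<in>\<U>. compatible_charts X c d)}"

text \<open>From here on a lamination is given by its maximal atlas \<open>\<F>\<close>.\<close>

definition leaf_topology :: "'x fol_chart set \<Rightarrow> 'x topology" where
  "leaf_topology \<F> = topology_generated_by (\<Union>c\<in>\<F>. plaques c)"

definition leaves :: "'x fol_chart set \<Rightarrow> 'x set set" where
  "leaves \<F> = connected_components_of (leaf_topology \<F>)"

definition restrict_lamination :: "'x fol_chart set \<Rightarrow> 'x set \<Rightarrow> 'x fol_chart set" where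
  "restrict_lamination \<F> U = {c \<in> \<F>. chart_dom c \<subseteq> U}"

definition locally_finite_atlas :: "'x topology \<Rightarrow> 'x fol_chart set \<Rightarrow> bool" where
  "locally_finite_atlas X \<U> \<longleftrightarrow>
     (\<forall>x\<in>topspace X. \<exists>W. openin X W \<and> x \<in> W \<and> finite {c \<in> \<U>. chart_dom c \<inter> W \<noteq> {}})"

text \<open>\<open>subchart c d\<close> says that the chart of \<open>c\<close> is the restriction of the one of \<open>d\<close> up to a
  leafwise change of coordinates: the plaques of \<open>c\<close> are traces on its domain of plaques of \<open>d\<close>.
  Literal equality of the coordinate maps cannot be demanded for all pairs of intersecting charts:
  the leafwise coordinates would then glue to a continuous map from the compact space \<open>X\<close> to
  Euclidean space that is open on leaves, which is impossible in positive dimension.\<close>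

definition subchart :: "'x fol_chart \<Rightarrow> 'x fol_chart \<Rightarrow> bool" where
  "subchart c d \<longleftrightarrow>
     chart_dom c \<subseteq> chart_dom d \<and> (\<forall>P\<in>plaques c. \<exists>Q\<in>plaques d. P = chart_dom c \<inter> Q)"

definition regular_atlas :: "nat \<Rightarrow> 'x topology \<Rightarrow> 'x fol_chart set \<Rightarrow> 'x fol_chart set \<Rightarrow> bool" where
  "regular_atlas n X \<F> \<U> \<longleftrightarrow>
     foliated_atlas n X \<U> \<and> \<U> \<subseteq> \<F> \<and> locally_finite_atlas X \<U> \<and>
     (\<forall>c\<in>\<U>. \<forall>d\<in>\<U>. \<forall>P\<in>plaques c. P \<inter> chart_dom d \<noteq> {} \<longrightarrow>
        (\<exists>!Q. Q \<in> plaques d \<and> P \<inter> chart_dom d \<subseteq> Q)) \<and>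
     (\<forall>c\<in>\<U>. \<forall>d\<in>\<U>. chart_dom c \<inter> chart_dom d \<noteq> {} \<longrightarrow>
        (\<exists>v\<in>\<F>. subchart c v \<and> subchart d v))"

text \<open>A transverse invariant measure is given by a complete transversal \<open>\<iota> : space \<Lambda> \<rightarrow> X\<close> and a
  holonomy invariant measure \<open>\<Lambda>\<close> on it. Its extension to a transverse set \<open>T\<close> is obtained by cutting
  \<open>T\<close> into countably many Borel pieces, moving every piece injectively along the leaves into the
  transversal and adding up the measures of the images. All such decompositions give the same value
  by holonomy invariance; the infimum merely selects it.\<close>

definition leafwise_decomposition ::
  "'x topology \<Rightarrow> 'x fol_chart set \<Rightarrow> ('y \<Rightarrow> 'x) \<Rightarrow> 'y measure \<Rightarrow> 'x set \<Rightarrow>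
   (nat \<Rightarrow> 'x set) \<Rightarrow> (nat \<Rightarrow> 'x \<Rightarrow> 'y) \<Rightarrow> bool" where
  "leafwise_decomposition X \<F> \<iota> \<Lambda> T P f \<longleftrightarrow>
     disjoint_family P \<and> (\<Union>i. P i) = T \<and>
     (\<forall>i. P i \<in> sets (borel_of X) \<and>
          f i \<in> measurable (restrict_space (borel_of X) (P i)) \<Lambda> \<and>
          inj_on (f i) (P i) \<and> f i ` P i \<in> sets \<Lambda> \<and>
          (\<forall>x\<in>P i. \<exists>L\<in>leaves \<F>. x \<in> L \<and> \<iota> (f i x) \<in> L))"

definition transverse_extension ::
  "'x topology \<Rightarrow> 'x fol_chart set \<Rightarrow> ('y \<Rightarrow> 'x) \<Rightarrow> 'y measure \<Rightarrow> 'x set \<Rightarrow> ennreal" where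
  "transverse_extension X \<F> \<iota> \<Lambda> T =
     Inf {\<Sum>i. emeasure \<Lambda> (f i ` P i) | P f. leafwise_decomposition X \<F> \<iota> \<Lambda> T P f}"

section \<open>The measured category and its secondary version\<close>

definition tangential_deformation ::
  "'x topology \<Rightarrow> 'x fol_chart set \<Rightarrow> 'x set \<Rightarrow> ('x \<times> real \<Rightarrow> 'x) \<Rightarrow> bool" where
  "tangential_deformation X \<F> U H \<longleftrightarrow>
     continuous_map (prod_topology (subtopology X U) euclideanreal) X H \<and>
     (\<forall>L\<in>leaves (restrict_lamination \<F> U). \<exists>L'\<in>leaves \<F>. H ` (L \<times> UNIV) \<subseteq> L') \<and>
     (\<forall>x\<in>U. H (x, 0) = x)"

definition tangential_contraction ::
  "'x topology \<Rightarrow> 'x fol_chart set \<Rightarrow> 'x set \<Rightarrow> ('x \<times> real \<Rightarrow> 'x) \<Rightarrow> bool" where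
  "tangential_contraction X \<F> U H \<longleftrightarrow>
     tangential_deformation X \<F> U H \<and>
     (\<forall>L\<in>leaves (restrict_lamination \<F> U). \<exists>z. \<forall>x\<in>L. H (x, 1) = z)"

text \<open>In the following, \<open>C U\<close> is the set of admissible contractions of \<open>U\<close>, and \<open>\<mu>\<close> is the (extended)
  transverse measure; the infimum over no coverings is \<open>\<infinity>\<close>.\<close>

definition category_of ::
  "'x topology \<Rightarrow> ('x set \<Rightarrow> ennreal) \<Rightarrow> ('x set \<Rightarrow> ('x \<times> real \<Rightarrow> 'x) set) \<Rightarrow> ennreal" where
  "category_of X \<mu> C =
     (INF \<V>\<in>{\<V>. (\<forall>U\<in>\<V>. openin X U \<and> C U \<noteq> {}) \<and> \<Union>\<V> = topspace X}.
        \<Sum>\<^sub>\<infinity>U\<in>\<V>. (INF H\<in>C U. \<mu> (H ` (U \<times> {1}))))"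

definition Cat :: "'x topology \<Rightarrow> 'x fol_chart set \<Rightarrow> ('x set \<Rightarrow> ennreal) \<Rightarrow> ennreal" where
  "Cat X \<F> \<mu> = category_of X \<mu> (\<lambda>U. {H. tangential_contraction X \<F> U H})"

definition plaque_chain :: "'x fol_chart set \<Rightarrow> 'x set list \<Rightarrow> bool" where
  "plaque_chain \<U> Ps \<longleftrightarrow>
     set Ps \<subseteq> (\<Union>c\<in>\<U>. plaques c) \<and> (\<forall>i. Suc i < length Ps \<longrightarrow> Ps ! i \<inter> Ps ! Suc i \<noteq> {})"

definition leaf_path_length :: "'x fol_chart set \<Rightarrow> (real \<Rightarrow> 'x) \<Rightarrow> enat" where
  "leaf_path_length \<U> c =
     (INF Ps\<in>{Ps. plaque_chain \<U> Ps \<and> c ` {0..1} \<subseteq> \<Union>(set Ps)}. enat (length Ps + 1))"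

definition deformation_length ::
  "'x fol_chart set \<Rightarrow> 'x set \<Rightarrow> ('x \<times> real \<Rightarrow> 'x) \<Rightarrow> enat" where
  "deformation_length \<U> U H = (SUP x\<in>U. leaf_path_length \<U> (\<lambda>t. H (x, t)))"

definition Cat_bounded ::
  "'x topology \<Rightarrow> 'x fol_chart set \<Rightarrow> ('x set \<Rightarrow> ennreal) \<Rightarrow> nat \<Rightarrow> 'x fol_chart set \<Rightarrow> ennreal" where
  "Cat_bounded X \<F> \<mu> n \<U> =
     category_of X \<mu>
       (\<lambda>U. {H. tangential_contraction X \<F> U H \<and> deformation_length \<U> U H \<le> enat n})"

section \<open>Growth types\<close>

text \<open>Sequences are indexed by the positive integers; the value at \<open>0\<close> is irrelevant.\<close>

definition growth_function :: "(nat \<Rightarrow> real) \<Rightarrow> bool" where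
  "growth_function g \<longleftrightarrow> (\<forall>n\<ge>1. 0 \<le> g n) \<and> (\<forall>m\<ge>1. \<forall>n\<ge>m. g m \<le> g n)"

definition growth_le :: "(nat \<Rightarrow> real) \<Rightarrow> (nat \<Rightarrow> real) \<Rightarrow> bool" where
  "growth_le g k \<longleftrightarrow> (\<exists>B\<ge>1. \<exists>A>0. \<forall>n\<ge>1. g n \<le> A * k (B * n))"

definition growth_type :: "(nat \<Rightarrow> real) \<Rightarrow> (nat \<Rightarrow> real) set" where
  "growth_type g = {k. growth_function k \<and> growth_le g k \<and> growth_le k g}"

text \<open>The definite descriptions below refer to the common value for all finite regular atlases,
  respectively all finite symmetric generating sets. Note \<open>1 / \<infinity> = 0\<close> in \<^typ>\<open>ennreal\<close>.\<close>

definition Cat_II ::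
  "nat \<Rightarrow> 'x topology \<Rightarrow> 'x fol_chart set \<Rightarrow> ('x set \<Rightarrow> ennreal) \<Rightarrow> (nat \<Rightarrow> real) set" where
  "Cat_II n X \<F> \<mu> =
     (THE c. \<exists>\<U>. finite \<U> \<and> regular_atlas n X \<F> \<U> \<and>
        c = growth_type (\<lambda>k. enn2real (1 / Cat_bounded X \<F> \<mu> k \<U>)))"

definition symmetric_generating_set :: "('g, 'b) monoid_scheme \<Rightarrow> 'g set \<Rightarrow> bool" where
  "symmetric_generating_set G S \<longleftrightarrow>
     finite S \<and> S \<subseteq> carrier G \<and> \<one>\<^bsub>G\<^esub> \<in> S \<and> (\<forall>s\<in>S. inv\<^bsub>G\<^esub> s \<in> S) \<and> generate G S = carrier G"

definition products_up_to :: "('g, 'b) monoid_scheme \<Rightarrow> 'g set \<Rightarrow> nat \<Rightarrow> 'g set" where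
  "products_up_to G S n =
     {foldr (\<lambda>x y. x \<otimes>\<^bsub>G\<^esub> y) xs \<one>\<^bsub>G\<^esub> | xs. set xs \<subseteq> S \<and> length xs \<le> n}"

definition group_growth :: "('g, 'b) monoid_scheme \<Rightarrow> (nat \<Rightarrow> real) set" where
  "group_growth G =
     (THE c. \<exists>S. symmetric_generating_set G S \<and>
        c = growth_type (\<lambda>n. real (card (products_up_to G S n))))"

section \<open>Suspensions\<close>

text \<open>\<open>G\<close> is the group acting on \<open>E\<close> by \<open>D\<close> and on \<open>F\<close> by \<open>h\<close>; the points of the suspension are
  the orbits of the diagonal action.\<close>

definition diagonal_action ::
  "('g \<Rightarrow> 'e \<Rightarrow> 'e) \<Rightarrow> ('g \<Rightarrow> 'f \<Rightarrow> 'f) \<Rightarrow> 'g \<Rightarrow> 'e \<times> 'f \<Rightarrow> 'e \<times> 'f" where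
  "diagonal_action D h g = (\<lambda>(e, y). (D g e, h g y))"

definition suspension_proj ::
  "('g, 'b) monoid_scheme \<Rightarrow> ('g \<Rightarrow> 'e \<Rightarrow> 'e) \<Rightarrow> ('g \<Rightarrow> 'f \<Rightarrow> 'f) \<Rightarrow> 'e \<times> 'f \<Rightarrow> ('e \<times> 'f) set" where
  "suspension_proj G D h = orbit G (diagonal_action D h)"

definition suspension_space ::
  "('g, 'b) monoid_scheme \<Rightarrow> ('g \<Rightarrow> 'e \<Rightarrow> 'e) \<Rightarrow> ('g \<Rightarrow> 'f \<Rightarrow> 'f) \<Rightarrow>
   'e topology \<Rightarrow> 'f topology \<Rightarrow> ('e \<times> 'f) set topology" where
  "suspension_space G D h E F = quotient_topology (prod_topology E F) (suspension_proj G D h)"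

text \<open>The defining charts: for a coordinate ball \<open>\<kappa> : W \<rightarrow> B\<close> of \<open>E\<close> on which the covering map \<open>p\<close> is
  injective, the image of \<open>W \<times> F\<close> is mapped by \<open>\<kappa>\<close> and by an identification \<open>\<sigma>\<close> of \<open>F\<close> with a
  topology on a set of reals. Their plaques are images of subsets of \<open>E \<times> {y}\<close>.\<close>

definition suspension_charts ::
  "nat \<Rightarrow> ('g, 'b) monoid_scheme \<Rightarrow> ('g \<Rightarrow> 'e \<Rightarrow> 'e) \<Rightarrow> ('g \<Rightarrow> 'f \<Rightarrow> 'f) \<Rightarrow>
   'e topology \<Rightarrow> ('e \<Rightarrow> 'a) \<Rightarrow> 'f topology \<Rightarrow> ('e \<times> 'f) set fol_chart set" where
  "suspension_charts n G D h E p F =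
     {c. open_ball_of_dim n (chart_ball c) \<and>
         (\<exists>W \<kappa> \<sigma>. openin E W \<and> inj_on p W \<and>
            homeomorphic_map (subtopology E W) (subtopology (Euclidean_space n) (chart_ball c)) \<kappa> \<and>
            homeomorphic_map F (chart_trans c) \<sigma> \<and>
            chart_dom c = suspension_proj G D h ` (W \<times> topspace F) \<and>
            (\<forall>w\<in>W. \<forall>y\<in>topspace F. chart_map c (suspension_proj G D h (w, y)) = (\<kappa> w, \<sigma> y)))}"

definition suspension_lamination ::
  "nat \<Rightarrow> ('g, 'b) monoid_scheme \<Rightarrow> ('g \<Rightarrow> 'e \<Rightarrow> 'e) \<Rightarrow> ('g \<Rightarrow> 'f \<Rightarrow> 'f) \<Rightarrow>
   'e topology \<Rightarrow> ('e \<Rightarrow> 'a) \<Rightarrow> 'f topology \<Rightarrow> ('e \<times> 'f) set fol_chart set" where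
  "suspension_lamination n G D h E p F =
     maximal_atlas n (suspension_space G D h E F) (suspension_charts n G D h E p F)"

text \<open>The transverse invariant measure of the suspension, given on the fibre through \<open>e0\<close>.\<close>

definition suspension_measure ::
  "nat \<Rightarrow> ('g, 'b) monoid_scheme \<Rightarrow> ('g \<Rightarrow> 'e \<Rightarrow> 'e) \<Rightarrow> ('g \<Rightarrow> 'f \<Rightarrow> 'f) \<Rightarrow>
   'e topology \<Rightarrow> ('e \<Rightarrow> 'a) \<Rightarrow> 'f topology \<Rightarrow> 'e \<Rightarrow> 'f measure \<Rightarrow> ('e \<times> 'f) set set \<Rightarrow> ennreal" where
  "suspension_measure n G D h E p F e0 \<Lambda> =
     transverse_extension (suspension_space G D h E F) (suspension_lamination n G D h E p F)
       (\<lambda>y. suspension_proj G D h (e0, y)) \<Lambda>"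

end

theory Submission
  imports Defs
begin

text \<open>Write \<open>G = \<pi>\<^sub>1(M)\<close>, let \<open>q : E \<times> F \<rightarrow> X\<close> be the projection onto the suspension, and let \<open>S\<close> be a finite
  symmetric generating set of \<open>G\<close> with word balls \<open>S\<^sub>l\<close>. The leaves are the sets \<open>q(E \<times> {y})\<close>. Since \<open>h\<close> is
  free, the points of a leaf that lie in the fibre \<open>q({e0} \<times> F)\<close> form a copy of \<open>G\<close>, and because \<open>M\<close> and
  \<open>F\<close> are compact the number of plaques needed to go from one of them to another is comparable with
  their distance in the word metric. Hence the category with contractions of length at most \<open>m\<close> is
  comparable with \<open>1 / #S\<^sub>m\<close>, up to constant factors in \<open>m\<close> and in the value, which is the claim.

  For the lower bound, plaques of a finite regular atlas have bounded diameter in the word metric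
  (\<open>plaques_bounded\<close>), so a contraction of length at most \<open>m\<close> moves points by words of length \<open>O(m)\<close>.
  The time-one map on the part of the fibre in \<open>U\<close> is therefore at most \<open>#S\<^sub>K\<^sub>m\<close> to one, and as
  the transverse measure is holonomy invariant, the image has at least \<open>1 / #S\<^sub>K\<^sub>m\<close> of the measure
  (\<open>contraction_measure_bound\<close>). The open sets of a cover contain together the whole fibre, of measure one.

  For the upper bound, freeness and compactness give a Borel marker set \<open>V\<close> in \<open>F\<close> whose translates by
  \<open>S\<^sub>l\<close> are disjoint, so that its measure is at most \<open>1 / #S\<^sub>l\<close>, while its translates by \<open>S\<^sub>2\<^sub>l\<close> cover \<open>F\<close>
  (\<open>marker_set\<close>, \<open>marker_measure\<close>). After an approximation by compact and open sets, the tubes over the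
  translates of \<open>V\<close> are contracted along paths that follow words of length \<open>2 l\<close> into one copy of \<open>V\<close>
  (\<open>transversal_partition\<close>, \<open>tube_contraction\<close>). This covers \<open>X\<close> by boundedly many sets, contracted to transversals
  of measure \<open>O(1 / #S\<^sub>l)\<close> with length \<open>O(l)\<close> (\<open>Cat_bounded_upper\<close>).

  Both estimates rest on covering theory: \<open>\<pi>\<^sub>1(M)\<close> acts on \<open>E\<close> by homeomorphisms, simply transitively on the
  fibres of the covering. So charts over sheets of the covering differ by single elements of \<open>G\<close>.\<close>

section \<open>Path lifting and monodromy\<close>

text \<open>A sheet over \<open>T\<close> is recorded together with the openness of the rest of the preimage of \<open>T\<close>:
  this makes the sheet relatively clopen, so a connected set over \<open>T\<close> that meets it stays in it.\<close>

definition sheet :: "'e topology \<Rightarrow> 'a topology \<Rightarrow> ('e \<Rightarrow> 'a) \<Rightarrow> 'a set \<Rightarrow> 'e set \<Rightarrow> bool" where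
  "sheet E M p T V \<longleftrightarrow> openin M T \<and> openin E V \<and>
     homeomorphic_map (subtopology E V) (subtopology M T) p \<and>
     openin E ({e \<in> topspace E. p e \<in> T} - V)"

definition lift_on ::
  "'e topology \<Rightarrow> ('e \<Rightarrow> 'a) \<Rightarrow> (real \<Rightarrow> 'a) \<Rightarrow> real \<Rightarrow> real \<Rightarrow> (real \<Rightarrow> 'e) \<Rightarrow> bool" where
  "lift_on E p f a b c \<longleftrightarrow> continuous_map (top_of_set {a..b}) E c \<and> (\<forall>t\<in>{a..b}. p (c t) = f t)"

lemma evenly_covered_nbhd:
  assumes "covering_projection E M p" "x \<in> topspace M"
  obtains T where "openin M T" "x \<in> T"
    "\<And>e. e \<in> topspace E \<Longrightarrow> p e \<in> T \<Longrightarrow> \<exists>V. e \<in> V \<and> sheet E M p T V"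
proof -
  from assms obtain T where T: "openin M T" "x \<in> T" and ex:
      "\<exists>\<V>. \<Union>\<V> = {e \<in> topspace E. p e \<in> T} \<and> (\<forall>V\<in>\<V>. openin E V) \<and> pairwise disjnt \<V> \<and>
        (\<forall>V\<in>\<V>. homeomorphic_map (subtopology E V) (subtopology M T) p)"
    unfolding covering_projection_def by meson
  from ex obtain \<V> where
    V: "\<Union>\<V> = {e \<in> topspace E. p e \<in> T}" "\<And>V. V\<in>\<V> \<Longrightarrow> openin E V" "pairwise disjnt \<V>"
      "\<And>V. V\<in>\<V> \<Longrightarrow> homeomorphic_map (subtopology E V) (subtopology M T) p"
    by auto
  have "\<exists>V. e \<in> V \<and> sheet E M p T V" if e: "e \<in> topspace E" "p e \<in> T" for e
  proof -
    obtain V where Ve: "V \<in> \<V>" "e \<in> V" using V(1) e by blast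
    have "{e \<in> topspace E. p e \<in> T} - V = \<Union>(\<V> - {V})"
    proof -
      have "U \<inter> V = {}" if "U \<in> \<V> - {V}" for U
        using V(3) Ve(1) that by (auto simp: pairwise_def disjnt_def)
      then have "\<Union>\<V> - V = \<Union>(\<V> - {V})" using Ve(1) by blast
      then show ?thesis using V(1) by simp
    qed
    moreover have "openin E (\<Union>(\<V> - {V}))" using V(2) by blast
    ultimately have "sheet E M p T V" unfolding sheet_def using Ve(1) V(2,4) T(1) by simp
    then show ?thesis using Ve(2) by blast
  qed
  with T that show thesis by blast
qed

lemma sheetD:
  assumes "sheet E M p T V"
  shows "openin M T" "openin E V" "V \<subseteq> topspace E" "T \<subseteq> topspace M" "inj_on p V" "p ` V = T"
    "openin E ({e \<in> topspace E. p e \<in> T} - V)"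
    "homeomorphic_map (subtopology E V) (subtopology M T) p"
proof -
  show 1: "openin M T" "openin E V" "openin E ({e \<in> topspace E. p e \<in> T} - V)"
    and h: "homeomorphic_map (subtopology E V) (subtopology M T) p"
    using assms by (auto simp: sheet_def)
  show 2: "V \<subseteq> topspace E" "T \<subseteq> topspace M" using 1 openin_subset by auto
  show "inj_on p V" "p ` V = T"
    using h 2 by (auto simp: homeomorphic_eq_everything_map Int_absorb1)
qed

lemma sheet_open_image:
  assumes "sheet E M p T V" "openin E N" "N \<subseteq> V"
  shows "openin M (p ` N)"
proof -
  have "open_map (subtopology E V) (subtopology M T) p"
    using sheetD(8)[OF assms(1)] homeomorphic_imp_open_map by blast
  moreover have "openin (subtopology E V) N" using assms by (simp add: openin_open_subtopology sheetD)
  ultimately have "openin (subtopology M T) (p ` N)" by (simp add: open_map_def)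
  then show ?thesis using sheetD(1)[OF assms(1)] openin_open_subtopology by blast
qed

lemma sheet_inverse_continuous:
  assumes "sheet E M p T V"
  shows "continuous_map (subtopology M T) E (inv_into V p)"
proof -
  obtain g where g: "homeomorphic_maps (subtopology E V) (subtopology M T) p g"
    using sheetD(8)[OF assms] homeomorphic_map_maps by blast
  then have c: "continuous_map (subtopology M T) (subtopology E V) g"
    by (simp add: homeomorphic_maps_def)
  have "inv_into V p x = g x" if "x \<in> topspace (subtopology M T)" for x
  proof -
    have "g x \<in> V" "p (g x) = x" using g c that sheetD(3)[OF assms]
      by (auto simp: homeomorphic_maps_def continuous_map_def)
    then show ?thesis using inv_into_f_f[OF sheetD(5)[OF assms]] by metis
  qed
  then show ?thesis using c continuous_map_eq[of _ _ g] by (metis continuous_map_in_subtopology)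
qed

lemma connected_subset_sheet:
  assumes s: "sheet E M p T V" and C: "connectedin E C" "p ` C \<subseteq> T" "C \<inter> V \<noteq> {}"
  shows "C \<subseteq> V"
proof -
  let ?W = "{e \<in> topspace E. p e \<in> T} - V"
  have CE: "C \<subseteq> topspace E" using C(1) by (simp add: connectedin_subset_topspace)
  have "C \<subseteq> V \<union> ?W" using CE C(2) by blast
  moreover have "V \<inter> ?W \<inter> C = {}" by blast
  ultimately have "V \<inter> C = {} \<or> ?W \<inter> C = {}"
    using C(1) sheetD(2)[OF s] sheetD(7)[OF s] unfolding connectedin by blast
  then show ?thesis using C(3) CE C(2) by blast
qed

lemma continuous_interval_nbhd:
  assumes "continuous_map (top_of_set {a..b::real}) X c" "openin X V" "x \<in> {a..b}" "c x \<in> V"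
  obtains d where "d > 0" "\<And>t. t \<in> {a..b} \<Longrightarrow> \<bar>t - x\<bar> < d \<Longrightarrow> c t \<in> V"
proof -
  have "openin (top_of_set {a..b}) {t \<in> topspace (top_of_set {a..b}). c t \<in> V}"
    by (rule openin_continuous_map_preimage[OF assms(1,2)])
  then obtain d where "d > 0" "\<And>t. t \<in> {a..b} \<Longrightarrow> dist t x < d \<Longrightarrow> t \<in> {t \<in> {a..b}. c t \<in> V}"
    using assms(3,4) unfolding openin_euclidean_subtopology_iff by auto
  then show thesis using that by (auto simp: dist_real_def)
qed

lemma continuous_square_nbhd:
  assumes "continuous_map (prod_topology (top_of_set {0..1::real}) (top_of_set {0..1::real})) X H"
    "openin X V" "s0 \<in> {0..1}" "x \<in> {0..1}" "H (s0, x) \<in> V"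
  obtains d where "d > 0"
    "\<And>s t. s \<in> {0..1} \<Longrightarrow> t \<in> {0..1} \<Longrightarrow> \<bar>s - s0\<bar> < d \<Longrightarrow> \<bar>t - x\<bar> < d \<Longrightarrow> H (s, t) \<in> V"
proof -
  let ?I = "top_of_set {0..1::real}"
  define S where "S = {z \<in> topspace (prod_topology ?I ?I). H z \<in> V}"
  have "openin (prod_topology ?I ?I) S"
    unfolding S_def by (rule openin_continuous_map_preimage[OF assms(1,2)])
  moreover have "(s0, x) \<in> S" using assms(3-5) by (simp add: S_def)
  ultimately have "\<exists>A B. openin ?I A \<and> openin ?I B \<and> s0 \<in> A \<and> x \<in> B \<and> A \<times> B \<subseteq> S"
    unfolding openin_prod_topology_alt by (elim allE impE) assumption+
  then obtain A B where AB: "openin ?I A" "openin ?I B" "s0 \<in> A" "x \<in> B" "A \<times> B \<subseteq> S"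
    by metis
  obtain d1 where d1: "d1 > 0" "\<And>t. t \<in> {0..1} \<Longrightarrow> dist t s0 < d1 \<Longrightarrow> t \<in> A"
    using AB(1,3) unfolding openin_euclidean_subtopology_iff by blast
  obtain d2 where d2: "d2 > 0" "\<And>t. t \<in> {0..1} \<Longrightarrow> dist t x < d2 \<Longrightarrow> t \<in> B"
    using AB(2,4) unfolding openin_euclidean_subtopology_iff by blast
  show thesis
  proof (rule that[of "min d1 d2"])
    fix s t :: real assume a: "s \<in> {0..1}" "t \<in> {0..1}" "\<bar>s - s0\<bar> < min d1 d2" "\<bar>t - x\<bar> < min d1 d2"
    have "s \<in> A" using a by (intro d1(2)) (simp_all add: dist_real_def)
    moreover have "t \<in> B" using a by (intro d2(2)) (simp_all add: dist_real_def)
    ultimately have "(s, t) \<in> S" using AB(5) by blast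
    then show "H (s, t) \<in> V" by (simp add: S_def)
  qed (use d1(1) d2(1) in simp)
qed

text \<open>The form of compactness of intervals used below: a relation between parameters that holds on short
  intervals and can be chained holds on the whole interval.\<close>

lemma interval_chaining:
  fixes a b :: real
  assumes ab: "a \<le> b"
    and trans: "\<And>u v w. a \<le> u \<Longrightarrow> u \<le> v \<Longrightarrow> v \<le> w \<Longrightarrow> w \<le> b \<Longrightarrow> Q u v \<Longrightarrow> Q v w \<Longrightarrow> Q u w"
    and local: "\<And>x. x \<in> {a..b} \<Longrightarrow>
      \<exists>d>0. \<forall>u v. a \<le> u \<longrightarrow> u \<le> x \<longrightarrow> x \<le> v \<longrightarrow> v \<le> b \<longrightarrow> v - u < d \<longrightarrow> Q u v"
  shows "Q a b"
proof -
  have "a \<le> a \<longrightarrow> b \<le> b \<longrightarrow> Q a b"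
  proof (rule Bolzano[where P = "\<lambda>u v. a \<le> u \<longrightarrow> v \<le> b \<longrightarrow> Q u v", OF ab])
    fix u v w assume "a \<le> u \<longrightarrow> v \<le> b \<longrightarrow> Q u v" "a \<le> v \<longrightarrow> w \<le> b \<longrightarrow> Q v w" "u \<le> v" "v \<le> w"
    then show "a \<le> u \<longrightarrow> w \<le> b \<longrightarrow> Q u w" using trans by auto
  next
    fix x assume "a \<le> x" "x \<le> b"
    then show "\<exists>d>0. \<forall>u v. u \<le> x \<and> x \<le> v \<and> v - u < d \<longrightarrow> a \<le> u \<longrightarrow> v \<le> b \<longrightarrow> Q u v"
      using local[of x] by auto
  qed
  then show ?thesis by simp
qed

lemma lift_on_subinterval:
  "lift_on E p f a b c \<Longrightarrow> a \<le> u \<Longrightarrow> v \<le> b \<Longrightarrow> lift_on E p f u v c"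
  unfolding lift_on_def using continuous_map_from_subtopology_mono[of euclideanreal "{a..b}" E c "{u..v}"] by auto

lemma lift_on_connected:
  assumes "lift_on E p f a b c" shows "connectedin E (c ` {a..b})"
proof -
  have "connectedin (top_of_set {a..b}) {a..b}" by (simp add: connectedin_subtopology)
  then show ?thesis using assms unfolding lift_on_def using connectedin_continuous_map_image by blast
qed

text \<open>Locally, two lifts of a path agree throughout if they agree at one parameter and differ throughout
  if they differ at one; so agreement propagates along the interval.\<close>

lemma lift_unique:
  assumes cov: "covering_projection E M p" and f: "f ` {a..b} \<subseteq> topspace M"
    and c: "lift_on E p f a b c" "lift_on E p f a b c'" and eq: "c a = c' a" and ab: "a \<le> b"
    and t: "t \<in> {a..b}"
  shows "c t = c' t"
proof -
  define Q where "Q u v \<longleftrightarrow> (c u = c' u \<longrightarrow> (\<forall>t\<in>{u..v}. c t = c' t))" for u v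
  have "Q a b"
  proof (rule interval_chaining[OF ab])
    fix u v w assume a: "u \<le> v" "v \<le> w" "Q u v" "Q v w"
    show "Q u w" unfolding Q_def
    proof (intro impI ballI)
      fix t assume b: "c u = c' u" "t \<in> {u..w}"
      have 1: "\<forall>t\<in>{u..v}. c t = c' t" using a b by (auto simp: Q_def)
      then have "\<forall>t\<in>{v..w}. c t = c' t" using a by (auto simp: Q_def)
      then show "c t = c' t" using 1 b by (cases "t \<le> v") auto
    qed
  next
    fix x assume x: "x \<in> {a..b}"
    have cc: "continuous_map (top_of_set {a..b}) E c" "continuous_map (top_of_set {a..b}) E c'"
      and pc: "\<And>t. t \<in> {a..b} \<Longrightarrow> p (c t) = f t" "\<And>t. t \<in> {a..b} \<Longrightarrow> p (c' t) = f t"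
      using c by (auto simp: lift_on_def)
    have cE: "c x \<in> topspace E" "c' x \<in> topspace E" using cc x
      by (auto simp: continuous_map_def)
    have "f x \<in> topspace M" using f x by blast
    from evenly_covered_nbhd[OF cov this] obtain T where T: "f x \<in> T"
      "\<And>e. e \<in> topspace E \<Longrightarrow> p e \<in> T \<Longrightarrow> \<exists>V. e \<in> V \<and> sheet E M p T V"
      by metis
    obtain V where V: "c x \<in> V" "sheet E M p T V" using T cE pc x by metis
    obtain d where d: "d > 0" "\<And>t. t \<in> {a..b} \<Longrightarrow> \<bar>t - x\<bar> < d \<Longrightarrow> c t \<in> V"
      using continuous_interval_nbhd[OF cc(1) sheetD(2)[OF V(2)] x V(1)] by blast
    show "\<exists>d>0. \<forall>u v. a \<le> u \<longrightarrow> u \<le> x \<longrightarrow> x \<le> v \<longrightarrow> v \<le> b \<longrightarrow> v - u < d \<longrightarrow> Q u v"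
    proof (cases "c' x \<in> V")
      case True
      obtain d' where d': "d' > 0" "\<And>t. t \<in> {a..b} \<Longrightarrow> \<bar>t - x\<bar> < d' \<Longrightarrow> c' t \<in> V"
        using continuous_interval_nbhd[OF cc(2) sheetD(2)[OF V(2)] x True] by blast
      have near: "c t = c' t" if "t \<in> {a..b}" "\<bar>t - x\<bar> < min d d'" for t
      proof -
        have "c t \<in> V" "c' t \<in> V" "p (c t) = p (c' t)" using that d(2) d'(2) pc by auto
        then show ?thesis using sheetD(5)[OF V(2)] by (meson inj_onD)
      qed
      have "Q u v" if "a \<le> u" "u \<le> x" "x \<le> v" "v \<le> b" "v - u < min d d'" for u v
        unfolding Q_def using that by (intro impI ballI near) auto
      then show ?thesis using d(1) d'(1) by (intro exI[of _ "min d d'"]) simp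
    next
      case False
      then have "c' x \<in> {e \<in> topspace E. p e \<in> T} - V" using cE pc x T by auto
      then obtain d' where d': "d' > 0"
          "\<And>t. t \<in> {a..b} \<Longrightarrow> \<bar>t - x\<bar> < d' \<Longrightarrow> c' t \<in> {e \<in> topspace E. p e \<in> T} - V"
        using continuous_interval_nbhd[OF cc(2) sheetD(7)[OF V(2)] x] by blast
      have "c t \<noteq> c' t" if "t \<in> {a..b}" "\<bar>t - x\<bar> < min d d'" for t
        using that d(2)[of t] d'(2)[of t] by auto
      then show ?thesis using d(1) d'(1) unfolding Q_def by (intro exI[of _ "min d d'"]) auto
    qed
  qed
  then show ?thesis using eq t by (auto simp: Q_def)
qed

lemma continuous_map_glue_intervals:
  assumes "continuous_map (top_of_set {u..v::real}) X c1" "continuous_map (top_of_set {v..w}) X c2"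
    "c1 v = c2 v" "u \<le> v" "v \<le> w"
  shows "continuous_map (top_of_set {u..w}) X (\<lambda>t. if t \<le> v then c1 t else c2 t)"
proof (rule continuous_map_cases_le)
  have "{x \<in> topspace (top_of_set {u..w}). x \<le> v} = {u..v}"
    "{x \<in> topspace (top_of_set {u..w}). v \<le> x} = {v..w}" using assms by auto
  moreover have "{u..w} \<inter> {u..v} = {u..v}" "{u..w} \<inter> {v..w} = {v..w}" using assms by auto
  ultimately show "continuous_map (subtopology (top_of_set {u..w}) {x \<in> topspace (top_of_set {u..w}). x \<le> v}) X c1"
    "continuous_map (subtopology (top_of_set {u..w}) {x \<in> topspace (top_of_set {u..w}). v \<le> x}) X c2"
    using assms(1,2) by (simp_all only: subtopology_subtopology)
qed (use assms in auto)

lemma path_lift_exists: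
  assumes cov: "covering_projection E M p" and f: "continuous_map (top_of_set {a..b}) M f"
    and ab: "a \<le> b" and e: "e \<in> topspace E" "p e = f a"
  shows "\<exists>c. lift_on E p f a b c \<and> c a = e"
proof -
  define Q where
    "Q u v \<longleftrightarrow> (\<forall>e\<in>topspace E. p e = f u \<longrightarrow> (\<exists>c. lift_on E p f u v c \<and> c u = e))" for u v
  have "Q a b"
  proof (rule interval_chaining[OF ab])
    fix u v w assume uvw: "u \<le> v" "v \<le> w" and Q: "Q u v" "Q v w"
    show "Q u w" unfolding Q_def
    proof (intro impI ballI)
      fix e assume a: "e \<in> topspace E" "p e = f u"
      obtain c1 where c1: "lift_on E p f u v c1" "c1 u = e" using Q(1) a by (auto simp: Q_def)
      have "c1 v \<in> topspace E" "p (c1 v) = f v"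
        using c1 uvw by (auto simp: lift_on_def continuous_map_def)
      then obtain c2 where c2: "lift_on E p f v w c2" "c2 v = c1 v" using Q(2) by (auto simp: Q_def)
      have "lift_on E p f u w (\<lambda>t. if t \<le> v then c1 t else c2 t)"
        using c1 c2 uvw unfolding lift_on_def
        by (intro conjI continuous_map_glue_intervals) auto
      then show "\<exists>c. lift_on E p f u w c \<and> c u = e"
        using c1 uvw by (intro exI[of _ "\<lambda>t. if t \<le> v then c1 t else c2 t"]) auto
    qed
  next
    fix x assume x: "x \<in> {a..b}"
    then have "f x \<in> topspace M" using f by (auto simp: continuous_map_def)
    from evenly_covered_nbhd[OF cov this] obtain T where T: "openin M T" "f x \<in> T"
      "\<And>e. e \<in> topspace E \<Longrightarrow> p e \<in> T \<Longrightarrow> \<exists>V. e \<in> V \<and> sheet E M p T V"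
      by metis
    obtain d where d: "d > 0" "\<And>t. t \<in> {a..b} \<Longrightarrow> \<bar>t - x\<bar> < d \<Longrightarrow> f t \<in> T"
      using continuous_interval_nbhd[OF f T(1) x T(2)] by blast
    show "\<exists>d>0. \<forall>u v. a \<le> u \<longrightarrow> u \<le> x \<longrightarrow> x \<le> v \<longrightarrow> v \<le> b \<longrightarrow> v - u < d \<longrightarrow> Q u v"
      unfolding Q_def
    proof (intro exI[of _ d] conjI allI impI ballI)
      show "d > 0" by fact
    next
      fix u v e assume a: "a \<le> u" "u \<le> x" "x \<le> v" "v \<le> b" "v - u < d"
        "e \<in> topspace E" "p e = f u"
      have fT: "f t \<in> T" if "t \<in> {u..v}" for t using d that a by auto
      obtain V where V: "e \<in> V" "sheet E M p T V" using T(3)[of e] a fT by auto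
      have "continuous_map (top_of_set {u..v}) M f"
        using a by (intro continuous_map_from_subtopology_mono[OF f]) simp
      then have "continuous_map (top_of_set {u..v}) (subtopology M T) f"
        using fT by (simp add: continuous_map_in_subtopology image_subset_iff_funcset[symmetric] image_subset_iff)
      then have "continuous_map (top_of_set {u..v}) E (inv_into V p \<circ> f)"
        using sheet_inverse_continuous[OF V(2)] continuous_map_compose by blast
      moreover have "p (inv_into V p (f t)) = f t" if "t \<in> {u..v}" for t
        using fT[OF that] sheetD(6)[OF V(2)] f_inv_into_f by metis
      moreover have "inv_into V p (f u) = e"
        using inv_into_f_f[OF sheetD(5)[OF V(2)] V(1)] a(7) by simp
      ultimately show "\<exists>c. lift_on E p f u v c \<and> c u = e"
        by (intro exI[of _ "inv_into V p \<circ> f"]) (auto simp: lift_on_def)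
    qed
  qed
  then show ?thesis using e by (auto simp: Q_def)
qed

text \<open>Along a homotopy with fixed end points, the end point of the lifted paths is locally constant:
  subdividing the path at \<open>s0\<close> into pieces that lie in sheets, closeness to it at the beginning
  of a piece propagates to its end.\<close>

lemma lift_endpoint_homotopy_invariant:
  assumes cov: "covering_projection E M p"
    and H: "continuous_map (prod_topology (top_of_set {0..1::real}) (top_of_set {0..1::real})) M H"
    and c: "\<And>s. s \<in> {0..1} \<Longrightarrow> lift_on E p (\<lambda>t. H (s, t)) 0 1 (c s)"
    and c0: "\<And>s. s \<in> {0..1} \<Longrightarrow> c s 0 = e"
    and H1: "\<And>s. s \<in> {0..1} \<Longrightarrow> H (s, 1) = x1"
  shows "c 0 1 = c 1 1"
proof -
  have cont: "\<And>s. s \<in> {0..1} \<Longrightarrow> continuous_map (top_of_set {0..1}) E (c s)"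
    and pc: "\<And>s t. s \<in> {0..1} \<Longrightarrow> t \<in> {0..1} \<Longrightarrow> p (c s t) = H (s, t)"
    using c by (auto simp: lift_on_def)
  have HM: "H (s, t) \<in> topspace M" if "s \<in> {0..1}" "t \<in> {0..1}" for s t
    using H that by (auto simp: continuous_map_def)
  have cE: "c s t \<in> topspace E" if "s \<in> {0..1}" "t \<in> {0..1}" for s t
    using cont[OF that(1)] that(2) by (auto simp: continuous_map_def)
  have loc: "\<exists>\<delta>>0. \<forall>s\<in>{0..1}. \<bar>s - s0\<bar> < \<delta> \<longrightarrow> c s 1 = c s0 1" if s0: "s0 \<in> {0..1}" for s0
  proof -
    define Q where "Q u v \<longleftrightarrow> (\<forall>N. openin E N \<and> c s0 v \<in> N \<longrightarrow>
      (\<exists>N' \<delta>. openin E N' \<and> c s0 u \<in> N' \<and> \<delta> > 0 \<and>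
         (\<forall>s\<in>{0..1}. \<bar>s - s0\<bar> < \<delta> \<longrightarrow> c s u \<in> N' \<longrightarrow> c s v \<in> N)))" for u v
    have "Q 0 1"
    proof (rule interval_chaining[OF zero_le_one])
      fix u v w assume trans: "Q u v" "Q v w"
      show "Q u w" unfolding Q_def
      proof (intro impI allI)
        fix N assume a: "openin E N \<and> c s0 w \<in> N"
        obtain N2 d2 where 2: "openin E N2" "c s0 v \<in> N2" "d2 > 0"
          "\<And>s. s\<in>{0..1} \<Longrightarrow> \<bar>s - s0\<bar> < d2 \<Longrightarrow> c s v \<in> N2 \<Longrightarrow> c s w \<in> N"
          using trans(2) a unfolding Q_def by meson
        obtain N1 d1 where 1: "openin E N1" "c s0 u \<in> N1" "d1 > 0"
          "\<And>s. s\<in>{0..1} \<Longrightarrow> \<bar>s - s0\<bar> < d1 \<Longrightarrow> c s u \<in> N1 \<Longrightarrow> c s v \<in> N2"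
          using trans(1) 2(1,2) unfolding Q_def by meson
        show "\<exists>N' \<delta>. openin E N' \<and> c s0 u \<in> N' \<and> \<delta> > 0 \<and>
           (\<forall>s\<in>{0..1}. \<bar>s - s0\<bar> < \<delta> \<longrightarrow> c s u \<in> N' \<longrightarrow> c s w \<in> N)"
          using 1(1-3) 2(3) by (intro exI[of _ N1] exI[of _ "min d1 d2"]) (simp add: 1(4) 2(4))
      qed
    next
      fix x :: real assume x: "x \<in> {0..1}"
      from evenly_covered_nbhd[OF cov HM[OF s0 x]] obtain T where T: "openin M T" "H (s0, x) \<in> T"
        "\<And>e. e \<in> topspace E \<Longrightarrow> p e \<in> T \<Longrightarrow> \<exists>V. e \<in> V \<and> sheet E M p T V"
        by metis
      obtain V where V: "c s0 x \<in> V" "sheet E M p T V" using T cE[OF s0 x] pc[OF s0 x] by metis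
      obtain d1 where d1: "d1 > 0"
        "\<And>s t. s \<in> {0..1} \<Longrightarrow> t \<in> {0..1} \<Longrightarrow> \<bar>s - s0\<bar> < d1 \<Longrightarrow> \<bar>t - x\<bar> < d1 \<Longrightarrow> H (s, t) \<in> T"
        using continuous_square_nbhd[OF H T(1) s0 x T(2)] by blast
      obtain d2 where d2: "d2 > 0" "\<And>t. t \<in> {0..1} \<Longrightarrow> \<bar>t - x\<bar> < d2 \<Longrightarrow> c s0 t \<in> V"
        using continuous_interval_nbhd[OF cont[OF s0] sheetD(2)[OF V(2)] x V(1)] by blast
      show "\<exists>d>0. \<forall>u v. 0 \<le> u \<longrightarrow> u \<le> x \<longrightarrow> x \<le> v \<longrightarrow> v \<le> 1 \<longrightarrow> v - u < d \<longrightarrow> Q u v"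
        unfolding Q_def
      proof (intro exI[of _ "min d1 d2"] conjI allI impI)
        show "min d1 d2 > 0" using d1 d2 by simp
      next
        fix u v N assume a: "0 \<le> u" "u \<le> x" "x \<le> v" "v \<le> 1" "v - u < min d1 d2"
          "openin E N \<and> c s0 v \<in> N"
        have uv: "u \<in> {0..1}" "v \<in> {0..1}" using a by auto
        have inV: "c s0 u \<in> V" "c s0 v \<in> V" using d2(2) a uv by auto
        \<comment> \<open>The end of a short piece is controlled by the base: a lift that starts in the sheet \<open>V\<close> stays in it.\<close>
        let ?T' = "p ` (N \<inter> V)"
        have T': "openin M ?T'" using sheet_open_image[OF V(2)] a sheetD(2)[OF V(2)] by blast
        have "H (s0, v) \<in> ?T'" using pc[OF s0 uv(2)] inV a by (metis IntI imageI)
        then obtain d3 where d3: "d3 > 0"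
          "\<And>s t. s \<in> {0..1} \<Longrightarrow> t \<in> {0..1} \<Longrightarrow> \<bar>s - s0\<bar> < d3 \<Longrightarrow> \<bar>t - v\<bar> < d3 \<Longrightarrow> H (s, t) \<in> ?T'"
          using continuous_square_nbhd[OF H T' s0 uv(2)] by blast
        have "c s v \<in> N" if s: "s \<in> {0..1}" "\<bar>s - s0\<bar> < min d1 d3" "c s u \<in> V" for s
        proof -
          have "connectedin E (c s ` {u..v})"
            using lift_on_connected[OF lift_on_subinterval[OF c[OF s(1)]]] a by auto
          moreover have "p ` c s ` {u..v} \<subseteq> T" using pc[OF s(1)] d1(2)[OF s(1)] s a by auto
          moreover have "c s u \<in> c s ` {u..v}" using a by simp
          then have "c s ` {u..v} \<inter> V \<noteq> {}" using s(3) by blast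
          ultimately have "c s ` {u..v} \<subseteq> V" using connected_subset_sheet[OF V(2)] by blast
          then have 1: "c s v \<in> V" using a by auto
          have "p (c s v) \<in> ?T'" using d3 s uv pc[OF s(1) uv(2)] by auto
          then obtain m where "m \<in> N \<inter> V" "p (c s v) = p m" by blast
          then show ?thesis using 1 sheetD(5)[OF V(2)] by (metis IntD1 IntD2 inj_on_def)
        qed
        then show "\<exists>N' \<delta>. openin E N' \<and> c s0 u \<in> N' \<and> \<delta> > 0 \<and>
           (\<forall>s\<in>{0..1}. \<bar>s - s0\<bar> < \<delta> \<longrightarrow> c s u \<in> N' \<longrightarrow> c s v \<in> N)"
          using inV sheetD(2)[OF V(2)] d1(1) d3(1)
          by (intro exI[of _ V] exI[of _ "min d1 d3"]) auto
      qed
    qed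
    then have Q: "\<And>N. openin E N \<Longrightarrow> c s0 1 \<in> N \<Longrightarrow>
      (\<exists>N' \<delta>. openin E N' \<and> c s0 0 \<in> N' \<and> \<delta> > 0 \<and>
         (\<forall>s\<in>{0..1}. \<bar>s - s0\<bar> < \<delta> \<longrightarrow> c s 0 \<in> N' \<longrightarrow> c s 1 \<in> N))" unfolding Q_def by blast
    have one: "(1::real) \<in> {0..1}" by simp
    from evenly_covered_nbhd[OF cov HM[OF s0 one]] obtain T where T: "H (s0, 1) \<in> T"
      "\<And>e. e \<in> topspace E \<Longrightarrow> p e \<in> T \<Longrightarrow> \<exists>V. e \<in> V \<and> sheet E M p T V"
      by metis
    obtain V where V: "c s0 1 \<in> V" "sheet E M p T V" using T cE[OF s0 one] pc[OF s0 one] by metis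
    obtain N' \<delta> where N: "c s0 0 \<in> N'" "\<delta> > 0"
      "\<And>s. s\<in>{0..1} \<Longrightarrow> \<bar>s - s0\<bar> < \<delta> \<Longrightarrow> c s 0 \<in> N' \<Longrightarrow> c s 1 \<in> V"
      using Q[OF sheetD(2)[OF V(2)] V(1)] by metis
    have "c s 1 = c s0 1" if s: "s \<in> {0..1}" "\<bar>s - s0\<bar> < \<delta>" for s
    proof -
      have "c s 1 \<in> V" using N(3)[OF s] c0 N(1) s0 s(1) by metis
      moreover have "p (c s 1) = p (c s0 1)" using pc s(1) s0 one H1 by metis
      ultimately show ?thesis using V sheetD(5)[OF V(2)] by (auto simp: inj_on_def)
    qed
    then show ?thesis using N(2) by blast
  qed
  show ?thesis
  proof (rule interval_chaining[OF zero_le_one, where Q = "\<lambda>u v. c u 1 = c v 1"])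
    fix x :: real assume x: "x \<in> {0..1}"
    from loc[OF this] obtain \<delta> where
      d: "\<delta> > 0" "\<And>s. s \<in> {0..1} \<Longrightarrow> \<bar>s - x\<bar> < \<delta> \<Longrightarrow> c s 1 = c x 1"
      by metis
    show "\<exists>d>0. \<forall>u v. 0 \<le> u \<longrightarrow> u \<le> x \<longrightarrow> x \<le> v \<longrightarrow> v \<le> 1 \<longrightarrow> v - u < d \<longrightarrow> c u 1 = c v 1"
      proof (intro exI[of _ \<delta>] conjI allI impI d(1))
      fix u v :: real assume "0 \<le> u" "u \<le> x" "x \<le> v" "v \<le> 1" "v - u < \<delta>"
      then have "c u 1 = c x 1" "c v 1 = c x 1" by (intro d(2), auto)+
      then show "c u 1 = c v 1" by simp
    qed
  qed simp
qed

section \<open>Homotopy of paths and simply connected spaces\<close>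

lemma path_homotopic_iff:
  "path_homotopic X f g \<longleftrightarrow>
    (\<exists>H. continuous_map (prod_topology (top_of_set {0..1::real}) (top_of_set {0..1::real})) X H \<and>
      (\<forall>t\<in>{0..1}. H (0, t) = f t) \<and> (\<forall>t\<in>{0..1}. H (1, t) = g t) \<and>
      (\<forall>s\<in>{0..1}. H (s, 0) = f 0 \<and> H (s, 1) = f 1))"
  unfolding path_homotopic_def by (subst homotopic_with) simp_all

lemma path_homotopicD:
  assumes "path_homotopic X f g"
  shows "pathin X f" "pathin X g" "f 0 = g 0" "f 1 = g 1"
  using homotopic_with_imp_continuous_maps[OF assms[unfolded path_homotopic_def]]
    homotopic_with_imp_property[OF assms[unfolded path_homotopic_def]]
  by (auto simp: pathin_def)

lemma path_homotopic_equal: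
  assumes "pathin X f" "\<And>t. t \<in> {0..1} \<Longrightarrow> f t = g t"
  shows "path_homotopic X f g"
  unfolding path_homotopic_def using assms
  by (intro homotopic_with_equal) (auto simp: pathin_def)

lemma path_homotopic_sym:
  assumes "path_homotopic X f g" shows "path_homotopic X g f"
  using homotopic_with_symD[OF assms[unfolded path_homotopic_def]] path_homotopicD(3,4)[OF assms]
  unfolding path_homotopic_def by simp

lemma path_homotopic_trans:
  assumes "path_homotopic X f g" "path_homotopic X g k" shows "path_homotopic X f k"
proof -
  have "homotopic_with (\<lambda>r. r 0 = f 0 \<and> r 1 = f 1) (top_of_set {0..1}) X g k"
    using assms(2) path_homotopicD(3,4)[OF assms(1)] unfolding path_homotopic_def by simp
  then show ?thesis using homotopic_with_trans[OF assms(1)[unfolded path_homotopic_def]]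
    unfolding path_homotopic_def by simp
qed

lemma path_homotopic_compose:
  assumes "path_homotopic X f g" "continuous_map X Y q"
  shows "path_homotopic Y (q \<circ> f) (q \<circ> g)"
  unfolding path_homotopic_def
  by (rule homotopic_with_compose_continuous_map_left[OF assms(1)[unfolded path_homotopic_def] assms(2)]) auto

lemma pathin_join:
  assumes "pathin X f" "pathin X g" "f 1 = g 0"
  shows "pathin X (path_join f g)"
proof -
  have "continuous_map (top_of_set {0..1/2::real}) X (f \<circ> (\<lambda>t. 2 * t))"
    using assms(1) unfolding pathin_def
    by (intro continuous_map_compose[where X' = "top_of_set {0..1}"]) (auto intro!: continuous_intros)
  moreover have "continuous_map (top_of_set {1/2..1::real}) X (g \<circ> (\<lambda>t. 2 * t - 1))"
    using assms(2) unfolding pathin_def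
    by (intro continuous_map_compose[where X' = "top_of_set {0..1}"]) (auto intro!: continuous_intros)
  ultimately have "pathin X (\<lambda>t. if t \<le> 1/2 then (f \<circ> (\<lambda>t. 2 * t)) t else (g \<circ> (\<lambda>t. 2 * t - 1)) t)"
    unfolding pathin_def using assms(3) by (intro continuous_map_glue_intervals) (auto simp: o_def)
  then show ?thesis unfolding path_join_def comp_def .
qed

text \<open>A contraction \<open>K\<close> of the loop that runs along \<open>c\<close> and back along \<open>c'\<close> is a map on the square
  that is constant on three sides. Inside the square the initial half of the fourth side, where
  \<open>K\<close> is \<open>c\<close>, can be pushed to the path along the three other sides followed by the second half,
  where \<open>K\<close> is constant and then a reparametrization of \<open>c'\<close>.\<close>

lemma simply_connected_paths_homotopic:
  assumes sc: "simply_connected_space X" and c: "pathin X c" and c': "pathin X c'"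
    and eq: "c 0 = c' 0" "c 1 = c' 1"
  shows "path_homotopic X c c'"
proof -
  let ?I = "top_of_set {0..1::real}"
  define l where "l = path_join c (\<lambda>t. c' (1 - t))"
  have rev: "pathin X (\<lambda>t. c' (1 - t))"
  proof -
    have "continuous_map ?I X (c' \<circ> (\<lambda>t. 1 - t))"
      using c' unfolding pathin_def
      by (intro continuous_map_compose[where X' = ?I]) (auto intro!: continuous_intros)
    then show ?thesis by (simp add: pathin_def o_def)
  qed
  have l: "pathin X l" unfolding l_def using c rev eq by (intro pathin_join) auto
  have l0: "l 0 = c 0" "l 1 = c 0" using eq by (auto simp: l_def path_join_def)
  have x: "c 0 \<in> topspace X" using c path_start_in_topspace by blast
  then have "path_homotopic X l (\<lambda>_. c 0)"
    using sc l l0 by (auto simp: simply_connected_space_def loops_def)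
  then obtain K where K: "continuous_map (prod_topology ?I ?I) X K"
    and K0: "\<And>t. t \<in> {0..1} \<Longrightarrow> K (0, t) = l t" and K1: "\<And>t. t \<in> {0..1} \<Longrightarrow> K (1, t) = c 0"
    and Ks: "\<And>s. s \<in> {0..1} \<Longrightarrow> K (s, 0) = c 0" "\<And>s. s \<in> {0..1} \<Longrightarrow> K (s, 1) = c 0"
    unfolding path_homotopic_iff using l0 by metis
  \<comment> \<open>\<open>(a r, b r)\<close> runs along the three sides on which \<open>K\<close> is constant while \<open>r \<le> 1/2\<close>, then back along the second half of the fourth.\<close>
  define a where "a r = max 0 (min 1 (min (6 * r) (3 - 6 * r)))" for r :: real
  define b where "b r = min (max 0 (min 1 (6 * r - 1))) (3/2 - r)" for r :: real
  have ab: "a r \<in> {0..1}" "b r \<in> {0..1}" if "r \<in> {0..1}" for r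
    using that by (auto simp: a_def b_def)
  have cont: "continuous_on {0..1} a" "continuous_on {0..1} b"
    unfolding a_def b_def by (intro continuous_intros)+
  define g where "g r = K (a r, b r)" for r
  have "path_homotopic X c g"
    unfolding path_homotopic_iff
  proof (intro exI conjI ballI)
    let ?\<phi> = "\<lambda>z::real\<times>real. (fst z * a (snd z), (1 - fst z) * (snd z / 2) + fst z * b (snd z))"
    have sub: "?\<phi> z \<in> {0..1} \<times> {0..1}" if z01: "z \<in> {0..1} \<times> {0..1}" for z
    proof -
      obtain s r where z: "z = (s, r)" "s \<in> {0..1}" "r \<in> {0..1}" using z01 by (cases z) auto
      have "s * a r \<in> {0..1}" using z ab[of r] by (auto intro: mult_le_one)
      moreover have "(1 - s) * (r / 2) + s * b r \<in> {0..1}"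
        using z ab[of r] convex_bound_le[of "r/2" 1 "b r" "1 - s" s] by auto
      ultimately show ?thesis using z by simp
    qed
    have "continuous_on ({0..1} \<times> {0..1}) ?\<phi>"
      by (intro continuous_intros continuous_on_compose2[OF cont(1)] continuous_on_compose2[OF cont(2)]) auto
    then have "continuous_map (prod_topology ?I ?I) (prod_topology ?I ?I) ?\<phi>"
      using sub by (simp add: Pi_iff)
    then show "continuous_map (prod_topology ?I ?I) X (K \<circ> ?\<phi>)"
      using K continuous_map_compose by blast
    show "(K \<circ> ?\<phi>) (0, t) = c t" if "t \<in> {0..1}" for t
      using that K0[of "t/2"] by (simp add: l_def path_join_def)
    show "(K \<circ> ?\<phi>) (1, t) = g t" if "t \<in> {0..1}" for t by (simp add: g_def)
    have v: "a 0 = 0" "b 0 = 0" "a 1 = 0" "b 1 = 1/2" by (auto simp: a_def b_def)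
    show "(K \<circ> ?\<phi>) (s, 0) = c 0" if "s \<in> {0..1}" for s using Ks(1)[of 0] by (simp add: v)
    show "(K \<circ> ?\<phi>) (s, 1) = c 1" if "s \<in> {0..1}" for s
    proof -
      have "(1 - s) / 2 + s / 2 = (1/2 :: real)" by (simp add: field_simps)
      then have "K (0, (1 - s) / 2 + s / 2) = K (0, 1/2)" by (simp only:)
      then show ?thesis using K0[of "1/2"] by (simp add: v l_def path_join_def)
    qed
  qed
  moreover have g: "g r = c' (max 0 (2 * r - 1))" if r: "r \<in> {0..1}" for r
  proof -
    consider "r \<le> 1/6" | "1/6 \<le> r" "r \<le> 1/3" | "1/3 \<le> r" "r \<le> 1/2" | "1/2 < r" by linarith
    then show ?thesis
    proof cases
      case 1
      then have "b r = 0" using r by (auto simp: b_def)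
      then show ?thesis using Ks(1)[OF ab(1)[OF r]] 1 eq by (simp add: g_def)
    next
      case 2
      then have "a r = 1" using r by (auto simp: a_def)
      then show ?thesis using K1[OF ab(2)[OF r]] 2 eq by (simp add: g_def)
    next
      case 3
      then have "b r = 1" using r by (auto simp: b_def)
      then show ?thesis using Ks(2)[OF ab(1)[OF r]] 3 eq by (simp add: g_def)
    next
      case 4
      then have "a r = 0" "b r = 3/2 - r" using r by (auto simp: a_def b_def)
      then have "g r = l (3/2 - r)" using K0[of "3/2 - r"] r 4 by (simp add: g_def)
      also have "\<dots> = c' (max 0 (2 * r - 1))"
        using 4 r eq by (cases "r = 1") (auto simp: l_def path_join_def algebra_simps)
      finally show ?thesis .
    qed
  qed
  moreover have "path_homotopic X g c'"
    unfolding path_homotopic_iff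
  proof (intro exI conjI ballI)
    let ?\<phi> = "\<lambda>z::real\<times>real. (1 - fst z) * max 0 (2 * snd z - 1) + fst z * snd z"
    have sub: "?\<phi> z \<in> {0..1}" if z01: "z \<in> {0..1} \<times> {0..1}" for z
    proof -
      obtain s r where z: "z = (s, r)" "s \<in> {0..1}" "r \<in> {0..1}" using z01 by (cases z) auto
      have "(1 - s) * max 0 (2 * r - 1) + s * r \<le> 1"
        using z convex_bound_le[of "max 0 (2 * r - 1)" 1 r "1 - s" s] by auto
      moreover have "0 \<le> (1 - s) * max 0 (2 * r - 1) + s * r" using z by auto
      ultimately show ?thesis using z by simp
    qed
    have "continuous_on ({0..1} \<times> {0..1}) ?\<phi>" by (intro continuous_intros)
    then have "continuous_map (prod_topology ?I ?I) ?I ?\<phi>"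
      using sub by (simp add: Pi_iff)
    then show "continuous_map (prod_topology ?I ?I) X (c' \<circ> ?\<phi>)"
      using c' continuous_map_compose unfolding pathin_def by blast
    show "(c' \<circ> ?\<phi>) (0, t) = g t" if "t \<in> {0..1}" for t using g[OF that] by simp
    show "(c' \<circ> ?\<phi>) (1, t) = c' t" if "t \<in> {0..1}" for t by simp
    show "(c' \<circ> ?\<phi>) (s, 0) = g 0" if "s \<in> {0..1}" for s using g[of 0] by simp
    show "(c' \<circ> ?\<phi>) (s, 1) = g 1" if "s \<in> {0..1}" for s using g[of 1] by simp
  qed
  ultimately show ?thesis using path_homotopic_trans by blast
qed

section \<open>Deck transformations and the fundamental group\<close>

definition lift_end :: "'e topology \<Rightarrow> ('e \<Rightarrow> 'a) \<Rightarrow> 'e \<Rightarrow> (real \<Rightarrow> 'a) \<Rightarrow> 'e" where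
  "lift_end E p e f = (SOME x. \<exists>c. lift_on E p f 0 1 c \<and> c 0 = e \<and> c 1 = x)"

lemma lift_end_eq:
  assumes cov: "covering_projection E M p" and c: "lift_on E p f 0 1 c"
  shows "lift_end E p (c 0) f = c 1"
proof -
  have "f t \<in> topspace M" if "t \<in> {0..1}" for t
  proof -
    have "c t \<in> topspace E" "f t = p (c t)" using c that by (auto simp: lift_on_def continuous_map_def)
    then show ?thesis using cov by (auto simp: covering_projection_def continuous_map_def)
  qed
  then have f: "f ` {0..1} \<subseteq> topspace M" by blast
  show ?thesis unfolding lift_end_def
  proof (rule some_equality)
    show "\<exists>c'. lift_on E p f 0 1 c' \<and> c' 0 = c 0 \<and> c' 1 = c 1" using c by blast
    fix x assume "\<exists>c'. lift_on E p f 0 1 c' \<and> c' 0 = c 0 \<and> c' 1 = x"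
    then show "x = c 1" using lift_unique[OF cov f _ c, of _ 1] by auto
  qed
qed

lemma lift_end_homotopic:
  assumes cov: "covering_projection E M p" and h: "path_homotopic M f g"
    and e: "e \<in> topspace E" "p e = f 0"
  shows "lift_end E p e f = lift_end E p e g"
proof -
  let ?I = "top_of_set {0..1::real}"
  obtain H where H: "continuous_map (prod_topology ?I ?I) M H"
    and H0: "\<And>t. t \<in> {0..1} \<Longrightarrow> H (0, t) = f t" "\<And>t. t \<in> {0..1} \<Longrightarrow> H (1, t) = g t"
    and Hs: "\<And>s. s \<in> {0..1} \<Longrightarrow> H (s, 0) = f 0" "\<And>s. s \<in> {0..1} \<Longrightarrow> H (s, 1) = f 1"
    using h unfolding path_homotopic_iff by metis
  have "\<exists>c. lift_on E p (\<lambda>t. H (s, t)) 0 1 c \<and> c 0 = e" if s: "s \<in> {0..1}" for s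
  proof (rule path_lift_exists[OF cov])
    have "continuous_map ?I M (H \<circ> Pair s)" using s by (intro continuous_map_o_Pair[OF H]) simp
    then show "continuous_map ?I M (\<lambda>t. H (s, t))" by (simp add: o_def)
  qed (use e Hs s in auto)
  then obtain c where c: "\<And>s. s \<in> {0..1} \<Longrightarrow> lift_on E p (\<lambda>t. H (s, t)) 0 1 (c s)"
    "\<And>s. s \<in> {0..1} \<Longrightarrow> c s 0 = e" by metis
  have "c 0 1 = c 1 1" by (rule lift_endpoint_homotopy_invariant[OF cov H c Hs(2)])
  moreover have "lift_on E p f 0 1 (c 0)" "lift_on E p g 0 1 (c 1)"
    using c(1)[of 0] c(1)[of 1] H0 by (auto simp: lift_on_def)
  ultimately show ?thesis using lift_end_eq[OF cov] c(2)[of 0] c(2)[of 1]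
    by (metis atLeastAtMost_iff order_refl zero_le_one)
qed

locale simply_connected_covering =
  fixes E :: "'e topology" and M :: "'a topology" and p :: "'e \<Rightarrow> 'a"
  assumes universal: "universal_cover E M p"
    and small_path_connected: "\<And>e N. openin E N \<Longrightarrow> e \<in> N \<Longrightarrow>
      \<exists>V. openin E V \<and> e \<in> V \<and> V \<subseteq> N \<and> path_connectedin E V"
begin

lemma cov: "covering_projection E M p" and sc: "simply_connected_space E"
  using universal by (auto simp: universal_cover_def)

lemma p_cont: "continuous_map E M p" using cov by (simp add: covering_projection_def)

lemma p_in: "e \<in> topspace E \<Longrightarrow> p e \<in> topspace M"
  using p_cont by (auto simp: continuous_map_def)

lemma path_between:
  assumes "e \<in> topspace E" "z \<in> topspace E"
  obtains c where "pathin E c" "c 0 = e" "c 1 = z"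
  using assms sc unfolding simply_connected_space_def path_connected_space_def by blast

lemma pathin_lift: "pathin E c \<Longrightarrow> lift_on E p (p \<circ> c) 0 1 c"
  by (simp add: lift_on_def pathin_def)

lemma pathin_point: "pathin E c \<Longrightarrow> t \<in> {0..1} \<Longrightarrow> c t \<in> topspace E"
  by (auto simp: pathin_def continuous_map_def)

lemma lift_along:
  assumes "pathin E c" "e \<in> topspace E" "p e = p (c 0)"
  obtains c' where "pathin E c'" "c' 0 = e" "\<And>t. t \<in> {0..1} \<Longrightarrow> p (c' t) = p (c t)"
    "lift_end E p e (p \<circ> c) = c' 1"
proof -
  have "continuous_map (top_of_set {0..1}) M (p \<circ> c)"
    using assms(1) p_cont continuous_map_compose unfolding pathin_def by blast
  then obtain c' where c': "lift_on E p (p \<circ> c) 0 1 c'" "c' 0 = e"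
    using path_lift_exists[OF cov, of 0 1 "p \<circ> c" e] assms by auto
  show thesis using that[of c'] c' lift_end_eq[OF cov c'(1)] by (auto simp: lift_on_def pathin_def)
qed

text \<open>The deck transformation that moves \<open>e\<close> to \<open>e'\<close>, by lifting to \<open>e'\<close> the projections of paths
  that start at \<open>e\<close>.\<close>

definition deck :: "'e \<Rightarrow> 'e \<Rightarrow> 'e \<Rightarrow> 'e" where
  "deck e e' z = lift_end E p e' (p \<circ> (SOME c. pathin E c \<and> c 0 = e \<and> c 1 = z))"

lemma deck_path:
  assumes e: "e' \<in> topspace E" "p e = p e'" and c: "pathin E c" "c 0 = e"
  shows "deck e e' (c 1) = lift_end E p e' (p \<circ> c)"
proof -
  define c1 where "c1 = (SOME c1. pathin E c1 \<and> c1 0 = e \<and> c1 1 = c 1)"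
  have "pathin E c1 \<and> c1 0 = e \<and> c1 1 = c 1" unfolding c1_def
    by (rule someI[of "\<lambda>c1. pathin E c1 \<and> c1 0 = e \<and> c1 1 = c 1" c]) (use c in simp)
  then have "path_homotopic E c1 c" using c by (intro simply_connected_paths_homotopic[OF sc]) auto
  then have "path_homotopic M (p \<circ> c1) (p \<circ> c)" by (rule path_homotopic_compose[OF _ p_cont])
  then show ?thesis unfolding deck_def c1_def[symmetric]
    using e c \<open>pathin E c1 \<and> _\<close> by (intro lift_end_homotopic[OF cov]) auto
qed

context
  fixes e e' assumes e: "e \<in> topspace E" "e' \<in> topspace E" "p e = p e'"
begin

lemma deck_lift:
  assumes "pathin E c" "c 0 = e"
  obtains c' where "pathin E c'" "c' 0 = e'" "\<And>t. t \<in> {0..1} \<Longrightarrow> p (c' t) = p (c t)"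
    "deck e e' (c 1) = c' 1"
  using lift_along[OF assms(1) e(2)] deck_path[OF e(2,3) assms] assms e by metis

lemma deck_in: "z \<in> topspace E \<Longrightarrow> deck e e' z \<in> topspace E"
  and p_deck: "z \<in> topspace E \<Longrightarrow> p (deck e e' z) = p z"
proof -
  assume "z \<in> topspace E"
  then obtain c where c: "pathin E c" "c 0 = e" "c 1 = z" using path_between e by blast
  obtain c' where c': "pathin E c'" "\<And>t. t \<in> {0..1} \<Longrightarrow> p (c' t) = p (c t)" "deck e e' (c 1) = c' 1"
    using deck_lift[OF c(1,2)] by metis
  show "deck e e' z \<in> topspace E" using c' c pathin_point[of c' 1] by simp
  show "p (deck e e' z) = p z" using c' c by simp
qed

lemma deck_base: "deck e e' e = e'"
proof -
  have c: "pathin E (\<lambda>_. e)" using e by simp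
  have "lift_on E p (p \<circ> (\<lambda>_. e)) 0 1 (\<lambda>_. e')" using e by (auto simp: lift_on_def)
  then show ?thesis using deck_path[OF e(2,3) c] lift_end_eq[OF cov] by fastforce
qed

text \<open>Near \<open>z\<close>, a path from \<open>e\<close> to a point \<open>z'\<close> can be chosen as a path to \<open>z\<close> followed by a short path, whose lift
  stays in a sheet.\<close>

lemma deck_continuous: "continuous_map E E (deck e e')"
proof -
  have "\<exists>U. openin E U \<and> z \<in> U \<and> (\<forall>z'\<in>U. deck e e' z' \<in> N)"
    if z: "z \<in> topspace E" and N: "openin E N" "deck e e' z \<in> N" for z N
  proof -
    let ?d = "deck e e' z"
    obtain T where T: "openin M T" "p z \<in> T"
      "\<And>e. e \<in> topspace E \<Longrightarrow> p e \<in> T \<Longrightarrow> \<exists>V. e \<in> V \<and> sheet E M p T V"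
      using evenly_covered_nbhd[OF cov p_in[OF z]] by metis
    have "p ?d \<in> T" using T(2) p_deck[OF z] by simp
    from T(3)[OF deck_in[OF z] this] obtain V where V: "?d \<in> V" "sheet E M p T V" by blast
    have VN: "openin M (p ` (N \<inter> V))"
      using sheet_open_image[OF V(2)] N sheetD(2)[OF V(2)] by blast
    have "openin E {x \<in> topspace E. p x \<in> p ` (N \<inter> V)}"
      by (rule openin_continuous_map_preimage[OF p_cont VN])
    moreover have "z \<in> {x \<in> topspace E. p x \<in> p ` (N \<inter> V)}"
    proof -
      have "p ?d \<in> p ` (N \<inter> V)" using N V by blast
      then show ?thesis using z p_deck[OF z] by simp
    qed
    ultimately obtain U where U: "openin E U" "z \<in> U" "U \<subseteq> {x \<in> topspace E. p x \<in> p ` (N \<inter> V)}"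
      "path_connectedin E U" using small_path_connected by meson
    have "deck e e' z' \<in> N" if z': "z' \<in> U" for z'
    proof -
      obtain c where c: "pathin E c" "c 0 = e" "c 1 = z" using path_between e z by blast
      obtain q where q: "pathin E q" "q ` {0..1} \<subseteq> U" "q 0 = z" "q 1 = z'"
        using U(4) z' U(2) unfolding path_connectedin by (metis image_subset_iff_funcset)
      obtain c' where c': "pathin E c'" "c' 0 = e'" "\<And>t. t \<in> {0..1} \<Longrightarrow> p (c' t) = p (c t)" "?d = c' 1"
        using deck_lift[OF c(1,2)] c(3) by metis
      obtain q' where q': "pathin E q'" "q' 0 = ?d" "\<And>t. t \<in> {0..1} \<Longrightarrow> p (q' t) = p (q t)"
        using lift_along[OF q(1) deck_in[OF z]] p_deck[OF z] q(3) by metis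
      have j: "pathin E (path_join c q)" "pathin E (path_join c' q')"
        using c q c' q' by (auto intro!: pathin_join)
      have "lift_on E p (p \<circ> path_join c q) 0 1 (path_join c' q')"
        using j(2) c'(3) q'(3) by (auto simp: lift_on_def pathin_def path_join_def)
      then have "lift_end E p e' (p \<circ> path_join c q) = q' 1"
        using lift_end_eq[OF cov] c'(2) by (fastforce simp: path_join_def)
      moreover have "path_join c q 0 = e" "path_join c q 1 = z'" using c q by (auto simp: path_join_def)
      ultimately have d: "deck e e' z' = q' 1" using deck_path[OF e(2,3) j(1)] by simp
      have "q' ` {0..1} \<subseteq> V"
      proof (rule connected_subset_sheet[OF V(2)])
        show "connectedin E (q' ` {0..1})" using q'(1) connectedin_path_image by blast
        have "q t \<in> U" if "t \<in> {0..1}" for t using q(2) that by blast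
        then show "p ` q' ` {0..1} \<subseteq> T"
          using q'(3) U(3) sheetD(6)[OF V(2)] by fastforce
        have "q' 0 \<in> q' ` {0..1}" by simp
        then show "q' ` {0..1} \<inter> V \<noteq> {}" using q'(2) V(1) by auto
      qed
      then have 1: "q' 1 \<in> V" by auto
      have "p (q' 1) \<in> p ` (N \<inter> V)" using q'(3)[of 1] q(4) z' U(3) by auto
      then obtain m where m: "m \<in> N" "m \<in> V" "p (q' 1) = p m" by blast
      then have "q' 1 = m" using 1 sheetD(5)[OF V(2)] by (meson inj_onD)
      then show ?thesis using d m by simp
    qed
    then show ?thesis using U by blast
  qed
  then show ?thesis
    unfolding continuous_map_eq_topcontinuous_at topcontinuous_at_def using deck_in by blast
qed

text \<open>A lift of the identity of the base maps a path from \<open>e\<close> to the lift of its projection at \<open>e'\<close>.\<close>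

lemma deck_unique:
  assumes d: "continuous_map E E d" "\<And>z. z \<in> topspace E \<Longrightarrow> p (d z) = p z" "d e = e'"
    and z: "z \<in> topspace E"
  shows "d z = deck e e' z"
proof -
  obtain c where c: "pathin E c" "c 0 = e" "c 1 = z" using path_between e z by blast
  have "pathin E (d \<circ> c)" using c(1) d(1) continuous_map_compose unfolding pathin_def by blast
  then have l: "lift_on E p (p \<circ> c) 0 1 (d \<circ> c)"
    using d(2) pathin_point[OF c(1)] by (simp add: lift_on_def pathin_def)
  show ?thesis using lift_end_eq[OF cov l] deck_path[OF e(2,3) c(1,2)] c d(3) by simp
qed

end

lemma deck_deck:
  assumes "e1 \<in> topspace E" "e2 \<in> topspace E" "e3 \<in> topspace E" "p e1 = p e2" "p e2 = p e3"
    and "z \<in> topspace E"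
  shows "deck e2 e3 (deck e1 e2 z) = deck e1 e3 z"
proof -
  have "(deck e2 e3 \<circ> deck e1 e2) z = deck e1 e3 z"
  proof (rule deck_unique)
    show "continuous_map E E (deck e2 e3 \<circ> deck e1 e2)"
      using deck_continuous assms continuous_map_compose by metis
  qed (use assms in \<open>auto simp: p_deck deck_in deck_base\<close>)
  then show ?thesis by simp
qed

lemma deck_self: "e \<in> topspace E \<Longrightarrow> z \<in> topspace E \<Longrightarrow> deck e e z = z"
  using deck_unique[of e e id z] by simp

lemma deck_homeomorphic:
  assumes "e \<in> topspace E" "e' \<in> topspace E" "p e = p e'"
  shows "homeomorphic_map E E (deck e e')"
proof -
  have "homeomorphic_maps E E (deck e e') (deck e' e)"
    unfolding homeomorphic_maps_def
    using assms by (auto simp: deck_continuous deck_deck deck_self)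
  then show ?thesis using homeomorphic_map_maps by blast
qed

end

text \<open>With a base point \<open>e0\<close>, a class of loops is determined by the end point of its lifts
  at \<open>e0\<close>, so the fundamental group is the fibre through \<open>e0\<close> in disguise, and also the group of
  deck transformations.\<close>

locale pointed_covering = simply_connected_covering E M p
  for E :: "'e topology" and M :: "'a topology" and p :: "'e \<Rightarrow> 'a" +
  fixes e0 :: 'e
  assumes e0: "e0 \<in> topspace E"
begin

definition fibre0 :: "'e set" where "fibre0 = {e \<in> topspace E. p e = p e0}"

definition loop_class :: "'e \<Rightarrow> (real \<Rightarrow> 'a) set" where
  "loop_class e = {f \<in> loops M (p e0). lift_end E p e0 f = e}"

abbreviation "\<pi>1 \<equiv> fundamental_group M (p e0)"

lemma e0_fibre: "e0 \<in> fibre0" using e0 by (simp add: fibre0_def)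

lemma fibre0D: "e \<in> fibre0 \<Longrightarrow> e \<in> topspace E" "e \<in> fibre0 \<Longrightarrow> p e = p e0" by (auto simp: fibre0_def)

lemma loop_lift:
  assumes "f \<in> loops M (p e0)"
  obtains c where "pathin E c" "c 0 = e0" "\<And>t. t \<in> {0..1} \<Longrightarrow> p (c t) = f t" "lift_end E p e0 f = c 1"
proof -
  obtain c where c: "lift_on E p f 0 1 c" "c 0 = e0"
    using path_lift_exists[OF cov, of 0 1 f e0] assms e0 by (auto simp: loops_def pathin_def)
  then show thesis using that[of c] lift_end_eq[OF cov c(1)] by (auto simp: lift_on_def pathin_def)
qed

lemma lift_end_fibre:
  assumes "f \<in> loops M (p e0)" shows "lift_end E p e0 f \<in> fibre0"
proof -
  obtain c where c: "pathin E c" "\<And>t. t \<in> {0..1} \<Longrightarrow> p (c t) = f t" "lift_end E p e0 f = c 1"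
    using loop_lift[OF assms] by metis
  show ?thesis using c pathin_point[OF c(1), of 1] assms by (auto simp: fibre0_def loops_def)
qed

lemma loops_homotopic_iff:
  assumes f: "f \<in> loops M (p e0)" and g: "g \<in> loops M (p e0)"
  shows "path_homotopic M f g \<longleftrightarrow> lift_end E p e0 f = lift_end E p e0 g"
proof
  show "path_homotopic M f g \<Longrightarrow> lift_end E p e0 f = lift_end E p e0 g"
    using lift_end_homotopic[OF cov] e0 f by (auto simp: loops_def)
next
  assume eq: "lift_end E p e0 f = lift_end E p e0 g"
  obtain c where c: "pathin E c" "c 0 = e0" "\<And>t. t \<in> {0..1} \<Longrightarrow> p (c t) = f t" "lift_end E p e0 f = c 1"
    using loop_lift[OF f] by metis
  obtain d where d: "pathin E d" "d 0 = e0" "\<And>t. t \<in> {0..1} \<Longrightarrow> p (d t) = g t" "lift_end E p e0 g = d 1"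
    using loop_lift[OF g] by metis
  have "path_homotopic E c d" using simply_connected_paths_homotopic[OF sc c(1) d(1)] c d eq by simp
  then have "path_homotopic M (p \<circ> c) (p \<circ> d)" by (rule path_homotopic_compose[OF _ p_cont])
  moreover have "path_homotopic M f (p \<circ> c)" "path_homotopic M g (p \<circ> d)"
    using f g c(3) d(3) by (auto intro!: path_homotopic_equal simp: loops_def)
  ultimately show "path_homotopic M f g" using path_homotopic_trans path_homotopic_sym by blast
qed

lemma loop_to:
  assumes "e \<in> fibre0"
  obtains c where "pathin E c" "c 0 = e0" "c 1 = e" "p \<circ> c \<in> loop_class e"
proof -
  obtain c where c: "pathin E c" "c 0 = e0" "c 1 = e" using path_between[OF e0, of e] fibre0D[OF assms] by blast
  have "pathin M (p \<circ> c)" using c(1) p_cont continuous_map_compose unfolding pathin_def by blast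
  then have "p \<circ> c \<in> loop_class e"
    using c lift_end_eq[OF cov pathin_lift[OF c(1)]] fibre0D[OF assms]
    by (auto simp: loop_class_def loops_def)
  with c that show thesis by blast
qed

lemma carrier_pi1: "carrier \<pi>1 = loop_class ` fibre0"
proof -
  let ?r = "{(f, g). f \<in> loops M (p e0) \<and> g \<in> loops M (p e0) \<and> path_homotopic M f g}"
  have r: "?r `` {f} = loop_class (lift_end E p e0 f)" if "f \<in> loops M (p e0)" for f
    using that loops_homotopic_iff[OF that] by (auto simp: loop_class_def)
  have "carrier \<pi>1 = (\<Union>f\<in>loops M (p e0). {?r `` {f}})"
    by (simp add: fundamental_group_def quotient_def)
  also have "\<dots> = (\<lambda>f. loop_class (lift_end E p e0 f)) ` loops M (p e0)" using r by auto
  also have "\<dots> = loop_class ` fibre0"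
  proof (intro equalityI subsetI)
    fix x assume "x \<in> loop_class ` fibre0"
    then obtain e where e: "e \<in> fibre0" "x = loop_class e" by blast
    obtain c where "p \<circ> c \<in> loop_class e" using loop_to[OF e(1)] by metis
    then have "p \<circ> c \<in> loops M (p e0)" "lift_end E p e0 (p \<circ> c) = e" by (auto simp: loop_class_def)
    then show "x \<in> (\<lambda>f. loop_class (lift_end E p e0 f)) ` loops M (p e0)" using e by (metis imageI)
  qed (use lift_end_fibre in auto)
  finally show ?thesis .
qed

lemma one_pi1: "\<one>\<^bsub>\<pi>1\<^esub> = loop_class e0"
proof -
  have const: "(\<lambda>_. p e0) \<in> loops M (p e0)" using p_in[OF e0] by (simp add: loops_def)
  have "lift_on E p (\<lambda>_. p e0) 0 1 (\<lambda>_. e0)" using e0 by (auto simp: lift_on_def)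
  then have "lift_end E p e0 (\<lambda>_. p e0) = e0" using lift_end_eq[OF cov] by fastforce
  then show ?thesis using loops_homotopic_iff[OF const]
    by (auto simp: fundamental_group_def loop_class_def)
qed

lemma join_lift_end:
  assumes f: "f \<in> loop_class e" "e \<in> fibre0" and g: "g \<in> loop_class e'"
  shows "path_join f g \<in> loops M (p e0)" "lift_end E p e0 (path_join f g) = deck e0 e e'"
proof -
  have fg: "f \<in> loops M (p e0)" "g \<in> loops M (p e0)" using f g by (auto simp: loop_class_def)
  show j: "path_join f g \<in> loops M (p e0)"
    using fg pathin_join[of M f g] by (auto simp: loops_def path_join_def)
  obtain c where c: "pathin E c" "c 0 = e0" "\<And>t. t \<in> {0..1} \<Longrightarrow> p (c t) = f t" "lift_end E p e0 f = c 1"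
    using loop_lift[OF fg(1)] by metis
  obtain d where d: "pathin E d" "d 0 = e0" "\<And>t. t \<in> {0..1} \<Longrightarrow> p (d t) = g t" "lift_end E p e0 g = d 1"
    using loop_lift[OF fg(2)] by metis
  have e: "c 1 = e" "d 1 = e'" using c d f g by (auto simp: loop_class_def)
  note ee = e0 fibre0D(1)[OF f(2)] fibre0D(2)[OF f(2), symmetric]
  let ?d = "deck e0 e \<circ> d"
  have 1: "pathin E ?d" using d(1) deck_continuous[OF ee] continuous_map_compose unfolding pathin_def by blast
  have 2: "?d 0 = e" "?d 1 = deck e0 e e'" using d e deck_base[OF ee] by auto
  have 3: "p (?d t) = g t" if "t \<in> {0..1}" for t
    using p_deck[OF ee pathin_point[OF d(1) that]] d(3)[OF that] by simp
  have "pathin E (path_join c ?d)" using c(1) 1 2 e by (intro pathin_join) auto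
  then have "lift_on E p (path_join f g) 0 1 (path_join c ?d)"
    using c(3) 3 by (auto simp: lift_on_def pathin_def path_join_def)
  from lift_end_eq[OF cov this] show "lift_end E p e0 (path_join f g) = deck e0 e e'"
    using c(2) 2 by (simp add: path_join_def)
qed

lemma deck_fibre:
  assumes "e \<in> fibre0" "e' \<in> fibre0" shows "deck e0 e e' \<in> fibre0"
  using deck_in[OF e0, of e e'] p_deck[OF e0, of e e'] fibre0D[OF assms(1)] fibre0D[OF assms(2)]
  by (simp add: fibre0_def)

text \<open>The lift of \<open>f\<close> followed by \<open>g\<close> is the lift of \<open>f\<close> followed by the translate of the lift of \<open>g\<close> by the deck
  transformation of \<open>f\<close>: concatenation of loops is composition of deck transformations.\<close>

lemma mult_pi1:
  assumes e: "e \<in> fibre0" "e' \<in> fibre0"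
  shows "loop_class e \<otimes>\<^bsub>\<pi>1\<^esub> loop_class e' = loop_class (deck e0 e e')"
proof (intro equalityI subsetI)
  fix k assume "k \<in> loop_class e \<otimes>\<^bsub>\<pi>1\<^esub> loop_class e'"
  then obtain f g where fg: "k \<in> loops M (p e0)" "f \<in> loop_class e" "g \<in> loop_class e'"
      "path_homotopic M (path_join f g) k"
    by (auto simp: fundamental_group_def)
  then show "k \<in> loop_class (deck e0 e e')"
    using loops_homotopic_iff[OF join_lift_end(1)[OF fg(2) e(1) fg(3)] fg(1)]
      join_lift_end(2)[OF fg(2) e(1) fg(3)] by (simp add: loop_class_def)
next
  fix k assume k: "k \<in> loop_class (deck e0 e e')"
  obtain f g where fg: "f \<in> loop_class e" "g \<in> loop_class e'" using loop_to e by metis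
  have "k \<in> loops M (p e0)" using k by (simp add: loop_class_def)
  then have "path_homotopic M (path_join f g) k"
    using loops_homotopic_iff[OF join_lift_end(1)[OF fg(1) e(1) fg(2)]]
      join_lift_end(2)[OF fg(1) e(1) fg(2)] k by (simp add: loop_class_def)
  then show "k \<in> loop_class e \<otimes>\<^bsub>\<pi>1\<^esub> loop_class e'"
    using fg \<open>k \<in> loops M (p e0)\<close> by (auto simp: fundamental_group_def)
qed

lemma deck_action_eq:
  assumes e: "e \<in> fibre0"
  shows "deck_action E p e0 (loop_class e) = restrict (deck e0 e) (topspace E)"
proof -
  note ee = e0 fibre0D(1)[OF e] fibre0D(2)[OF e, symmetric]
  show ?thesis unfolding deck_action_def
  proof (rule the_equality)
    obtain c where c: "pathin E c" "c 0 = e0" "c 1 = e" "p \<circ> c \<in> loop_class e" using loop_to[OF e] by metis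
    have "homeomorphic_map E E (restrict (deck e0 e) (topspace E))"
      by (rule homeomorphic_map_eq[OF deck_homeomorphic[OF ee]]) simp
    moreover have "\<exists>f\<in>loop_class e. \<exists>c. pathin E c \<and> c 0 = e0 \<and> (\<forall>t\<in>{0..1}. p (c t) = f t) \<and>
        c 1 = restrict (deck e0 e) (topspace E) e0"
      using c deck_base[OF ee] e0 by (intro bexI[OF _ c(4)] exI[of _ c]) simp
    ultimately show "restrict (deck e0 e) (topspace E) \<in> extensional (topspace E) \<and>
      homeomorphic_map E E (restrict (deck e0 e) (topspace E)) \<and>
      (\<forall>x\<in>topspace E. p (restrict (deck e0 e) (topspace E) x) = p x) \<and>
      (\<exists>f\<in>loop_class e. \<exists>c. pathin E c \<and> c 0 = e0 \<and> (\<forall>t\<in>{0..1}. p (c t) = f t) \<and>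
        c 1 = restrict (deck e0 e) (topspace E) e0)"
      using p_deck[OF ee] by simp
  next
    fix d assume d: "d \<in> extensional (topspace E) \<and> homeomorphic_map E E d \<and>
      (\<forall>x\<in>topspace E. p (d x) = p x) \<and>
      (\<exists>f\<in>loop_class e. \<exists>c. pathin E c \<and> c 0 = e0 \<and> (\<forall>t\<in>{0..1}. p (c t) = f t) \<and> c 1 = d e0)"
    then obtain f c where fc: "f \<in> loop_class e" "pathin E c" "c 0 = e0" "\<forall>t\<in>{0..1}. p (c t) = f t"
      "c 1 = d e0" by blast
    have "lift_on E p f 0 1 c" using fc by (simp add: lift_on_def pathin_def)
    from lift_end_eq[OF cov this] have de: "d e0 = e" using fc by (simp add: loop_class_def)
    have "d z = deck e0 e z" if "z \<in> topspace E" for z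
      by (rule deck_unique[OF ee]) (use d de that homeomorphic_imp_continuous_map in auto)
    then show "d = restrict (deck e0 e) (topspace E)" using d by (auto simp: extensional_def)
  qed
qed

lemma deck_deck0:
  assumes "e1 \<in> fibre0" "e2 \<in> fibre0" "z \<in> topspace E"
  shows "deck e0 e1 (deck e0 e2 z) = deck e0 (deck e0 e1 e2) z"
proof -
  note e1 = e0 fibre0D(1)[OF assms(1)] fibre0D(2)[OF assms(1), symmetric]
  note e2 = e0 fibre0D(1)[OF assms(2)] fibre0D(2)[OF assms(2), symmetric]
  note e3 = deck_fibre[OF assms(1,2)]
  have "(deck e0 e1 \<circ> deck e0 e2) z = deck e0 (deck e0 e1 e2) z"
  proof (rule deck_unique)
    show "continuous_map E E (deck e0 e1 \<circ> deck e0 e2)"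
      by (rule continuous_map_compose[OF deck_continuous[OF e2] deck_continuous[OF e1]])
    show "p ((deck e0 e1 \<circ> deck e0 e2) w) = p w" if "w \<in> topspace E" for w
      using p_deck[OF e1 deck_in[OF e2 that]] p_deck[OF e2 that] by simp
    show "(deck e0 e1 \<circ> deck e0 e2) e0 = deck e0 e1 e2" using deck_base[OF e2] by simp
  qed (use e0 e3 fibre0D assms(3) in auto)
  then show ?thesis by simp
qed

lemma group_pi1: "group \<pi>1"
proof (rule groupI)
  fix x y assume xy: "x \<in> carrier \<pi>1" "y \<in> carrier \<pi>1"
  then obtain e1 e2 where "e1 \<in> fibre0" "x = loop_class e1" "e2 \<in> fibre0" "y = loop_class e2"
    by (auto simp: carrier_pi1)
  then show "x \<otimes>\<^bsub>\<pi>1\<^esub> y \<in> carrier \<pi>1" by (simp add: carrier_pi1 mult_pi1 deck_fibre)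
next
  show "\<one>\<^bsub>\<pi>1\<^esub> \<in> carrier \<pi>1" using e0_fibre by (simp add: one_pi1 carrier_pi1)
next
  fix x y z assume "x \<in> carrier \<pi>1" "y \<in> carrier \<pi>1" "z \<in> carrier \<pi>1"
  then obtain e1 e2 e3 where e: "e1 \<in> fibre0" "x = loop_class e1" "e2 \<in> fibre0" "y = loop_class e2"
    "e3 \<in> fibre0" "z = loop_class e3" by (auto simp: carrier_pi1)
  then show "x \<otimes>\<^bsub>\<pi>1\<^esub> y \<otimes>\<^bsub>\<pi>1\<^esub> z = x \<otimes>\<^bsub>\<pi>1\<^esub> (y \<otimes>\<^bsub>\<pi>1\<^esub> z)"
    using deck_deck0[OF e(1,3) fibre0D(1)[OF e(5)]] by (simp add: mult_pi1 deck_fibre)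
next
  fix x assume "x \<in> carrier \<pi>1"
  then obtain e where e: "e \<in> fibre0" "x = loop_class e" by (auto simp: carrier_pi1)
  show "\<one>\<^bsub>\<pi>1\<^esub> \<otimes>\<^bsub>\<pi>1\<^esub> x = x"
    using e mult_pi1[OF e0_fibre e(1)] deck_self[OF e0] fibre0D(1) by (simp add: one_pi1)
  note ee = fibre0D(1)[OF e(1)] e0 fibre0D(2)[OF e(1)]
  have i: "deck e e0 e0 \<in> fibre0"
    using deck_in[OF ee e0] p_deck[OF ee e0] by (simp add: fibre0_def)
  have "deck e0 (deck e e0 e0) e = e0"
  proof -
    have "deck e e0 e = deck e0 (deck e e0 e0) e"
      by (rule deck_unique)
        (use ee i fibre0D deck_continuous[OF ee] p_deck[OF ee] in auto)
    then show ?thesis using deck_base[OF ee] by simp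
  qed
  then have "loop_class (deck e e0 e0) \<otimes>\<^bsub>\<pi>1\<^esub> x = \<one>\<^bsub>\<pi>1\<^esub>"
    using e mult_pi1[OF i e(1)] by (simp add: one_pi1)
  then show "\<exists>y\<in>carrier \<pi>1. y \<otimes>\<^bsub>\<pi>1\<^esub> x = \<one>\<^bsub>\<pi>1\<^esub>" using i by (auto simp: carrier_pi1)
qed

lemma deck_action_mult:
  assumes "a \<in> carrier \<pi>1" "b \<in> carrier \<pi>1" "z \<in> topspace E"
  shows "deck_action E p e0 (a \<otimes>\<^bsub>\<pi>1\<^esub> b) z = deck_action E p e0 a (deck_action E p e0 b z)"
proof -
  obtain e1 e2 where e: "e1 \<in> fibre0" "a = loop_class e1" "e2 \<in> fibre0" "b = loop_class e2"
    using assms by (auto simp: carrier_pi1)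
  show ?thesis
    using e assms(3) deck_in[OF e0, of e2 z] fibre0D
    by (simp add: mult_pi1 deck_action_eq deck_fibre deck_deck0)
qed

lemma deck_action_homeomorphic:
  assumes "a \<in> carrier \<pi>1"
  shows "homeomorphic_map E E (deck_action E p e0 a)"
    and "\<And>z. z \<in> topspace E \<Longrightarrow> p (deck_action E p e0 a z) = p z"
proof -
  obtain e where e: "e \<in> fibre0" "a = loop_class e" using assms by (auto simp: carrier_pi1)
  note ee = e0 fibre0D(1)[OF e(1)] fibre0D(2)[OF e(1), symmetric]
  show "homeomorphic_map E E (deck_action E p e0 a)"
    unfolding e(2) deck_action_eq[OF e(1)] by (rule homeomorphic_map_eq[OF deck_homeomorphic[OF ee]]) simp
  show "\<And>z. z \<in> topspace E \<Longrightarrow> p (deck_action E p e0 a z) = p z"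
    unfolding e(2) deck_action_eq[OF e(1)] using p_deck[OF ee] by simp
qed

lemma deck_action_simply_transitive:
  assumes z: "z \<in> topspace E" "z' \<in> topspace E" "p z = p z'"
  shows "\<exists>!a. a \<in> carrier \<pi>1 \<and> deck_action E p e0 a z = z'"
proof -
  let ?e = "deck z z' e0"
  have e: "?e \<in> fibre0" using deck_in[OF z e0] p_deck[OF z e0] by (simp add: fibre0_def)
  have eq: "deck z (deck e0 e1 z) w = deck e0 e1 w" if "e1 \<in> fibre0" "w \<in> topspace E" for e1 w
  proof -
    note ee = e0 fibre0D(1)[OF that(1)] fibre0D(2)[OF that(1), symmetric]
    show ?thesis
      by (rule deck_unique[symmetric])
         (use that z p_deck[OF ee] deck_continuous[OF ee] deck_in[OF ee] in auto)
  qed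
  have "deck e0 ?e z = deck z z' z"
    by (rule deck_unique[symmetric])
       (use z e e0 fibre0D p_deck[OF z] deck_continuous[OF z] in auto)
  then have 1: "deck e0 ?e z = z'" using deck_base[OF z] by simp
  show ?thesis
  proof (rule ex1I[of _ "loop_class ?e"])
    show "loop_class ?e \<in> carrier \<pi>1 \<and> deck_action E p e0 (loop_class ?e) z = z'"
      using e z 1 by (simp add: carrier_pi1 deck_action_eq)
  next
    fix a assume a: "a \<in> carrier \<pi>1 \<and> deck_action E p e0 a z = z'"
    then obtain e1 where e1: "e1 \<in> fibre0" "a = loop_class e1" by (auto simp: carrier_pi1)
    then have "deck e0 e1 z = z'" using a z by (simp add: deck_action_eq)
    then have "deck e0 e1 e0 = ?e" using eq[OF e1(1) e0] by simp
    moreover have "deck e0 e1 e0 = e1" using deck_base[OF e0] e1(1) fibre0D by simp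
    ultimately show "a = loop_class ?e" using e1 by simp
  qed
qed

end

section \<open>Compact metrizable spaces and their copies on sets of reals\<close>

text \<open>Urysohn's embedding: for a countable base, the Urysohn functions of the pairs \<open>(A, B)\<close> of
  basic sets with the closure of \<open>A\<close> inside \<open>B\<close> separate points.\<close>

lemma compact_Hausdorff_second_countable_imp_completely_metrizable:
  assumes comp: "compact_space X" and haus: "Hausdorff_space X" and sec: "second_countable X"
  shows "completely_metrizable_space X"
proof -
  obtain \<B> where B: "countable \<B>" "\<And>V. V \<in> \<B> \<Longrightarrow> openin X V"
      "\<And>U x. openin X U \<Longrightarrow> x \<in> U \<Longrightarrow> \<exists>V\<in>\<B>. x \<in> V \<and> V \<subseteq> U"
    using sec unfolding second_countable_def by metis
  have norm: "normal_space X" using comp haus compact_Hausdorff_or_regular_imp_normal_space by blast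
  define I where "I = {(A, B). A \<in> \<B> \<and> B \<in> \<B> \<and> X closure_of A \<subseteq> B}"
  have "countable (\<B> \<times> \<B>)" using B(1) by simp
  moreover have "I \<subseteq> \<B> \<times> \<B>" by (auto simp: I_def)
  ultimately have cI: "countable I" by (rule countable_subset[rotated])
  have "\<exists>f. continuous_map X euclideanreal f \<and> f ` (X closure_of fst i) \<subseteq> {0} \<and>
      f ` (topspace X - snd i) \<subseteq> {1::real}" if i: "i \<in> I" for i
  proof -
    have "openin X (snd i)" "X closure_of fst i \<subseteq> snd i" using i B(2) by (auto simp: I_def)
    then have "closedin X (X closure_of fst i)" "closedin X (topspace X - snd i)"
      "disjnt (X closure_of fst i) (topspace X - snd i)"
      unfolding disjnt_def by (simp, blast+)
    from Urysohn_lemma_alt[OF norm this, of 0 1] show ?thesis by metis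
  qed
  then obtain f where f: "\<And>i. i \<in> I \<Longrightarrow> continuous_map X euclideanreal (f i)"
      "\<And>i. i \<in> I \<Longrightarrow> f i ` (X closure_of fst i) \<subseteq> {0::real}"
      "\<And>i. i \<in> I \<Longrightarrow> f i ` (topspace X - snd i) \<subseteq> {1}"
    by metis
  define Y where "Y = product_topology (\<lambda>_::'a set \<times> 'a set. euclideanreal) I"
  define e where "e x = (\<lambda>i\<in>I. f i x)" for x
  have metY: "metrizable_space Y"
    unfolding Y_def metrizable_space_product_topology
    using countable_subset[of "{i \<in> I. \<not> (\<exists>a. topspace euclideanreal \<subseteq> {a::real})}" I] cI
      metrizable_space_euclidean by blast
  have hausY: "Hausdorff_space Y" using metY metrizable_imp_Hausdorff_space by blast
  have cont: "continuous_map X Y e"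
    unfolding Y_def e_def continuous_map_componentwise using f(1) by (auto simp: continuous_map_eq)
  have inj: "inj_on e (topspace X)"
  proof (rule inj_onI, rule ccontr)
    fix x y assume xy: "x \<in> topspace X" "y \<in> topspace X" "e x = e y" "x \<noteq> y"
    obtain U where U: "openin X U" "x \<in> U" "y \<notin> U"
      using haus xy unfolding Hausdorff_space_def disjnt_def by blast
    obtain V where V: "V \<in> \<B>" "x \<in> V" "V \<subseteq> U" using B(3)[OF U(1,2)] by blast
    have "regular_space X" using comp haus compact_Hausdorff_imp_regular_space by blast
    moreover have "closedin X (topspace X - V)" "x \<in> topspace X - (topspace X - V)"
      using B(2)[OF V(1)] V(2) xy by auto
    ultimately obtain W where W: "openin X W" "x \<in> W" "disjnt (topspace X - V) (X closure_of W)"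
      unfolding regular_space by metis
    obtain A where A: "A \<in> \<B>" "x \<in> A" "A \<subseteq> W" using B(3)[OF W(1,2)] by blast
    have "X closure_of A \<subseteq> X closure_of W" by (rule closure_of_mono[OF A(3)])
    moreover have "X closure_of W \<subseteq> topspace X" by (rule closure_of_subset_topspace)
    ultimately have AV: "X closure_of A \<subseteq> V" using W(3) unfolding disjnt_def by blast
    then have i: "(A, V) \<in> I" using A V by (simp add: I_def)
    have "x \<in> X closure_of A" using A(2) closure_of_subset[of A X] openin_subset[OF B(2)[OF A(1)]] by blast
    then have "f (A, V) x = 0" using f(2)[OF i] by auto
    moreover have "f (A, V) y = 1" using f(3)[OF i] xy(2) U(3) V(3) by auto
    moreover have "f (A, V) x = f (A, V) y" using fun_cong[OF xy(3), of "(A, V)"] i by (simp add: e_def)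
    ultimately show False by simp
  qed
  have "closed_map X Y e" using T1_Spaces.continuous_imp_closed_map[OF cont comp hausY] .
  then have "embedding_map X Y e" using injective_closed_imp_embedding_map cont inj by blast
  then have "X homeomorphic_space subtopology Y (e ` topspace X)"
    by (rule embedding_map_imp_homeomorphic_space)
  then have "metrizable_space X"
    using homeomorphic_metrizable_space metrizable_space_subtopology[OF metY] by blast
  then show ?thesis
    using locally_compact_imp_completely_metrizable_space compact_imp_locally_compact_space[OF comp] by blast
qed

text \<open>A point is determined by the set of members of a countable base that contain it.\<close>

lemma second_countable_Hausdorff_inj_real:
  assumes haus: "Hausdorff_space X" and sec: "second_countable X"
  obtains \<sigma> :: "'a \<Rightarrow> real" where "inj_on \<sigma> (topspace X)"
proof -
  obtain \<B> where B: "countable \<B>" "\<And>V. V \<in> \<B> \<Longrightarrow> openin X V"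
      "\<And>U x. openin X U \<Longrightarrow> x \<in> U \<Longrightarrow> \<exists>V\<in>\<B>. x \<in> V \<and> V \<subseteq> U"
    using sec unfolding second_countable_def by metis
  obtain g :: "nat set \<Rightarrow> real" where g: "inj g"
    using nat_sets_eqpoll_reals unfolding eqpoll_def bij_betw_def by blast
  obtain c :: "'a set \<Rightarrow> nat" where c: "inj_on c \<B>" using B(1) countableE by blast
  have "inj_on (\<lambda>x. g (c ` {V \<in> \<B>. x \<in> V})) (topspace X)"
  proof (rule inj_onI, rule ccontr)
    fix x y assume xy: "x \<in> topspace X" "y \<in> topspace X"
      "g (c ` {V \<in> \<B>. x \<in> V}) = g (c ` {V \<in> \<B>. y \<in> V})" "x \<noteq> y"
    have "c ` {V \<in> \<B>. x \<in> V} = c ` {V \<in> \<B>. y \<in> V}" using g xy(3) by (simp add: inj_eq)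
    moreover have "{V \<in> \<B>. x \<in> V} \<subseteq> \<B>" "{V \<in> \<B>. y \<in> V} \<subseteq> \<B>" by auto
    ultimately have eq: "{V \<in> \<B>. x \<in> V} = {V \<in> \<B>. y \<in> V}" using inj_on_image_eq_iff[OF c] by metis
    obtain U where U: "openin X U" "x \<in> U" "y \<notin> U"
      using haus xy unfolding Hausdorff_space_def disjnt_def by blast
    obtain V where "V \<in> \<B>" "x \<in> V" "V \<subseteq> U" using B(3)[OF U(1,2)] by blast
    then show False using eq U(3) by blast
  qed
  then show thesis by (rule that)
qed

lemma homeomorphic_copy:
  assumes "inj_on \<sigma> (topspace X)"
  shows "homeomorphic_map X (quotient_topology X \<sigma>) \<sigma>"
  unfolding homeomorphic_map_def quotient_map_def
  using assms by (auto simp: topspace_quotient_topology openin_quotient_topology)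

lemma polish_topology_homeomorphic:
  "X homeomorphic_space Y \<Longrightarrow> polish_topology X \<Longrightarrow> polish_topology Y"
  unfolding polish_topology_def
  using homeomorphic_completely_metrizable_space homeomorphic_space_second_countability by blast

section \<open>Coordinate balls\<close>

definition coord_ball ::
  "nat \<Rightarrow> 'e topology \<Rightarrow> 'e set \<Rightarrow> (nat \<Rightarrow> real) set \<Rightarrow> ('e \<Rightarrow> nat \<Rightarrow> real) \<Rightarrow> bool" where
  "coord_ball n E W B \<kappa> \<longleftrightarrow> openin E W \<and> open_ball_of_dim n B \<and>
     homeomorphic_map (subtopology E W) (subtopology (Euclidean_space n) B) \<kappa>"

lemma continuous_map_Euclidean_proj: "continuous_map (Euclidean_space n) euclideanreal (\<lambda>x. x i)"
  unfolding Euclidean_space_def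
  by (rule continuous_map_from_subtopology[OF continuous_map_product_projection]) simp

lemma openin_open_ball: "open_ball_of_dim n B \<Longrightarrow> openin (Euclidean_space n) B"
proof -
  assume "open_ball_of_dim n B"
  then obtain c r where B: "B = {x \<in> topspace (Euclidean_space n). sqrt (\<Sum>i<n. (x i - c i)\<^sup>2) < r}"
    by (auto simp: open_ball_of_dim_def)
  let ?f = "\<lambda>x. sqrt (\<Sum>i<n. (x i - c i)\<^sup>2)"
  have "continuous_map (Euclidean_space n) euclideanreal (\<lambda>x. \<Sum>i<n. (x i - c i)\<^sup>2)"
    using continuous_map_Euclidean_proj
    by (intro continuous_map_sum continuous_map_real_pow
        continuous_map_diff continuous_map_canonical_const) auto
  moreover have "continuous_map euclideanreal euclideanreal sqrt"
    by (simp add: continuous_on_real_sqrt)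
  ultimately have "continuous_map (Euclidean_space n) euclideanreal ?f"
    using continuous_map_compose[of "Euclidean_space n" euclideanreal _ euclideanreal sqrt] by (simp add: o_def)
  then have "openin (Euclidean_space n) {x \<in> topspace (Euclidean_space n). ?f x \<in> {..<r}}"
    by (rule openin_continuous_map_preimage) simp
  then show ?thesis unfolding B by simp
qed

lemma open_contains_ball_of_dim:
  assumes Q: "openin (Euclidean_space n) Q" and c: "c \<in> Q"
  obtains B where "open_ball_of_dim n B" "c \<in> B" "B \<subseteq> Q"
proof -
  have cE: "c \<in> topspace (Euclidean_space n)" using openin_subset[OF Q] c by blast
  obtain U where U: "openin (powertop_real UNIV) U" "Q = U \<inter> {x. \<forall>i\<ge>n. x i = 0}"
    using Q unfolding Euclidean_space_def openin_subtopology by blast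
  have "c \<in> U" using c U by blast
  then obtain S where S: "c \<in> (\<Pi>\<^sub>E i\<in>UNIV. S i)" "\<And>i. openin euclideanreal (S i)"
      "finite {i. S i \<noteq> topspace euclideanreal}" "(\<Pi>\<^sub>E i\<in>UNIV. S i) \<subseteq> U"
    using product_topology_open_contains_basis[OF U(1)] by metis
  have "\<exists>\<epsilon>>0. \<forall>t. \<bar>t - c i\<bar> < \<epsilon> \<longrightarrow> t \<in> S i" for i
  proof -
    have "open (S i)" "c i \<in> S i" using S(1,2) by auto
    then show ?thesis unfolding open_dist by (auto simp: dist_real_def)
  qed
  then obtain \<epsilon> where e: "\<And>i. \<epsilon> i > 0" "\<And>i t. \<bar>t - c i\<bar> < \<epsilon> i \<Longrightarrow> t \<in> S i" by metis
  define r where "r = Min (insert 1 (\<epsilon> ` {..<n}))"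
  have r: "r > 0" "\<And>i. i < n \<Longrightarrow> r \<le> \<epsilon> i" using e(1) by (auto simp: r_def)
  define B where "B = {x \<in> topspace (Euclidean_space n). sqrt (\<Sum>i<n. (x i - c i)\<^sup>2) < r}"
  have "x \<in> Q" if x: "x \<in> B" for x
  proof -
    have xE: "x \<in> topspace (Euclidean_space n)" using x by (simp add: B_def)
    have "x i \<in> S i" for i
    proof (cases "i < n")
      case True
      have "(x i - c i)\<^sup>2 \<le> (\<Sum>i<n. (x i - c i)\<^sup>2)" using True by (intro member_le_sum) auto
      then have "\<bar>x i - c i\<bar> \<le> sqrt (\<Sum>i<n. (x i - c i)\<^sup>2)" by (simp add: real_le_rsqrt)
      then show ?thesis using x r(2)[OF True] by (intro e(2)) (auto simp: B_def)
    next
      case False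
      then have "x i = c i" using xE cE by (simp add: topspace_Euclidean_space)
      then show ?thesis using S(1) by auto
    qed
    then have "x \<in> U" using S(4) by auto
    then show ?thesis using xE U(2) by (simp add: topspace_Euclidean_space)
  qed
  moreover have "open_ball_of_dim n B" unfolding open_ball_of_dim_def B_def using cE r by blast
  moreover have "c \<in> B" using cE r by (simp add: B_def)
  ultimately show thesis using that by blast
qed

lemma open_ball_contractible:
  assumes "open_ball_of_dim n B"
  obtains c H where "c \<in> B" "B \<subseteq> topspace (Euclidean_space n)"
    "continuous_map (prod_topology (subtopology (Euclidean_space n) B) (top_of_set {0..1::real}))
       (subtopology (Euclidean_space n) B) H"
    "\<And>x. x \<in> B \<Longrightarrow> H (x, 0) = x" "\<And>x. x \<in> B \<Longrightarrow> H (x, 1) = c"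
proof -
  obtain c r where c: "c \<in> topspace (Euclidean_space n)" "r > 0" and
    B: "B = {x \<in> topspace (Euclidean_space n). sqrt (\<Sum>i<n. (x i - c i)\<^sup>2) < r}"
    using assms by (auto simp: open_ball_of_dim_def)
  let ?X = "prod_topology (subtopology (Euclidean_space n) B) (top_of_set {0..1::real})"
  define H where "H z = (\<lambda>i. (1 - snd z) * fst z i + snd z * c i)" for z :: "(nat \<Rightarrow> real) \<times> real"
  have f: "continuous_map ?X euclideanreal (\<lambda>z. fst z i)" for i
  proof -
    have "continuous_map ?X (Euclidean_space n) fst"
      using continuous_map_fst[of "subtopology (Euclidean_space n) B" "top_of_set {0..1::real}"]
      by (simp add: continuous_map_in_subtopology)
    from continuous_map_compose[OF this continuous_map_Euclidean_proj[of n i]] show ?thesis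
      by (simp add: o_def)
  qed
  have s: "continuous_map ?X euclideanreal snd"
    using continuous_map_snd[of "subtopology (Euclidean_space n) B" "top_of_set {0..1::real}"]
    by (simp add: continuous_map_in_subtopology)
  have inB: "H z \<in> B" if z: "z \<in> topspace ?X" for z
  proof -
    obtain x t where zz: "z = (x, t)" by (cases z)
    then have x: "x \<in> B" "x \<in> topspace (Euclidean_space n)" "0 \<le> t" "t \<le> 1" using z by (auto simp: B)
    have e: "H z i - c i = (1 - t) * (x i - c i)" for i by (simp add: H_def zz algebra_simps)
    have "(H z i - c i)\<^sup>2 \<le> (x i - c i)\<^sup>2" for i
    proof -
      have "(1 - t)\<^sup>2 \<le> 1" using x by (simp add: power_le_one)
      then show ?thesis unfolding e power_mult_distrib by (simp add: mult_left_le_one_le)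
    qed
    then have "sqrt (\<Sum>i<n. (H z i - c i)\<^sup>2) \<le> sqrt (\<Sum>i<n. (x i - c i)\<^sup>2)" by (simp add: sum_mono)
    moreover have "H z \<in> topspace (Euclidean_space n)"
      using x c by (simp add: topspace_Euclidean_space H_def zz)
    moreover have "sqrt (\<Sum>i<n. (x i - c i)\<^sup>2) < r" using x(1) unfolding B by simp
    ultimately show ?thesis unfolding B using order.strict_trans1 by blast
  qed
  have "continuous_map ?X (powertop_real UNIV) H"
    unfolding continuous_map_componentwise_UNIV H_def
    using f s by (intro allI continuous_map_add continuous_map_real_mult continuous_map_diff
        continuous_map_canonical_const) auto
  moreover have "\<And>z. z \<in> topspace ?X \<Longrightarrow> H z \<in> topspace (Euclidean_space n)"
    using inB unfolding B by blast
  ultimately have "continuous_map ?X (Euclidean_space n) H"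
    unfolding Euclidean_space_def continuous_map_in_subtopology
    by (auto simp: topspace_Euclidean_space)
  then have "continuous_map ?X (subtopology (Euclidean_space n) B) H"
    using inB by (auto simp: continuous_map_in_subtopology)
  moreover have "c \<in> B" using c by (simp add: B)
  ultimately show thesis using that[of c H] by (auto simp: H_def B)
qed

lemma coord_ballD:
  assumes "coord_ball n E W B \<kappa>"
  shows "openin E W" "open_ball_of_dim n B" "W \<subseteq> topspace E"
    "homeomorphic_map (subtopology E W) (subtopology (Euclidean_space n) B) \<kappa>"
  using assms openin_subset by (auto simp: coord_ball_def)

lemma coord_ball_contractible:
  assumes "coord_ball n E W B \<kappa>"
  obtains w0 H where "w0 \<in> W"
    "continuous_map (prod_topology (subtopology E W) (top_of_set {0..1::real})) (subtopology E W) H"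
    "\<And>x. x \<in> W \<Longrightarrow> H (x, 0) = x" "\<And>x. x \<in> W \<Longrightarrow> H (x, 1) = w0"
proof -
  note W = coord_ballD[OF assms]
  let ?S = "subtopology (Euclidean_space n) B"
  obtain c H where H: "c \<in> B" "B \<subseteq> topspace (Euclidean_space n)"
    "continuous_map (prod_topology ?S (top_of_set {0..1::real})) ?S H"
    "\<And>x. x \<in> B \<Longrightarrow> H (x, 0) = x" "\<And>x. x \<in> B \<Longrightarrow> H (x, 1) = c"
    using open_ball_contractible[OF W(2)] by metis
  obtain g where g: "homeomorphic_maps (subtopology E W) ?S \<kappa> g"
    using W(4) homeomorphic_map_maps by blast
  have tW: "topspace (subtopology E W) = W" "topspace ?S = B" using W(3) H(2) by auto
  have \<kappa>: "continuous_map (subtopology E W) ?S \<kappa>" "continuous_map ?S (subtopology E W) g"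
    "\<And>x. x \<in> W \<Longrightarrow> g (\<kappa> x) = x" "\<And>x. x \<in> W \<Longrightarrow> \<kappa> x \<in> B" "\<And>x. x \<in> B \<Longrightarrow> g x \<in> W"
  proof -
    show 1: "continuous_map (subtopology E W) ?S \<kappa>" "continuous_map ?S (subtopology E W) g"
      and "\<And>x. x \<in> W \<Longrightarrow> g (\<kappa> x) = x"
      using g tW by (simp_all add: homeomorphic_maps_def)
    show "\<And>x. x \<in> W \<Longrightarrow> \<kappa> x \<in> B" "\<And>x. x \<in> B \<Longrightarrow> g x \<in> W"
      using continuous_map_image_subset_topspace[OF 1(1)] continuous_map_image_subset_topspace[OF 1(2)] tW
      by auto
  qed
  let ?q = "\<lambda>(x, t). (\<kappa> x, t)"
  have "continuous_map (prod_topology (subtopology E W) (top_of_set {0..1::real}))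
      (prod_topology ?S (top_of_set {0..1::real})) ?q"
    using \<kappa>(1) by (simp add: continuous_map_prod_top)
  from continuous_map_compose[OF continuous_map_compose[OF this H(3)] \<kappa>(2)]
  have "continuous_map (prod_topology (subtopology E W) (top_of_set {0..1::real})) (subtopology E W)
     (g \<circ> (H \<circ> ?q))" .
  moreover have "(g \<circ> (H \<circ> ?q)) (x, 0) = x" "(g \<circ> (H \<circ> ?q)) (x, 1) = g c" if "x \<in> W" for x
    using \<kappa>(3,4)[OF that] H(4,5) by auto
  ultimately show thesis using that[OF \<kappa>(5)[OF H(1)]] by metis
qed

lemma coord_ball_path_connected:
  assumes "coord_ball n E W B \<kappa>"
  shows "path_connectedin E W"
proof -
  obtain w0 H where H: "w0 \<in> W"
    "continuous_map (prod_topology (subtopology E W) (top_of_set {0..1::real})) (subtopology E W) H"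
    "\<And>x. x \<in> W \<Longrightarrow> H (x, 0) = x" "\<And>x. x \<in> W \<Longrightarrow> H (x, 1) = w0"
    using coord_ball_contractible[OF assms] by metis
  have tW: "topspace (subtopology E W) = W" using coord_ballD(3)[OF assms] by auto
  have fwd: "pathin (subtopology E W) (\<lambda>t. H (x, t))" if "x \<in> W" for x
    using continuous_map_o_Pair[OF H(2), of x] that coord_ballD(3)[OF assms]
    by (simp add: pathin_def o_def subset_eq)
  have bwd: "pathin (subtopology E W) (\<lambda>t. H (x, 1 - t))" if "x \<in> W" for x
  proof -
    have "continuous_map (top_of_set {0..1::real}) (top_of_set {0..1}) (\<lambda>t. 1 - t)"
      by (auto intro!: continuous_intros)
    from continuous_map_compose[OF this fwd[OF that, unfolded pathin_def]] show ?thesis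
      by (simp add: pathin_def o_def)
  qed
  have "path_connected_space (subtopology E W)"
    unfolding path_connected_space_def tW
  proof (intro ballI)
    fix x y assume xy: "x \<in> W" "y \<in> W"
    have "pathin (subtopology E W) (path_join (\<lambda>t. H (x, t)) (\<lambda>t. H (y, 1 - t)))"
      using fwd[OF xy(1)] bwd[OF xy(2)] H xy by (intro pathin_join) auto
    then show "\<exists>g. pathin (subtopology E W) g \<and> g 0 = x \<and> g 1 = y"
      using H xy by (intro exI[of _ "path_join (\<lambda>t. H (x, t)) (\<lambda>t. H (y, 1 - t))"])
        (simp add: path_join_def)
  qed
  then show ?thesis using coord_ballD(3)[OF assms] by (simp add: path_connectedin_def)
qed

text \<open>A sheet over a coordinate neighbourhood is itself a coordinate neighbourhood upstairs.\<close>

lemma covering_coord_ball: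
  assumes M: "topological_manifold n M" and cov: "covering_projection E M p"
    and N: "openin E N" "e \<in> N"
  obtains W B \<kappa> where "coord_ball n E W B \<kappa>" "e \<in> W" "W \<subseteq> N" "inj_on p W"
proof -
  have e: "e \<in> topspace E" using N openin_subset by blast
  then have pe: "p e \<in> topspace M" using cov by (auto simp: covering_projection_def continuous_map_def)
  obtain T where T: "openin M T" "p e \<in> T"
    "\<And>e. e \<in> topspace E \<Longrightarrow> p e \<in> T \<Longrightarrow> \<exists>V. e \<in> V \<and> sheet E M p T V"
    using evenly_covered_nbhd[OF cov pe] by metis
  obtain V where V: "e \<in> V" "sheet E M p T V" using T(3)[OF e T(2)] by blast
  obtain U V' where U: "openin M U" "p e \<in> U" "openin (Euclidean_space n) V'"
    "subtopology M U homeomorphic_space subtopology (Euclidean_space n) V'"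
    using M pe unfolding topological_manifold_def by metis
  obtain \<phi> where \<phi>: "homeomorphic_map (subtopology M U) (subtopology (Euclidean_space n) V') \<phi>"
    using U(4) homeomorphic_space by blast
  have tU: "topspace (subtopology M U) = U" "topspace (subtopology (Euclidean_space n) V') = V'"
    using openin_subset[OF U(1)] openin_subset[OF U(3)] by auto
  have \<phi>i: "\<phi> ` U = V'" "inj_on \<phi> U" "open_map (subtopology M U) (subtopology (Euclidean_space n) V') \<phi>"
     "continuous_map (subtopology M U) (subtopology (Euclidean_space n) V') \<phi>"
    using \<phi> tU by (auto simp: homeomorphic_eq_everything_map)
  let ?N' = "p ` (N \<inter> V) \<inter> U"
  have N': "openin M ?N'" using sheet_open_image[OF V(2)] N(1) sheetD(2)[OF V(2)] U(1) by (simp add: openin_Int)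
  have "openin (subtopology M U) ?N'" using N' U(1) by (simp add: openin_open_subtopology)
  then have "openin (subtopology (Euclidean_space n) V') (\<phi> ` ?N')" using \<phi>i(3) by (simp add: open_map_def)
  then have "openin (Euclidean_space n) (\<phi> ` ?N')" using U(3) openin_open_subtopology by blast
  moreover have "\<phi> (p e) \<in> \<phi> ` ?N'" using N V U by blast
  ultimately obtain B where B: "open_ball_of_dim n B" "\<phi> (p e) \<in> B" "B \<subseteq> \<phi> ` ?N'"
    using open_contains_ball_of_dim by metis
  have BV: "B \<subseteq> V'" using B(3) \<phi>i(1) by blast
  define O' where "O' = {x \<in> U. \<phi> x \<in> B}"
  have "openin (subtopology (Euclidean_space n) V') B"
    using openin_open_ball[OF B(1)] BV U(3) by (simp add: openin_open_subtopology)
  from openin_continuous_map_preimage[OF \<phi>i(4) this] have "openin (subtopology M U) O'"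
    unfolding O'_def tU .
  then have O': "openin M O'" using U(1) openin_open_subtopology by blast
  have O'N: "O' \<subseteq> ?N'"
  proof
    fix x assume x: "x \<in> O'"
    then have "\<phi> x \<in> \<phi> ` ?N'" using B(3) by (auto simp: O'_def)
    then obtain y where "y \<in> ?N'" "\<phi> x = \<phi> y" by blast
    then show "x \<in> ?N'" using \<phi>i(2) x by (metis (mono_tags, lifting) IntD2 O'_def inj_onD mem_Collect_eq)
  qed
  define W where "W = {x \<in> topspace (subtopology E V). p x \<in> O'}"
  have O'T: "openin (subtopology M T) O'"
    using O' O'N sheetD(6)[OF V(2)] T(1) by (auto simp: openin_open_subtopology)
  have tV: "topspace (subtopology E V) = V" using sheetD(3)[OF V(2)] by auto
  have "openin (subtopology E V) W"
    unfolding W_def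
    using sheetD(8)[OF V(2)] homeomorphic_imp_continuous_map O'T openin_continuous_map_preimage by blast
  then have W: "openin E W" "W \<subseteq> V" using sheetD(2)[OF V(2)] openin_open_subtopology by blast+
  have pW: "p ` W = O'"
    using O'N sheetD(6)[OF V(2)] unfolding W_def tV by blast
  have "homeomorphic_map (subtopology (subtopology E V) W) (subtopology (subtopology M T) O') p"
    using pW W(2) tV openin_subset[OF O'T]
    by (intro homeomorphic_map_subtopologies[OF sheetD(8)[OF V(2)]]) (simp add: Int_absorb1)
  then have 1: "homeomorphic_map (subtopology E W) (subtopology M O') p"
    using W(2) openin_subset[OF O'T] by (simp add: subtopology_subtopology Int_absorb1)
  have "\<phi> ` O' = B" using BV \<phi>i(1) unfolding O'_def by blast
  moreover have "O' \<subseteq> U" by (auto simp: O'_def)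
  ultimately have "homeomorphic_map (subtopology (subtopology M U) O')
      (subtopology (subtopology (Euclidean_space n) V') B) \<phi>"
    using tU BV by (intro homeomorphic_map_subtopologies[OF \<phi>]) (simp add: Int_absorb1)
  then have 2: "homeomorphic_map (subtopology M O') (subtopology (Euclidean_space n) B) \<phi>"
    using \<open>O' \<subseteq> U\<close> BV by (simp add: subtopology_subtopology Int_absorb1)
  have "coord_ball n E W B (\<phi> \<circ> p)"
    unfolding coord_ball_def using W(1) B(1) homeomorphic_map_compose[OF 1 2] by blast
  moreover have "e \<in> W" using V B(2) U(2) tV by (simp add: W_def O'_def)
  moreover have "inj_on p W" using sheetD(5)[OF V(2)] W(2) inj_on_subset by blast
  moreover have "W \<subseteq> N"
  proof
    fix w assume w: "w \<in> W"
    then obtain m where "m \<in> N" "m \<in> V" "p w = p m" using pW O'N by blast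
    then have "w = m" using w W(2) sheetD(5)[OF V(2)] by (meson inj_onD subsetD)
    then show "w \<in> N" using \<open>m \<in> N\<close> by simp
  qed
  ultimately show thesis using that by blast
qed

lemma covering_open_map:
  assumes "covering_projection E M p" "openin E N"
  shows "openin M (p ` N)"
proof (subst openin_subopen, intro ballI)
  fix x assume "x \<in> p ` N"
  then obtain e where e: "e \<in> N" "x = p e" by blast
  have eE: "e \<in> topspace E" using e assms(2) openin_subset by blast
  then have pe: "p e \<in> topspace M" using assms(1) by (auto simp: covering_projection_def continuous_map_def)
  obtain T where T: "openin M T" "p e \<in> T"
    "\<And>e. e \<in> topspace E \<Longrightarrow> p e \<in> T \<Longrightarrow> \<exists>V. e \<in> V \<and> sheet E M p T V"
    using evenly_covered_nbhd[OF assms(1) pe] by metis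
  obtain V where V: "e \<in> V" "sheet E M p T V" using T(3)[OF eE T(2)] by blast
  have "openin M (p ` (N \<inter> V))"
    using sheet_open_image[OF V(2)] assms(2) sheetD(2)[OF V(2)] by blast
  then show "\<exists>T. openin M T \<and> x \<in> T \<and> T \<subseteq> p ` N" using V(1) e by (intro exI[of _ "p ` (N \<inter> V)"]) auto
qed

section \<open>The suspension as a quotient\<close>

lemma openin_prod_rectangle:
  assumes "openin (prod_topology E F) Q" "(e, y) \<in> Q"
  obtains A O' where "openin E A" "e \<in> A" "openin F O'" "y \<in> O'" "A \<times> O' \<subseteq> Q"
proof -
  have "\<exists>A O'. openin E A \<and> openin F O' \<and> e \<in> A \<and> y \<in> O' \<and> A \<times> O' \<subseteq> Q"
    using assms unfolding openin_prod_topology_alt by (elim allE impE) assumption+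
  then show thesis using that by metis
qed

lemma compact_space_subcover:
  assumes F: "compact_space F" and P: "\<And>y. y \<in> topspace F \<Longrightarrow> \<exists>V. openin F V \<and> y \<in> V \<and> P V"
  obtains \<U> where "finite \<U>" "\<And>V. V \<in> \<U> \<Longrightarrow> openin F V" "\<And>V. V \<in> \<U> \<Longrightarrow> P V" "topspace F \<subseteq> \<Union>\<U>"
proof -
  define \<C> where "\<C> = {V. openin F V \<and> P V}"
  have "(\<forall>U\<in>\<C>. openin F U) \<and> topspace F \<subseteq> \<Union>\<C>" using P by (auto simp: \<C>_def)
  then obtain \<U> where "finite \<U>" "\<U> \<subseteq> \<C>" "topspace F \<subseteq> \<Union>\<U>"
    using F unfolding compact_space_alt by metis
  then show thesis using that by (auto simp: \<C>_def)
qed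

text \<open>The tube lemma: by compactness of \<open>F\<close>, a property of \<open>A\<close> and \<open>z\<close> that holds near every point of \<open>{e} \<times> F\<close>
  holds on a product neighbourhood of the whole fibre.\<close>

lemma compact_uniform_nbhd:
  assumes F: "compact_space F" and e: "e \<in> topspace E"
    and loc: "\<And>y. y \<in> topspace F \<Longrightarrow>
      \<exists>A O'. openin E A \<and> e \<in> A \<and> openin F O' \<and> y \<in> O' \<and> (\<forall>z\<in>O'. R A z)"
    and mono: "\<And>A A' z. A' \<subseteq> A \<Longrightarrow> R A z \<Longrightarrow> R A' z"
  obtains A where "openin E A" "e \<in> A" "\<And>z. z \<in> topspace F \<Longrightarrow> R A z"
proof -
  define good where "good O' A \<longleftrightarrow> openin E A \<and> e \<in> A \<and> (\<forall>z\<in>O'. R A z)" for O' A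
  have "\<exists>V. openin F V \<and> y \<in> V \<and> (\<exists>A. good V A)" if "y \<in> topspace F" for y
  proof -
    from loc[OF that] obtain A O' where "openin E A" "e \<in> A" "openin F O'" "y \<in> O'" "\<forall>z\<in>O'. R A z"
      by metis
    then show ?thesis by (auto simp: good_def)
  qed
  from compact_space_subcover[OF F this] obtain \<U> where
    \<U>: "finite \<U>" "\<And>V. V \<in> \<U> \<Longrightarrow> \<exists>A. good V A" "topspace F \<subseteq> \<Union>\<U>" by metis
  from \<U>(2) have "\<forall>O'\<in>\<U>. \<exists>A. good O' A" by blast
  then obtain A where "\<forall>O'\<in>\<U>. good O' (A O')" by (rule bchoice[THEN exE])
  then have A: "\<And>O'. O' \<in> \<U> \<Longrightarrow> good O' (A O')" by blast
  define B where "B = topspace E \<inter> \<Inter>(A ` \<U>)"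
  have "openin E B"
  proof (cases "\<U> = {}")
    case False
    then have "openin E (\<Inter>(A ` \<U>))" using \<U>(1) A by (intro openin_Inter) (auto simp: good_def)
    then show ?thesis unfolding B_def by blast
  qed (simp add: B_def)
  moreover have "e \<in> B" using e A by (auto simp: B_def good_def)
  moreover have "R B z" if z: "z \<in> topspace F" for z
  proof -
    obtain O' where O': "O' \<in> \<U>" "z \<in> O'" using \<U>(3) z by blast
    then have "R (A O') z" using A[OF O'(1)] by (simp add: good_def)
    moreover have "B \<subseteq> A O'" using O' by (auto simp: B_def)
    ultimately show ?thesis using mono by blast
  qed
  ultimately show thesis using that by blast
qed

text \<open>What the proof uses of a universal cover \<open>p : E \<rightarrow> M\<close> and of the two actions of
  \<open>G = \<pi>\<^sub>1(M)\<close>.\<close>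

locale suspension =
  fixes n :: nat and M :: "'a topology" and E :: "'e topology" and p :: "'e \<Rightarrow> 'a"
    and F :: "'f topology" and G :: "('g, 'z) monoid_scheme"
    and D :: "'g \<Rightarrow> 'e \<Rightarrow> 'e" and h :: "'g \<Rightarrow> 'f \<Rightarrow> 'f" and e0 :: 'e
  assumes group_G: "group G"
    and M_compact: "compact_space M" and M_Hausdorff: "Hausdorff_space M"
    and p_cont: "continuous_map E M p" and p_surj: "p ` topspace E = topspace M"
    and p_open: "\<And>N. openin E N \<Longrightarrow> openin M (p ` N)"
    and E_path_connected: "path_connected_space E" and e0: "e0 \<in> topspace E"
    and small_ball: "\<And>e N. openin E N \<Longrightarrow> e \<in> N \<Longrightarrow>
      \<exists>W B \<kappa>. coord_ball n E W B \<kappa> \<and> e \<in> W \<and> W \<subseteq> N \<and> inj_on p W"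
    and D_cont: "\<And>a. a \<in> carrier G \<Longrightarrow> continuous_map E E (D a)"
    and p_D: "\<And>a e. a \<in> carrier G \<Longrightarrow> e \<in> topspace E \<Longrightarrow> p (D a e) = p e"
    and D_mult: "\<And>a b e. a \<in> carrier G \<Longrightarrow> b \<in> carrier G \<Longrightarrow> e \<in> topspace E \<Longrightarrow>
      D (a \<otimes>\<^bsub>G\<^esub> b) e = D a (D b e)"
    and D_transitive: "\<And>e e'. e \<in> topspace E \<Longrightarrow> e' \<in> topspace E \<Longrightarrow> p e = p e' \<Longrightarrow>
      \<exists>!a. a \<in> carrier G \<and> D a e = e'"
    and F_compact: "compact_space F" and F_Hausdorff: "Hausdorff_space F"
    and F_second_countable: "second_countable F"
    and h_cont: "\<And>a. a \<in> carrier G \<Longrightarrow> continuous_map F F (h a)"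
    and h_mult: "\<And>a b y. a \<in> carrier G \<Longrightarrow> b \<in> carrier G \<Longrightarrow> y \<in> topspace F \<Longrightarrow>
      h (a \<otimes>\<^bsub>G\<^esub> b) y = h a (h b y)"
    and h_one: "\<And>y. y \<in> topspace F \<Longrightarrow> h \<one>\<^bsub>G\<^esub> y = y"
    and h_free: "\<And>a y. a \<in> carrier G \<Longrightarrow> y \<in> topspace F \<Longrightarrow> h a y = y \<Longrightarrow> a = \<one>\<^bsub>G\<^esub>"
begin

sublocale G: group G by (rule group_G)

abbreviation q :: "'e \<times> 'f \<Rightarrow> ('e \<times> 'f) set" where "q \<equiv> suspension_proj G D h"
abbreviation X :: "('e \<times> 'f) set topology" where "X \<equiv> suspension_space G D h E F"
abbreviation EF :: "('e \<times> 'f) topology" where "EF \<equiv> prod_topology E F"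

lemma D_in: "a \<in> carrier G \<Longrightarrow> e \<in> topspace E \<Longrightarrow> D a e \<in> topspace E"
  using D_cont[of a] by (auto simp: continuous_map_def)

lemma h_in: "a \<in> carrier G \<Longrightarrow> y \<in> topspace F \<Longrightarrow> h a y \<in> topspace F"
  using h_cont[of a] by (auto simp: continuous_map_def)

lemma D_one: assumes "e \<in> topspace E" shows "D \<one>\<^bsub>G\<^esub> e = e"
proof -
  obtain a where a: "a \<in> carrier G" "D a e = e" using D_transitive[OF assms assms] by blast
  then show ?thesis using D_mult[OF G.one_closed a(1) assms] by simp
qed

lemma D_inv: "a \<in> carrier G \<Longrightarrow> e \<in> topspace E \<Longrightarrow> D (inv\<^bsub>G\<^esub> a) (D a e) = e"
  and D_inv': "a \<in> carrier G \<Longrightarrow> e \<in> topspace E \<Longrightarrow> D a (D (inv\<^bsub>G\<^esub> a) e) = e"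
  using D_one by (simp_all flip: D_mult)

lemma h_inv: "a \<in> carrier G \<Longrightarrow> y \<in> topspace F \<Longrightarrow> h (inv\<^bsub>G\<^esub> a) (h a y) = y"
  and h_inv': "a \<in> carrier G \<Longrightarrow> y \<in> topspace F \<Longrightarrow> h a (h (inv\<^bsub>G\<^esub> a) y) = y"
  using h_one by (simp_all flip: h_mult)

lemma h_inj:
  assumes "a \<in> carrier G" "b \<in> carrier G" "y \<in> topspace F" "h a y = h b y" shows "a = b"
proof -
  have "h (inv\<^bsub>G\<^esub> b \<otimes>\<^bsub>G\<^esub> a) y = y" using assms by (simp add: h_mult h_inv)
  then have "inv\<^bsub>G\<^esub> b \<otimes>\<^bsub>G\<^esub> a = \<one>\<^bsub>G\<^esub>" using assms h_free by blast
  then show ?thesis using assms G.inv_equality G.inv_inv by fastforce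
qed

lemma D_inj: "a \<in> carrier G \<Longrightarrow> b \<in> carrier G \<Longrightarrow> e \<in> topspace E \<Longrightarrow> D a e = D b e \<Longrightarrow> a = b"
  using D_transitive[of e "D a e"] D_in p_D by metis

lemma D_transport: "e \<in> topspace E \<Longrightarrow> e' \<in> topspace E \<Longrightarrow> p e = p e' \<Longrightarrow>
  (\<And>a. a \<in> carrier G \<Longrightarrow> e' = D a e \<Longrightarrow> thesis) \<Longrightarrow> thesis"
  using D_transitive[of e e'] by blast

lemma p_in: "e \<in> topspace E \<Longrightarrow> p e \<in> topspace M" using p_surj by blast

lemma q_def': "q (e, y) = {(D a e, h a y) | a. a \<in> carrier G}"
  unfolding suspension_proj_def orbit_def diagonal_action_def by auto

lemma q_eq_iff:
  assumes "e \<in> topspace E" "y \<in> topspace F" "e' \<in> topspace E" "y' \<in> topspace F"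
  shows "q (e, y) = q (e', y') \<longleftrightarrow> (\<exists>a\<in>carrier G. e' = D a e \<and> y' = h a y)"
proof
  assume eq: "q (e, y) = q (e', y')"
  have "(e', y') \<in> q (e', y')"
    unfolding q_def' using assms D_one h_one G.one_closed by (auto intro!: exI[of _ "\<one>\<^bsub>G\<^esub>"])
  then have "(e', y') \<in> q (e, y)" using eq by simp
  then show "\<exists>a\<in>carrier G. e' = D a e \<and> y' = h a y" unfolding q_def' by auto
next
  assume "\<exists>a\<in>carrier G. e' = D a e \<and> y' = h a y"
  then obtain a where a: "a \<in> carrier G" "e' = D a e" "y' = h a y" by blast
  show "q (e, y) = q (e', y')"
  proof (intro equalityI subsetI)
    fix z assume "z \<in> q (e, y)"
    then obtain b where b: "b \<in> carrier G" "z = (D b e, h b y)" by (auto simp: q_def')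
    have "z = (D (b \<otimes>\<^bsub>G\<^esub> inv\<^bsub>G\<^esub> a) e', h (b \<otimes>\<^bsub>G\<^esub> inv\<^bsub>G\<^esub> a) y')"
      using a b assms by (simp add: D_mult h_mult D_inv h_inv D_in h_in)
    then show "z \<in> q (e', y')" using a b by (auto simp: q_def')
  next
    fix z assume "z \<in> q (e', y')"
    then obtain b where b: "b \<in> carrier G" "z = (D b e', h b y')" by (auto simp: q_def')
    then have "z = (D (b \<otimes>\<^bsub>G\<^esub> a) e, h (b \<otimes>\<^bsub>G\<^esub> a) y)" using a assms by (simp add: D_mult h_mult)
    then show "z \<in> q (e, y)" using a b by (auto simp: q_def')
  qed
qed

lemma q_action: "a \<in> carrier G \<Longrightarrow> e \<in> topspace E \<Longrightarrow> y \<in> topspace F \<Longrightarrow> q (D a e, h a y) = q (e, y)"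
  using q_eq_iff[of e y "D a e" "h a y"] D_in h_in by auto

lemma topspace_X: "topspace X = q ` (topspace E \<times> topspace F)"
  unfolding suspension_space_def topspace_quotient_topology by simp

lemma q_in: "e \<in> topspace E \<Longrightarrow> y \<in> topspace F \<Longrightarrow> q (e, y) \<in> topspace X"
  unfolding topspace_X by blast

lemma q_cont: "continuous_map EF X q"
  unfolding continuous_map_def suspension_space_def
  by (auto simp: topspace_quotient_topology openin_quotient_topology)

lemma q_open: assumes Q: "openin EF Q" shows "openin X (q ` Q)"
proof -
  have QEF: "Q \<subseteq> topspace E \<times> topspace F" using openin_subset[OF Q] by simp
  let ?d = "\<lambda>a (e, y). (D a e, h a y)"
  have "{z \<in> topspace EF. q z \<in> q ` Q} = (\<Union>a\<in>carrier G. {z \<in> topspace EF. ?d a z \<in> Q})"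
  proof (intro equalityI subsetI)
    fix z assume "z \<in> {z \<in> topspace EF. q z \<in> q ` Q}"
    then obtain e y e' y' where z: "z = (e, y)" "e \<in> topspace E" "y \<in> topspace F" "(e', y') \<in> Q"
      "q (e, y) = q (e', y')" by auto
    then obtain a where "a \<in> carrier G" "e' = D a e" "y' = h a y" using q_eq_iff[of e y e' y'] QEF by blast
    then show "z \<in> (\<Union>a\<in>carrier G. {z \<in> topspace EF. ?d a z \<in> Q})" using z by auto
  next
    fix z assume "z \<in> (\<Union>a\<in>carrier G. {z \<in> topspace EF. ?d a z \<in> Q})"
    then obtain a e y where z: "z = (e, y)" "a \<in> carrier G" "e \<in> topspace E" "y \<in> topspace F"
      "(D a e, h a y) \<in> Q" by auto
    then have "q z = q (D a e, h a y)" by (simp add: q_action)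
    then show "z \<in> {z \<in> topspace EF. q z \<in> q ` Q}" using z by auto
  qed
  moreover have "openin EF {z \<in> topspace EF. ?d a z \<in> Q}" if "a \<in> carrier G" for a
    using D_cont[OF that] h_cont[OF that]
    by (intro openin_continuous_map_preimage[OF _ Q]) (simp add: continuous_map_prod_top)
  then have "openin EF (\<Union>a\<in>carrier G. {z \<in> topspace EF. ?d a z \<in> Q})" by blast
  ultimately show ?thesis
    unfolding suspension_space_def openin_quotient_topology using QEF by (auto intro: imageI)
qed

lemma q_open_Times: "openin E A \<Longrightarrow> openin F O' \<Longrightarrow> openin X (q ` (A \<times> O'))"
  by (intro q_open) (simp add: openin_prod_Times_iff)

lemma q_inj_sheet:
  assumes "W \<subseteq> topspace E" "inj_on p W"
  shows "inj_on q (W \<times> topspace F)"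
proof (rule inj_onI)
  fix z z' assume z: "z \<in> W \<times> topspace F" "z' \<in> W \<times> topspace F" "q z = q z'"
  obtain e y e' y' where [simp]: "z = (e, y)" "z' = (e', y')" by (cases z, cases z')
  obtain a where a: "a \<in> carrier G" "e' = D a e" "y' = h a y" using q_eq_iff[of e y e' y'] z assms by auto
  have "p e' = p e" using a p_D z assms by auto
  then have "e' = e" using assms z by (auto simp: inj_on_def)
  then have "a = \<one>\<^bsub>G\<^esub>" using a D_inj[OF a(1) G.one_closed, of e] D_one z assms by auto
  then show "z = z'" using a \<open>e' = e\<close> h_one z by auto
qed

text \<open>Different points of a sheet are in different orbits, so the open quotient map \<open>q\<close> is injective over it.\<close>

lemma q_sheet_homeomorphic:
  assumes W: "openin E W" "inj_on p W" and O': "openin F O'"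
  shows "homeomorphic_map (subtopology EF (W \<times> O')) (subtopology X (q ` (W \<times> O'))) q"
proof (rule bijective_open_imp_homeomorphic_map)
  have sub: "W \<subseteq> topspace E" "O' \<subseteq> topspace F" using W O' openin_subset by auto
  have t: "topspace (subtopology EF (W \<times> O')) = W \<times> O'" using sub by auto
  show "continuous_map (subtopology EF (W \<times> O')) (subtopology X (q ` (W \<times> O'))) q"
    using continuous_map_from_subtopology[OF q_cont] sub by (auto simp: continuous_map_in_subtopology)
  have op: "openin EF (W \<times> O')" using W O' by (simp add: openin_prod_Times_iff)
  then have opX: "openin X (q ` (W \<times> O'))" by (rule q_open)
  show "open_map (subtopology EF (W \<times> O')) (subtopology X (q ` (W \<times> O'))) q"
    unfolding open_map_def
  proof (intro allI impI)
    fix U assume "openin (subtopology EF (W \<times> O')) U"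
    then have U: "openin EF U" "U \<subseteq> W \<times> O'" using op openin_open_subtopology by blast+
    then show "openin (subtopology X (q ` (W \<times> O'))) (q ` U)"
      using q_open[OF U(1)] opX by (simp add: openin_open_subtopology image_mono)
  qed
  show "q ` topspace (subtopology EF (W \<times> O')) = topspace (subtopology X (q ` (W \<times> O')))"
    using openin_subset[OF opX] t by auto
  have "inj_on q (W \<times> topspace F)" using q_inj_sheet W(2) sub(1) by blast
  then show "inj_on q (topspace (subtopology EF (W \<times> O')))"
    unfolding t using sub by (auto elim!: inj_on_subset)
qed

text \<open>\<open>X\<close> fibres over \<open>M\<close> with fibre \<open>F\<close>: finitely many members of an open cover suffice over a neighbourhood of
  each point of \<open>M\<close>, and finitely many such neighbourhoods cover \<open>M\<close>.\<close>

lemma X_compact: "compact_space X"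
  unfolding compact_space_alt
proof (intro allI impI)
  fix \<U> assume \<U>: "(\<forall>U\<in>\<U>. openin X U) \<and> topspace X \<subseteq> \<Union>\<U>"
  have ex: "\<exists>A. openin E A \<and> e \<in> A \<and> (\<exists>\<V>. finite \<V> \<and> \<V> \<subseteq> \<U> \<and> q ` (A \<times> topspace F) \<subseteq> \<Union>\<V>)"
    if e: "e \<in> topspace E" for e
  proof -
    define Q where "Q U = {z \<in> topspace EF. q z \<in> U}" for U
    have Qo: "openin EF (Q U)" if "U \<in> \<U>" for U
      unfolding Q_def using that \<U> by (intro openin_continuous_map_preimage[OF q_cont]) auto
    define good where "good O' A U \<longleftrightarrow> openin E A \<and> e \<in> A \<and> U \<in> \<U> \<and> A \<times> O' \<subseteq> Q U" for O' A U
    have "\<exists>V. openin F V \<and> y \<in> V \<and> (\<exists>A U. good V A U)" if y: "y \<in> topspace F" for y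
    proof -
      obtain U where U: "U \<in> \<U>" "q (e, y) \<in> U" using \<U> q_in[OF e y] by blast
      have "(e, y) \<in> Q U" using U e y by (simp add: Q_def)
      then obtain A O' where "openin E A" "e \<in> A" "openin F O'" "y \<in> O'" "A \<times> O' \<subseteq> Q U"
        using openin_prod_rectangle[OF Qo[OF U(1)]] by metis
      then show ?thesis using U by (auto simp: good_def)
    qed
    from compact_space_subcover[OF F_compact this] obtain \<W> where
      \<W>: "finite \<W>" "\<And>V. V \<in> \<W> \<Longrightarrow> \<exists>A U. good V A U" "topspace F \<subseteq> \<Union>\<W>" by metis
    from \<W>(2) have "\<forall>O'\<in>\<W>. \<exists>A. \<exists>U. good O' A U" by blast
    then obtain A where "\<forall>O'\<in>\<W>. \<exists>U. good O' (A O') U" by (rule bchoice[THEN exE])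
    then obtain U where "\<forall>O'\<in>\<W>. good O' (A O') (U O')" by (rule bchoice[THEN exE])
    then have A: "\<And>O'. O' \<in> \<W> \<Longrightarrow> good O' (A O') (U O')" by blast
    define B where "B = topspace E \<inter> \<Inter>(A ` \<W>)"
    have "openin E B"
    proof (cases "\<W> = {}")
      case False
      then have "openin E (\<Inter>(A ` \<W>))" using \<W>(1) A by (intro openin_Inter) (auto simp: good_def)
      then show ?thesis unfolding B_def by blast
    qed (simp add: B_def)
    moreover have "e \<in> B" using e A by (auto simp: B_def good_def)
    moreover have "q ` (B \<times> topspace F) \<subseteq> \<Union>(U ` \<W>)"
    proof
      fix u assume "u \<in> q ` (B \<times> topspace F)"
      then obtain x z where xz: "u = q (x, z)" "x \<in> B" "z \<in> topspace F" by blast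
      obtain O' where O': "O' \<in> \<W>" "z \<in> O'" using \<W>(3) xz(3) by blast
      then have "(x, z) \<in> Q (U O')" using A[OF O'(1)] xz by (auto simp: good_def B_def)
      then show "u \<in> \<Union>(U ` \<W>)" using xz(1) O' by (auto simp: Q_def)
    qed
    moreover have "finite (U ` \<W>)" "U ` \<W> \<subseteq> \<U>" using \<W>(1) A by (auto simp: good_def)
    ultimately show ?thesis by blast
  qed
  have "\<exists>V. openin M V \<and> x \<in> V \<and>
      (\<exists>\<V>. finite \<V> \<and> \<V> \<subseteq> \<U> \<and> (\<forall>e\<in>topspace E. p e \<in> V \<longrightarrow> (\<forall>y\<in>topspace F. q (e, y) \<in> \<Union>\<V>)))"
    if x: "x \<in> topspace M" for x
  proof -
    obtain e where e: "e \<in> topspace E" "x = p e" using x p_surj by blast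
    obtain A \<V> where A: "openin E A" "e \<in> A" "finite \<V>" "\<V> \<subseteq> \<U>" "q ` (A \<times> topspace F) \<subseteq> \<Union>\<V>"
      using ex[OF e(1)] by blast
    have "q (e', y) \<in> \<Union>\<V>" if e': "e' \<in> topspace E" "p e' \<in> p ` A" and y: "y \<in> topspace F" for e' y
    proof -
      obtain e'' where e'': "e'' \<in> A" "p e' = p e''" using e'(2) by blast
      have "e'' \<in> topspace E" using e'' A(1) openin_subset by blast
      then obtain a where a: "a \<in> carrier G" "e'' = D a e'" using D_transport[OF e'(1) _ e''(2)] by blast
      have "q (e', y) = q (e'', h a y)" using a e' y q_action by simp
      then show ?thesis using A(5) e''(1) h_in[OF a(1) y] by blast
    qed
    then have "\<forall>e\<in>topspace E. p e \<in> p ` A \<longrightarrow> (\<forall>y\<in>topspace F. q (e, y) \<in> \<Union>\<V>)" by blast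
    moreover have "x \<in> p ` A" using A(2) e(2) by blast
    ultimately show ?thesis using A(3,4) p_open[OF A(1)] by (intro exI[of _ "p ` A"] conjI exI[of _ \<V>])
  qed
  from compact_space_subcover[OF M_compact this] obtain \<W> where \<W>: "finite \<W>"
    "\<And>V. V \<in> \<W> \<Longrightarrow> \<exists>\<V>. finite \<V> \<and> \<V> \<subseteq> \<U> \<and> (\<forall>e\<in>topspace E. p e \<in> V \<longrightarrow> (\<forall>y\<in>topspace F. q (e, y) \<in> \<Union>\<V>))"
    "topspace M \<subseteq> \<Union>\<W>" by metis
  from \<W>(2) have "\<forall>V\<in>\<W>. \<exists>\<V>. finite \<V> \<and> \<V> \<subseteq> \<U> \<and>
      (\<forall>e\<in>topspace E. p e \<in> V \<longrightarrow> (\<forall>y\<in>topspace F. q (e, y) \<in> \<Union>\<V>))" by blast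
  then obtain \<V> where "\<forall>V\<in>\<W>. finite (\<V> V) \<and> \<V> V \<subseteq> \<U> \<and>
      (\<forall>e\<in>topspace E. p e \<in> V \<longrightarrow> (\<forall>y\<in>topspace F. q (e, y) \<in> \<Union>(\<V> V)))" by (rule bchoice[THEN exE])
  then have \<V>: "\<And>V. V \<in> \<W> \<Longrightarrow> finite (\<V> V)" "\<And>V. V \<in> \<W> \<Longrightarrow> \<V> V \<subseteq> \<U>"
    "\<And>V e y. V \<in> \<W> \<Longrightarrow> e \<in> topspace E \<Longrightarrow> p e \<in> V \<Longrightarrow> y \<in> topspace F \<Longrightarrow> q (e, y) \<in> \<Union>(\<V> V)"
    by blast+
  have "topspace X \<subseteq> \<Union>(\<Union>(\<V> ` \<W>))"
  proof
    fix u assume "u \<in> topspace X"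
    then obtain e y where u: "u = q (e, y)" "e \<in> topspace E" "y \<in> topspace F" by (auto simp: topspace_X)
    obtain V where V: "V \<in> \<W>" "p e \<in> V" using \<W>(3) p_in[OF u(2)] by blast
    then show "u \<in> \<Union>(\<Union>(\<V> ` \<W>))" using \<V>(3)[OF V(1) u(2) V(2) u(3)] u(1) by blast
  qed
  moreover have "finite (\<Union>(\<V> ` \<W>))" using \<W>(1) \<V>(1) by blast
  moreover have "\<Union>(\<V> ` \<W>) \<subseteq> \<U>" using \<V>(2) by blast
  ultimately show "\<exists>\<V>. finite \<V> \<and> \<V> \<subseteq> \<U> \<and> topspace X \<subseteq> \<Union>\<V>" by blast
qed

section \<open>Foliated charts and leaves of the suspension\<close>

abbreviation \<F> :: "('e \<times> 'f) set fol_chart set" where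
  "\<F> \<equiv> suspension_lamination n G D h E p F"

text \<open>In contrast to the defining charts of the suspension, the transversal is only an open part \<open>O'\<close> of the
  fibre: the category is computed with tubes over such parts.\<close>

definition tube_chart ::
  "('e \<times> 'f) set fol_chart \<Rightarrow> 'e set \<Rightarrow> ('e \<Rightarrow> nat \<Rightarrow> real) \<Rightarrow> 'f set \<Rightarrow> ('f \<Rightarrow> real) \<Rightarrow> bool" where
  "tube_chart c W \<kappa> O' \<sigma> \<longleftrightarrow> coord_ball n E W (chart_ball c) \<kappa> \<and> inj_on p W \<and> openin F O' \<and>
     homeomorphic_map (subtopology F O') (chart_trans c) \<sigma> \<and>
     chart_dom c = q ` (W \<times> O') \<and> (\<forall>w\<in>W. \<forall>y\<in>O'. chart_map c (q (w, y)) = (\<kappa> w, \<sigma> y))"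

lemma polish_open: assumes "openin F O'" shows "polish_topology (subtopology F O')"
proof -
  have "completely_metrizable_space F"
    using compact_Hausdorff_second_countable_imp_completely_metrizable
      F_compact F_Hausdorff F_second_countable by blast
  then show ?thesis unfolding polish_topology_def
    using completely_metrizable_space_openin assms second_countable_subtopology[OF F_second_countable]
    by blast
qed

lemma tube_chart_foliated:
  assumes "tube_chart c W \<kappa> O' \<sigma>" shows "foliated_chart n X c"
proof -
  have c: "coord_ball n E W (chart_ball c) \<kappa>" "inj_on p W" "openin F O'"
     "homeomorphic_map (subtopology F O') (chart_trans c) \<sigma>" "chart_dom c = q ` (W \<times> O')"
     "\<And>w y. w\<in>W \<Longrightarrow> y\<in>O' \<Longrightarrow> chart_map c (q (w, y)) = (\<kappa> w, \<sigma> y)"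
    using assms by (auto simp: tube_chart_def)
  note W = coord_ballD[OF c(1)]
  have sub: "W \<subseteq> topspace E" "O' \<subseteq> topspace F" using W(3) c(3) openin_subset by auto
  let ?Y = "prod_topology (subtopology (Euclidean_space n) (chart_ball c)) (chart_trans c)"
  obtain \<kappa>' \<sigma>' where k: "homeomorphic_maps (subtopology E W) (subtopology (Euclidean_space n) (chart_ball c)) \<kappa> \<kappa>'"
      and s: "homeomorphic_maps (subtopology F O') (chart_trans c) \<sigma> \<sigma>'"
    using W(4) c(4) homeomorphic_map_maps by metis
  have "homeomorphic_maps (prod_topology (subtopology E W) (subtopology F O')) ?Y
      (\<lambda>(x,y). (\<kappa> x, \<sigma> y)) (\<lambda>(x,y). (\<kappa>' x, \<sigma>' y))"
    using k s by (simp add: homeomorphic_maps_prod)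
  then have 1: "homeomorphic_map (subtopology EF (W \<times> O')) ?Y (\<lambda>(x,y). (\<kappa> x, \<sigma> y))"
    using homeomorphic_map_maps subtopology_Times by metis
  obtain g where g: "homeomorphic_maps (subtopology EF (W \<times> O')) (subtopology X (q ` (W \<times> O'))) q g"
    using q_sheet_homeomorphic[OF W(1) c(2,3)] homeomorphic_map_maps by blast
  then have "homeomorphic_map (subtopology X (q ` (W \<times> O'))) (subtopology EF (W \<times> O')) g"
    using homeomorphic_maps_map by blast
  from homeomorphic_map_compose[OF this 1]
  have 2: "homeomorphic_map (subtopology X (q ` (W \<times> O'))) ?Y ((\<lambda>(x,y). (\<kappa> x, \<sigma> y)) \<circ> g)" .
  have "homeomorphic_map (subtopology X (q ` (W \<times> O'))) ?Y (chart_map c)"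
  proof (rule homeomorphic_map_eq[OF 2])
    fix u assume "u \<in> topspace (subtopology X (q ` (W \<times> O')))"
    then obtain w y where u: "u = q (w, y)" "w \<in> W" "y \<in> O'" by auto
    have "g u = (w, y)" using g u sub by (auto simp: homeomorphic_maps_def)
    then show "((\<lambda>(x,y). (\<kappa> x, \<sigma> y)) \<circ> g) u = chart_map c u" using u c(6) by simp
  qed
  moreover have "polish_topology (chart_trans c)"
    using polish_topology_homeomorphic[OF _ polish_open[OF c(3)]] c(4) homeomorphic_map_imp_homeomorphic_space
    by blast
  moreover have "openin X (chart_dom c)" unfolding c(5) by (rule q_open_Times[OF W(1) c(3)])
  ultimately show ?thesis using W(2) c(5) by (simp add: foliated_chart_def)
qed

text \<open>Two sheets that meet over \<open>M\<close> differ near a common point by one element of \<open>G\<close>, whose action on \<open>F\<close> is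
  the change of the transverse coordinate.\<close>

lemma tube_chart_change:
  assumes "tube_chart c W \<kappa> O' \<sigma>" "tube_chart c' W' \<kappa>' O'' \<sigma>'"
  shows "foliated_change X c c'"
  unfolding foliated_change_def
proof
  have c: "openin E W" "inj_on p W" "openin F O'" "chart_dom c = q ` (W \<times> O')" "inj_on \<sigma> O'"
     "\<And>w y. w\<in>W \<Longrightarrow> y\<in>O' \<Longrightarrow> chart_map c (q (w, y)) = (\<kappa> w, \<sigma> y)"
    using assms(1) openin_subset[of F O']
    by (auto simp: tube_chart_def coord_ball_def homeomorphic_eq_everything_map Int_absorb1)
  have c': "openin E W'" "openin F O''" "chart_dom c' = q ` (W' \<times> O'')"
     "\<And>w y. w\<in>W' \<Longrightarrow> y\<in>O'' \<Longrightarrow> chart_map c' (q (w, y)) = (\<kappa>' w, \<sigma>' y)"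
    using assms(2) by (auto simp: tube_chart_def coord_ball_def)
  have sub: "W \<subseteq> topspace E" "O' \<subseteq> topspace F" "W' \<subseteq> topspace E" "O'' \<subseteq> topspace F"
    using c(1,3) c'(1,2) by (simp_all add: openin_subset)
  fix u assume "u \<in> chart_dom c \<inter> chart_dom c'"
  then have uu: "u \<in> q ` (W \<times> O')" "u \<in> q ` (W' \<times> O'')" using c(4) c'(3) by auto
  obtain w y where wy: "u = q (w, y)" "w \<in> W" "y \<in> O'" using uu(1) by blast
  obtain w' y' where wy': "u = q (w', y')" "w' \<in> W'" "y' \<in> O''" using uu(2) by blast
  note u = wy wy'
  obtain a where a: "a \<in> carrier G" "w' = D a w" "y' = h a y"
  proof -
    have "w \<in> topspace E" "y \<in> topspace F" "w' \<in> topspace E" "y' \<in> topspace F" using sub u by auto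
    then show thesis using q_eq_iff[of w y w' y'] u that by metis
  qed
  define A where "A = W \<inter> {x \<in> topspace E. D a x \<in> W'}"
  define B where "B = O' \<inter> {z \<in> topspace F. h a z \<in> O''}"
  have A: "openin E A" unfolding A_def
    using c(1) openin_continuous_map_preimage[OF D_cont[OF a(1)] c'(1)] by (simp add: openin_Int)
  have B: "openin F B" unfolding B_def
    using c(3) openin_continuous_map_preimage[OF h_cont[OF a(1)] c'(2)] by (simp add: openin_Int)
  have sh: "q (x, z) = q (D a x, h a z)" if "x \<in> A" "z \<in> B" for x z
    using that q_action[OF a(1)] by (simp add: A_def B_def)
  show "\<exists>N g. openin X N \<and> u \<in> N \<and> N \<subseteq> chart_dom c \<inter> chart_dom c' \<and>
      (\<forall>v\<in>N. snd (chart_map c' v) = g (snd (chart_map c v)))"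
  proof (intro exI conjI ballI)
    show "openin X (q ` (A \<times> B))" by (rule q_open_Times[OF A B])
    have "w \<in> A" "y \<in> B" using u a sub by (auto simp: A_def B_def)
    then show "u \<in> q ` (A \<times> B)" using u by blast
    show "q ` (A \<times> B) \<subseteq> chart_dom c \<inter> chart_dom c'"
    proof
      fix v assume "v \<in> q ` (A \<times> B)"
      then obtain x z where v: "v = q (x, z)" "x \<in> A" "z \<in> B" by blast
      have "v \<in> q ` (W \<times> O')" using v by (auto simp: A_def B_def)
      moreover have "v \<in> q ` (W' \<times> O'')" using v sh[OF v(2,3)] by (auto simp: A_def B_def)
      ultimately show "v \<in> chart_dom c \<inter> chart_dom c'" using c(4) c'(3) by simp
    qed
    fix v assume "v \<in> q ` (A \<times> B)"
    then obtain x z where v: "v = q (x, z)" "x \<in> A" "z \<in> B" by blast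
    have "snd (chart_map c v) = \<sigma> z" using v c(6) by (simp add: A_def B_def)
    moreover have "snd (chart_map c' v) = \<sigma>' (h a z)" using v sh[OF v(2,3)] c'(4) by (simp add: A_def B_def)
    moreover have "inv_into O' \<sigma> (\<sigma> z) = z" using v c(5) by (simp add: B_def)
    ultimately show "snd (chart_map c' v) = (\<sigma>' \<circ> h a \<circ> inv_into O' \<sigma>) (snd (chart_map c v))" by simp
  qed
qed

lemma suspension_chart_tube:
  assumes "c \<in> suspension_charts n G D h E p F"
  obtains W \<kappa> \<sigma> where "tube_chart c W \<kappa> (topspace F) \<sigma>"
  using assms that unfolding suspension_charts_def tube_chart_def coord_ball_def
  by (auto simp: subtopology_topspace)

lemma tube_chart_in_lamination:
  assumes "tube_chart c W \<kappa> O' \<sigma>" shows "c \<in> \<F>"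
proof -
  have "foliated_change X c d \<and> foliated_change X d c" if d: "d \<in> suspension_charts n G D h E p F" for d
  proof -
    obtain W' \<kappa>' \<sigma>' where "tube_chart d W' \<kappa>' (topspace F) \<sigma>'" by (rule suspension_chart_tube[OF d])
    then show ?thesis using tube_chart_change assms by metis
  qed
  then show ?thesis
    unfolding suspension_lamination_def maximal_atlas_def compatible_charts_def
    using tube_chart_foliated[OF assms] by simp
qed

lemma tube_chart_exists:
  assumes W: "coord_ball n E W B \<kappa>" "inj_on p W" and O': "openin F O'"
  obtains c \<sigma> where "tube_chart c W \<kappa> O' \<sigma>" "inj_on \<sigma> O'"
    "O' = topspace F \<Longrightarrow> c \<in> suspension_charts n G D h E p F"
proof -
  obtain \<sigma> :: "'f \<Rightarrow> real" where s: "inj_on \<sigma> (topspace F)"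
    using second_countable_Hausdorff_inj_real[OF F_Hausdorff F_second_countable] by blast
  have OF: "O' \<subseteq> topspace F" using O' openin_subset by blast
  have sO: "inj_on \<sigma> (topspace (subtopology F O'))" using s by (auto intro: inj_on_subset)
  note Wo = coord_ballD[OF W(1)]
  define c where "c = \<lparr>chart_dom = q ` (W \<times> O'),
    chart_map = (\<lambda>u. let z = inv_into (W \<times> O') q u in (\<kappa> (fst z), \<sigma> (snd z))),
    chart_ball = B, chart_trans = quotient_topology (subtopology F O') \<sigma>\<rparr>"
  have inj: "inj_on q (W \<times> O')"
    using q_inj_sheet[OF Wo(3) W(2)] OF by (auto elim!: inj_on_subset)
  have t: "tube_chart c W \<kappa> O' \<sigma>"
    unfolding tube_chart_def
    using W O' homeomorphic_copy[OF sO] inj by (simp add: c_def inv_into_f_f)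
  moreover have "c \<in> suspension_charts n G D h E p F" if "O' = topspace F"
    unfolding suspension_charts_def
    using t Wo unfolding tube_chart_def coord_ball_def that by (auto simp: subtopology_topspace)
  moreover have "inj_on \<sigma> O'" using s OF inj_on_subset by blast
  ultimately show thesis using that by blast
qed

text \<open>Near each of its points, a chart of the lamination has the leaf coordinate \<open>e\<close> and the
  transverse coordinate \<open>y\<close>: its own transverse coordinate is an injective function of \<open>y\<close>.\<close>

lemma local_product_structure:
  assumes c: "c \<in> \<F>" and e: "e \<in> topspace E" "y \<in> topspace F" "q (e, y) \<in> chart_dom c"
  obtains A O' where "openin E A" "e \<in> A" "openin F O'" "y \<in> O'" "q ` (A \<times> O') \<subseteq> chart_dom c"
    "\<And>x x' z z'. x \<in> A \<Longrightarrow> x' \<in> A \<Longrightarrow> z \<in> O' \<Longrightarrow> z' \<in> O' \<Longrightarrow>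
       snd (chart_map c (q (x, z))) = snd (chart_map c (q (x', z'))) \<longleftrightarrow> z = z'"
proof -
  obtain W B \<kappa> where W: "coord_ball n E W B \<kappa>" "e \<in> W" "inj_on p W"
    using small_ball[OF openin_topspace e(1)] by metis
  obtain s \<sigma> where s: "tube_chart s W \<kappa> (topspace F) \<sigma>" "inj_on \<sigma> (topspace F)"
      "s \<in> suspension_charts n G D h E p F"
    using tube_chart_exists[OF W(1,3) openin_topspace] by metis
  have "compatible_charts X c s"
    using c s(3) by (auto simp: suspension_lamination_def maximal_atlas_def)
  moreover have u: "q (e, y) \<in> chart_dom s" using s(1) W(2) e by (auto simp: tube_chart_def)
  ultimately obtain N1 g1 N2 g2 where N: "openin X N1" "q (e, y) \<in> N1" "N1 \<subseteq> chart_dom c \<inter> chart_dom s"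
      "\<And>v. v \<in> N1 \<Longrightarrow> snd (chart_map s v) = g1 (snd (chart_map c v))"
      "openin X N2" "q (e, y) \<in> N2" "\<And>v. v \<in> N2 \<Longrightarrow> snd (chart_map c v) = g2 (snd (chart_map s v))"
    unfolding compatible_charts_def foliated_change_def using e(3) by (metis IntI)
  define Q where "Q = {z \<in> topspace EF. q z \<in> N1 \<inter> N2} \<inter> W \<times> topspace F"
  have "openin EF Q" unfolding Q_def
    using openin_continuous_map_preimage[OF q_cont openin_Int[OF N(1,5)]] coord_ballD(1)[OF W(1)]
    by (intro openin_Int) (auto simp: openin_prod_Times_iff)
  moreover have "(e, y) \<in> Q" using e N W by (simp add: Q_def)
  ultimately obtain A O' where AO: "openin E A" "e \<in> A" "openin F O'" "y \<in> O'" "A \<times> O' \<subseteq> Q"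
    using openin_prod_rectangle by metis
  have qs: "snd (chart_map s (q (x, z))) = \<sigma> z" "q (x, z) \<in> N1" "q (x, z) \<in> N2" "z \<in> topspace F"
    if "x \<in> A" "z \<in> O'" for x z
  proof -
    have "(x, z) \<in> Q" using AO(5) that by blast
    then show "q (x, z) \<in> N1" "q (x, z) \<in> N2" "z \<in> topspace F" "snd (chart_map s (q (x, z))) = \<sigma> z"
      using s(1) by (auto simp: Q_def tube_chart_def)
  qed
  show thesis
  proof (rule that[OF AO(1-4)])
    show "q ` (A \<times> O') \<subseteq> chart_dom c" using qs(2) N(3) by blast
    fix x x' z z' assume a: "x \<in> A" "x' \<in> A" "z \<in> O'" "z' \<in> O'"
    show "snd (chart_map c (q (x, z))) = snd (chart_map c (q (x', z'))) \<longleftrightarrow> z = z'"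
    proof
      assume "snd (chart_map c (q (x, z))) = snd (chart_map c (q (x', z')))"
      then have "\<sigma> z = \<sigma> z'" using N(4)[OF qs(2)] qs(1) a by metis
      then show "z = z'" using s(2) qs(4) a by (meson inj_onD)
    next
      assume "z = z'"
      then show "snd (chart_map c (q (x, z))) = snd (chart_map c (q (x', z')))"
        using N(7)[OF qs(3)] qs(1) a by metis
    qed
  qed
qed

definition leaf :: "'f \<Rightarrow> ('e \<times> 'f) set set" where "leaf y = (\<lambda>e. q (e, y)) ` topspace E"

lemma leaf_eq_or_disjoint:
  assumes "y \<in> topspace F" "y' \<in> topspace F" "leaf y \<inter> leaf y' \<noteq> {}"
  shows "leaf y = leaf y'"
proof -
  have *: "leaf (h a z) \<subseteq> leaf z" if "a \<in> carrier G" "z \<in> topspace F" for a z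
  proof
    fix u assume "u \<in> leaf (h a z)"
    then obtain e where e: "e \<in> topspace E" "u = q (e, h a z)" by (auto simp: leaf_def)
    have "u = q (D (inv\<^bsub>G\<^esub> a) e, z)"
      using q_action[of "inv\<^bsub>G\<^esub> a" e "h a z"] e that by (simp add: h_inv h_in)
    then show "u \<in> leaf z" using e that D_in by (auto simp: leaf_def)
  qed
  obtain e e' where e: "e \<in> topspace E" "e' \<in> topspace E" "q (e, y) = q (e', y')"
    using assms(3) by (auto simp: leaf_def)
  then obtain a where a: "a \<in> carrier G" "y' = h a y"
    using q_eq_iff[OF e(1) assms(1) e(2) assms(2)] by metis
  have "y = h (inv\<^bsub>G\<^esub> a) y'" using a assms by (simp add: h_inv)
  then show ?thesis using *[of a y] *[of "inv\<^bsub>G\<^esub> a" y'] a assms by auto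
qed

lemma connectedin_in_partition:
  assumes C: "connectedin T C" "C \<noteq> {}" and V: "\<And>i. i \<in> I \<Longrightarrow> openin T (V i)" "topspace T = (\<Union>i\<in>I. V i)"
    and disj: "\<And>i j. i \<in> I \<Longrightarrow> j \<in> I \<Longrightarrow> V i \<inter> V j \<noteq> {} \<Longrightarrow> V i = V j"
  obtains i where "i \<in> I" "C \<subseteq> V i"
proof -
  obtain x i where x: "x \<in> C" "i \<in> I" "x \<in> V i" using C V(2) connectedin_subset_topspace by blast
  have "topspace T - V i = \<Union>(V ` {j \<in> I. V j \<noteq> V i})"
  proof (intro equalityI subsetI)
    fix z assume "z \<in> \<Union>(V ` {j \<in> I. V j \<noteq> V i})"
    then obtain j where "j \<in> I" "V j \<noteq> V i" "z \<in> V j" by blast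
    then show "z \<in> topspace T - V i" using disj[of j i] x(2) V(2) by blast
  qed (use V(2) in blast)
  moreover have "openin T (\<Union>(V ` {j \<in> I. V j \<noteq> V i}))" using V(1) by blast
  ultimately have "closedin T (V i)" using V(1)[OF x(2)] openin_subset closedin_def by metis
  then have "C \<subseteq> V i \<or> disjnt C (V i)" using connectedin_clopen_cases[OF C(1)] V(1)[OF x(2)] by blast
  then show thesis using that x by (auto simp: disjnt_def)
qed

lemma tube_plaque:
  assumes c: "tube_chart c W \<kappa> O' \<sigma>" and y: "y \<in> O'"
  shows "q ` (W \<times> {y}) \<in> plaques c"
proof -
  have "inj_on \<sigma> O'" "\<sigma> y \<in> topspace (chart_trans c)"
    using c y openin_subset[of F O']
    by (auto simp: tube_chart_def homeomorphic_eq_everything_map Int_absorb1)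
  moreover have "{x \<in> chart_dom c. snd (chart_map c x) = \<sigma> y} = q ` (W \<times> {y})"
    using c y \<open>inj_on \<sigma> O'\<close> by (auto simp: tube_chart_def inj_on_def)
  ultimately show ?thesis unfolding plaques_def by auto
qed

lemma plaque_subset_dom: "P \<in> plaques c \<Longrightarrow> P \<subseteq> chart_dom c" by (auto simp: plaques_def)

lemma chart_dom_subset: "c \<in> \<F> \<Longrightarrow> chart_dom c \<subseteq> topspace X"
  using openin_subset by (auto simp: suspension_lamination_def maximal_atlas_def foliated_chart_def)

lemma topspace_leaf_topology: "topspace (leaf_topology \<F>) = topspace X"
proof (intro equalityI subsetI)
  fix u assume "u \<in> topspace X"
  then obtain e y where u: "u = q (e, y)" "e \<in> topspace E" "y \<in> topspace F" by (auto simp: topspace_X)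
  obtain W B \<kappa> where W: "coord_ball n E W B \<kappa>" "e \<in> W" "inj_on p W"
    using small_ball[OF openin_topspace u(2)] by metis
  obtain s \<sigma> where s: "tube_chart s W \<kappa> (topspace F) \<sigma>"
    using tube_chart_exists[OF W(1,3) openin_topspace] by metis
  have "u \<in> q ` (W \<times> {y})" using u W(2) by blast
  then show "u \<in> topspace (leaf_topology \<F>)"
    using tube_plaque[OF s u(3)] tube_chart_in_lamination[OF s]
    unfolding leaf_topology_def topology_generated_by_topspace by blast
next
  fix u assume "u \<in> topspace (leaf_topology \<F>)"
  then obtain c P where c: "c \<in> \<F>" "P \<in> plaques c" "u \<in> P" by (auto simp: leaf_topology_def)
  show "u \<in> topspace X" using plaque_subset_dom[OF c(2)] chart_dom_subset[OF c(1)] c(3) by blast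
qed

lemma leaf_map_continuous:
  assumes y: "y \<in> topspace F" shows "continuous_map E (leaf_topology \<F>) (\<lambda>e. q (e, y))"
  unfolding leaf_topology_def continuous_on_generated_topo_iff
proof (intro conjI allI impI)
  have "q (e, y) \<in> topspace (leaf_topology \<F>)" if "e \<in> topspace E" for e
    using that y q_in topspace_leaf_topology by simp
  then show "(\<lambda>e. q (e, y)) ` topspace E \<subseteq> \<Union>(\<Union>c\<in>\<F>. plaques c)"
    by (auto simp: leaf_topology_def)
  fix P assume "P \<in> (\<Union>c\<in>\<F>. plaques c)"
  then obtain c s where c: "c \<in> \<F>" "P = {x \<in> chart_dom c. snd (chart_map c x) = s}" by (auto simp: plaques_def)
  show "openin E ((\<lambda>e. q (e, y)) -` P \<inter> topspace E)"
  proof (subst openin_subopen, intro ballI)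
    fix e assume e: "e \<in> (\<lambda>e. q (e, y)) -` P \<inter> topspace E"
    then have e': "e \<in> topspace E" "q (e, y) \<in> chart_dom c" "snd (chart_map c (q (e, y))) = s" using c by auto
    obtain A O' where A: "openin E A" "e \<in> A" "y \<in> O'" "q ` (A \<times> O') \<subseteq> chart_dom c"
      "\<And>x x' z z'. x \<in> A \<Longrightarrow> x' \<in> A \<Longrightarrow> z \<in> O' \<Longrightarrow> z' \<in> O' \<Longrightarrow>
         snd (chart_map c (q (x, z))) = snd (chart_map c (q (x', z'))) \<longleftrightarrow> z = z'"
      using local_product_structure[OF c(1) e'(1) y e'(2)] by metis
    have "A \<subseteq> (\<lambda>e. q (e, y)) -` P \<inter> topspace E"
    proof
      fix x assume x: "x \<in> A"
      have "snd (chart_map c (q (x, y))) = s" using A(5)[OF x A(2,3,3)] e'(3) by simp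
      moreover have "q (x, y) \<in> chart_dom c" using x A(3,4) by blast
      moreover have "x \<in> topspace E" using x A(1) openin_subset by blast
      ultimately show "x \<in> (\<lambda>e. q (e, y)) -` P \<inter> topspace E" using c(2) by simp
    qed
    then show "\<exists>T. openin E T \<and> e \<in> T \<and> T \<subseteq> (\<lambda>e. q (e, y)) -` P \<inter> topspace E" using A by blast
  qed
qed

lemma leaf_connected: "y \<in> topspace F \<Longrightarrow> connectedin (leaf_topology \<F>) (leaf y)"
  unfolding leaf_def
  using connectedin_continuous_map_image[OF leaf_map_continuous] path_connected_imp_connected_space[OF E_path_connected]
  by (simp add: connectedin_topspace)

lemma leaf_open:
  assumes y: "y \<in> topspace F" shows "openin (leaf_topology \<F>) (leaf y)"
proof (subst openin_subopen, intro ballI)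
  fix u assume "u \<in> leaf y"
  then obtain e where e: "e \<in> topspace E" "u = q (e, y)" by (auto simp: leaf_def)
  obtain W B \<kappa> where W: "coord_ball n E W B \<kappa>" "e \<in> W" "inj_on p W"
    using small_ball[OF openin_topspace e(1)] by metis
  obtain s \<sigma> where s: "tube_chart s W \<kappa> (topspace F) \<sigma>"
    using tube_chart_exists[OF W(1,3) openin_topspace] by metis
  have "openin (leaf_topology \<F>) (q ` (W \<times> {y}))"
    unfolding leaf_topology_def
    using tube_plaque[OF s y] tube_chart_in_lamination[OF s] by (intro topology_generated_by_Basis) blast
  moreover have "q ` (W \<times> {y}) \<subseteq> leaf y" using coord_ballD(3)[OF W(1)] by (auto simp: leaf_def)
  ultimately show "\<exists>T. openin (leaf_topology \<F>) T \<and> u \<in> T \<and> T \<subseteq> leaf y" using e W(2) by blast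
qed

text \<open>The sets \<open>q(E \<times> {y})\<close> are connected and open in the leaf topology, and they partition \<open>X\<close>.\<close>

lemma leaves_eq: "leaves \<F> = leaf ` topspace F"
proof -
  have tX: "topspace X = (\<Union>y\<in>topspace F. leaf y)" unfolding topspace_X leaf_def by auto
  have comp: "connected_component_of_set (leaf_topology \<F>) u = leaf y"
    if y: "y \<in> topspace F" and u: "u \<in> leaf y" for u y
  proof
    show "leaf y \<subseteq> connected_component_of_set (leaf_topology \<F>) u"
      by (rule connected_component_of_maximal[OF leaf_connected[OF y] u])
    then have u': "u \<in> connected_component_of_set (leaf_topology \<F>) u" using u by blast
    obtain i where i: "i \<in> topspace F" "connected_component_of_set (leaf_topology \<F>) u \<subseteq> leaf i"
      by (rule connectedin_in_partition[OF connectedin_connected_component_of[of "leaf_topology \<F>" u],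
            where I = "topspace F" and V = leaf])
        (use u' leaf_open leaf_eq_or_disjoint tX topspace_leaf_topology in \<open>auto\<close>)
    then have "leaf i = leaf y" using leaf_eq_or_disjoint[OF i(1) y] u u' by blast
    then show "connected_component_of_set (leaf_topology \<F>) u \<subseteq> leaf y" using i by simp
  qed
  show ?thesis
    unfolding leaves_def connected_components_of_def topspace_leaf_topology tX
  proof (intro equalityI subsetI)
    fix L assume "L \<in> connected_component_of_set (leaf_topology \<F>) ` (\<Union>y\<in>topspace F. leaf y)"
    then show "L \<in> leaf ` topspace F" using comp by force
  next
    fix L assume "L \<in> leaf ` topspace F"
    then obtain y where y: "y \<in> topspace F" "L = leaf y" by blast
    have "q (e0, y) \<in> leaf y" using e0 by (simp add: leaf_def)
    then show "L \<in> connected_component_of_set (leaf_topology \<F>) ` (\<Union>y\<in>topspace F. leaf y)"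
      using y comp[OF y(1)] by (intro image_eqI[of _ _ "q (e0, y)"]) auto
  qed
qed

text \<open>The plaques of a tube are open in its leaf topology and partition the tube, so a leaf lies in one
  of them.\<close>

lemma tube_leaf:
  assumes W: "coord_ball n E W B \<kappa>" "inj_on p W" and O': "openin F O'"
    and L: "L \<in> leaves (restrict_lamination \<F> (q ` (W \<times> O')))"
  obtains y where "y \<in> O'" "L \<subseteq> q ` (W \<times> {y})"
proof -
  let ?U = "q ` (W \<times> O')"
  let ?T = "leaf_topology (restrict_lamination \<F> ?U)"
  obtain s \<sigma> where s: "tube_chart s W \<kappa> O' \<sigma>" using tube_chart_exists[OF W O'] by metis
  have "s \<in> restrict_lamination \<F> ?U"
    using tube_chart_in_lamination[OF s] s by (simp add: restrict_lamination_def tube_chart_def)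
  then have op: "openin ?T (q ` (W \<times> {y}))" if "y \<in> O'" for y
    unfolding leaf_topology_def using tube_plaque[OF s that] by (intro topology_generated_by_Basis) blast
  have top: "topspace ?T = (\<Union>y\<in>O'. q ` (W \<times> {y}))"
  proof
    have "topspace ?T \<subseteq> ?U"
      using plaque_subset_dom by (fastforce simp: leaf_topology_def restrict_lamination_def)
    then show "topspace ?T \<subseteq> (\<Union>y\<in>O'. q ` (W \<times> {y}))" by blast
    show "(\<Union>y\<in>O'. q ` (W \<times> {y})) \<subseteq> topspace ?T" using op openin_subset by blast
  qed
  have inj: "inj_on q (W \<times> topspace F)" by (rule q_inj_sheet[OF coord_ballD(3)[OF W(1)] W(2)])
  have OF: "O' \<subseteq> topspace F" using O' openin_subset by blast
  obtain x where "L = connected_component_of_set ?T x" "x \<in> topspace ?T"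
    using L by (auto simp: leaves_def connected_components_of_def)
  then have "connectedin ?T L" "L \<noteq> {}"
    using connectedin_connected_component_of by (metis, metis connected_component_of_eq_empty)
  then obtain y where "y \<in> O'" "L \<subseteq> q ` (W \<times> {y})"
  proof (rule connectedin_in_partition)
    fix i j assume ij: "i \<in> O'" "j \<in> O'" "q ` (W \<times> {i}) \<inter> q ` (W \<times> {j}) \<noteq> {}"
    then obtain w w' where w: "w \<in> W" "w' \<in> W" "q (w, i) = q (w', j)" by blast
    have "(w, i) = (w', j)" by (rule inj_onD[OF inj w(3)]) (use w ij OF in auto)
    then show "q ` (W \<times> {i}) = q ` (W \<times> {j})" by simp
  qed (use op top in auto)
  then show thesis using that by blast
qed

end

section \<open>Word balls in a group\<close>

context group
begin

lemma foldr_mult_closed: "set xs \<subseteq> carrier G \<Longrightarrow> foldr (\<lambda>x y. x \<otimes> y) xs \<one> \<in> carrier G"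
  by (induction xs) auto

lemma foldr_mult_append:
  "set xs \<subseteq> carrier G \<Longrightarrow> set ys \<subseteq> carrier G \<Longrightarrow>
    foldr (\<lambda>x y. x \<otimes> y) (xs @ ys) \<one> = foldr (\<lambda>x y. x \<otimes> y) xs \<one> \<otimes> foldr (\<lambda>x y. x \<otimes> y) ys \<one>"
  using foldr_mult_closed[of ys] by (induction xs) (simp_all add: foldr_mult_closed m_assoc)

lemma products_up_to_closed: "S \<subseteq> carrier G \<Longrightarrow> products_up_to G S l \<subseteq> carrier G"
  unfolding products_up_to_def using foldr_mult_closed by blast

lemma products_up_to_one: "\<one> \<in> products_up_to G S l"
  unfolding products_up_to_def by (auto intro!: exI[of _ "[]"])

lemma products_up_to_mono: "l \<le> m \<Longrightarrow> products_up_to G S l \<subseteq> products_up_to G S m"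
  unfolding products_up_to_def by (auto intro: order_trans)

lemma products_up_to_mult:
  assumes S: "S \<subseteq> carrier G" and x: "x \<in> products_up_to G S l" and y: "y \<in> products_up_to G S m"
  shows "x \<otimes> y \<in> products_up_to G S (l + m)"
proof -
  obtain xs where xs: "x = foldr (\<lambda>x y. x \<otimes> y) xs \<one>" "set xs \<subseteq> S" "length xs \<le> l"
    using x by (auto simp: products_up_to_def)
  obtain ys where ys: "y = foldr (\<lambda>x y. x \<otimes> y) ys \<one>" "set ys \<subseteq> S" "length ys \<le> m"
    using y by (auto simp: products_up_to_def)
  have "x \<otimes> y = foldr (\<lambda>x y. x \<otimes> y) (xs @ ys) \<one>"
    using xs ys S by (subst foldr_mult_append) auto
  then show ?thesis unfolding products_up_to_def using xs ys by (auto intro!: exI[of _ "xs @ ys"])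
qed

lemma products_up_to_generator: "s \<in> S \<Longrightarrow> S \<subseteq> carrier G \<Longrightarrow> s \<in> products_up_to G S (Suc 0)"
  unfolding products_up_to_def by (auto intro!: exI[of _ "[s]"])

lemma products_up_to_inv:
  assumes S: "S \<subseteq> carrier G" "\<And>s. s \<in> S \<Longrightarrow> inv s \<in> S" and x: "x \<in> products_up_to G S l"
  shows "inv x \<in> products_up_to G S l"
proof -
  have *: "inv (foldr (\<lambda>x y. x \<otimes> y) xs \<one>) \<in> products_up_to G S (length xs)" if "set xs \<subseteq> S" for xs
    using that
  proof (induction xs)
    case Nil then show ?case by (simp add: products_up_to_one)
  next
    case (Cons a xs)
    let ?z = "foldr (\<lambda>x y. x \<otimes> y) xs \<one>"
    have a: "a \<in> S" "set xs \<subseteq> S" using Cons(2) by auto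
    have c: "a \<in> carrier G" "?z \<in> carrier G" using a S foldr_mult_closed[of xs] by auto
    have "inv ?z \<otimes> inv a \<in> products_up_to G S (length xs + Suc 0)"
      using Cons(1) a S by (intro products_up_to_mult products_up_to_generator) auto
    then show ?case using c by (simp add: inv_mult_group)
  qed
  obtain xs where xs: "x = foldr (\<lambda>x y. x \<otimes> y) xs \<one>" "set xs \<subseteq> S" "length xs \<le> l"
    using x by (auto simp: products_up_to_def)
  then show ?thesis using *[OF xs(2)] products_up_to_mono[OF xs(3), of S] by auto
qed

lemma products_up_to_finite: assumes "finite S" shows "finite (products_up_to G S l)"
proof -
  have "products_up_to G S l = (\<lambda>xs. foldr (\<lambda>x y. x \<otimes> y) xs \<one>) ` {xs. set xs \<subseteq> S \<and> length xs \<le> l}"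
    by (auto simp: products_up_to_def)
  then show ?thesis using finite_lists_length_le[OF assms] by simp
qed

lemma products_up_to_generate:
  assumes S: "S \<subseteq> carrier G" "\<And>s. s \<in> S \<Longrightarrow> inv s \<in> S" and x: "x \<in> generate G S"
  shows "\<exists>l. x \<in> products_up_to G S l"
  using x
proof (induction rule: generate.induct)
  case one then show ?case using products_up_to_one by blast
next
  case (incl s) then show ?case using products_up_to_generator S(1) by blast
next
  case (inv s) then show ?case using products_up_to_generator S by blast
next
  case (eng x y) then show ?case using products_up_to_mult[OF S(1)] by blast
qed

text \<open>Word metrics of two generating sets differ by a constant factor.\<close>

lemma products_up_to_power:
  assumes T: "T \<subseteq> products_up_to G S k" and S: "S \<subseteq> carrier G"
  shows "products_up_to G T l \<subseteq> products_up_to G S (k * l)"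
proof
  fix x assume "x \<in> products_up_to G T l"
  then obtain xs where xs: "x = foldr (\<lambda>x y. x \<otimes> y) xs \<one>" "set xs \<subseteq> T" "length xs \<le> l"
    by (auto simp: products_up_to_def)
  have "foldr (\<lambda>x y. x \<otimes> y) xs \<one> \<in> products_up_to G S (k * length xs)"
    using xs(2)
  proof (induction xs)
    case Nil then show ?case by (simp add: products_up_to_one)
  next
    case (Cons a xs)
    have "a \<otimes> foldr (\<lambda>x y. x \<otimes> y) xs \<one> \<in> products_up_to G S (k + k * length xs)"
      using Cons T S by (intro products_up_to_mult) auto
    then show ?case by simp
  qed
  then show "x \<in> products_up_to G S (k * l)"
    using xs products_up_to_mono[of "k * length xs" "k * l" S] by auto
qed

lemma finite_subset_products_up_to:
  assumes S: "symmetric_generating_set G S" and K: "finite K" "K \<subseteq> carrier G"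
  obtains l where "l \<ge> 1" "K \<subseteq> products_up_to G S l"
proof -
  have "\<forall>x\<in>K. \<exists>l. x \<in> products_up_to G S l"
    using products_up_to_generate[of S] S K(2) unfolding symmetric_generating_set_def by blast
  then obtain f where f: "\<forall>x\<in>K. x \<in> products_up_to G S (f x)" by (rule bchoice[THEN exE])
  have "K \<subseteq> products_up_to G S (Max (insert 1 (f ` K)))"
  proof
    fix x assume x: "x \<in> K"
    then have "f x \<le> Max (insert 1 (f ` K))" using K(1) by (intro Max_ge) auto
    then show "x \<in> products_up_to G S (Max (insert 1 (f ` K)))" using f x products_up_to_mono by blast
  qed
  moreover have "Max (insert 1 (f ` K)) \<ge> 1" using K(1) by (intro Max_ge) auto
  ultimately show thesis using that by blast
qed

end

section \<open>A star-refined cover, generators and a regular atlas\<close>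

context suspension
begin

definition ball_sheet :: "'e set \<Rightarrow> bool" where
  "ball_sheet W \<longleftrightarrow> (\<exists>B \<kappa>. coord_ball n E W B \<kappa>) \<and> inj_on p W"

lemma ball_sheetD:
  assumes "ball_sheet W"
  shows "openin E W" "W \<subseteq> topspace E" "inj_on p W" "connectedin E W"
  using assms coord_ballD(1,3) path_connectedin_imp_connectedin[OF coord_ball_path_connected]
  unfolding ball_sheet_def by blast+

lemma small_ball_sheet:
  assumes "openin E N" "e \<in> N" obtains W where "ball_sheet W" "e \<in> W" "W \<subseteq> N"
proof -
  obtain W B \<kappa> where "coord_ball n E W B \<kappa>" "e \<in> W" "W \<subseteq> N" "inj_on p W"
    using small_ball[OF assms] by metis
  then show thesis using that[of W] by (auto simp: ball_sheet_def)
qed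

text \<open>Any two members with overlapping projections have to lie in translates of one common sheet \<open>W\<close>. This makes the
  element of \<open>G\<close> relating them unique, and provides the larger chart that regularity of an atlas asks for.\<close>

definition star_cover :: "'e set set \<Rightarrow> bool" where
  "star_cover \<A> \<longleftrightarrow> finite \<A> \<and> (\<forall>A\<in>\<A>. ball_sheet A \<and> A \<noteq> {}) \<and> topspace M \<subseteq> (\<Union>A\<in>\<A>. p ` A) \<and>
     (\<forall>A\<in>\<A>. \<forall>A'\<in>\<A>. p ` A \<inter> p ` A' \<noteq> {} \<longrightarrow> (\<exists>W. ball_sheet W \<and> p ` A \<subseteq> p ` W \<and> p ` A' \<subseteq> p ` W))"

text \<open>Sheets \<open>W\<^sub>N\<close> are chosen over the closures of the members \<open>N\<close> of a finite cover of \<open>M\<close>. A set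
  that contains \<open>x\<close>, lies in the \<open>p W\<^sub>N\<close> with \<open>x\<close> in the closure of \<open>N\<close>, and avoids the other
  closures is small enough: two such sets with a common point \<open>z \<in> N\<close> both lie in \<open>p W\<^sub>N\<close>.\<close>

lemma star_cover_exists: "\<exists>\<A>. star_cover \<A>"
proof -
  have reg: "regular_space M" using compact_Hausdorff_imp_regular_space[OF M_compact M_Hausdorff] .
  have "\<exists>N. openin M N \<and> x \<in> N \<and> (\<exists>W. ball_sheet W \<and> M closure_of N \<subseteq> p ` W)" if x: "x \<in> topspace M" for x
  proof -
    obtain e where e: "e \<in> topspace E" "x = p e" using x p_surj by blast
    obtain W where W: "ball_sheet W" "e \<in> W" using small_ball_sheet[OF openin_topspace e(1)] by metis
    have "closedin M (topspace M - p ` W)" "x \<in> topspace M - (topspace M - p ` W)"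
      using p_open[OF ball_sheetD(1)[OF W(1)]] x e W(2) by auto
    then obtain N where N: "openin M N" "x \<in> N" "disjnt (topspace M - p ` W) (M closure_of N)"
      using reg unfolding regular_space by metis
    then have "M closure_of N \<subseteq> p ` W" using closure_of_subset_topspace[of M N] by (auto simp: disjnt_def)
    then show ?thesis using N W by blast
  qed
  from compact_space_subcover[OF M_compact this] obtain \<N> where N: "finite \<N>"
    "\<And>N. N \<in> \<N> \<Longrightarrow> openin M N" "\<And>N. N \<in> \<N> \<Longrightarrow> \<exists>W. ball_sheet W \<and> M closure_of N \<subseteq> p ` W"
    "topspace M \<subseteq> \<Union>\<N>" by metis
  from N(3) have "\<forall>N\<in>\<N>. \<exists>W. ball_sheet W \<and> M closure_of N \<subseteq> p ` W" by blast
  then obtain W where "\<forall>N\<in>\<N>. ball_sheet (W N) \<and> M closure_of N \<subseteq> p ` W N" by (rule bchoice[THEN exE])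
  then have W: "\<And>N. N \<in> \<N> \<Longrightarrow> ball_sheet (W N)" "\<And>N. N \<in> \<N> \<Longrightarrow> M closure_of N \<subseteq> p ` W N" by blast+
  define good where "good x A \<longleftrightarrow> (\<forall>N\<in>\<N>. (x \<in> M closure_of N \<longrightarrow> p ` A \<subseteq> p ` W N) \<and>
    (x \<notin> M closure_of N \<longrightarrow> p ` A \<inter> M closure_of N = {}))" for x A
  have "\<exists>V. openin M V \<and> x \<in> V \<and> (\<exists>A. V = p ` A \<and> ball_sheet A \<and> A \<noteq> {} \<and> (\<exists>x. good x A))"
    if x: "x \<in> topspace M" for x
  proof -
    obtain e where e: "e \<in> topspace E" "x = p e" using x p_surj by blast
    define T where "T N = (if x \<in> M closure_of N then p ` W N else topspace M - M closure_of N)" for N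
    define Q where "Q = topspace M \<inter> \<Inter>(T ` \<N>)"
    have T: "openin M (T N)" "x \<in> T N" if "N \<in> \<N>" for N
      using that W p_open[OF ball_sheetD(1)] x by (auto simp: T_def)
    have "openin M Q"
    proof (cases "\<N> = {}")
      case False
      then have "openin M (\<Inter>(T ` \<N>))" using N(1) T(1) by (intro openin_Inter) auto
      then show ?thesis unfolding Q_def by blast
    qed (simp add: Q_def)
    then have "openin E {e \<in> topspace E. p e \<in> Q}" by (rule openin_continuous_map_preimage[OF p_cont])
    moreover have "e \<in> {e \<in> topspace E. p e \<in> Q}" using T(2) e x by (auto simp: Q_def)
    ultimately obtain A where A: "ball_sheet A" "e \<in> A" "A \<subseteq> {e \<in> topspace E. p e \<in> Q}"
      by (rule small_ball_sheet)
    have "good x A" unfolding good_def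
    proof (intro ballI conjI impI)
      fix N assume "N \<in> \<N>"
      then have "p ` A \<subseteq> T N" using A(3) by (auto simp: Q_def)
      then show "x \<in> M closure_of N \<Longrightarrow> p ` A \<subseteq> p ` W N"
        "x \<notin> M closure_of N \<Longrightarrow> p ` A \<inter> M closure_of N = {}" by (auto simp: T_def)
    qed
    moreover have "openin M (p ` A)" "x \<in> p ` A" "A \<noteq> {}"
      using p_open[OF ball_sheetD(1)[OF A(1)]] A(2) e by auto
    ultimately show ?thesis using A(1) by blast
  qed
  from compact_space_subcover[OF M_compact this] obtain \<V> where V: "finite \<V>"
    "\<And>V. V \<in> \<V> \<Longrightarrow> \<exists>A. V = p ` A \<and> ball_sheet A \<and> A \<noteq> {} \<and> (\<exists>x. good x A)" "topspace M \<subseteq> \<Union>\<V>" by metis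
  from V(2) have "\<forall>V\<in>\<V>. \<exists>A. V = p ` A \<and> ball_sheet A \<and> A \<noteq> {} \<and> (\<exists>x. good x A)" by blast
  then obtain A where A: "\<forall>V\<in>\<V>. V = p ` A V \<and> ball_sheet (A V) \<and> A V \<noteq> {} \<and> (\<exists>x. good x (A V))"
    by (rule bchoice[THEN exE])
  have AV: "V = p ` A V" "ball_sheet (A V)" "A V \<noteq> {}" "\<exists>x. good x (A V)" if "V \<in> \<V>" for V
    using bspec[OF A that] by auto
  have "star_cover (A ` \<V>)" unfolding star_cover_def
  proof (intro conjI ballI impI)
    show "finite (A ` \<V>)" using V(1) by simp
    show "ball_sheet B" "B \<noteq> {}" if "B \<in> A ` \<V>" for B using AV that by auto
    show "topspace M \<subseteq> (\<Union>A\<in>A ` \<V>. p ` A)"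
    proof
      fix x assume "x \<in> topspace M"
      then obtain V where VV: "V \<in> \<V>" "x \<in> V" using V(3) by blast
      then have "x \<in> p ` A V" using AV(1)[OF VV(1)] by simp
      then show "x \<in> (\<Union>A\<in>A ` \<V>. p ` A)" using VV(1) by blast
    qed
    fix B B' assume B: "B \<in> A ` \<V>" "B' \<in> A ` \<V>" "p ` B \<inter> p ` B' \<noteq> {}"
    obtain x where x1: "good x B" using AV(4) B(1) by (metis imageE)
    obtain x' where x2: "good x' B'" using AV(4) B(2) by (metis imageE)
    note x = x1 x2
    have sh: "ball_sheet B" using AV(2) B(1) by (metis imageE)
    obtain z where z: "z \<in> p ` B" "z \<in> p ` B'" using B(3) by blast
    have "z \<in> topspace M" using z(1) ball_sheetD(2)[OF sh] p_in by blast
    then obtain N0 where N0: "N0 \<in> \<N>" "z \<in> N0" using N(4) by blast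
    have zc: "z \<in> M closure_of N0" using closure_of_subset[of N0 M] openin_subset[OF N(2)[OF N0(1)]] N0(2) by blast
    have "p ` B \<subseteq> p ` W N0" "p ` B' \<subseteq> p ` W N0"
    proof -
      have *: "p ` C \<subseteq> p ` W N0" if "good y C" "z \<in> p ` C" "z \<in> M closure_of N0" for y C
        using that N0(1) unfolding good_def by blast
      show "p ` B \<subseteq> p ` W N0" by (rule *[OF x(1) z(1) zc])
      show "p ` B' \<subseteq> p ` W N0" by (rule *[OF x(2) z(2) zc])
    qed
    then show "\<exists>W. ball_sheet W \<and> p ` B \<subseteq> p ` W \<and> p ` B' \<subseteq> p ` W" using W(1)[OF N0(1)] by blast
  qed
  then show ?thesis by blast
qed

definition \<A> :: "'e set set" where "\<A> = (SOME \<A>. star_cover \<A>)"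

text \<open>The transition elements of the charts over the cover: by these, transverse coordinates of a common point
  of two charts differ.\<close>

definition S :: "'g set" where "S = {a \<in> carrier G. \<exists>A\<in>\<A>. \<exists>A'\<in>\<A>. A \<inter> D a ` A' \<noteq> {}}"

lemma \<A>: "star_cover \<A>" unfolding \<A>_def by (rule someI_ex[OF star_cover_exists])

lemma \<A>_finite: "finite \<A>" and \<A>_sheet: "A \<in> \<A> \<Longrightarrow> ball_sheet A" and \<A>_nonempty: "A \<in> \<A> \<Longrightarrow> A \<noteq> {}"
  and \<A>_cover: "topspace M \<subseteq> (\<Union>A\<in>\<A>. p ` A)"
  and \<A>_star: "A \<in> \<A> \<Longrightarrow> A' \<in> \<A> \<Longrightarrow> p ` A \<inter> p ` A' \<noteq> {} \<Longrightarrow>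
    \<exists>W. ball_sheet W \<and> p ` A \<subseteq> p ` W \<and> p ` A' \<subseteq> p ` W"
  using \<A> unfolding star_cover_def by blast+

lemma \<A>_over:
  assumes "e \<in> topspace E"
  obtains A x a where "A \<in> \<A>" "x \<in> A" "x \<in> topspace E" "a \<in> carrier G" "x = D a e"
proof -
  have "p e \<in> (\<Union>A\<in>\<A>. p ` A)" using subsetD[OF \<A>_cover p_in[OF assms]] .
  then obtain A where A: "A \<in> \<A>" "p e \<in> p ` A" by (rule UN_E)
  obtain x where x: "x \<in> A" "p e = p x" using A(2) by (rule imageE)
  have xE: "x \<in> topspace E" using x(1) ball_sheetD(2)[OF \<A>_sheet[OF A(1)]] by blast
  show thesis using D_transport[OF assms xE x(2)] that A(1) x(1) xE by metis
qed

lemma D_image_open: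
  assumes "a \<in> carrier G" "openin E W" shows "openin E (D a ` W)"
proof -
  have W: "W \<subseteq> topspace E" using assms(2) openin_subset by blast
  have "D a ` W = {e \<in> topspace E. D (inv\<^bsub>G\<^esub> a) e \<in> W}"
  proof (intro equalityI subsetI)
    fix e assume "e \<in> D a ` W"
    then obtain w where "w \<in> W" "e = D a w" by blast
    then show "e \<in> {e \<in> topspace E. D (inv\<^bsub>G\<^esub> a) e \<in> W}" using assms(1) W D_in D_inv by auto
  next
    fix e assume "e \<in> {e \<in> topspace E. D (inv\<^bsub>G\<^esub> a) e \<in> W}"
    then show "e \<in> D a ` W" using D_inv'[OF assms(1), of e] by (metis (mono_tags, lifting) image_eqI mem_Collect_eq)
  qed
  moreover have "openin E {e \<in> topspace E. D (inv\<^bsub>G\<^esub> a) e \<in> W}"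
    using assms by (intro openin_continuous_map_preimage[OF D_cont]) auto
  ultimately show ?thesis by simp
qed

lemma D_image_sheet:
  assumes "a \<in> carrier G" "W \<subseteq> topspace E" "inj_on p W" shows "inj_on p (D a ` W)" "D a ` W \<subseteq> topspace E"
  using assms p_D D_in by (auto simp: inj_on_def subset_iff)

lemma sheet_translates_disjoint:
  assumes "W \<subseteq> topspace E" "inj_on p W" "a \<in> carrier G" "b \<in> carrier G" "D a ` W \<inter> D b ` W \<noteq> {}"
  shows "a = b"
proof -
  obtain w w' where w: "w \<in> W" "w' \<in> W" "D a w = D b w'" using assms(5) by blast
  have wE: "w \<in> topspace E" "w' \<in> topspace E" using w assms(1) by auto
  then have "p w = p w'" using p_D[OF assms(3) wE(1)] p_D[OF assms(4) wE(2)] w(3) by simp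
  then have "w = w'" using w assms(2) by (meson inj_onD)
  then show ?thesis using D_inj[OF assms(3,4) wE(1)] w(3) by simp
qed

text \<open>The translates of a sheet \<open>W\<close> are disjoint open sets that fill the preimage of its projection.\<close>

lemma connected_in_sheet_translate:
  assumes W: "openin E W" "inj_on p W" and C: "connectedin E C" "C \<noteq> {}" "p ` C \<subseteq> p ` W"
  obtains a where "a \<in> carrier G" "C \<subseteq> D a ` W"
proof -
  have WE: "W \<subseteq> topspace E" using W(1) openin_subset by blast
  let ?T = "{e \<in> topspace E. p e \<in> p ` W}"
  have T: "openin E ?T" by (rule openin_continuous_map_preimage[OF p_cont p_open[OF W(1)]])
  have sub: "D a ` W \<subseteq> ?T" if "a \<in> carrier G" for a
    using D_image_sheet(2)[OF that WE W(2)] p_D[OF that] WE by auto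
  have CT: "C \<subseteq> ?T" using C connectedin_subset_topspace by blast
  obtain a where "a \<in> carrier G" "C \<subseteq> D a ` W"
  proof (rule connectedin_in_partition[of "subtopology E ?T" C "carrier G" "\<lambda>a. D a ` W"])
    show "connectedin (subtopology E ?T) C" using C(1) CT by (simp add: connectedin_subtopology)
    show "openin (subtopology E ?T) (D a ` W)" if "a \<in> carrier G" for a
      using D_image_open[OF that W(1)] sub[OF that] T by (simp add: openin_open_subtopology)
    show "topspace (subtopology E ?T) = (\<Union>a\<in>carrier G. D a ` W)"
    proof (intro equalityI subsetI)
      fix e assume "e \<in> topspace (subtopology E ?T)"
      then obtain w where w: "e \<in> topspace E" "w \<in> W" "p w = p e" by auto
      then obtain a where "a \<in> carrier G" "e = D a w" using D_transport[of w e] WE by blast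
      then show "e \<in> (\<Union>a\<in>carrier G. D a ` W)" using w by blast
    next
      fix e assume "e \<in> (\<Union>a\<in>carrier G. D a ` W)"
      then have "e \<in> ?T" using sub by blast
      then show "e \<in> topspace (subtopology E ?T)" by simp
    qed
    show "D a ` W = D b ` W" if "a \<in> carrier G" "b \<in> carrier G" "D a ` W \<inter> D b ` W \<noteq> {}" for a b
      using sheet_translates_disjoint[OF WE W(2) that] by simp
  qed (use C that in auto)
  then show thesis using that by blast
qed

lemma transition_unique:
  assumes A: "A \<in> \<A>" "A' \<in> \<A>" and a: "a \<in> carrier G" "A \<inter> D a ` A' \<noteq> {}" and b: "b \<in> carrier G" "A \<inter> D b ` A' \<noteq> {}"
  shows "a = b"
proof -
  note sA = ball_sheetD[OF \<A>_sheet[OF A(1)]] and sA' = ball_sheetD[OF \<A>_sheet[OF A(2)]]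
  have "p ` D a ` A' = p ` A'" using p_D[OF a(1)] sA'(2) by (force simp: image_image)
  then have "p ` A \<inter> p ` A' \<noteq> {}" using a(2) by blast
  then obtain W where W: "ball_sheet W" "p ` A \<subseteq> p ` W" "p ` A' \<subseteq> p ` W" using \<A>_star[OF A] by blast
  note sW = ball_sheetD[OF W(1)]
  obtain c where c: "c \<in> carrier G" "A \<subseteq> D c ` W"
    using connected_in_sheet_translate[OF sW(1,3) sA(4) \<A>_nonempty[OF A(1)] W(2)] by blast
  obtain d where d: "d \<in> carrier G" "A' \<subseteq> D d ` W"
    using connected_in_sheet_translate[OF sW(1,3) sA'(4) \<A>_nonempty[OF A(2)] W(3)] by blast
  have *: "c = x \<otimes>\<^bsub>G\<^esub> d" if x: "x \<in> carrier G" "A \<inter> D x ` A' \<noteq> {}" for x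
  proof (rule sheet_translates_disjoint[OF sW(2,3) c(1)])
    show "x \<otimes>\<^bsub>G\<^esub> d \<in> carrier G" using x d by simp
    have "D x ` A' \<subseteq> D (x \<otimes>\<^bsub>G\<^esub> d) ` W"
    proof
      fix e assume "e \<in> D x ` A'"
      then obtain w where w: "w \<in> W" "e = D x (D d w)" using d(2) by blast
      then have "e = D (x \<otimes>\<^bsub>G\<^esub> d) w" using D_mult[OF x(1) d(1)] sW(2) by auto
      then show "e \<in> D (x \<otimes>\<^bsub>G\<^esub> d) ` W" using w by blast
    qed
    then show "D c ` W \<inter> D (x \<otimes>\<^bsub>G\<^esub> d) ` W \<noteq> {}" using c(2) x(2) by blast
  qed
  show ?thesis using *[OF a] *[OF b] a(1) b(1) d(1) by simp
qed

text \<open>The sets \<open>D a A\<close> with \<open>a\<close> in the subgroup generated by \<open>S\<close> and those with \<open>a\<close> outside it have disjoint open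
  unions that cover \<open>E\<close>; as \<open>E\<close> is connected, nothing is outside. Finiteness is the uniqueness of transitions.\<close>

lemma S_symmetric_generating: "symmetric_generating_set G S"
  unfolding symmetric_generating_set_def
proof (intro conjI ballI)
  show SG: "S \<subseteq> carrier G" by (auto simp: S_def)
  show "finite S"
  proof -
    have "S \<subseteq> (\<Union>A\<in>\<A>. \<Union>A'\<in>\<A>. {a \<in> carrier G. A \<inter> D a ` A' \<noteq> {}})" by (auto simp: S_def)
    moreover have "finite {a \<in> carrier G. A \<inter> D a ` A' \<noteq> {}}" if "A \<in> \<A>" "A' \<in> \<A>" for A A'
    proof (cases "{a \<in> carrier G. A \<inter> D a ` A' \<noteq> {}} = {}")
      case True
      then show ?thesis by (simp only: finite.emptyI)
    next
      case False
      then obtain a where "a \<in> carrier G" "A \<inter> D a ` A' \<noteq> {}" by blast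
      then have "{a \<in> carrier G. A \<inter> D a ` A' \<noteq> {}} \<subseteq> {a}" using transition_unique[OF that] by blast
      then show ?thesis by (rule finite_subset) simp
    qed
    then have "finite (\<Union>A\<in>\<A>. \<Union>A'\<in>\<A>. {a \<in> carrier G. A \<inter> D a ` A' \<noteq> {}})"
      using \<A>_finite by (intro finite_UN_I) auto
    ultimately show ?thesis by (rule finite_subset)
  qed
  obtain A0 where A0: "A0 \<in> \<A>" using \<A>_over[OF e0] by metis
  have "D \<one>\<^bsub>G\<^esub> ` A0 = A0" using D_one ball_sheetD(2)[OF \<A>_sheet[OF A0]] by (force simp: image_iff)
  then have "A0 \<inter> D \<one>\<^bsub>G\<^esub> ` A0 \<noteq> {}" using \<A>_nonempty[OF A0] by simp
  then show one: "\<one>\<^bsub>G\<^esub> \<in> S" using A0 unfolding S_def by blast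
  show "inv\<^bsub>G\<^esub> s \<in> S" if s: "s \<in> S" for s
  proof -
    obtain A A' where A: "s \<in> carrier G" "A \<in> \<A>" "A' \<in> \<A>" "A \<inter> D s ` A' \<noteq> {}" using s by (auto simp: S_def)
    then obtain x where x: "x \<in> A'" "D s x \<in> A" by blast
    have "x \<in> topspace E" using x(1) ball_sheetD(2)[OF \<A>_sheet[OF A(3)]] by blast
    then have "x = D (inv\<^bsub>G\<^esub> s) (D s x)" using D_inv[OF A(1)] by simp
    then have "A' \<inter> D (inv\<^bsub>G\<^esub> s) ` A \<noteq> {}" using x by blast
    then show ?thesis using A by (auto simp: S_def)
  qed
  let ?H = "generate G S"
  have HG: "?H \<subseteq> carrier G" using G.generate_incl[OF SG] .
  define V where "V K = (\<Union>a\<in>K. \<Union>A\<in>\<A>. D a ` A)" for K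
  have Vo: "openin E (V K)" if "K \<subseteq> carrier G" for K
    unfolding V_def using that D_image_open ball_sheetD(1)[OF \<A>_sheet] by blast
  have top: "topspace E \<subseteq> V ?H \<union> V (carrier G - ?H)"
  proof
    fix e assume e: "e \<in> topspace E"
    obtain A x a where A: "A \<in> \<A>" "x \<in> A" "a \<in> carrier G" "x = D a e" using \<A>_over[OF e] by metis
    then have "inv\<^bsub>G\<^esub> a \<in> carrier G" "e = D (inv\<^bsub>G\<^esub> a) x" using D_inv[OF A(3) e] by auto
    then show "e \<in> V ?H \<union> V (carrier G - ?H)" using A by (auto simp: V_def)
  qed
  have disj: "V ?H \<inter> V (carrier G - ?H) = {}"
  proof (rule ccontr)
    assume "V ?H \<inter> V (carrier G - ?H) \<noteq> {}"
    then obtain z where z: "z \<in> V ?H" "z \<in> V (carrier G - ?H)" by blast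
    obtain a A x where 11: "a \<in> ?H" "A \<in> \<A>" "x \<in> A" "z = D a x" using z(1) unfolding V_def by blast
    obtain b A' x' where 12: "b \<in> carrier G - ?H" "A' \<in> \<A>" "x' \<in> A'" "z = D b x'"
      using z(2) unfolding V_def by blast
    have 1: "a \<in> ?H" "b \<in> carrier G - ?H" "A \<in> \<A>" "A' \<in> \<A>" "x \<in> A" "x' \<in> A'"
      "D a x = D b x'" using 11 12 by auto
    have c: "a \<in> carrier G" "b \<in> carrier G" using 1 HG by auto
    have xE: "x \<in> topspace E" "x' \<in> topspace E"
      using 1 ball_sheetD(2)[OF \<A>_sheet[OF 1(3)]] ball_sheetD(2)[OF \<A>_sheet[OF 1(4)]] by auto
    have "x = D (inv\<^bsub>G\<^esub> a \<otimes>\<^bsub>G\<^esub> b) x'" using D_inv[OF c(1) xE(1)] 1(7) c xE D_mult by simp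
    then have "A \<inter> D (inv\<^bsub>G\<^esub> a \<otimes>\<^bsub>G\<^esub> b) ` A' \<noteq> {}" using 1(5,6) by blast
    then have "inv\<^bsub>G\<^esub> a \<otimes>\<^bsub>G\<^esub> b \<in> S" using 1 c by (auto simp: S_def)
    then have "a \<otimes>\<^bsub>G\<^esub> (inv\<^bsub>G\<^esub> a \<otimes>\<^bsub>G\<^esub> b) \<in> ?H" using generate.eng[OF 1(1) generate.incl] by blast
    moreover have "a \<otimes>\<^bsub>G\<^esub> (inv\<^bsub>G\<^esub> a \<otimes>\<^bsub>G\<^esub> b) = b" using c by (simp flip: G.m_assoc)
    ultimately have "b \<in> ?H" by simp
    then show False using 1(2) by simp
  qed
  have "connected_space E" using path_connected_imp_connected_space[OF E_path_connected] .
  then have "connectedin E (topspace E)" by (simp add: connectedin_topspace)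
  then have "V ?H \<inter> topspace E = {} \<or> V (carrier G - ?H) \<inter> topspace E = {}"
    using Vo[OF HG] Vo[of "carrier G - ?H"] top disj unfolding connectedin by blast
  moreover have "V ?H \<inter> topspace E \<noteq> {}"
  proof -
    obtain x where x: "x \<in> A0" using \<A>_nonempty[OF A0] by blast
    have "D \<one>\<^bsub>G\<^esub> x \<in> V ?H" using A0 x generate.one[of G S] by (auto simp: V_def)
    moreover have "x \<in> topspace E" using x ball_sheetD(2)[OF \<A>_sheet[OF A0]] by blast
    ultimately show ?thesis using D_one[of x] by auto
  qed
  ultimately have emp: "V (carrier G - ?H) \<inter> topspace E = {}" by blast
  show "?H = carrier G"
  proof (rule ccontr)
    assume "?H \<noteq> carrier G"
    then obtain b where b: "b \<in> carrier G - ?H" using HG by blast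
    obtain x where x: "x \<in> A0" using \<A>_nonempty[OF A0] by blast
    have "D b x \<in> V (carrier G - ?H)" using b A0 x by (auto simp: V_def)
    moreover have "D b x \<in> topspace E" using b x D_in ball_sheetD(2)[OF \<A>_sheet[OF A0]] by blast
    ultimately show False using emp by blast
  qed
qed

lemma q_sheet_translate:
  assumes a: "a \<in> carrier G" and A: "A \<subseteq> D a ` W" "W \<subseteq> topspace E" "inj_on p W" and y: "y \<in> topspace F"
  shows "q ` (A \<times> topspace F) \<inter> q ` (W \<times> {h (inv\<^bsub>G\<^esub> a) y}) = q ` (A \<times> {y})"
proof (intro equalityI subsetI)
  fix u assume "u \<in> q ` (A \<times> topspace F) \<inter> q ` (W \<times> {h (inv\<^bsub>G\<^esub> a) y})"
  then have "u \<in> q ` (A \<times> topspace F)" "u \<in> q ` (W \<times> {h (inv\<^bsub>G\<^esub> a) y})" by auto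
  then obtain x z w where u: "u = q (x, z)" "x \<in> A" "z \<in> topspace F" "w \<in> W" "q (x, z) = q (w, h (inv\<^bsub>G\<^esub> a) y)"
    by auto
  have wE: "w \<in> topspace E" using u(4) A(2) by blast
  have "q (w, h (inv\<^bsub>G\<^esub> a) y) = q (D a w, y)"
    using q_action[OF a wE, of "h (inv\<^bsub>G\<^esub> a) y"] h_in[of "inv\<^bsub>G\<^esub> a" y] h_inv'[OF a y] a y by simp
  then have eq: "q (x, z) = q (D a w, y)" using u(5) by simp
  have "inj_on q (D a ` W \<times> topspace F)" using q_inj_sheet D_image_sheet[OF a A(2,3)] by blast
  from inj_onD[OF this eq] have "(x, z) = (D a w, y)" using u A(1) y by blast
  then show "u \<in> q ` (A \<times> {y})" using u by auto
next
  fix u assume "u \<in> q ` (A \<times> {y})"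
  then obtain x where x: "x \<in> A" "u = q (x, y)" by blast
  then obtain w where w: "w \<in> W" "x = D a w" using A(1) by blast
  have wE: "w \<in> topspace E" using w(1) A(2) by blast
  have "u = q (w, h (inv\<^bsub>G\<^esub> a) y)"
    using q_action[OF a wE, of "h (inv\<^bsub>G\<^esub> a) y"] h_in[of "inv\<^bsub>G\<^esub> a" y] h_inv'[OF a y] a y x w by simp
  then show "u \<in> q ` (A \<times> topspace F) \<inter> q ` (W \<times> {h (inv\<^bsub>G\<^esub> a) y})" using w x y by blast
qed

lemma tube_plaque_iff:
  assumes c: "tube_chart c W \<kappa> O' \<sigma>"
  shows "P \<in> plaques c \<longleftrightarrow> (\<exists>y\<in>O'. P = q ` (W \<times> {y}))"
proof
  assume "P \<in> plaques c"
  then obtain s where s: "s \<in> topspace (chart_trans c)" "P = {x \<in> chart_dom c. snd (chart_map c x) = s}"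
    by (auto simp: plaques_def)
  have \<sigma>: "inj_on \<sigma> O'" "topspace (chart_trans c) = \<sigma> ` O'"
    using c openin_subset[of F O'] by (auto simp: tube_chart_def homeomorphic_eq_everything_map Int_absorb1)
  then obtain y where y: "y \<in> O'" "s = \<sigma> y" using s by blast
  have "P = q ` (W \<times> {y})" using c y \<sigma>(1) s(2) by (auto simp: tube_chart_def inj_on_def)
  then show "\<exists>y\<in>O'. P = q ` (W \<times> {y})" using y by blast
qed (use tube_plaque[OF c] in blast)

lemma plaques_disjoint:
  assumes "P \<in> plaques c" "Q \<in> plaques c" "u \<in> P" "u \<in> Q" shows "P = Q"
  using assms by (auto simp: plaques_def)

lemma lamination_chartD:
  assumes "c \<in> \<F>"
  shows "foliated_chart n X c" "openin X (chart_dom c)"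
    "\<And>u. u \<in> chart_dom c \<Longrightarrow> snd (chart_map c u) \<in> topspace (chart_trans c)"
proof -
  show f: "foliated_chart n X c" using assms by (simp add: suspension_lamination_def maximal_atlas_def)
  then show o: "openin X (chart_dom c)" by (simp add: foliated_chart_def)
  have h: "homeomorphic_map (subtopology X (chart_dom c))
       (prod_topology (subtopology (Euclidean_space n) (chart_ball c)) (chart_trans c)) (chart_map c)"
    using f by (simp add: foliated_chart_def)
  fix u assume "u \<in> chart_dom c"
  then have "u \<in> topspace (subtopology X (chart_dom c))" using openin_subset[OF o] by auto
  then have "chart_map c u \<in> topspace (prod_topology (subtopology (Euclidean_space n) (chart_ball c)) (chart_trans c))"
    using homeomorphic_imp_surjective_map[OF h] by blast
  then show "snd (chart_map c u) \<in> topspace (chart_trans c)" by (metis mem_Times_iff topspace_prod_topology)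
qed

lemma plaque_through:
  assumes "c \<in> \<F>" "u \<in> chart_dom c"
  shows "{x \<in> chart_dom c. snd (chart_map c x) = snd (chart_map c u)} \<in> plaques c"
  using lamination_chartD(3)[OF assms] by (auto simp: plaques_def)

lemma subcharts_plaque:
  assumes d: "d \<in> \<F>" and s: "subchart c v" "subchart d v" and P: "P \<in> plaques c" "P \<inter> chart_dom d \<noteq> {}"
  shows "\<exists>!Q. Q \<in> plaques d \<and> P \<inter> chart_dom d \<subseteq> Q"
proof -
  obtain u where u: "u \<in> P" "u \<in> chart_dom d" using P(2) by blast
  define Q where "Q = {x \<in> chart_dom d. snd (chart_map d x) = snd (chart_map d u)}"
  have Q: "Q \<in> plaques d" "u \<in> Q" using plaque_through[OF d u(2)] u by (auto simp: Q_def)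
  have "\<forall>P\<in>plaques c. \<exists>Q\<in>plaques v. P = chart_dom c \<inter> Q" "\<forall>P\<in>plaques d. \<exists>Q\<in>plaques v. P = chart_dom d \<inter> Q"
    using s by (simp_all add: subchart_def)
  note sv = bspec[OF this(1) P(1)] bspec[OF this(2) Q(1)]
  obtain Pv where Pv: "Pv \<in> plaques v" "P = chart_dom c \<inter> Pv" using sv(1) by (rule bexE)
  obtain Qv where Qv: "Qv \<in> plaques v" "Q = chart_dom d \<inter> Qv" using sv(2) by (rule bexE)
  have "u \<in> Pv" "u \<in> Qv" using u(1) Q(2) Pv(2) Qv(2) by (metis IntD2)+
  then have "Pv = Qv" using plaques_disjoint Pv(1) Qv(1) by metis
  then have PQ: "P \<inter> chart_dom d \<subseteq> Q" using Pv(2) Qv(2) by (metis Int_commute Int_mono inf_le2 subset_refl)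
  show ?thesis
  proof (rule ex1I[of _ Q])
    show "Q \<in> plaques d \<and> P \<inter> chart_dom d \<subseteq> Q" using Q(1) PQ by blast
    fix Q' assume "Q' \<in> plaques d \<and> P \<inter> chart_dom d \<subseteq> Q'"
    then have "Q' \<in> plaques d" "u \<in> Q'" using u by auto
    then show "Q' = Q" using plaques_disjoint Q by metis
  qed
qed

text \<open>The tubes over the star-refined cover form a regular atlas: two that meet are subcharts of the tube over
  the sheet that contains both up to translation.\<close>

lemma regular_atlas_exists: "\<exists>\<U>. finite \<U> \<and> regular_atlas n X \<F> \<U>"
proof -
  have "\<forall>A\<in>\<A>. \<exists>c. \<exists>\<kappa> \<sigma>. tube_chart c A \<kappa> (topspace F) \<sigma>"
  proof
    fix A assume "A \<in> \<A>"
    then obtain B \<kappa> where "coord_ball n E A B \<kappa>" "inj_on p A" using \<A>_sheet[of A] by (auto simp: ball_sheet_def)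
    then show "\<exists>c. \<exists>\<kappa> \<sigma>. tube_chart c A \<kappa> (topspace F) \<sigma>" using tube_chart_exists[OF _ _ openin_topspace] by metis
  qed
  then obtain c where c: "\<forall>A\<in>\<A>. \<exists>\<kappa> \<sigma>. tube_chart (c A) A \<kappa> (topspace F) \<sigma>" by (rule bchoice[THEN exE])
  then have dom: "\<And>A. A \<in> \<A> \<Longrightarrow> chart_dom (c A) = q ` (A \<times> topspace F)" by (auto simp: tube_chart_def)
  have cF: "c A \<in> \<F>" if A: "A \<in> \<A>" for A using c A tube_chart_in_lamination by blast
  let ?U = "c ` \<A>"
  have comp: "compatible_charts X (c A) (c A')" if AA: "A \<in> \<A>" "A' \<in> \<A>" for A A'
  proof -
    obtain \<kappa> \<sigma> \<kappa>' \<sigma>' where "tube_chart (c A) A \<kappa> (topspace F) \<sigma>" "tube_chart (c A') A' \<kappa>' (topspace F) \<sigma>'"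
      using bspec[OF c AA(1)] bspec[OF c AA(2)] by metis
    then show ?thesis using tube_chart_change unfolding compatible_charts_def by metis
  qed
  have cover: "(\<Union>c\<in>?U. chart_dom c) = topspace X"
  proof (intro equalityI subsetI)
    fix u assume "u \<in> topspace X"
    then obtain e y where u: "u = q (e, y)" "e \<in> topspace E" "y \<in> topspace F" by (auto simp: topspace_X)
    obtain A x a where A: "A \<in> \<A>" "x \<in> A" and a: "a \<in> carrier G" "x = D a e" using \<A>_over[OF u(2)] by metis
    then have "u = q (x, h a y)" using u q_action by simp
    then have "u \<in> chart_dom (c A)" using dom[OF A(1)] A(2) h_in[OF a(1) u(3)] by blast
    then show "u \<in> (\<Union>c\<in>?U. chart_dom c)" using A(1) by blast
  next
    fix u assume "u \<in> (\<Union>c\<in>?U. chart_dom c)"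
    then show "u \<in> topspace X" using chart_dom_subset cF by blast
  qed
  have sub: "\<exists>v\<in>\<F>. subchart (c A) v \<and> subchart (c A') v"
    if A: "A \<in> \<A>" "A' \<in> \<A>" and meet: "chart_dom (c A) \<inter> chart_dom (c A') \<noteq> {}" for A A'
  proof -
    have sA: "A \<subseteq> topspace E" "A' \<subseteq> topspace E" using ball_sheetD(2)[OF \<A>_sheet] A by auto
    obtain u where "u \<in> q ` (A \<times> topspace F)" "u \<in> q ` (A' \<times> topspace F)" using meet dom A by auto
    then obtain x y x' y' where x: "x \<in> A" "y \<in> topspace F" "x' \<in> A'" "y' \<in> topspace F" "q (x, y) = q (x', y')" by auto
    then obtain a where "a \<in> carrier G" "x' = D a x" using q_eq_iff[of x y x' y'] sA by blast
    then have "p x' = p x" using p_D x sA by blast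
    then have "p ` A \<inter> p ` A' \<noteq> {}" using x by (metis IntI empty_iff imageI)
    then obtain W where W: "ball_sheet W" "p ` A \<subseteq> p ` W" "p ` A' \<subseteq> p ` W" using \<A>_star[OF A] by blast
    note sW = ball_sheetD[OF W(1)]
    obtain B \<kappa> where "coord_ball n E W B \<kappa>" using W(1) by (auto simp: ball_sheet_def)
    then obtain v \<sigma> where v: "tube_chart v W \<kappa> (topspace F) \<sigma>" using tube_chart_exists[OF _ sW(3) openin_topspace] by metis
    have "subchart (c A) v" if A: "A \<in> \<A>" "p ` A \<subseteq> p ` W" for A
    proof -
      obtain a where a: "a \<in> carrier G" "A \<subseteq> D a ` W"
        using connected_in_sheet_translate[OF sW(1,3) ball_sheetD(4)[OF \<A>_sheet[OF A(1)]] \<A>_nonempty[OF A(1)] A(2)] by blast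
      obtain \<kappa>A \<sigma>A where t: "tube_chart (c A) A \<kappa>A (topspace F) \<sigma>A" using c A(1) by blast
      note tr = q_sheet_translate[OF a sW(2,3)]
      have hy: "h (inv\<^bsub>G\<^esub> a) y \<in> topspace F" if "y \<in> topspace F" for y using a h_in that by simp
      have dv: "chart_dom v = q ` (W \<times> topspace F)" using v by (simp add: tube_chart_def)
      show ?thesis unfolding subchart_def
      proof (intro conjI ballI)
        show "chart_dom (c A) \<subseteq> chart_dom v"
        proof
          fix u assume "u \<in> chart_dom (c A)"
          then obtain x y where u: "u = q (x, y)" "x \<in> A" "y \<in> topspace F" using dom[OF A(1)] by auto
          then have "u \<in> q ` (A \<times> {y})" by blast
          then have "u \<in> q ` (W \<times> {h (inv\<^bsub>G\<^esub> a) y})" using tr[OF u(3)] by blast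
          then show "u \<in> chart_dom v" unfolding dv using hy[OF u(3)] by blast
        qed
        fix P assume "P \<in> plaques (c A)"
        then obtain y where y: "y \<in> topspace F" "P = q ` (A \<times> {y})" using tube_plaque_iff[OF t] by blast
        have "P = chart_dom (c A) \<inter> q ` (W \<times> {h (inv\<^bsub>G\<^esub> a) y})" using tr[OF y(1)] y(2) dom[OF A(1)] by simp
        moreover have "q ` (W \<times> {h (inv\<^bsub>G\<^esub> a) y}) \<in> plaques v" using tube_plaque[OF v hy[OF y(1)]] .
        ultimately show "\<exists>Q\<in>plaques v. P = chart_dom (c A) \<inter> Q" by blast
      qed
    qed
    then show ?thesis using A W tube_chart_in_lamination[OF v] by blast
  qed
  have fin: "finite ?U" using \<A>_finite by simp
  have "regular_atlas n X \<F> ?U"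
    unfolding regular_atlas_def foliated_atlas_def locally_finite_atlas_def
  proof (intro conjI ballI impI)
    show "foliated_chart n X d" if "d \<in> ?U" for d using that cF lamination_chartD(1) by blast
    show "compatible_charts X d d'" if "d \<in> ?U" "d' \<in> ?U" for d d' using that comp by blast
    show "?U \<subseteq> \<F>" using cF by blast
    show "\<exists>W. openin X W \<and> x \<in> W \<and> finite {d \<in> ?U. chart_dom d \<inter> W \<noteq> {}}" if "x \<in> topspace X" for x
      using that fin by (intro exI[of _ "topspace X"]) simp
    show "\<exists>v\<in>\<F>. subchart d v \<and> subchart d' v" if "d \<in> ?U" "d' \<in> ?U" "chart_dom d \<inter> chart_dom d' \<noteq> {}" for d d'
      using that sub by blast
    show "\<exists>!Q. Q \<in> plaques d' \<and> P \<inter> chart_dom d' \<subseteq> Q"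
      if d: "d \<in> ?U" "d' \<in> ?U" and P: "P \<in> plaques d" "P \<inter> chart_dom d' \<noteq> {}" for d d' P
    proof -
      have "chart_dom d \<inter> chart_dom d' \<noteq> {}" using P plaque_subset_dom by blast
      then obtain v where "subchart d v" "subchart d' v" using sub d by blast
      moreover have "d' \<in> \<F>" using d cF by blast
      ultimately show ?thesis using subcharts_plaque P by blast
    qed
  qed (rule cover)
  then show ?thesis using fin by blast
qed

end

section \<open>Plaques of a regular atlas are uniformly bounded\<close>

text \<open>In a connected set with a finite open cover, any two members of the cover that meet the set are
  joined by a chain of members whose consecutive terms overlap in the set, of length at most the
  number of members: the set of members reached in \<open>j\<close> steps grows until it is everything.\<close>

lemma connected_cover_chain:
  assumes C: "connectedin X C" and fin: "finite \<N>" and op: "\<And>N. N \<in> \<N> \<Longrightarrow> openin X N" and cov: "C \<subseteq> \<Union>\<N>"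
    and N0: "N0 \<in> \<N>" "C \<inter> N0 \<noteq> {}" "T 0 N0"
    and mono: "\<And>j N. N \<in> \<N> \<Longrightarrow> C \<inter> N \<noteq> {} \<Longrightarrow> T j N \<Longrightarrow> T (Suc j) N"
    and step: "\<And>j N N'. N \<in> \<N> \<Longrightarrow> N' \<in> \<N> \<Longrightarrow> C \<inter> N \<inter> N' \<noteq> {} \<Longrightarrow> T j N \<Longrightarrow> T (Suc j) N'"
    and N: "N \<in> \<N>" "C \<inter> N \<noteq> {}"
  shows "T (card \<N>) N"
proof -
  define All where "All = {N \<in> \<N>. C \<inter> N \<noteq> {}}"
  define R where "R j = {N \<in> All. T j N}" for j
  have R: "R j \<subseteq> All" "R j \<subseteq> R (Suc j)" "finite (R j)" for j
    using fin mono by (auto simp: R_def All_def)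
  have stable: "R j = All" if "R (Suc j) = R j" "R j \<noteq> {}" for j
  proof (rule ccontr)
    assume neq: "R j \<noteq> All"
    let ?U = "\<Union>(R j)" and ?V = "\<Union>(All - R j)"
    have "openin X ?U" "openin X ?V" using R(1) op by (auto simp: All_def)
    moreover have "C \<subseteq> ?U \<union> ?V" using cov by (auto simp: All_def)
    moreover have "?U \<inter> ?V \<inter> C = {}"
    proof (rule ccontr)
      assume "?U \<inter> ?V \<inter> C \<noteq> {}"
      then obtain N1 N2 z where z: "N1 \<in> R j" "N2 \<in> All - R j" "z \<in> N1" "z \<in> N2" "z \<in> C" by blast
      then have "N1 \<in> \<N>" "N2 \<in> \<N>" "T j N1" "C \<inter> N1 \<inter> N2 \<noteq> {}" by (auto simp: R_def All_def)
      then have "T (Suc j) N2" by (intro step)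
      then have "N2 \<in> R (Suc j)" using z(2) by (simp add: R_def)
      then show False using that z(2) by simp
    qed
    ultimately have "?U \<inter> C = {} \<or> ?V \<inter> C = {}" using C unfolding connectedin by blast
    moreover have "?U \<inter> C \<noteq> {}" using that(2) R(1) by (auto simp: All_def)
    moreover have "?V \<inter> C \<noteq> {}"
    proof -
      obtain N1 where N1: "N1 \<in> All - R j" using neq R(1)[of j] by blast
      then have "C \<inter> N1 \<noteq> {}" by (simp add: All_def)
      then show ?thesis using N1 by blast
    qed
    ultimately show False by blast
  qed
  have grow: "R j = All \<or> Suc j \<le> card (R j)" for j
  proof (induction j)
    case 0
    have "N0 \<in> R 0" using N0 by (simp add: R_def All_def)
    then have "card (R 0) > 0" using R(3) by (auto simp: card_gt_0_iff)
    then show ?case by simp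
  next
    case (Suc j)
    show ?case
    proof (cases "R j = All")
      case True
      then have "R (Suc j) = All" using R(1,2) by blast
      then show ?thesis by simp
    next
      case False
      then have c: "Suc j \<le> card (R j)" using Suc by simp
      then have "R j \<noteq> {}" by auto
      then have "R (Suc j) \<noteq> R j" using stable False by blast
      then have "card (R j) < card (R (Suc j))" using R(2,3) by (intro psubset_card_mono) auto
      then show ?thesis using c by simp
    qed
  qed
  have "card (R (card \<N>)) \<le> card \<N>" using fin R(1) by (intro card_mono) (auto simp: All_def)
  then have "R (card \<N>) = All" using grow[of "card \<N>"] by linarith
  then show ?thesis using N by (auto simp: R_def All_def)
qed

context suspension
begin

abbreviation wb :: "nat \<Rightarrow> 'g set" where "wb l \<equiv> products_up_to G S l"

lemma S_subset: "S \<subseteq> carrier G" and S_inv: "s \<in> S \<Longrightarrow> inv\<^bsub>G\<^esub> s \<in> S" and S_finite: "finite S"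
  and S_generates: "generate G S = carrier G"
  using S_symmetric_generating by (auto simp: symmetric_generating_set_def)

lemmas wb_closed = subsetD[OF G.products_up_to_closed[OF S_subset]]
lemmas wb_mono = subsetD[OF G.products_up_to_mono]
lemmas wb_mult = G.products_up_to_mult[OF S_subset]
lemmas wb_one = G.products_up_to_one
lemmas wb_finite = G.products_up_to_finite[OF S_finite]

lemma wb_inv: "s \<in> wb k \<Longrightarrow> inv\<^bsub>G\<^esub> s \<in> wb k"
  by (rule G.products_up_to_inv[OF S_subset S_inv])

text \<open>The points of \<open>X\<close> over \<open>A\<close> are labelled by their coordinates in \<open>F\<close>. A change of the sheet
  \<open>A\<close> acts on labels by a generator, so labels measure distances in the leaves.\<close>

definition label :: "'e set \<Rightarrow> ('e \<times> 'f) set \<Rightarrow> 'f \<Rightarrow> bool" where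
  "label A u y \<longleftrightarrow> A \<in> \<A> \<and> y \<in> topspace F \<and> (\<exists>x\<in>A. u = q (x, y))"

lemma label_exists: assumes "u \<in> topspace X" obtains A y where "label A u y"
proof -
  obtain e y where u: "u = q (e, y)" "e \<in> topspace E" "y \<in> topspace F" using assms by (auto simp: topspace_X)
  obtain A x a where A: "A \<in> \<A>" "x \<in> A" "a \<in> carrier G" "x = D a e" using \<A>_over[OF u(2)] by metis
  have "u = q (x, h a y)" using u A q_action by simp
  then show thesis using that[of A "h a y"] A h_in[OF A(3) u(3)] by (auto simp: label_def)
qed

lemma label_transition:
  assumes "label A u y" "label A' u y'" obtains s where "s \<in> S" "y' = h s y"
proof -
  obtain x where x: "A \<in> \<A>" "y \<in> topspace F" "x \<in> A" "u = q (x, y)" using assms(1) by (auto simp: label_def)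
  obtain x' where x': "A' \<in> \<A>" "y' \<in> topspace F" "x' \<in> A'" "u = q (x', y')" using assms(2) by (auto simp: label_def)
  have E: "x \<in> topspace E" "x' \<in> topspace E"
    using ball_sheetD(2)[OF \<A>_sheet[OF x(1)]] ball_sheetD(2)[OF \<A>_sheet[OF x'(1)]] x(3) x'(3) by auto
  have "q (x, y) = q (x', y')" using x(4) x'(4) by simp
  then obtain a where a: "a \<in> carrier G" "x' = D a x" "y' = h a y"
    using q_eq_iff[OF E(1) x(2) E(2) x'(2)] by metis
  have "x' \<in> A' \<inter> D a ` A" using a x x' by blast
  then have "a \<in> S" unfolding S_def using a(1) x(1) x'(1) by blast
  then show thesis using that a(3) by blast
qed

text \<open>The distance of \<open>u\<close> and \<open>v\<close> in their leaf is at most \<open>k\<close> in the word metric, whichever members of the cover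
  are used to read off the labels.\<close>

definition near :: "nat \<Rightarrow> ('e \<times> 'f) set \<Rightarrow> ('e \<times> 'f) set \<Rightarrow> bool" where
  "near k u v \<longleftrightarrow> (\<forall>A y A' y'. label A u y \<longrightarrow> label A' v y' \<longrightarrow> (\<exists>s\<in>wb k. y' = h s y))"

definition plaque_bound :: "('e \<times> 'f) set fol_chart set \<Rightarrow> nat \<Rightarrow> bool" where
  "plaque_bound \<U> K \<longleftrightarrow> (\<forall>c\<in>\<U>. \<forall>P\<in>plaques c. \<forall>u\<in>P. \<forall>v\<in>P. near K u v)"

lemma near_sym: assumes "near k u v" shows "near k v u"
  unfolding near_def
proof (intro allI impI)
  fix A y A' y' assume a: "label A v y" "label A' u y'"
  then obtain s where s: "s \<in> wb k" "y = h s y'" using assms unfolding near_def by blast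
  have "y' = h (inv\<^bsub>G\<^esub> s) y" using s wb_closed[OF s(1)] a(2) by (simp add: label_def h_inv)
  then show "\<exists>s\<in>wb k. y' = h s y" using wb_inv[OF s(1)] by blast
qed

lemma near_trans:
  assumes v: "v \<in> topspace X" and "near k u v" "near l v w" shows "near (l + k) u w"
  unfolding near_def
proof (intro allI impI)
  fix A y A' y' assume a: "label A u y" "label A' w y'"
  obtain B z where b: "label B v z" using label_exists[OF v] by blast
  obtain s where s: "s \<in> wb k" "z = h s y" using assms(2) a(1) b unfolding near_def by blast
  obtain t where t: "t \<in> wb l" "y' = h t z" using assms(3) a(2) b unfolding near_def by blast
  have "y' = h (t \<otimes>\<^bsub>G\<^esub> s) y"
    using s t wb_closed[OF s(1)] wb_closed[OF t(1)] a(1) by (simp add: label_def h_mult)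
  then show "\<exists>s\<in>wb (l + k). y' = h s y" using wb_mult[OF t(1) s(1)] by blast
qed

lemma near_mono: "near k u v \<Longrightarrow> k \<le> l \<Longrightarrow> near l u v"
  unfolding near_def using wb_mono by meson

lemma plaque_connected:
  assumes c: "c \<in> \<F>" and P: "P \<in> plaques c" shows "connectedin X P" "P \<noteq> {}"
proof -
  obtain s where s: "s \<in> topspace (chart_trans c)" "P = {x \<in> chart_dom c. snd (chart_map c x) = s}"
    using P by (auto simp: plaques_def)
  let ?B = "subtopology (Euclidean_space n) (chart_ball c)"
  have f: "open_ball_of_dim n (chart_ball c)" "openin X (chart_dom c)"
    "homeomorphic_map (subtopology X (chart_dom c)) (prod_topology ?B (chart_trans c)) (chart_map c)"
    using lamination_chartD(1)[OF c] by (auto simp: foliated_chart_def)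
  then obtain g where g: "homeomorphic_maps (subtopology X (chart_dom c)) (prod_topology ?B (chart_trans c)) (chart_map c) g"
    using homeomorphic_map_maps by blast
  have tB: "topspace ?B = chart_ball c" using openin_subset[OF openin_open_ball[OF f(1)]] by auto
  have tX: "topspace (subtopology X (chart_dom c)) = chart_dom c" using openin_subset[OF f(2)] by auto
  have gc: "continuous_map (prod_topology ?B (chart_trans c)) (subtopology X (chart_dom c)) g"
    and cc: "continuous_map (subtopology X (chart_dom c)) (prod_topology ?B (chart_trans c)) (chart_map c)"
    and gi: "\<And>x. x \<in> chart_dom c \<Longrightarrow> g (chart_map c x) = x"
    and ig: "\<And>b t. b \<in> chart_ball c \<Longrightarrow> t \<in> topspace (chart_trans c) \<Longrightarrow> chart_map c (g (b, t)) = (b, t)"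
    using g tB tX by (simp_all add: homeomorphic_maps_def)
  have img: "P = (\<lambda>b. g (b, s)) ` chart_ball c"
  proof (intro equalityI subsetI)
    fix x assume x: "x \<in> P"
    then have x': "x \<in> chart_dom c" "snd (chart_map c x) = s" using s by auto
    then have "chart_map c x \<in> topspace (prod_topology ?B (chart_trans c))"
      using continuous_map_image_subset_topspace[OF cc] tX by blast
    then have "fst (chart_map c x) \<in> chart_ball c" using tB by (metis mem_Times_iff topspace_prod_topology)
    moreover have "x = g (fst (chart_map c x), s)" using gi[OF x'(1)] x'(2) by (metis prod.collapse)
    ultimately show "x \<in> (\<lambda>b. g (b, s)) ` chart_ball c" by blast
  next
    fix x assume "x \<in> (\<lambda>b. g (b, s)) ` chart_ball c"
    then obtain b where b: "b \<in> chart_ball c" "x = g (b, s)" by blast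
    have "(b, s) \<in> topspace (prod_topology ?B (chart_trans c))" using b s tB by simp
    then have "x \<in> chart_dom c" using continuous_map_image_subset_topspace[OF gc] b(2) tX by blast
    moreover have "chart_map c x = (b, s)" using ig[OF b(1) s(1)] b(2) by simp
    ultimately show "x \<in> P" unfolding s(2) by simp
  qed
  have "homeomorphic_map ?B ?B id" by (rule homeomorphic_map_id[THEN iffD2]) simp
  then have "coord_ball n (Euclidean_space n) (chart_ball c) (chart_ball c) id"
    using f(1) openin_open_ball[OF f(1)] by (simp add: coord_ball_def)
  from path_connectedin_imp_connectedin[OF coord_ball_path_connected[OF this]]
  have "connectedin ?B (chart_ball c)" by (simp add: connectedin_subtopology)
  moreover have "continuous_map ?B X (\<lambda>b. g (b, s))"
  proof -
    have "continuous_map ?B (prod_topology ?B (chart_trans c)) (\<lambda>b. (b, s))"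
      using s(1) by (intro continuous_map_pairedI) auto
    from continuous_map_compose[OF this gc] show ?thesis by (simp add: o_def continuous_map_in_subtopology)
  qed
  ultimately show "connectedin X P" unfolding img by (rule connectedin_continuous_map_image[rotated])
  obtain b where "b \<in> chart_ball c" using open_ball_contractible[OF f(1)] by metis
  then show "P \<noteq> {}" unfolding img by blast
qed

text \<open>Around each point of \<open>X\<close> the labels over a sheet are constant on the plaques of one chart \<open>c\<close> of
  the atlas, hence on all its plaques, because a plaque meets \<open>c\<close> in only one plaque of \<open>c\<close>. By
  compactness a plaque takes boundedly many labels; being connected, it has bounded diameter.\<close>

lemma plaques_bounded:
  assumes fin: "finite \<U>" and reg: "regular_atlas n X \<F> \<U>"
  obtains K where "K \<ge> 1" "plaque_bound \<U> K"
proof -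
  have UF: "\<U> \<subseteq> \<F>" and cov: "(\<Union>c\<in>\<U>. chart_dom c) = topspace X"
    using reg by (auto simp: regular_atlas_def foliated_atlas_def)
  have one: "\<exists>Q. Q \<in> plaques d \<and> P \<inter> chart_dom d \<subseteq> Q"
    if "c \<in> \<U>" "d \<in> \<U>" "P \<in> plaques c" "P \<inter> chart_dom d \<noteq> {}" for c d P
  proof -
    have "\<forall>c\<in>\<U>. \<forall>d\<in>\<U>. \<forall>P\<in>plaques c. P \<inter> chart_dom d \<noteq> {} \<longrightarrow> (\<exists>!Q. Q \<in> plaques d \<and> P \<inter> chart_dom d \<subseteq> Q)"
      using reg unfolding regular_atlas_def by (elim conjE) assumption
    then have "\<exists>!Q. Q \<in> plaques d \<and> P \<inter> chart_dom d \<subseteq> Q" using that by metis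
    then show ?thesis by (rule ex1_implies_ex)
  qed
  define good where "good N A \<longleftrightarrow> A \<in> \<A> \<and> (\<forall>c\<in>\<U>. \<forall>P\<in>plaques c. \<exists>y. \<forall>u\<in>P \<inter> N. label A u y)" for N A
  have "\<exists>N. openin X N \<and> u \<in> N \<and> (\<exists>A. good N A)" if u: "u \<in> topspace X" for u
  proof -
    obtain A y where l: "label A u y" using label_exists[OF u] by blast
    then obtain x where x: "A \<in> \<A>" "y \<in> topspace F" "x \<in> A" "u = q (x, y)" by (auto simp: label_def)
    note sA = ball_sheetD[OF \<A>_sheet[OF x(1)]]
    have xE: "x \<in> topspace E" using x(3) sA(2) by blast
    obtain d where d: "d \<in> \<U>" "u \<in> chart_dom d" using cov u by blast
    have dF: "d \<in> \<F>" using d(1) UF by blast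
    have ud: "q (x, y) \<in> chart_dom d" using d(2) x(4) by simp
    obtain A1 O1 where A1: "openin E A1" "x \<in> A1" "openin F O1" "y \<in> O1" "q ` (A1 \<times> O1) \<subseteq> chart_dom d"
      "\<And>x x' z z'. x \<in> A1 \<Longrightarrow> x' \<in> A1 \<Longrightarrow> z \<in> O1 \<Longrightarrow> z' \<in> O1 \<Longrightarrow>
         snd (chart_map d (q (x, z))) = snd (chart_map d (q (x', z'))) \<longleftrightarrow> z = z'"
      using local_product_structure[OF dF xE x(2) ud] by metis
    define N where "N = q ` ((A \<inter> A1) \<times> O1)"
    have No: "openin X N" unfolding N_def using sA(1) A1(1,3) by (intro q_open_Times openin_Int)
    have uN: "u \<in> N" using x A1 by (auto simp: N_def)
    have "good N A" unfolding good_def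
    proof (intro conjI ballI x(1))
      fix c P assume cP: "c \<in> \<U>" "P \<in> plaques c"
      show "\<exists>y. \<forall>u\<in>P \<inter> N. label A u y"
      proof (cases "P \<inter> N = {}")
        case False
        then obtain u1 where u1: "u1 \<in> P" "u1 \<in> N" by blast
        then obtain x1 z1 where x1: "x1 \<in> A" "x1 \<in> A1" "z1 \<in> O1" "u1 = q (x1, z1)" by (auto simp: N_def)
        have Nd: "N \<subseteq> chart_dom d" using A1(5) by (auto simp: N_def)
        then have "P \<inter> chart_dom d \<noteq> {}" using u1 by blast
        then obtain Q where Q: "Q \<in> plaques d" "P \<inter> chart_dom d \<subseteq> Q" using one[OF cP(1) d(1) cP(2)] by blast
        obtain s where s: "Q = {x \<in> chart_dom d. snd (chart_map d x) = s}" using Q(1) by (auto simp: plaques_def)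
        have ON: "O1 \<subseteq> topspace F" using A1(3) openin_subset by blast
        have "label A v z1" if v: "v \<in> P \<inter> N" for v
        proof -
          obtain x2 z2 where x2: "x2 \<in> A" "x2 \<in> A1" "z2 \<in> O1" "v = q (x2, z2)" using v by (auto simp: N_def)
          have "v \<in> Q" "u1 \<in> Q" using v u1 Q(2) Nd by auto
          then have "snd (chart_map d (q (x1, z1))) = snd (chart_map d (q (x2, z2)))" using s x1(4) x2(4) by simp
          then have "z1 = z2" using A1(6)[OF x1(2) x2(2) x1(3) x2(3)] by simp
          then show ?thesis using x2 x(1) ON by (auto simp: label_def)
        qed
        then show ?thesis by blast
      qed blast
    qed
    then show ?thesis using No uN by blast
  qed
  from compact_space_subcover[OF X_compact this] obtain \<N> where N: "finite \<N>" "\<And>N. N \<in> \<N> \<Longrightarrow> openin X N"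
     "\<And>N. N \<in> \<N> \<Longrightarrow> \<exists>A. good N A" "topspace X \<subseteq> \<Union>\<N>" by metis
  from N(3) have "\<forall>N\<in>\<N>. \<exists>A. good N A" by blast
  then obtain A where A: "\<forall>N\<in>\<N>. good N (A N)" by (rule bchoice[THEN exE])
  have "near (card \<N> + 2) u v" if c: "c \<in> \<U>" and P: "P \<in> plaques c" and uv: "u \<in> P" "v \<in> P" for c P u v
    unfolding near_def
  proof (intro allI impI)
    fix Bu yu Bv yv assume lab: "label Bu u yu" "label Bv v yv"
    have cF: "c \<in> \<F>" using c UF by blast
    have PX: "P \<subseteq> topspace X" using plaque_subset_dom[OF P] chart_dom_subset[OF cF] by blast
    have "\<forall>N\<in>\<N>. \<exists>y. \<forall>u\<in>P \<inter> N. label (A N) u y" using A c P unfolding good_def by blast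
    then obtain y where "\<forall>N\<in>\<N>. \<forall>u\<in>P \<inter> N. label (A N) u (y N)" by (rule bchoice[THEN exE])
    then have y: "\<And>N u. N \<in> \<N> \<Longrightarrow> u \<in> P \<Longrightarrow> u \<in> N \<Longrightarrow> label (A N) u (y N)" by blast
    obtain N0 where N0: "N0 \<in> \<N>" "u \<in> N0" using N(4) PX uv(1) by blast
    obtain N1 where N1: "N1 \<in> \<N>" "v \<in> N1" using N(4) PX uv(2) by blast
    have yF: "y N0 \<in> topspace F" using y[OF N0(1) uv(1) N0(2)] by (simp add: label_def)
    define T where "T j N \<longleftrightarrow> (\<exists>s\<in>wb j. y N = h s (y N0))" for j N
    have "T (card \<N>) N1"
    proof (rule connected_cover_chain[OF plaque_connected(1)[OF cF P] N(1,2) _ N0(1) _ _ _ _ N1(1)])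
      show "P \<subseteq> \<Union>\<N>" using N(4) PX by blast
      show "P \<inter> N0 \<noteq> {}" "P \<inter> N1 \<noteq> {}" using uv N0 N1 by auto
      show "T 0 N0" unfolding T_def using wb_one h_one[OF yF] by (intro bexI[of _ "\<one>\<^bsub>G\<^esub>"]) auto
      show "T (Suc j) N" if "T j N" for j N using that wb_mono[of j "Suc j"] unfolding T_def by fastforce
      show "T (Suc j) N'" if st: "N \<in> \<N>" "N' \<in> \<N>" "P \<inter> N \<inter> N' \<noteq> {}" "T j N" for j N N'
      proof -
        obtain w where w: "w \<in> P" "w \<in> N" "w \<in> N'" using st(3) by blast
        obtain s where s: "s \<in> S" "y N' = h s (y N)"
          using label_transition[OF y[OF st(1) w(1,2)] y[OF st(2) w(1,3)]] by blast
        obtain t where t: "t \<in> wb j" "y N = h t (y N0)" using st(4) by (auto simp: T_def)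
        have "y N' = h (s \<otimes>\<^bsub>G\<^esub> t) (y N0)"
          using s t S_subset wb_closed[OF t(1)] yF by (simp add: h_mult subset_iff)
        moreover have "s \<otimes>\<^bsub>G\<^esub> t \<in> wb (Suc 0 + j)"
          using wb_mult[OF G.products_up_to_generator[OF s(1) S_subset] t(1)] .
        ultimately show ?thesis unfolding T_def by auto
      qed
    qed
    then obtain t where t: "t \<in> wb (card \<N>)" "y N1 = h t (y N0)" by (auto simp: T_def)
    obtain s0 where s0: "s0 \<in> S" "y N0 = h s0 yu" using label_transition[OF lab(1) y[OF N0(1) uv(1) N0(2)]] by blast
    obtain s1 where s1: "s1 \<in> S" "yv = h s1 (y N1)" using label_transition[OF y[OF N1(1) uv(2) N1(2)] lab(2)] by blast
    have cl: "s0 \<in> carrier G" "s1 \<in> carrier G" "t \<in> carrier G" "yu \<in> topspace F"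
      using s0(1) s1(1) S_subset wb_closed[OF t(1)] lab(1) by (auto simp: label_def)
    have "yv = h (s1 \<otimes>\<^bsub>G\<^esub> (t \<otimes>\<^bsub>G\<^esub> s0)) yu" using s0 s1 t cl by (simp add: h_mult h_in)
    moreover have "s1 \<otimes>\<^bsub>G\<^esub> (t \<otimes>\<^bsub>G\<^esub> s0) \<in> wb (Suc 0 + (card \<N> + Suc 0))"
      using s0(1) s1(1) t(1) by (intro wb_mult G.products_up_to_generator[OF _ S_subset])
    ultimately show "\<exists>s\<in>wb (card \<N> + 2). yv = h s yu" by (auto simp: numeral_2_eq_2)
  qed
  then show thesis using that[of "card \<N> + 2"] unfolding plaque_bound_def by simp
qed

lemma plaque_chain_near:
  assumes UF: "\<U> \<subseteq> \<F>"
    and K: "plaque_bound \<U> K"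
    and "plaque_chain \<U> Ps" "Ps \<noteq> []" "u \<in> hd Ps" "v \<in> \<Union>(set Ps)"
  shows "near (K * length Ps) u v"
  using assms(3-6)
proof (induction Ps arbitrary: u)
  case (Cons P Ps)
  obtain c where c: "c \<in> \<U>" "P \<in> plaques c" using Cons.prems(1) by (auto simp: plaque_chain_def)
  have PX: "P \<subseteq> topspace X" using plaque_subset_dom[OF c(2)] chart_dom_subset c(1) UF by blast
  show ?case
  proof (cases "v \<in> P")
    case True
    then have "near K u v" using K c Cons.prems(3) True unfolding plaque_bound_def by auto
    then show ?thesis by (rule near_mono) simp
  next
    case False
    then have v: "v \<in> \<Union>(set Ps)" "Ps \<noteq> []" using Cons.prems(4) by auto
    have "P \<inter> hd Ps \<noteq> {}"
      using Cons.prems(1) v(2) unfolding plaque_chain_def by (cases Ps) (auto elim!: allE[of _ 0])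
    then obtain w where w: "w \<in> P" "w \<in> hd Ps" by blast
    have ch: "plaque_chain \<U> Ps"
      using Cons.prems(1) unfolding plaque_chain_def by (auto elim!: allE[of _ "Suc _"])
    have "near (K * length Ps) w v" by (rule Cons.IH[OF ch v(2) w(2) v(1)])
    moreover have "near K u w" using K c Cons.prems(3) w(1) unfolding plaque_bound_def by auto
    ultimately have "near (K * length Ps + K) u v" using near_trans w(1) PX by blast
    then show ?thesis by (simp add: add.commute)
  qed
qed simp

text \<open>The path is covered by a chain of plaques, but its end points may lie in any two of them; both are
  compared with a point of the first plaque, whence the factor 2.\<close>

lemma short_path_near:
  assumes UF: "\<U> \<subseteq> \<F>"
    and K: "plaque_bound \<U> K"
    and len: "leaf_path_length \<U> \<gamma> \<le> enat m"
  shows "near (2 * K * m) (\<gamma> 0) (\<gamma> 1)" "\<gamma> 1 \<in> topspace X"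
proof -
  have "\<exists>Ps. plaque_chain \<U> Ps \<and> \<gamma> ` {0..1} \<subseteq> \<Union>(set Ps) \<and> length Ps + 1 \<le> m"
  proof (rule ccontr)
    assume no: "\<not> ?thesis"
    have "enat (Suc m) \<le> leaf_path_length \<U> \<gamma>"
      unfolding leaf_path_length_def
    proof (rule INF_greatest)
      fix Ps assume "Ps \<in> {Ps. plaque_chain \<U> Ps \<and> \<gamma> ` {0..1} \<subseteq> \<Union>(set Ps)}"
      then have "\<not> length Ps + 1 \<le> m" using no by blast
      then show "enat (Suc m) \<le> enat (length Ps + 1)" by simp
    qed
    then have "enat (Suc m) \<le> enat m" using len by (rule order_trans)
    then show False by simp
  qed
  then obtain Ps where Ps: "plaque_chain \<U> Ps" "\<gamma> ` {0..1} \<subseteq> \<Union>(set Ps)" "length Ps + 1 \<le> m" by blast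
  have "\<gamma> 0 \<in> \<gamma> ` {0..1}" "\<gamma> 1 \<in> \<gamma> ` {0..1}" by simp_all
  then have g: "\<gamma> 0 \<in> \<Union>(set Ps)" "\<gamma> 1 \<in> \<Union>(set Ps)" using Ps(2) by blast+
  then have ne: "Ps \<noteq> []" by auto
  have plq: "\<exists>c\<in>\<U>. P \<in> plaques c" if "P \<in> set Ps" for P using Ps(1) that by (auto simp: plaque_chain_def)
  have sX: "P \<subseteq> topspace X" if "P \<in> set Ps" for P
    using plq[OF that] plaque_subset_dom chart_dom_subset UF by blast
  show "\<gamma> 1 \<in> topspace X" using g(2) sX by blast
  obtain c where c: "c \<in> \<U>" "hd Ps \<in> plaques c" using plq[of "hd Ps"] ne by auto
  then obtain u0 where u0: "u0 \<in> hd Ps" using plaque_connected(2) UF by blast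
  have "u0 \<in> topspace X" using u0 sX[of "hd Ps"] ne by auto
  from near_trans[OF this near_sym[OF plaque_chain_near[OF UF K Ps(1) ne u0 g(1)]]
        plaque_chain_near[OF UF K Ps(1) ne u0 g(2)]]
  have "near (K * length Ps + K * length Ps) (\<gamma> 0) (\<gamma> 1)" .
  moreover have "K * length Ps + K * length Ps \<le> 2 * K * m"
  proof -
    have "2 * K * length Ps \<le> 2 * K * m" using Ps(3) by (intro mult_le_mono2) simp
    then show ?thesis by (simp only: mult_2 distrib_right)
  qed
  ultimately show "near (2 * K * m) (\<gamma> 0) (\<gamma> 1)" by (rule near_mono)
qed

end

section \<open>The lower bound\<close>

text \<open>Sets that cover each point of \<open>C\<close> at most \<open>N\<close> times: compare the integrals of the indicator functions.\<close>

lemma emeasure_le_bounded_multiplicity: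
  assumes I: "finite I" and B: "\<And>i. i \<in> I \<Longrightarrow> B i \<in> sets M" "\<And>i. i \<in> I \<Longrightarrow> B i \<subseteq> C" and C: "C \<in> sets M"
    and N: "\<And>z. z \<in> C \<Longrightarrow> card {i \<in> I. z \<in> B i} \<le> N"
  shows "(\<Sum>i\<in>I. emeasure M (B i)) \<le> of_nat N * emeasure M C"
proof -
  have "(\<Sum>i\<in>I. emeasure M (B i)) = (\<Sum>i\<in>I. \<integral>\<^sup>+z. indicator (B i) z \<partial>M)" using B(1) by simp
  also have "\<dots> = (\<integral>\<^sup>+z. (\<Sum>i\<in>I. indicator (B i) z) \<partial>M)" using B(1) by (subst nn_integral_sum) auto
  also have "\<dots> \<le> (\<integral>\<^sup>+z. of_nat N * indicator C z \<partial>M)"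
  proof (rule nn_integral_mono)
    fix z
    show "(\<Sum>i\<in>I. indicator (B i) z) \<le> (of_nat N * indicator C z :: ennreal)"
    proof (cases "z \<in> C")
      case True
      have "(\<Sum>i\<in>I. indicator (B i) z) = (of_nat (card {i \<in> I. z \<in> B i}) :: ennreal)"
        using I by (simp add: indicator_def sum.If_cases Int_def)
      also have "\<dots> \<le> of_nat N" using N[OF True] by (simp only: of_nat_le_iff)
      finally show ?thesis using True by simp
    next
      case False
      then have "\<And>i. i \<in> I \<Longrightarrow> z \<notin> B i" using B(2) by blast
      then show ?thesis by (simp add: indicator_def)
    qed
  qed
  also have "\<dots> = of_nat N * emeasure M C" using C by (simp add: nn_integral_cmult_indicator)
  finally show ?thesis .
qed

lemma space_borel_of: "space (borel_of T) = topspace T"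
  unfolding borel_of_def using openin_subset by (intro space_measure_of) blast

lemma sets_borel_of: "sets (borel_of T) = sigma_sets (topspace T) {U. openin T U}"
  unfolding borel_of_def using openin_subset by (intro sets_measure_of) blast

lemma borel_of_open: "openin T U \<Longrightarrow> U \<in> sets (borel_of T)"
  unfolding sets_borel_of by (rule sigma_sets.Basic) simp

lemma measurable_into_borel_of:
  assumes "\<And>x. x \<in> space N \<Longrightarrow> f x \<in> topspace T" "\<And>U. openin T U \<Longrightarrow> f -` U \<inter> space N \<in> sets N"
  shows "f \<in> measurable N (borel_of T)"
  unfolding borel_of_def
proof (rule measurable_measure_of)
  show "{U. openin T U} \<subseteq> Pow (topspace T)" using openin_subset by blast
  show "f \<in> space N \<rightarrow> topspace T" using assms(1) by blast
qed (use assms(2) in auto)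

text \<open>In a second countable Hausdorff space, two different points are separated by two members of a countable
  base, so that the set where two measurable functions differ is a countable union of measurable sets.\<close>

lemma sets_coincidence:
  assumes F: "Hausdorff_space F" "second_countable F" and L: "sets L = sets (borel_of F)"
    and f: "f \<in> measurable N L" "g \<in> measurable N L"
  shows "{y \<in> space N. f y = g y} \<in> sets N"
proof -
  obtain \<B> where B: "countable \<B>" "\<And>V. V \<in> \<B> \<Longrightarrow> openin F V"
      "\<And>U x. openin F U \<Longrightarrow> x \<in> U \<Longrightarrow> \<exists>V\<in>\<B>. x \<in> V \<and> V \<subseteq> U"
    using F(2) unfolding second_countable_def by metis
  define J where "J = {(V, V') \<in> \<B> \<times> \<B>. V \<inter> V' = {}}"
  have sp: "space L = topspace F" using sets_eq_imp_space_eq[OF L] space_borel_of by metis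
  have cJ: "countable J"
    by (rule countable_subset[of J "\<B> \<times> \<B>"]) (use B(1) in \<open>auto simp: J_def\<close>)
  have "(f -` fst j \<inter> space N) \<inter> (g -` snd j \<inter> space N) \<in> sets N" if "j \<in> J" for j
  proof -
    have "fst j \<in> sets L" "snd j \<in> sets L" using that borel_of_open[OF B(2)] L by (auto simp: J_def)
    then show ?thesis using sets.Int[OF measurable_sets[OF f(1)] measurable_sets[OF f(2)]] by blast
  qed
  then have "(\<Union>j\<in>J. (f -` fst j \<inter> space N) \<inter> (g -` snd j \<inter> space N)) \<in> sets N"
    using cJ by (intro sets.countable_UN') auto
  moreover have "(\<Union>j\<in>J. (f -` fst j \<inter> space N) \<inter> (g -` snd j \<inter> space N)) = {y \<in> space N. f y \<noteq> g y}"
  proof (intro equalityI subsetI)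
    fix y assume "y \<in> {y \<in> space N. f y \<noteq> g y}"
    then have y: "y \<in> space N" "f y \<noteq> g y" by auto
    have "f y \<in> topspace F" "g y \<in> topspace F"
      using measurable_space[OF f(1) y(1)] measurable_space[OF f(2) y(1)] sp by auto
    then obtain U U' where U: "openin F U" "openin F U'" "f y \<in> U" "g y \<in> U'" "disjnt U U'"
      using F(1) y(2) unfolding Hausdorff_space_def by metis
    obtain V where V: "V \<in> \<B>" "f y \<in> V" "V \<subseteq> U" using B(3)[OF U(1,3)] by blast
    obtain V' where V': "V' \<in> \<B>" "g y \<in> V'" "V' \<subseteq> U'" using B(3)[OF U(2,4)] by blast
    have "(V, V') \<in> J" using V V' U(5) by (auto simp: J_def disjnt_def)
    then show "y \<in> (\<Union>j\<in>J. (f -` fst j \<inter> space N) \<inter> (g -` snd j \<inter> space N))" using V V' y(1) by force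
  qed (auto simp: J_def)
  ultimately have "space N - {y \<in> space N. f y \<noteq> g y} \<in> sets N" by auto
  moreover have "space N - {y \<in> space N. f y \<noteq> g y} = {y \<in> space N. f y = g y}" by auto
  ultimately show ?thesis by simp
qed

locale measured_suspension = suspension n M E p F G D h e0
  for n and M :: "'a topology" and E :: "'e topology" and p :: "'e \<Rightarrow> 'a" and F :: "'f topology"
    and G :: "('g, 'z) monoid_scheme" and D :: "'g \<Rightarrow> 'e \<Rightarrow> 'e" and h :: "'g \<Rightarrow> 'f \<Rightarrow> 'f" and e0 :: 'e +
  fixes \<Lambda> :: "'f measure"
  assumes sets_\<Lambda>: "sets \<Lambda> = sets (borel_of F)" and prob_\<Lambda>: "prob_space \<Lambda>" and regular_\<Lambda>: "regular_measure F \<Lambda>"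
    and invariant: "\<And>a B. a \<in> carrier G \<Longrightarrow> B \<in> sets \<Lambda> \<Longrightarrow> h a ` B \<in> sets \<Lambda> \<and> emeasure \<Lambda> (h a ` B) = emeasure \<Lambda> B"
begin

abbreviation \<mu> :: "('e \<times> 'f) set set \<Rightarrow> ennreal" where "\<mu> \<equiv> suspension_measure n G D h E p F e0 \<Lambda>"

lemma space_\<Lambda>: "space \<Lambda> = topspace F"
  using sets_eq_imp_space_eq[OF sets_\<Lambda>] space_borel_of by metis

lemma open_\<Lambda>: "openin F U \<Longrightarrow> U \<in> sets \<Lambda>" using sets_\<Lambda> borel_of_open by blast

lemma h_measurable: "a \<in> carrier G \<Longrightarrow> h a \<in> measurable \<Lambda> \<Lambda>"
proof -
  assume a: "a \<in> carrier G"
  have "h a -` U \<inter> space \<Lambda> \<in> sets \<Lambda>" if "openin F U" for U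
  proof -
    have "h a -` U \<inter> space \<Lambda> = {y \<in> topspace F. h a y \<in> U}" by (auto simp: space_\<Lambda>)
    then show ?thesis using openin_continuous_map_preimage[OF h_cont[OF a] that] open_\<Lambda> by simp
  qed
  then have "h a \<in> measurable \<Lambda> (borel_of F)"
    using h_in[OF a] by (intro measurable_into_borel_of) (auto simp: space_\<Lambda>)
  then show ?thesis using sets_\<Lambda> measurable_cong_sets by blast
qed

text \<open>A contraction of length at most \<open>m\<close> identifies at most \<open>#S\<^sub>2\<^sub>K\<^sub>m\<close> points of the fibre over the base
  point, so it cannot shrink the measure of the part of the fibre in \<open>U\<close> by more than that factor.\<close>

lemma contraction_measure_bound:
  assumes UF: "\<U> \<subseteq> \<F>" and K: "plaque_bound \<U> K" and U: "openin X U"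
    and H: "tangential_contraction X \<F> U H" and len: "deformation_length \<U> U H \<le> enat m"
  shows "emeasure \<Lambda> {y \<in> topspace F. q (e0, y) \<in> U} \<le> of_nat (card (wb (2 * K * m))) * \<mu> (H ` (U \<times> {1}))"
proof -
  define N where "N = card (wb (2 * K * m))"
  have Npos: "N > 0" unfolding N_def using wb_one wb_finite by (auto simp: card_gt_0_iff)
  define A where "A = {y \<in> topspace F. q (e0, y) \<in> U}"
  define r where "r y = H (q (e0, y), 1)" for y
  define \<iota> where "\<iota> y = q (e0, y)" for y
  have \<iota>c: "continuous_map F X \<iota>"
  proof -
    have "continuous_map F EF (\<lambda>y. (e0, y))" using e0 by (intro continuous_map_pairedI) auto
    from continuous_map_compose[OF this q_cont] show ?thesis by (simp add: o_def \<iota>_def[abs_def])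
  qed
  have Ao: "openin F A" unfolding A_def using openin_continuous_map_preimage[OF \<iota>c U] by (simp add: \<iota>_def)
  have AF: "A \<subseteq> topspace F" by (auto simp: A_def)
  have H0: "H (u, 0) = u" if "u \<in> U" for u
    using H that by (auto simp: tangential_contraction_def tangential_deformation_def)
  have rc: "continuous_map (subtopology F A) X r"
  proof -
    have Hc: "continuous_map (prod_topology (subtopology X U) euclideanreal) X H"
      using H by (simp add: tangential_contraction_def tangential_deformation_def)
    have "continuous_map (subtopology F A) (subtopology X U) \<iota>"
      using continuous_map_from_subtopology[OF \<iota>c] by (auto simp: continuous_map_in_subtopology A_def \<iota>_def)
    then have "continuous_map (subtopology F A) (prod_topology (subtopology X U) euclideanreal) (\<lambda>y. (\<iota> y, 1))"
      by (intro continuous_map_pairedI) auto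
    from continuous_map_compose[OF this Hc] show ?thesis by (simp add: o_def \<iota>_def r_def[abs_def])
  qed
  have near: "near (2 * K * m) (\<iota> y) (r y)" "r y \<in> topspace X" if y: "y \<in> A" for y
  proof -
    have yU: "\<iota> y \<in> U" using y by (simp add: A_def \<iota>_def)
    have "leaf_path_length \<U> (\<lambda>t. H (\<iota> y, t)) \<le> deformation_length \<U> U H"
      unfolding deformation_length_def by (rule SUP_upper[OF yU])
    then have l: "leaf_path_length \<U> (\<lambda>t. H (\<iota> y, t)) \<le> enat m" using len by (rule order_trans)
    show "near (2 * K * m) (\<iota> y) (r y)" "r y \<in> topspace X"
      using short_path_near[OF UF K l] H0[OF yU] by (simp_all add: r_def \<iota>_def)
  qed
  obtain A0 x0 a0 where A0: "A0 \<in> \<A>" "x0 \<in> A0" "a0 \<in> carrier G" "x0 = D a0 e0" using \<A>_over[OF e0] by metis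
  have lab: "label A0 (\<iota> y) (h a0 y)" if "y \<in> topspace F" for y
  proof -
    have "\<iota> y = q (x0, h a0 y)" using A0 q_action[OF A0(3) e0 that] by (simp add: \<iota>_def)
    then show ?thesis using A0 h_in[OF A0(3) that] by (auto simp: label_def)
  qed
  \<comment> \<open>The points of \<open>A\<close> that \<open>r\<close> sends to \<open>t\<close> are obtained from the label of \<open>t\<close> by short words.\<close>
  have fib: "\<exists>s\<in>wb (2 * K * m). yt = h (s \<otimes>\<^bsub>G\<^esub> a0) y" if yA: "y \<in> A" and yt: "label At (r y) yt" for y At yt
  proof -
    have yF: "y \<in> topspace F" using yA AF by blast
    obtain s where s: "s \<in> wb (2 * K * m)" "yt = h s (h a0 y)"
      using near(1)[OF yA] lab[OF yF] yt unfolding near_def by metis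
    then have "yt = h (s \<otimes>\<^bsub>G\<^esub> a0) y" using h_mult[OF wb_closed[OF s(1)] A0(3) yF] by simp
    then show ?thesis using s(1) by blast
  qed
  \<comment> \<open>Labels that differ by an element of \<open>G\<close> belong to the same leaf.\<close>
  have leafr: "r y \<in> leaf y" if y: "y \<in> A" for y
  proof -
    have yF: "y \<in> topspace F" using y AF by blast
    obtain At yt where l: "label At (r y) yt" using label_exists[OF near(2)[OF y]] by blast
    obtain s where s: "s \<in> wb (2 * K * m)" "yt = h (s \<otimes>\<^bsub>G\<^esub> a0) y" using fib[OF y l] by blast
    have sc: "s \<otimes>\<^bsub>G\<^esub> a0 \<in> carrier G" using wb_closed[OF s(1)] A0(3) by simp
    obtain x where x: "At \<in> \<A>" "x \<in> At" "r y = q (x, yt)" using l by (auto simp: label_def)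
    have xE: "x \<in> topspace E" using x ball_sheetD(2)[OF \<A>_sheet[OF x(1)]] by blast
    let ?g = "inv\<^bsub>G\<^esub> (s \<otimes>\<^bsub>G\<^esub> a0)"
    have "q (D ?g x, h ?g yt) = q (x, yt)" using q_action[of ?g x yt] sc xE s(2) h_in[OF sc yF] by simp
    then have "r y = q (D ?g x, y)" using x(3) s(2) h_inv[OF sc yF] by simp
    then show ?thesis using D_in[of ?g x] sc xE by (auto simp: leaf_def)
  qed
  have countable_G: "carrier G = (\<Union>l. wb l)"
  proof (intro equalityI subsetI)
    fix x assume "x \<in> carrier G"
    then have "x \<in> generate G S" using S_generates by simp
    from G.products_up_to_generate[OF S_subset S_inv this] show "x \<in> (\<Union>l. wb l)" by blast
  next
    fix x assume "x \<in> (\<Union>l. wb l)"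
    then obtain l where "x \<in> wb l" by blast
    then show "x \<in> carrier G" by (rule wb_closed)
  qed
  \<comment> \<open>A piece \<open>P i\<close> of the image is identified by \<open>f i\<close> with a part of \<open>F\<close>; then \<open>f i (r y)\<close> and \<open>y\<close> are in one orbit of \<open>h\<close>.\<close>
  have main: "emeasure \<Lambda> A \<le> of_nat N * (\<Sum>i. emeasure \<Lambda> (f i ` P i))"
    if dec: "leafwise_decomposition X \<F> \<iota> \<Lambda> (H ` (U \<times> {1})) P f" for P f
  proof -
    have P: "disjoint_family P" "(\<Union>i. P i) = H ` (U \<times> {1})" "\<And>i. P i \<in> sets (borel_of X)"
      "\<And>i. f i \<in> measurable (restrict_space (borel_of X) (P i)) \<Lambda>" "\<And>i. inj_on (f i) (P i)"
      "\<And>i. f i ` P i \<in> sets \<Lambda>" "\<And>i x. x \<in> P i \<Longrightarrow> \<exists>L\<in>leaves \<F>. x \<in> L \<and> \<iota> (f i x) \<in> L"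
      using dec by (auto simp: leafwise_decomposition_def)
    define B where "B i = {y \<in> A. r y \<in> P i}" for i
    have rm: "r \<in> measurable (restrict_space \<Lambda> A) (borel_of X)"
    proof (rule measurable_into_borel_of)
      have sA: "space (restrict_space \<Lambda> A) = A" using AF by (auto simp: space_restrict_space space_\<Lambda>)
      show "r y \<in> topspace X" if "y \<in> space (restrict_space \<Lambda> A)" for y using that near(2) sA by simp
      fix V assume "openin X V"
      from openin_continuous_map_preimage[OF rc this]
      have "openin (subtopology F A) {y \<in> topspace (subtopology F A). r y \<in> V}" .
      moreover have "{y \<in> topspace (subtopology F A). r y \<in> V} = r -` V \<inter> A" using AF by auto
      ultimately have "openin F (r -` V \<inter> A)" using openin_open_subtopology[OF Ao] by auto
      then show "r -` V \<inter> space (restrict_space \<Lambda> A) \<in> sets (restrict_space \<Lambda> A)"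
        using open_\<Lambda> open_\<Lambda>[OF Ao] AF unfolding sA by (subst sets_restrict_space_iff) (auto simp: space_\<Lambda> Int_absorb2)
    qed
    have Bm: "B i \<in> sets \<Lambda>" for i
    proof -
      have "r -` P i \<inter> space (restrict_space \<Lambda> A) \<in> sets (restrict_space \<Lambda> A)" by (rule measurable_sets[OF rm P(3)])
      moreover have "r -` P i \<inter> space (restrict_space \<Lambda> A) = B i"
        using AF by (auto simp: B_def space_restrict_space space_\<Lambda>)
      ultimately show ?thesis using open_\<Lambda>[OF Ao] AF by (auto simp: sets_restrict_space_iff space_\<Lambda> Int_absorb2)
    qed
    have BF: "B i \<subseteq> topspace F" for i using AF by (auto simp: B_def)
    have fr: "(\<lambda>y. f i (r y)) \<in> measurable (restrict_space \<Lambda> (B i)) \<Lambda>" for i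
    proof -
      have "r \<in> measurable (restrict_space \<Lambda> (B i)) (borel_of X)"
      proof -
        have "restrict_space (restrict_space \<Lambda> A) (B i) = restrict_space \<Lambda> (B i)"
        proof -
          have "A \<inter> space \<Lambda> = A" "B i \<inter> space \<Lambda> = B i" "A \<inter> B i = B i"
            using AF BF[of i] by (auto simp: space_\<Lambda> B_def)
          then show ?thesis using restrict_restrict_space[of A \<Lambda> "B i"] open_\<Lambda>[OF Ao] Bm[of i] by simp
        qed
        then show ?thesis using measurable_restrict_space1[OF rm, of "B i"] by simp
      qed
      then have "r \<in> measurable (restrict_space \<Lambda> (B i)) (restrict_space (borel_of X) (P i))"
        by (rule measurable_restrict_space2[rotated]) (auto simp: space_restrict_space B_def)
      from measurable_compose[OF this P(4)] show ?thesis .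
    qed
    \<comment> \<open>On \<open>C i g\<close>, the map to the transversal is the measure preserving homeomorphism \<open>h g\<close>.\<close>
    define C where "C i g = {y \<in> B i. f i (r y) = h g y}" for i g
    have Cm: "C i g \<in> sets \<Lambda>" if g: "g \<in> carrier G" for i g
    proof -
      have "{y \<in> space (restrict_space \<Lambda> (B i)). f i (r y) = h g y} \<in> sets (restrict_space \<Lambda> (B i))"
        by (rule sets_coincidence[OF F_Hausdorff F_second_countable sets_\<Lambda> fr measurable_restrict_space1[OF h_measurable[OF g]]])
      moreover have "{y \<in> space (restrict_space \<Lambda> (B i)). f i (r y) = h g y} = C i g"
        using BF by (auto simp: C_def space_restrict_space space_\<Lambda>)
      ultimately show ?thesis using Bm BF by (auto simp: sets_restrict_space_iff space_\<Lambda> Int_absorb2)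
    qed
    have cover: "B i = (\<Union>g\<in>carrier G. C i g)" for i
    proof (intro equalityI subsetI)
      fix y assume y: "y \<in> B i"
      then have yA: "y \<in> A" "r y \<in> P i" by (auto simp: B_def)
      have yF: "y \<in> topspace F" using yA AF by blast
      obtain L where L: "L \<in> leaves \<F>" "r y \<in> L" "\<iota> (f i (r y)) \<in> L" using P(7)[OF yA(2)] by blast
      then obtain z where z: "z \<in> topspace F" "L = leaf z" by (auto simp: leaves_eq)
      have "leaf y = leaf z" using leaf_eq_or_disjoint[OF yF z(1)] leafr[OF yA(1)] L(2) z(2) by blast
      then have "q (e0, f i (r y)) \<in> leaf y" using L(3) z(2) by (simp add: \<iota>_def)
      then obtain e where e: "e \<in> topspace E" "q (e, y) = q (e0, f i (r y))" by (auto simp: leaf_def)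
      have "f i (r y) \<in> topspace F" using P(6)[of i] yA(2) sets.sets_into_space space_\<Lambda> by blast
      then obtain g where "g \<in> carrier G" "f i (r y) = h g y" using q_eq_iff[OF e(1) yF e0] e(2) by metis
      then show "y \<in> (\<Union>g\<in>carrier G. C i g)" using y by (auto simp: C_def)
    qed (auto simp: C_def)
    have mult: "(\<Sum>g\<in>I. emeasure \<Lambda> (C i g)) \<le> of_nat N * emeasure \<Lambda> (f i ` P i)"
      if I: "finite I" "I \<subseteq> carrier G" for i I
    proof -
      have "(\<Sum>g\<in>I. emeasure \<Lambda> (C i g)) = (\<Sum>g\<in>I. emeasure \<Lambda> (h g ` C i g))"
        using I invariant Cm by (intro sum.cong) auto
      also have "\<dots> \<le> of_nat N * emeasure \<Lambda> (f i ` P i)"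
      proof (rule emeasure_le_bounded_multiplicity[OF I(1)])
        show "h g ` C i g \<in> sets \<Lambda>" if "g \<in> I" for g using that I invariant Cm by blast
        show "h g ` C i g \<subseteq> f i ` P i" if "g \<in> I" for g
        proof
          fix z assume "z \<in> h g ` C i g"
          then obtain y where "r y \<in> P i" "z = f i (r y)" by (auto simp: C_def B_def)
          then show "z \<in> f i ` P i" by blast
        qed
        show "f i ` P i \<in> sets \<Lambda>" by (rule P(6))
        fix z assume "z \<in> f i ` P i"
        then obtain t where t: "t \<in> P i" "z = f i t" by blast
        let ?J = "{g \<in> I. z \<in> h g ` C i g}"
        show "card ?J \<le> N"
        proof (cases "?J = {}")
          case False
          \<comment> \<open>The elements \<open>g\<close> counted here come from different points that \<open>r\<close> sends to \<open>t\<close>, hence from different short words.\<close>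
          have pre: "\<exists>y. y \<in> A \<and> r y = t \<and> z = h g y" if g: "g \<in> ?J" for g
          proof -
            obtain y where y: "y \<in> C i g" "z = h g y" using g by blast
            then have "r y \<in> P i" "f i (r y) = f i t" using t by (auto simp: C_def B_def)
            then have "r y = t" using P(5)[of i] t(1) by (meson inj_onD)
            then show ?thesis using y by (auto simp: C_def B_def)
          qed
          then have "t \<in> topspace X" using False near(2) by blast
          then obtain At yt where lt: "label At t yt" using label_exists by blast
          have "\<exists>s\<in>wb (2 * K * m). \<exists>y\<in>topspace F. yt = h (s \<otimes>\<^bsub>G\<^esub> a0) y \<and> z = h g y" if g: "g \<in> ?J" for g
          proof -
            obtain y where y: "y \<in> A" "r y = t" "z = h g y" using pre[OF g] by blast
            obtain s where "s \<in> wb (2 * K * m)" "yt = h (s \<otimes>\<^bsub>G\<^esub> a0) y" using fib[OF y(1)] lt y(2) by metis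
            then show ?thesis using y AF by blast
          qed
          then have "\<forall>g\<in>?J. \<exists>s. s \<in> wb (2 * K * m) \<and> (\<exists>y\<in>topspace F. yt = h (s \<otimes>\<^bsub>G\<^esub> a0) y \<and> z = h g y)" by blast
          then obtain s where "\<forall>g\<in>?J. s g \<in> wb (2 * K * m) \<and> (\<exists>y\<in>topspace F. yt = h (s g \<otimes>\<^bsub>G\<^esub> a0) y \<and> z = h g y)"
            by (rule bchoice[THEN exE])
          then have s: "\<And>g. g \<in> ?J \<Longrightarrow> s g \<in> wb (2 * K * m)"
            "\<And>g. g \<in> ?J \<Longrightarrow> \<exists>y\<in>topspace F. yt = h (s g \<otimes>\<^bsub>G\<^esub> a0) y \<and> z = h g y" by blast+
          have "inj_on s ?J"
          proof (rule inj_onI)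
            fix g g' assume g: "g \<in> ?J" "g' \<in> ?J" "s g = s g'"
            obtain y where y: "y \<in> topspace F" "yt = h (s g \<otimes>\<^bsub>G\<^esub> a0) y" "z = h g y" using s(2)[OF g(1)] by blast
            obtain y' where y': "y' \<in> topspace F" "yt = h (s g' \<otimes>\<^bsub>G\<^esub> a0) y'" "z = h g' y'" using s(2)[OF g(2)] by blast
            have sc: "s g \<otimes>\<^bsub>G\<^esub> a0 \<in> carrier G" using wb_closed[OF s(1)[OF g(1)]] A0(3) by simp
            have "y = h (inv\<^bsub>G\<^esub> (s g \<otimes>\<^bsub>G\<^esub> a0)) yt" using h_inv[OF sc y(1)] y(2) by simp
            also have "\<dots> = y'" using h_inv[OF sc y'(1)] y'(2) g(3) by simp
            finally have "h g y = h g' y" using y(3) y'(3) by simp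
            then show "g = g'" using h_inj[of g g' y] g I y(1) by blast
          qed
          then have "card ?J \<le> card (wb (2 * K * m))"
            by (rule card_inj_on_le) (use s(1) wb_finite in auto)
          then show ?thesis by (simp add: N_def)
        qed (simp only: card.empty)
      qed
      finally show ?thesis .
    qed
    \<comment> \<open>The bound for finitely many \<open>g\<close> passes to the countable group along the word balls.\<close>
    have Bi: "emeasure \<Lambda> (B i) \<le> of_nat N * emeasure \<Lambda> (f i ` P i)" for i
    proof -
      define V where "V l = (\<Union>g\<in>wb l. C i g)" for l
      have Vm: "range V \<subseteq> sets \<Lambda>"
        unfolding V_def using Cm wb_closed wb_finite by (auto intro!: sets.finite_UN)
      have inc: "incseq V" unfolding V_def incseq_def using wb_mono by blast
      have BV: "B i = (\<Union>l. V l)" using cover[of i] countable_G unfolding V_def by blast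
      have "emeasure \<Lambda> (V l) \<le> of_nat N * emeasure \<Lambda> (f i ` P i)" for l
      proof -
        have "emeasure \<Lambda> (V l) \<le> (\<Sum>g\<in>wb l. emeasure \<Lambda> (C i g))"
          unfolding V_def using wb_finite Cm wb_closed by (intro emeasure_subadditive_finite) auto
        also have "\<dots> \<le> of_nat N * emeasure \<Lambda> (f i ` P i)"
          by (rule mult[OF wb_finite]) (use wb_closed in blast)
        finally show ?thesis .
      qed
      then have "(SUP l. emeasure \<Lambda> (V l)) \<le> of_nat N * emeasure \<Lambda> (f i ` P i)" by (rule SUP_least)
      then show ?thesis unfolding BV using SUP_emeasure_incseq[OF Vm inc] by simp
    qed
    have "A = (\<Union>i. B i)"
    proof (intro equalityI subsetI)
      fix y assume y: "y \<in> A"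
      then have "r y \<in> H ` (U \<times> {1})" by (auto simp: r_def A_def)
      then have "r y \<in> (\<Union>i. P i)" using P(2) by simp
      then show "y \<in> (\<Union>i. B i)" using y by (auto simp: B_def)
    qed (auto simp: B_def)
    then have "emeasure \<Lambda> A \<le> (\<Sum>i. emeasure \<Lambda> (B i))"
      using emeasure_subadditive_countably[of B \<Lambda>] Bm by auto
    also have "\<dots> \<le> (\<Sum>i. of_nat N * emeasure \<Lambda> (f i ` P i))" using Bi by (intro suminf_le) auto
    also have "\<dots> = of_nat N * (\<Sum>i. emeasure \<Lambda> (f i ` P i))" by (rule ennreal_suminf_cmult)
    finally show ?thesis .
  qed
  have "ennreal (1 / N) * emeasure \<Lambda> A \<le> \<mu> (H ` (U \<times> {1}))"
    unfolding suspension_measure_def transverse_extension_def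
  proof (rule Inf_greatest)
    fix x assume "x \<in> {\<Sum>i. emeasure \<Lambda> (f i ` P i) |P f.
        leafwise_decomposition X \<F> (\<lambda>y. q (e0, y)) \<Lambda> (H ` (U \<times> {1})) P f}"
    then obtain P f where Pf: "x = (\<Sum>i. emeasure \<Lambda> (f i ` P i))"
      "leafwise_decomposition X \<F> (\<lambda>y. q (e0, y)) \<Lambda> (H ` (U \<times> {1})) P f" by blast
    have "(\<lambda>y. q (e0, y)) = \<iota>" by (simp add: \<iota>_def[abs_def])
    then have "emeasure \<Lambda> A \<le> of_nat N * x" using main[of P f] Pf by simp
    then have "ennreal (1 / N) * emeasure \<Lambda> A \<le> ennreal (1 / N) * (of_nat N * x)" by (rule mult_left_mono) simp
    also have "\<dots> = (ennreal (1 / N) * ennreal (real N)) * x" by (simp add: ennreal_of_nat_eq_real_of_nat mult.assoc)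
    also have "ennreal (1 / N) * ennreal (real N) = 1" using Npos by (simp flip: ennreal_mult)
    finally show "ennreal (1 / N) * emeasure \<Lambda> A \<le> x" by simp
  qed
  then have "of_nat N * (ennreal (1 / N) * emeasure \<Lambda> A) \<le> of_nat N * \<mu> (H ` (U \<times> {1}))" by (rule mult_left_mono) simp
  moreover have "of_nat N * (ennreal (1 / N) * emeasure \<Lambda> A) = (ennreal (real N) * ennreal (1 / N)) * emeasure \<Lambda> A"
    by (simp add: ennreal_of_nat_eq_real_of_nat mult.assoc)
  moreover have "ennreal (real N) * ennreal (1 / N) = 1" using Npos by (simp flip: ennreal_mult)
  ultimately show ?thesis by (simp add: N_def A_def)
qed

text \<open>The traces on the fibre of the members of a cover have total measure at least 1. Passing to a finite
  subcover first makes this a finite sum.\<close>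

lemma Cat_bounded_lower:
  assumes fin: "finite \<U>" and reg: "regular_atlas n X \<F> \<U>"
  obtains K where "K \<ge> 1" "\<And>m. ennreal (1 / card (wb (K * m))) \<le> Cat_bounded X \<F> \<mu> m \<U>"
proof -
  obtain K where K1: "K \<ge> 1" and K: "plaque_bound \<U> K" using plaques_bounded[OF fin reg] by blast
  have UF: "\<U> \<subseteq> \<F>" using reg by (simp add: regular_atlas_def)
  have "ennreal (1 / card (wb (2 * K * m))) \<le> Cat_bounded X \<F> \<mu> m \<U>" for m
  proof -
    define N where "N = card (wb (2 * K * m))"
    have Npos: "N > 0" unfolding N_def using wb_one wb_finite by (auto simp: card_gt_0_iff)
    define C where "C U = {H. tangential_contraction X \<F> U H \<and> deformation_length \<U> U H \<le> enat m}" for U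
    define \<tau> where "\<tau> U = (INF H\<in>C U. \<mu> (H ` (U \<times> {1})))" for U
    define A where "A U = {y \<in> topspace F. q (e0, y) \<in> U}" for U
    have \<tau>: "ennreal (1 / N) * emeasure \<Lambda> (A U) \<le> \<tau> U" if "openin X U" for U
      unfolding \<tau>_def
    proof (rule INF_greatest)
      fix H assume "H \<in> C U"
      then have "emeasure \<Lambda> (A U) \<le> of_nat N * \<mu> (H ` (U \<times> {1}))"
        using contraction_measure_bound[OF UF K that] by (simp add: C_def A_def N_def)
      then have "ennreal (1 / N) * emeasure \<Lambda> (A U) \<le> ennreal (1 / N) * (of_nat N * \<mu> (H ` (U \<times> {1})))"
        by (rule mult_left_mono) simp
      also have "\<dots> = (ennreal (1 / N) * ennreal (real N)) * \<mu> (H ` (U \<times> {1}))"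
        by (simp add: ennreal_of_nat_eq_real_of_nat mult.assoc)
      also have "ennreal (1 / N) * ennreal (real N) = 1" using Npos by (simp flip: ennreal_mult)
      finally show "ennreal (1 / N) * emeasure \<Lambda> (A U) \<le> \<mu> (H ` (U \<times> {1}))" by simp
    qed
    have "ennreal (1 / N) \<le> (\<Sum>\<^sub>\<infinity>U\<in>\<V>. \<tau> U)"
      if V: "\<And>U. U \<in> \<V> \<Longrightarrow> openin X U" "\<Union>\<V> = topspace X" for \<V>
    proof -
      obtain \<W> where W: "finite \<W>" "\<W> \<subseteq> \<V>" "topspace X \<subseteq> \<Union>\<W>"
        using X_compact V unfolding compact_space_alt by (metis order_refl)
      have Am: "A U \<in> sets \<Lambda>" if "U \<in> \<W>" for U
      proof -
        have "continuous_map F EF (\<lambda>y. (e0, y))" using e0 by (intro continuous_map_pairedI) auto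
        from openin_continuous_map_preimage[OF continuous_map_compose[OF this q_cont], of U]
        show ?thesis using V(1) W(2) that open_\<Lambda> by (auto simp: A_def)
      qed
      have "space \<Lambda> \<subseteq> (\<Union>U\<in>\<W>. A U)"
      proof
        fix y assume "y \<in> space \<Lambda>"
        then have y: "y \<in> topspace F" by (simp add: space_\<Lambda>)
        then obtain U where "U \<in> \<W>" "q (e0, y) \<in> U" using W(3) q_in[OF e0 y] by blast
        then show "y \<in> (\<Union>U\<in>\<W>. A U)" using y by (auto simp: A_def)
      qed
      moreover have "(\<Union>U\<in>\<W>. A U) \<in> sets \<Lambda>" using Am W(1) by (intro sets.finite_UN) auto
      ultimately have "emeasure \<Lambda> (space \<Lambda>) \<le> emeasure \<Lambda> (\<Union>U\<in>\<W>. A U)" by (rule emeasure_mono)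
      also have "\<dots> \<le> (\<Sum>U\<in>\<W>. emeasure \<Lambda> (A U))" using Am W(1) by (intro emeasure_subadditive_finite) auto
      finally have "1 \<le> (\<Sum>U\<in>\<W>. emeasure \<Lambda> (A U))" using prob_space.emeasure_space_1[OF prob_\<Lambda>] by simp
      then have "ennreal (1 / N) * 1 \<le> ennreal (1 / N) * (\<Sum>U\<in>\<W>. emeasure \<Lambda> (A U))" by (rule mult_left_mono) simp
      also have "\<dots> = (\<Sum>U\<in>\<W>. ennreal (1 / N) * emeasure \<Lambda> (A U))" by (rule sum_distrib_left)
      also have "\<dots> \<le> (\<Sum>U\<in>\<W>. \<tau> U)" using \<tau> V(1) W(2) by (intro sum_mono) blast
      also have "\<dots> \<le> (\<Sum>\<^sub>\<infinity>U\<in>\<V>. \<tau> U)"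
        using W(1,2) by (subst nonneg_infsum_complete) (auto intro!: SUP_upper)
      finally show ?thesis by simp
    qed
    then show ?thesis
      unfolding Cat_bounded_def category_of_def \<tau>_def C_def N_def by (intro INF_greatest) blast
  qed
  then show thesis using that[of "2 * K"] K1 by simp
qed

end

section \<open>Plaque chains along paths\<close>

lemma plaque_chain_append:
  assumes "plaque_chain \<U> Ps" "plaque_chain \<U> Qs" "Ps \<noteq> []" "Qs \<noteq> []" "last Ps \<inter> hd Qs \<noteq> {}"
  shows "plaque_chain \<U> (Ps @ Qs)"
  unfolding plaque_chain_def
proof (intro conjI allI impI)
  show "set (Ps @ Qs) \<subseteq> (\<Union>c\<in>\<U>. plaques c)" using assms(1,2) by (simp add: plaque_chain_def)
  fix i assume i: "Suc i < length (Ps @ Qs)"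
  consider "Suc i < length Ps" | "Suc i = length Ps" | "length Ps \<le> i" by linarith
  then show "(Ps @ Qs) ! i \<inter> (Ps @ Qs) ! Suc i \<noteq> {}"
  proof cases
    case 1
    then show ?thesis using assms(1) by (simp add: plaque_chain_def nth_append)
  next
    case 2
    then have "(Ps @ Qs) ! i = last Ps" using assms(3) by (simp add: nth_append last_conv_nth flip: 2)
    moreover have "(Ps @ Qs) ! Suc i = hd Qs" using 2 assms(4) by (simp add: nth_append hd_conv_nth)
    ultimately show ?thesis using assms(5) by simp
  next
    case 3
    then have "Suc (i - length Ps) < length Qs" using i by simp
    then have "Qs ! (i - length Ps) \<inter> Qs ! Suc (i - length Ps) \<noteq> {}" using assms(2) by (simp add: plaque_chain_def)
    then show ?thesis using 3 by (simp add: nth_append Suc_diff_le)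
  qed
qed

context suspension
begin

text \<open>Every leafwise copy of \<open>A\<close> fits in one plaque, so motions inside \<open>A\<close> are free of charge up to a constant.\<close>

definition small :: "('e \<times> 'f) set fol_chart set \<Rightarrow> 'e set \<Rightarrow> bool" where
  "small \<U> A \<longleftrightarrow> (\<forall>y\<in>topspace F. \<exists>P\<in>\<Union>(plaques ` \<U>). q ` (A \<times> {y}) \<subseteq> P)"

lemma small_subset: "small \<U> A \<Longrightarrow> A' \<subseteq> A \<Longrightarrow> small \<U> A'"
  unfolding small_def by (meson Sigma_mono image_mono order_refl subset_trans)

lemma small_nbhd:
  assumes UF: "\<U> \<subseteq> \<F>" and cov: "(\<Union>c\<in>\<U>. chart_dom c) = topspace X" and e: "e \<in> topspace E"
  obtains A where "openin E A" "e \<in> A" "small \<U> A"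
proof -
  define R where "R A y \<longleftrightarrow> (\<exists>P\<in>\<Union>(plaques ` \<U>). q ` (A \<times> {y}) \<subseteq> P)" for A :: "'e set" and y
  obtain A where A: "openin E A" "e \<in> A" "\<And>y. y \<in> topspace F \<Longrightarrow> R A y"
  proof (rule compact_uniform_nbhd[OF F_compact e, where R = R])
    fix y assume y: "y \<in> topspace F"
    obtain c where c: "c \<in> \<U>" "q (e, y) \<in> chart_dom c" using cov q_in[OF e y] by blast
    have cF: "c \<in> \<F>" using c(1) UF by blast
    obtain A O' where A: "openin E A" "e \<in> A" "openin F O'" "y \<in> O'" "q ` (A \<times> O') \<subseteq> chart_dom c"
      "\<And>x x' z z'. x \<in> A \<Longrightarrow> x' \<in> A \<Longrightarrow> z \<in> O' \<Longrightarrow> z' \<in> O' \<Longrightarrow>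
         snd (chart_map c (q (x, z))) = snd (chart_map c (q (x', z'))) \<longleftrightarrow> z = z'"
      using local_product_structure[OF cF e y c(2)] by metis
    have "R A z" if z: "z \<in> O'" for z
    proof -
      define P where "P = {u \<in> chart_dom c. snd (chart_map c u) = snd (chart_map c (q (e, z)))}"
      have "q (e, z) \<in> chart_dom c" using A(2,5) z by blast
      then have "P \<in> plaques c" unfolding P_def by (rule plaque_through[OF cF])
      moreover have "q ` (A \<times> {z}) \<subseteq> P"
      proof
        fix u assume "u \<in> q ` (A \<times> {z})"
        then obtain x where x: "x \<in> A" "u = q (x, z)" by blast
        have "u \<in> chart_dom c" using x A(5) z by blast
        then show "u \<in> P" using A(6)[OF x(1) A(2) z z] x(2) by (simp add: P_def)
      qed
      ultimately show ?thesis unfolding R_def using c(1) by blast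
    qed
    then show "\<exists>A O'. openin E A \<and> e \<in> A \<and> openin F O' \<and> y \<in> O' \<and> (\<forall>z\<in>O'. R A z)" using A by blast
  next
    fix A A' :: "'e set" and z assume "A' \<subseteq> A" "R A z"
    then show "R A' z" unfolding R_def by (meson Sigma_mono image_mono order_refl subset_trans)
  qed blast
  then show thesis using that unfolding small_def R_def by blast
qed

text \<open>The bound \<open>l\<close> does not depend on the leaf \<open>y\<close>, as needed for a bound on the length of a deformation. The
  conditions on the first and last plaques make chains composable.\<close>

definition covers :: "('e \<times> 'f) set fol_chart set \<Rightarrow> (real \<Rightarrow> 'e) \<Rightarrow> real \<Rightarrow> real \<Rightarrow> nat \<Rightarrow> bool" where
  "covers \<U> \<gamma> u v l \<longleftrightarrow> (\<forall>y\<in>topspace F. \<exists>Ps. plaque_chain \<U> Ps \<and> Ps \<noteq> [] \<and> length Ps \<le> l \<and>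
     (\<forall>t\<in>{u..v}. q (\<gamma> t, y) \<in> \<Union>(set Ps)) \<and> q (\<gamma> u, y) \<in> hd Ps \<and> q (\<gamma> v, y) \<in> last Ps)"

lemma covers_join:
  assumes 1: "covers \<U> \<gamma> u v l" and 2: "covers \<U> \<gamma>' u' v' l'" and meet: "\<gamma> v = \<gamma>' u'"
    and \<delta>: "\<And>t. t \<in> {a..b} \<Longrightarrow> \<delta> t \<in> \<gamma> ` {u..v} \<union> \<gamma>' ` {u'..v'}" "\<delta> a = \<gamma> u" "\<delta> b = \<gamma>' v'"
  shows "covers \<U> \<delta> a b (l + l')"
  unfolding covers_def
proof
  fix y assume y: "y \<in> topspace F"
  obtain Ps where P: "plaque_chain \<U> Ps" "Ps \<noteq> []" "length Ps \<le> l"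
     "\<And>t. t \<in> {u..v} \<Longrightarrow> q (\<gamma> t, y) \<in> \<Union>(set Ps)" "q (\<gamma> u, y) \<in> hd Ps" "q (\<gamma> v, y) \<in> last Ps"
    using 1 y unfolding covers_def by meson
  obtain Qs where Q: "plaque_chain \<U> Qs" "Qs \<noteq> []" "length Qs \<le> l'"
     "\<And>t. t \<in> {u'..v'} \<Longrightarrow> q (\<gamma>' t, y) \<in> \<Union>(set Qs)" "q (\<gamma>' u', y) \<in> hd Qs" "q (\<gamma>' v', y) \<in> last Qs"
    using 2 y unfolding covers_def by meson
  have "last Ps \<inter> hd Qs \<noteq> {}" using P(6) Q(5) meet by auto
  then have "plaque_chain \<U> (Ps @ Qs)" by (rule plaque_chain_append[OF P(1) Q(1) P(2) Q(2)])
  moreover have "q (\<delta> t, y) \<in> \<Union>(set (Ps @ Qs))" if t: "t \<in> {a..b}" for t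
  proof (cases "\<delta> t \<in> \<gamma> ` {u..v}")
    case True
    then obtain s where "s \<in> {u..v}" "\<delta> t = \<gamma> s" by blast
    then show ?thesis using P(4)[of s] by auto
  next
    case False
    then obtain s where "s \<in> {u'..v'}" "\<delta> t = \<gamma>' s" using \<delta>(1)[OF t] by blast
    then show ?thesis using Q(4)[of s] by auto
  qed
  ultimately show "\<exists>Ps. plaque_chain \<U> Ps \<and> Ps \<noteq> [] \<and> length Ps \<le> l + l' \<and>
     (\<forall>t\<in>{a..b}. q (\<delta> t, y) \<in> \<Union>(set Ps)) \<and> q (\<delta> a, y) \<in> hd Ps \<and> q (\<delta> b, y) \<in> last Ps"
    using P(2,3,5) Q(2,3,6) \<delta>(2,3) by (intro exI[of _ "Ps @ Qs"]) simp
qed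

lemma covers_mono: "covers \<U> \<gamma> u v l \<Longrightarrow> l \<le> l' \<Longrightarrow> covers \<U> \<gamma> u v l'"
  unfolding covers_def by (meson order_trans)

lemma covers_small:
  assumes "small \<U> A" "\<And>t. t \<in> {u..v} \<Longrightarrow> \<gamma> t \<in> A" "u \<le> v"
  shows "covers \<U> \<gamma> u v 1"
  unfolding covers_def
proof
  fix y assume "y \<in> topspace F"
  then obtain P where P: "P \<in> \<Union>(plaques ` \<U>)" "q ` (A \<times> {y}) \<subseteq> P" using assms(1) unfolding small_def by blast
  have in_P: "q (\<gamma> t, y) \<in> P" if "t \<in> {u..v}" for t using P(2) assms(2)[OF that] by blast
  show "\<exists>Ps. plaque_chain \<U> Ps \<and> Ps \<noteq> [] \<and> length Ps \<le> 1 \<and>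
     (\<forall>t\<in>{u..v}. q (\<gamma> t, y) \<in> \<Union>(set Ps)) \<and> q (\<gamma> u, y) \<in> hd Ps \<and> q (\<gamma> v, y) \<in> last Ps"
    using P(1) in_P assms(3) by (intro exI[of _ "[P]"]) (simp add: plaque_chain_def)
qed

lemma covers_path:
  assumes UF: "\<U> \<subseteq> \<F>" and cov: "(\<Union>c\<in>\<U>. chart_dom c) = topspace X" and \<gamma>: "pathin E \<gamma>"
  shows "\<exists>l. covers \<U> \<gamma> 0 1 l"
proof (rule interval_chaining[OF zero_le_one, where Q = "\<lambda>u v. \<exists>l. covers \<U> \<gamma> u v l"])
  fix u v w :: real assume uvw: "u \<le> v" "v \<le> w" "\<exists>l. covers \<U> \<gamma> u v l" "\<exists>l. covers \<U> \<gamma> v w l"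
  then obtain l l' where l: "covers \<U> \<gamma> u v l" "covers \<U> \<gamma> v w l'" by blast
  have "\<gamma> t \<in> \<gamma> ` {u..v} \<union> \<gamma> ` {v..w}" if "t \<in> {u..w}" for t using that uvw(1,2) by (cases "t \<le> v") auto
  then show "\<exists>l. covers \<U> \<gamma> u w l" using covers_join[OF l] by blast
next
  fix x :: real assume x: "x \<in> {0..1}"
  have c: "continuous_map (top_of_set {0..1}) E \<gamma>" using \<gamma> by (simp add: pathin_def)
  then have "\<gamma> x \<in> topspace E" using x by (auto simp: continuous_map_def)
  then obtain A where A: "openin E A" "\<gamma> x \<in> A" "small \<U> A" using small_nbhd[OF UF cov] by blast
  obtain d where d: "d > 0" "\<And>t. t \<in> {0..1} \<Longrightarrow> \<bar>t - x\<bar> < d \<Longrightarrow> \<gamma> t \<in> A"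
    using continuous_interval_nbhd[OF c A(1) x A(2)] by metis
  show "\<exists>d>0. \<forall>u v. 0 \<le> u \<longrightarrow> u \<le> x \<longrightarrow> x \<le> v \<longrightarrow> v \<le> 1 \<longrightarrow> v - u < d \<longrightarrow> (\<exists>l. covers \<U> \<gamma> u v l)"
  proof (intro exI[of _ d] conjI allI impI d(1))
    fix u v assume uv: "0 \<le> u" "u \<le> x" "x \<le> v" "v \<le> 1" "v - u < d"
    have "\<gamma> t \<in> A" if "t \<in> {u..v}" for t using that uv by (intro d(2)) auto
    then show "\<exists>l. covers \<U> \<gamma> u v l" using covers_small[OF A(3)] uv by (meson order_trans)
  qed
qed

text \<open>Translating the path by \<open>a\<close> amounts to passing from the leaf of \<open>y\<close> to that of \<open>h(a\<inverse>) y\<close>, and the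
  bound holds on all leaves.\<close>

lemma covers_translate:
  assumes c: "covers \<U> \<gamma> u v l" and a: "a \<in> carrier G" and uv: "u \<le> v"
    and \<gamma>: "\<And>t. t \<in> {u..v} \<Longrightarrow> \<gamma> t \<in> topspace E"
  shows "covers \<U> (D a \<circ> \<gamma>) u v l"
  unfolding covers_def
proof
  fix y assume y: "y \<in> topspace F"
  have ai: "inv\<^bsub>G\<^esub> a \<in> carrier G" using a by simp
  have eq: "q ((D a \<circ> \<gamma>) t, y) = q (\<gamma> t, h (inv\<^bsub>G\<^esub> a) y)" if "t \<in> {u..v}" for t
    using q_action[OF a \<gamma>[OF that] h_in[OF ai y]] h_inv'[OF a y] by simp
  obtain Ps where "plaque_chain \<U> Ps" "Ps \<noteq> []" "length Ps \<le> l"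
     "\<And>t. t \<in> {u..v} \<Longrightarrow> q (\<gamma> t, h (inv\<^bsub>G\<^esub> a) y) \<in> \<Union>(set Ps)" "q (\<gamma> u, h (inv\<^bsub>G\<^esub> a) y) \<in> hd Ps"
     "q (\<gamma> v, h (inv\<^bsub>G\<^esub> a) y) \<in> last Ps"
    using c h_in[OF ai y] unfolding covers_def by meson
  then show "\<exists>Ps. plaque_chain \<U> Ps \<and> Ps \<noteq> [] \<and> length Ps \<le> l \<and>
     (\<forall>t\<in>{u..v}. q ((D a \<circ> \<gamma>) t, y) \<in> \<Union>(set Ps)) \<and> q ((D a \<circ> \<gamma>) u, y) \<in> hd Ps \<and> q ((D a \<circ> \<gamma>) v, y) \<in> last Ps"
    using eq uv by (intro exI[of _ Ps]) auto
qed

lemma covers_path_join: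
  assumes "covers \<U> \<gamma> 0 1 l" "covers \<U> \<gamma>' 0 1 l'" "\<gamma> 1 = \<gamma>' 0"
  shows "covers \<U> (path_join \<gamma> \<gamma>') 0 1 (l + l')"
proof (rule covers_join[OF assms])
  fix t :: real assume t: "t \<in> {0..1}"
  show "path_join \<gamma> \<gamma>' t \<in> \<gamma> ` {0..1} \<union> \<gamma>' ` {0..1}"
  proof (cases "t \<le> 1/2")
    case True then show ?thesis using t by (auto simp: path_join_def intro!: imageI)
  next
    case False
    then have "2 * t - 1 \<in> {0..1}" using t by auto
    then show ?thesis using False by (auto simp: path_join_def)
  qed
qed (auto simp: path_join_def)

lemma D_pathin: "a \<in> carrier G \<Longrightarrow> pathin E \<gamma> \<Longrightarrow> pathin E (D a \<circ> \<gamma>)"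
  unfolding pathin_def by (rule continuous_map_compose[OF _ D_cont])

text \<open>A word of length \<open>l\<close> is followed from the base point by concatenating translates of paths for the
  generators; since the plaque chains of translates have the same length, it costs \<open>O(l)\<close> plaques.\<close>

lemma word_paths:
  assumes UF: "\<U> \<subseteq> \<F>" and cov: "(\<Union>c\<in>\<U>. chart_dom c) = topspace X"
  obtains R where "\<And>l a. a \<in> wb l \<Longrightarrow>
    \<exists>\<gamma>. pathin E \<gamma> \<and> \<gamma> 0 = e0 \<and> \<gamma> 1 = D a e0 \<and> covers \<U> \<gamma> 0 1 (R * (l + 1))"
proof -
  have "\<exists>\<gamma> l. pathin E \<gamma> \<and> \<gamma> 0 = e0 \<and> \<gamma> 1 = D s e0 \<and> covers \<U> \<gamma> 0 1 l" if s: "s \<in> carrier G" for s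
  proof -
    obtain \<gamma> where g: "pathin E \<gamma>" "\<gamma> 0 = e0" "\<gamma> 1 = D s e0"
      using E_path_connected e0 D_in[OF s e0] unfolding path_connected_space_def by blast
    then show ?thesis using covers_path[OF UF cov g(1)] by blast
  qed
  then have "\<forall>s\<in>carrier G. \<exists>l. \<exists>\<gamma>. pathin E \<gamma> \<and> \<gamma> 0 = e0 \<and> \<gamma> 1 = D s e0 \<and> covers \<U> \<gamma> 0 1 l" by blast
  then obtain L where L: "\<forall>s\<in>carrier G. \<exists>\<gamma>. pathin E \<gamma> \<and> \<gamma> 0 = e0 \<and> \<gamma> 1 = D s e0 \<and> covers \<U> \<gamma> 0 1 (L s)"
    by (rule bchoice[THEN exE])
  \<comment> \<open>The cost \<open>L s\<close> of a path realizing \<open>s\<close>, maximal over the generators; the empty word needs a plaque too.\<close>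
  define R where "R = Max (insert (L \<one>\<^bsub>G\<^esub>) (L ` S))"
  have LR: "L \<one>\<^bsub>G\<^esub> \<le> R" "\<And>s. s \<in> S \<Longrightarrow> L s \<le> R" unfolding R_def using S_finite by (auto intro: Max_ge)
  have word: "\<exists>\<gamma>. pathin E \<gamma> \<and> \<gamma> 0 = e0 \<and> \<gamma> 1 = D (foldr (\<lambda>x y. x \<otimes>\<^bsub>G\<^esub> y) xs \<one>\<^bsub>G\<^esub>) e0 \<and>
      covers \<U> \<gamma> 0 1 (R * (length xs + 1))" if "set xs \<subseteq> S" for xs
    using that
  proof (induction xs)
    case Nil
    obtain \<gamma> where "pathin E \<gamma> \<and> \<gamma> 0 = e0 \<and> \<gamma> 1 = D \<one>\<^bsub>G\<^esub> e0 \<and> covers \<U> \<gamma> 0 1 (L \<one>\<^bsub>G\<^esub>)"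
      using bspec[OF L G.one_closed] by blast
    then show ?case using covers_mono LR(1) by (intro exI[of _ \<gamma>]) auto
  next
    case (Cons a xs)
    let ?w = "foldr (\<lambda>x y. x \<otimes>\<^bsub>G\<^esub> y) xs \<one>\<^bsub>G\<^esub>"
    have a: "a \<in> S" "a \<in> carrier G" using Cons.prems S_subset by auto
    have w: "?w \<in> carrier G" using Cons.prems S_subset by (intro G.foldr_mult_closed) auto
    obtain \<gamma> where g: "pathin E \<gamma>" "\<gamma> 0 = e0" "\<gamma> 1 = D a e0" "covers \<U> \<gamma> 0 1 (L a)" using bspec[OF L a(2)] by blast
    have "set xs \<subseteq> S" using Cons.prems by simp
    then obtain \<gamma>' where g': "pathin E \<gamma>'" "\<gamma>' 0 = e0" "\<gamma>' 1 = D ?w e0" "covers \<U> \<gamma>' 0 1 (R * (length xs + 1))"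
      using Cons.IH by blast
    have in_E: "\<gamma>' t \<in> topspace E" if "t \<in> {0..1}" for t
      using g'(1) that by (auto simp: pathin_def continuous_map_def)
    have c: "covers \<U> (D a \<circ> \<gamma>') 0 1 (R * (length xs + 1))"
      by (rule covers_translate[OF g'(4) a(2) _ in_E]) auto
    have m: "\<gamma> 1 = (D a \<circ> \<gamma>') 0" using g(3) g'(2) by simp
    have "covers \<U> (path_join \<gamma> (D a \<circ> \<gamma>')) 0 1 (L a + R * (length xs + 1))"
      by (rule covers_path_join[OF g(4) c m])
    then have "covers \<U> (path_join \<gamma> (D a \<circ> \<gamma>')) 0 1 (R * (length (a # xs) + 1))"
      by (rule covers_mono) (use LR(2)[OF a(1)] in simp)
    moreover have "pathin E (path_join \<gamma> (D a \<circ> \<gamma>'))" using pathin_join[OF g(1) D_pathin[OF a(2) g'(1)] m] .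
    moreover have "path_join \<gamma> (D a \<circ> \<gamma>') 0 = e0" "path_join \<gamma> (D a \<circ> \<gamma>') 1 = D (a \<otimes>\<^bsub>G\<^esub> ?w) e0"
      using g(2) g'(3) D_mult[OF a(2) w e0] by (auto simp: path_join_def)
    ultimately show ?case by (intro exI[of _ "path_join \<gamma> (D a \<circ> \<gamma>')"]) simp
  qed
  show thesis
  proof (rule that[of R])
    fix l a assume "a \<in> wb l"
    then obtain xs where xs: "a = foldr (\<lambda>x y. x \<otimes>\<^bsub>G\<^esub> y) xs \<one>\<^bsub>G\<^esub>" "set xs \<subseteq> S" "length xs \<le> l"
      by (auto simp: products_up_to_def)
    obtain \<gamma> where g: "pathin E \<gamma>" "\<gamma> 0 = e0" "\<gamma> 1 = D a e0" "covers \<U> \<gamma> 0 1 (R * (length xs + 1))"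
      using word[OF xs(2)] xs(1) by blast
    have "covers \<U> \<gamma> 0 1 (R * (l + 1))" using covers_mono[OF g(4)] xs(3) by simp
    then show "\<exists>\<gamma>. pathin E \<gamma> \<and> \<gamma> 0 = e0 \<and> \<gamma> 1 = D a e0 \<and> covers \<U> \<gamma> 0 1 (R * (l + 1))" using g by blast
  qed
qed

section \<open>Contractions of tubes\<close>

text \<open>A tube over a small ball \<open>W\<close> is first contracted along \<open>W\<close> and then moved along paths that may
  differ on disjoint open pieces \<open>T a\<close> of its transversal.\<close>

lemma tube_contraction:
  assumes W: "ball_sheet W" "small \<U> W" "W \<noteq> {}"
    and T: "\<And>a. a \<in> J \<Longrightarrow> openin F (T a)" "disjoint_family_on T J" and J: "J \<subseteq> carrier G"
    and paths: "\<And>a w. a \<in> J \<Longrightarrow> w \<in> W \<Longrightarrow>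
      \<exists>\<gamma>. pathin E \<gamma> \<and> \<gamma> 0 = w \<and> \<gamma> 1 = D a e0 \<and> covers \<U> \<gamma> 0 1 l"
  obtains H where "tangential_contraction X \<F> (q ` (W \<times> (\<Union>a\<in>J. T a))) H"
    "deformation_length \<U> (q ` (W \<times> (\<Union>a\<in>J. T a))) H \<le> enat (l + 2)"
    "H ` (q ` (W \<times> (\<Union>a\<in>J. T a)) \<times> {1}) = (\<lambda>y. q (e0, y)) ` (\<Union>a\<in>J. h (inv\<^bsub>G\<^esub> a) ` T a)"
proof -
  note sW = ball_sheetD[OF W(1)]
  define V where "V = (\<Union>a\<in>J. T a)"
  define U where "U = q ` (W \<times> V)"
  have Vo: "openin F V" unfolding V_def using T(1) by blast
  have VF: "V \<subseteq> topspace F" using Vo openin_subset by blast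
  have TF: "T a \<subseteq> topspace F" if "a \<in> J" for a using T(1)[OF that] openin_subset by blast
  have Uo: "openin X U" unfolding U_def by (rule q_open_Times[OF sW(1) Vo])
  obtain B \<kappa> where cb: "coord_ball n E W B \<kappa>" using W(1) by (auto simp: ball_sheet_def)
  obtain w0 C where C: "w0 \<in> W"
    "continuous_map (prod_topology (subtopology E W) (top_of_set {0..1::real})) (subtopology E W) C"
    "\<And>x. x \<in> W \<Longrightarrow> C (x, 0) = x" "\<And>x. x \<in> W \<Longrightarrow> C (x, 1) = w0"
    using coord_ball_contractible[OF cb] by metis
  have "\<forall>a\<in>J. \<exists>\<gamma>. pathin E \<gamma> \<and> \<gamma> 0 = w0 \<and> \<gamma> 1 = D a e0 \<and> covers \<U> \<gamma> 0 1 l" using paths C(1) by blast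
  then obtain \<gamma> where "\<forall>a\<in>J. pathin E (\<gamma> a) \<and> \<gamma> a 0 = w0 \<and> \<gamma> a 1 = D a e0 \<and> covers \<U> (\<gamma> a) 0 1 l"
    by (rule bchoice[THEN exE])
  then have \<gamma>: "\<And>a. a \<in> J \<Longrightarrow> pathin E (\<gamma> a)" "\<And>a. a \<in> J \<Longrightarrow> \<gamma> a 0 = w0"
    "\<And>a. a \<in> J \<Longrightarrow> \<gamma> a 1 = D a e0" "\<And>a. a \<in> J \<Longrightarrow> covers \<U> (\<gamma> a) 0 1 l" by blast+
  \<comment> \<open>The deformation has to be defined for all real times: \<open>f\<close> and \<open>g\<close> run through the two halves of the motion and are constant outside.\<close>
  define f where "f t = max 0 (min 1 (2 * t))" for t :: real
  define g where "g t = max 0 (min 1 (2 * t - 1))" for t :: real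
  define \<delta> where "\<delta> a z = (if snd z \<le> 1/2 then C (fst z, f (snd z)) else \<gamma> a (g (snd z)))" for a and z :: "'e \<times> real"
  let ?WR = "prod_topology (subtopology E W) euclideanreal"
  have Cin: "C (w, t) \<in> W" if wt: "w \<in> W" "t \<in> {0..1}" for w t
  proof -
    have "(w, t) \<in> topspace (prod_topology (subtopology E W) (top_of_set {0..1::real}))" using wt sW(2) by auto
    then have "C (w, t) \<in> topspace (subtopology E W)" using continuous_map_image_subset_topspace[OF C(2)] by blast
    then show ?thesis by simp
  qed
  have fg: "f t \<in> {0..1}" "g t \<in> {0..1}" for t by (auto simp: f_def g_def)
  have fgc: "continuous_map euclideanreal (top_of_set {0..1}) f" "continuous_map euclideanreal (top_of_set {0..1}) g"
    using fg by (auto simp: continuous_map_in_subtopology f_def g_def intro!: continuous_intros)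
  have \<delta>c: "continuous_map ?WR E (\<delta> a)" if a: "a \<in> J" for a
    unfolding \<delta>_def
  proof (rule continuous_map_cases_le)
    show "continuous_map ?WR euclideanreal snd" "continuous_map ?WR euclideanreal (\<lambda>z. 1/2)"
      by (auto intro: continuous_map_snd)
    have s: "continuous_map ?WR euclideanreal snd" by (rule continuous_map_snd)
    have "continuous_map ?WR (prod_topology (subtopology E W) (top_of_set {0..1})) (\<lambda>z. (fst z, (f \<circ> snd) z))"
      by (intro continuous_map_pairedI continuous_map_fst continuous_map_compose[OF s fgc(1)])
    from continuous_map_compose[OF this C(2)]
    have "continuous_map ?WR E (\<lambda>z. C (fst z, f (snd z)))" by (simp add: o_def continuous_map_in_subtopology)
    then show "continuous_map (subtopology ?WR {x \<in> topspace ?WR. snd x \<le> 1/2}) E (\<lambda>z. C (fst z, f (snd z)))"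
      by (rule continuous_map_from_subtopology)
    have "continuous_map ?WR E (\<gamma> a \<circ> (g \<circ> snd))"
      using \<gamma>(1)[OF a] unfolding pathin_def by (rule continuous_map_compose[OF continuous_map_compose[OF s fgc(2)]])
    then have "continuous_map ?WR E (\<lambda>z. \<gamma> a (g (snd z)))" by (simp add: o_def)
    then show "continuous_map (subtopology ?WR {x \<in> topspace ?WR. 1/2 \<le> snd x}) E (\<lambda>z. \<gamma> a (g (snd z)))"
      by (rule continuous_map_from_subtopology)
    fix z assume z: "z \<in> topspace ?WR" "snd z = 1/2"
    then have "fst z \<in> W" by (simp add: mem_Times_iff)
    then show "C (fst z, f (snd z)) = \<gamma> a (g (snd z))" using C(4) \<gamma>(2)[OF a] z(2) by (simp add: f_def g_def)
  qed
  \<comment> \<open>As the pieces \<open>T a\<close> are disjoint, the path to follow is determined by the point \<open>y\<close> of the transversal.\<close>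
  define sel where "sel y = (SOME a. a \<in> J \<and> y \<in> T a)" for y
  have sel: "sel y = a" if "a \<in> J" "y \<in> T a" for a y
  proof -
    have "sel y \<in> J \<and> y \<in> T (sel y)" unfolding sel_def by (rule someI[of _ a]) (use that in simp)
    then show ?thesis using T(2) that unfolding disjoint_family_on_def by blast
  qed
  define loc where "loc u = inv_into (W \<times> topspace F) q u" for u
  have loc: "loc (q (w, y)) = (w, y)" if "w \<in> W" "y \<in> topspace F" for w y
    unfolding loc_def using q_inj_sheet[OF sW(2,3)] that by (intro inv_into_f_f) auto
  define Ha where "Ha a z = q (\<delta> a (fst (loc (fst z)), snd z), snd (loc (fst z)))" for a and z :: "('e \<times> 'f) set \<times> real"
  define H where "H z = Ha (sel (snd (loc (fst z)))) z" for z
  have Hval: "H (q (w, y), t) = q (\<delta> a (w, t), y)" if "w \<in> W" "a \<in> J" "y \<in> T a" for w y a t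
    using loc[of w y] sel[OF that(2,3)] TF[OF that(2)] that by (auto simp: H_def Ha_def)
  let ?Z = "prod_topology (subtopology X U) euclideanreal"
  have locc: "continuous_map (subtopology X U) (prod_topology (subtopology E W) F) loc"
  proof -
    obtain r where r: "homeomorphic_maps (subtopology EF (W \<times> topspace F)) (subtopology X (q ` (W \<times> topspace F))) q r"
      using q_sheet_homeomorphic[OF sW(1,3) openin_topspace] homeomorphic_map_maps by blast
    have "continuous_map (subtopology X (q ` (W \<times> topspace F))) (prod_topology (subtopology E W) F) r"
      using r by (simp add: homeomorphic_maps_def subtopology_Times)
    then have "continuous_map (subtopology X U) (prod_topology (subtopology E W) F) r"
      by (rule continuous_map_from_subtopology_mono) (use VF in \<open>auto simp: U_def\<close>)
    moreover have "r u = loc u" if u: "u \<in> topspace (subtopology X U)" for u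
    proof -
      have "u \<in> U" using u by simp
      then obtain w y where wy: "u = q (w, y)" "w \<in> W" "y \<in> V" by (auto simp: U_def)
      have yF: "y \<in> topspace F" using wy(3) VF by blast
      have "r (q (w, y)) = (w, y)" using r wy yF sW(2) by (auto simp: homeomorphic_maps_def)
      then show ?thesis using loc[OF wy(2) yF] wy(1) by simp
    qed
    ultimately show ?thesis by (rule continuous_map_eq)
  qed
  have Hac: "continuous_map ?Z X (Ha a)" if a: "a \<in> J" for a
  proof -
    have l: "continuous_map ?Z (prod_topology (subtopology E W) F) (loc \<circ> fst)"
      by (rule continuous_map_compose[OF continuous_map_fst locc])
    have 1: "continuous_map ?Z (subtopology E W) (fst \<circ> (loc \<circ> fst))"
      by (rule continuous_map_compose[OF l continuous_map_fst])
    have 2: "continuous_map ?Z F (snd \<circ> (loc \<circ> fst))" by (rule continuous_map_compose[OF l continuous_map_snd])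
    have "continuous_map ?Z ?WR (\<lambda>z. ((fst \<circ> (loc \<circ> fst)) z, snd z))"
      by (intro continuous_map_pairedI 1 continuous_map_snd)
    from continuous_map_pairedI[OF continuous_map_compose[OF this \<delta>c[OF a]] 2]
    have "continuous_map ?Z EF (\<lambda>z. ((\<delta> a \<circ> (\<lambda>z. ((fst \<circ> (loc \<circ> fst)) z, snd z))) z, (snd \<circ> (loc \<circ> fst)) z))" .
    from continuous_map_compose[OF this q_cont] show ?thesis by (simp add: o_def Ha_def[abs_def])
  qed
  \<comment> \<open>The pieces are open, so a map that is continuous over each of them is continuous.\<close>
  have Hc: "continuous_map ?Z X H"
  proof (rule pasting_lemma[where I = J and T = "\<lambda>a. q ` (W \<times> T a) \<times> UNIV" and f = Ha])
    fix a assume a: "a \<in> J"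
    have "openin X (q ` (W \<times> T a))" by (rule q_open_Times[OF sW(1) T(1)[OF a]])
    moreover have "q ` (W \<times> T a) \<subseteq> U" using a by (auto simp: U_def V_def)
    ultimately show "openin ?Z (q ` (W \<times> T a) \<times> UNIV)"
      using Uo by (simp add: openin_prod_Times_iff openin_open_subtopology)
    show "continuous_map (subtopology ?Z (q ` (W \<times> T a) \<times> UNIV)) X (Ha a)"
      by (rule continuous_map_from_subtopology[OF Hac[OF a]])
  next
    fix a b z assume ab: "a \<in> J" "b \<in> J" "z \<in> topspace ?Z \<inter> q ` (W \<times> T a) \<times> UNIV \<inter> q ` (W \<times> T b) \<times> UNIV"
    then have "fst z \<in> q ` (W \<times> T a)" "fst z \<in> q ` (W \<times> T b)" by auto
    then obtain w y w' y' where wy: "fst z = q (w, y)" "w \<in> W" "y \<in> T a" "fst z = q (w', y')" "w' \<in> W" "y' \<in> T b"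
      by blast
    have "loc (fst z) = (w, y)" "loc (fst z) = (w', y')"
      using loc[OF wy(2), of y] loc[OF wy(5), of y'] wy(1,4) subsetD[OF TF[OF ab(1)] wy(3)]
        subsetD[OF TF[OF ab(2)] wy(6)] by simp_all
    then have "y \<in> T b" using wy by simp
    then have "a = b" using sel[OF ab(1) wy(3)] sel[OF ab(2)] by metis
    then show "Ha a z = Ha b z" by simp
  next
    fix z assume "z \<in> topspace ?Z"
    then have "fst z \<in> U" by (simp add: mem_Times_iff)
    then obtain w y a where wy: "fst z = q (w, y)" "w \<in> W" "y \<in> T a" "a \<in> J" by (auto simp: U_def V_def)
    have "loc (fst z) = (w, y)" using loc[OF wy(2), of y] wy TF by auto
    then have "H z = Ha a z" using sel[OF wy(4,3)] by (simp add: H_def)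
    then show "\<exists>a. a \<in> J \<and> z \<in> q ` (W \<times> T a) \<times> UNIV \<and> H z = Ha a z"
      using wy by (intro exI[of _ a]) (auto simp: mem_Times_iff)
  qed
  have \<delta>E: "\<delta> a (w, t) \<in> topspace E" if "a \<in> J" "w \<in> W" for a w t
  proof -
    have "(w, t) \<in> topspace ?WR" using that sW(2) by auto
    then show ?thesis using continuous_map_image_subset_topspace[OF \<delta>c[OF that(1)]] by blast
  qed
  have \<delta>v: "\<delta> a (w, 0) = w" "\<delta> a (w, 1) = D a e0" if "a \<in> J" "w \<in> W" for a w
    using C(3)[OF that(2)] \<gamma>(3)[OF that(1)] by (auto simp: \<delta>_def f_def g_def)
  have leafL: "\<exists>y a. a \<in> J \<and> y \<in> T a \<and> L \<subseteq> q ` (W \<times> {y})" if L: "L \<in> leaves (restrict_lamination \<F> U)" for L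
  proof -
    obtain y where "y \<in> V" "L \<subseteq> q ` (W \<times> {y})" using tube_leaf[OF cb sW(3) Vo] L unfolding U_def by metis
    then show ?thesis by (auto simp: V_def)
  qed
  have "tangential_contraction X \<F> U H"
    unfolding tangential_contraction_def tangential_deformation_def
  proof (intro conjI ballI Hc)
    fix L assume "L \<in> leaves (restrict_lamination \<F> U)"
    then obtain y a where y: "a \<in> J" "y \<in> T a" "L \<subseteq> q ` (W \<times> {y})" using leafL by blast
    have yF: "y \<in> topspace F" using TF y by blast
    have "H ` (L \<times> UNIV) \<subseteq> leaf y"
    proof
      fix v assume "v \<in> H ` (L \<times> UNIV)"
      then obtain w t where "w \<in> W" "v = H (q (w, y), t)" using y(3) by blast
      then show "v \<in> leaf y" using Hval[OF _ y(1,2)] \<delta>E[OF y(1)] by (auto simp: leaf_def)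
    qed
    then show "\<exists>L'\<in>leaves \<F>. H ` (L \<times> UNIV) \<subseteq> L'" using yF by (auto simp: leaves_eq)
    show "\<exists>z. \<forall>x\<in>L. H (x, 1) = z"
    proof (intro exI ballI)
      fix x assume "x \<in> L"
      then obtain w where "w \<in> W" "x = q (w, y)" using y(3) by blast
      then show "H (x, 1) = q (D a e0, y)" using Hval[OF _ y(1,2)] \<delta>v(2)[OF y(1)] by simp
    qed
  next
    fix u assume "u \<in> U"
    then obtain w y a where u: "u = q (w, y)" "w \<in> W" "a \<in> J" "y \<in> T a" by (auto simp: U_def V_def)
    then show "H (u, 0) = u" using Hval[OF u(2-4)] \<delta>v(1)[OF u(3,2)] by simp
  qed
  moreover have "deformation_length \<U> U H \<le> enat (l + 2)"
    unfolding deformation_length_def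
  proof (rule SUP_least)
    fix u assume "u \<in> U"
    then obtain w y a where u: "u = q (w, y)" "w \<in> W" "a \<in> J" "y \<in> T a" by (auto simp: U_def V_def)
    have yF: "y \<in> topspace F" using TF u by blast
    obtain P where P: "P \<in> \<Union>(plaques ` \<U>)" "q ` (W \<times> {y}) \<subseteq> P" using W(2) yF unfolding small_def by blast
    obtain Ps where Ps: "plaque_chain \<U> Ps" "Ps \<noteq> []" "length Ps \<le> l"
      "\<And>t. t \<in> {0..1} \<Longrightarrow> q (\<gamma> a t, y) \<in> \<Union>(set Ps)" "q (\<gamma> a 0, y) \<in> hd Ps"
      using \<gamma>(4)[OF u(3)] yF unfolding covers_def by meson
    have "q (w0, y) \<in> P" using P(2) C(1) by blast
    then have "last [P] \<inter> hd Ps \<noteq> {}" using Ps(5) \<gamma>(2)[OF u(3)] by auto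
    moreover have "plaque_chain \<U> [P]" using P(1) by (simp add: plaque_chain_def)
    ultimately have chain: "plaque_chain \<U> ([P] @ Ps)" using Ps(1,2) by (intro plaque_chain_append) auto
    have "(\<lambda>t. H (u, t)) ` {0..1} \<subseteq> \<Union>(set ([P] @ Ps))"
    proof
      fix v assume "v \<in> (\<lambda>t. H (u, t)) ` {0..1}"
      then obtain t where t: "t \<in> {0..1}" "v = q (\<delta> a (w, t), y)" using Hval[OF u(2-4)] u(1) by auto
      show "v \<in> \<Union>(set ([P] @ Ps))"
      proof (cases "t \<le> 1/2")
        case True
        then have "v \<in> P" using t P(2) Cin[OF u(2) fg(1)] by (auto simp: \<delta>_def)
        then show ?thesis by simp
      next
        case False
        then show ?thesis using t Ps(4)[OF fg(2), of t] by (auto simp: \<delta>_def)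
      qed
    qed
    then have "leaf_path_length \<U> (\<lambda>t. H (u, t)) \<le> enat (length ([P] @ Ps) + 1)"
      unfolding leaf_path_length_def using chain by (intro INF_lower) simp
    also have "\<dots> \<le> enat (l + 2)" using Ps(3) by simp
    finally show "leaf_path_length \<U> (\<lambda>t. H (u, t)) \<le> enat (l + 2)" .
  qed
  moreover have "H ` (U \<times> {1}) = (\<lambda>y. q (e0, y)) ` (\<Union>a\<in>J. h (inv\<^bsub>G\<^esub> a) ` T a)"
  proof -
    have end1: "H (q (w, y), 1) = q (e0, h (inv\<^bsub>G\<^esub> a) y)" if "w \<in> W" "a \<in> J" "y \<in> T a" for w y a
    proof -
      have a: "a \<in> carrier G" "inv\<^bsub>G\<^esub> a \<in> carrier G" using that J by auto
      have yF: "y \<in> topspace F" using TF that by blast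
      have "H (q (w, y), 1) = q (D a e0, y)" using Hval[OF that] \<delta>v(2)[OF that(2,1)] by simp
      also have "\<dots> = q (e0, h (inv\<^bsub>G\<^esub> a) y)"
        using q_action[OF a(1) e0 h_in[OF a(2) yF]] h_inv'[OF a(1) yF] by simp
      finally show ?thesis .
    qed
    show ?thesis
    proof (intro equalityI subsetI)
      fix v assume "v \<in> H ` (U \<times> {1})"
      then obtain w y a where "v = H (q (w, y), 1)" "w \<in> W" "a \<in> J" "y \<in> T a" by (auto simp: U_def V_def)
      then show "v \<in> (\<lambda>y. q (e0, y)) ` (\<Union>a\<in>J. h (inv\<^bsub>G\<^esub> a) ` T a)" using end1 by auto
    next
      fix v assume "v \<in> (\<lambda>y. q (e0, y)) ` (\<Union>a\<in>J. h (inv\<^bsub>G\<^esub> a) ` T a)"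
      then obtain a y where v: "a \<in> J" "y \<in> T a" "v = q (e0, h (inv\<^bsub>G\<^esub> a) y)" by auto
      have "v = H (q (w0, y), 1)" using end1[OF C(1) v(1,2)] v(3) by simp
      moreover have "q (w0, y) \<in> U" using C(1) v(1,2) by (auto simp: U_def V_def)
      ultimately show "v \<in> H ` (U \<times> {1})" by blast
    qed
  qed
  ultimately show thesis using that unfolding U_def V_def by blast
qed

end

context measured_suspension
begin

text \<open>The embedding of the fibre in \<open>X\<close> is a Borel isomorphism onto a closed set, so its inverse is a leafwise
  decomposition with a single piece.\<close>

lemma \<mu>_fibre_part:
  assumes V: "openin F V"
  shows "\<mu> ((\<lambda>y. q (e0, y)) ` V) \<le> emeasure \<Lambda> V"
proof -
  define \<iota> where "\<iota> y = q (e0, y)" for y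
  obtain W where W: "ball_sheet W" "e0 \<in> W" using small_ball_sheet[OF openin_topspace e0] by metis
  note sW = ball_sheetD[OF W(1)]
  have VF: "V \<subseteq> topspace F" using V openin_subset by blast
  have inj: "inj_on \<iota> (topspace F)"
  proof (rule inj_onI)
    fix y z assume yz: "y \<in> topspace F" "z \<in> topspace F" "\<iota> y = \<iota> z"
    have "(e0, y) = (e0, z)" by (rule inj_onD[OF q_inj_sheet[OF sW(2,3)]]) (use yz W(2) in \<open>auto simp: \<iota>_def\<close>)
    then show "y = z" by simp
  qed
  \<comment> \<open>The fibre is closed because its preimage in \<open>E \<times> F\<close> is the preimage of a point of \<open>M\<close>.\<close>
  have closed: "closedin X (\<iota> ` topspace F)"
  proof -
    have pt: "closedin M {p e0}" using p_in[OF e0] by (intro closedin_Hausdorff_singleton M_Hausdorff)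
    have "openin E {e \<in> topspace E. p e \<in> topspace M - {p e0}}"
      by (rule openin_continuous_map_preimage[OF p_cont]) (use pt in blast)
    then have "openin X (q ` ({e \<in> topspace E. p e \<in> topspace M - {p e0}} \<times> topspace F))"
      by (intro q_open_Times) auto
    moreover have "q ` ({e \<in> topspace E. p e \<in> topspace M - {p e0}} \<times> topspace F) = topspace X - \<iota> ` topspace F"
    proof (intro equalityI subsetI)
      fix u assume "u \<in> q ` ({e \<in> topspace E. p e \<in> topspace M - {p e0}} \<times> topspace F)"
      then obtain e y where u: "u = q (e, y)" "e \<in> topspace E" "p e \<noteq> p e0" "y \<in> topspace F" by auto
      have "u \<notin> \<iota> ` topspace F"
      proof
        assume "u \<in> \<iota> ` topspace F"
        then obtain z where z: "z \<in> topspace F" "q (e, y) = q (e0, z)" using u(1) by (auto simp: \<iota>_def)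
        then obtain a where "a \<in> carrier G" "e0 = D a e" using q_eq_iff[OF u(2,4) e0 z(1)] by metis
        then show False using p_D[of a e] u by simp
      qed
      then show "u \<in> topspace X - \<iota> ` topspace F" using u q_in by simp
    next
      fix u assume u: "u \<in> topspace X - \<iota> ` topspace F"
      then obtain e y where e: "u = q (e, y)" "e \<in> topspace E" "y \<in> topspace F" by (auto simp: topspace_X)
      have "p e \<noteq> p e0"
      proof
        assume "p e = p e0"
        then obtain a where a: "a \<in> carrier G" "e0 = D a e" using D_transport[OF e(2) e0] by blast
        then have "u = \<iota> (h a y)" using q_action[OF a(1) e(2,3)] e(1) by (simp add: \<iota>_def)
        then show False using u h_in[OF a(1) e(3)] by blast
      qed
      then have "e \<in> {e \<in> topspace E. p e \<in> topspace M - {p e0}}" using e p_in by simp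
      then show "u \<in> q ` ({e \<in> topspace E. p e \<in> topspace M - {p e0}} \<times> topspace F)" using e by blast
    qed
    ultimately have "openin X (topspace X - \<iota> ` topspace F)" by simp
    moreover have "\<iota> ` topspace F \<subseteq> topspace X" using q_in[OF e0] by (auto simp: \<iota>_def)
    ultimately show ?thesis by (simp add: closedin_def)
  qed
  have \<iota>open: "\<iota> ` O' \<in> sets (borel_of X)" if O': "openin F O'" for O'
  proof -
    have OF: "O' \<subseteq> topspace F" using O' openin_subset by blast
    have "\<iota> ` O' = \<iota> ` topspace F \<inter> q ` (W \<times> O')"
    proof (intro equalityI subsetI)
      fix u assume "u \<in> \<iota> ` topspace F \<inter> q ` (W \<times> O')"
      then obtain y w z where u: "u = q (e0, y)" "y \<in> topspace F" "w \<in> W" "z \<in> O'" "q (e0, y) = q (w, z)"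
        by (auto simp: \<iota>_def)
      have "(e0, y) = (w, z)" by (rule inj_onD[OF q_inj_sheet[OF sW(2,3)] u(5)]) (use u W(2) OF in auto)
      then show "u \<in> \<iota> ` O'" using u by (auto simp: \<iota>_def)
    qed (use OF W(2) in \<open>auto simp: \<iota>_def\<close>)
    moreover have "q ` (W \<times> O') \<in> sets (borel_of X)" by (rule borel_of_open[OF q_open_Times[OF sW(1) O']])
    moreover have "\<iota> ` topspace F \<in> sets (borel_of X)"
    proof -
      have "openin X (topspace X - \<iota> ` topspace F)" using closed by (simp add: closedin_def)
      then have "space (borel_of X) - (topspace X - \<iota> ` topspace F) \<in> sets (borel_of X)"
        by (intro sets.compl_sets borel_of_open)
      moreover have "space (borel_of X) - (topspace X - \<iota> ` topspace F) = \<iota> ` topspace F"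
        using closedin_subset[OF closed] by (auto simp: space_borel_of)
      ultimately show ?thesis by simp
    qed
    ultimately show ?thesis by simp
  qed
  define f where "f = inv_into (topspace F) \<iota>"
  have f: "f (\<iota> y) = y" if "y \<in> topspace F" for y unfolding f_def by (rule inv_into_f_f[OF inj that])
  have sp: "space (restrict_space (borel_of X) (\<iota> ` V)) = \<iota> ` V"
    using VF q_in[OF e0] by (auto simp: space_restrict_space space_borel_of \<iota>_def)
  have "f \<in> measurable (restrict_space (borel_of X) (\<iota> ` V)) (borel_of F)"
  proof (rule measurable_into_borel_of)
    show "f x \<in> topspace F" if "x \<in> space (restrict_space (borel_of X) (\<iota> ` V))" for x
      using that f VF unfolding sp by auto
    fix O' assume O': "openin F O'"
    have "f -` O' \<inter> \<iota> ` V = \<iota> ` (O' \<inter> V)" using f VF by auto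
    moreover have "\<iota> ` (O' \<inter> V) \<in> sets (restrict_space (borel_of X) (\<iota> ` V))"
      using \<iota>open[OF openin_Int[OF O' V]] \<iota>open[OF V] by (subst sets_restrict_space_iff) auto
    ultimately show "f -` O' \<inter> space (restrict_space (borel_of X) (\<iota> ` V)) \<in> sets (restrict_space (borel_of X) (\<iota> ` V))"
      unfolding sp by simp
  qed
  then have fm: "f \<in> measurable (restrict_space (borel_of X) (\<iota> ` V)) \<Lambda>"
    using measurable_cong_sets[OF refl sets_\<Lambda>] by blast
  have fim: "f ` \<iota> ` V = V" using f VF by (auto simp: image_image subset_iff)
  define P where "P i = (if i = (0::nat) then \<iota> ` V else {})" for i
  have "leafwise_decomposition X \<F> \<iota> \<Lambda> (\<iota> ` V) P (\<lambda>_. f)"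
    unfolding leafwise_decomposition_def
  proof (intro conjI allI ballI)
    show "disjoint_family P" by (auto simp: disjoint_family_on_def P_def)
    show "(\<Union>i. P i) = \<iota> ` V" by (auto simp: P_def)
    fix i
    show "P i \<in> sets (borel_of X)" using \<iota>open[OF V] by (simp add: P_def)
    show "f \<in> measurable (restrict_space (borel_of X) (P i)) \<Lambda>"
    proof (cases "i = 0")
      case False
      then show ?thesis by (intro measurableI) (auto simp: P_def space_restrict_space)
    qed (use fm in \<open>simp add: P_def\<close>)
    show "inj_on f (P i)"
    proof (rule inj_onI)
      fix x x' assume x: "x \<in> P i" "x' \<in> P i" "f x = f x'"
      then obtain y y' where y: "y \<in> V" "x = \<iota> y" "y' \<in> V" "x' = \<iota> y'" by (auto simp: P_def split: if_splits)
      then show "x = x'" using f[OF subsetD[OF VF y(1)]] f[OF subsetD[OF VF y(3)]] x(3) by simp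
    qed
    show "f ` P i \<in> sets \<Lambda>" using fim open_\<Lambda>[OF V] by (simp add: P_def)
    fix x assume "x \<in> P i"
    then obtain y where y: "y \<in> V" "x = \<iota> y" by (auto simp: P_def split: if_splits)
    then have "\<iota> (f x) = x" "y \<in> topspace F" using f VF by auto
    moreover have "x \<in> leaf y" using y e0 by (auto simp: leaf_def \<iota>_def)
    ultimately show "\<exists>L\<in>leaves \<F>. x \<in> L \<and> \<iota> (f x) \<in> L" by (auto simp: leaves_eq)
  qed
  moreover have "(\<Sum>i. emeasure \<Lambda> (f ` P i)) = emeasure \<Lambda> V"
  proof -
    have "(\<Sum>i. emeasure \<Lambda> (f ` P i)) = (\<Sum>i\<in>{0}. emeasure \<Lambda> (f ` P i))"
      by (rule suminf_finite) (auto simp: P_def)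
    then show ?thesis using fim by (simp add: P_def)
  qed
  moreover have "(\<lambda>y. q (e0, y)) = \<iota>" by (simp add: \<iota>_def[abs_def])
  ultimately show ?thesis
    unfolding suspension_measure_def transverse_extension_def
    by (intro Inf_lower) (force intro!: exI[of _ P] exI[of _ "\<lambda>_. f"])
qed

end

section \<open>The upper bound\<close>

lemma separate_compact_sets:
  assumes "Hausdorff_space X" and J: "finite J" and C: "\<And>a. a \<in> J \<Longrightarrow> compactin X (C a)" "disjoint_family_on C J"
  obtains T where "\<And>a. a \<in> J \<Longrightarrow> openin X (T a)" "\<And>a. a \<in> J \<Longrightarrow> C a \<subseteq> T a" "disjoint_family_on T J"
proof -
  have "\<exists>U. fst z \<in> J \<and> snd z \<in> J \<and> fst z \<noteq> snd z \<longrightarrow> openin X (fst U) \<and> openin X (snd U) \<and>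
      C (fst z) \<subseteq> fst U \<and> C (snd z) \<subseteq> snd U \<and> disjnt (fst U) (snd U)" for z
  proof (cases "fst z \<in> J \<and> snd z \<in> J \<and> fst z \<noteq> snd z")
    case True
    then have "disjnt (C (fst z)) (C (snd z))" using C(2) by (auto simp: disjoint_family_on_def disjnt_def)
    then obtain U V where "openin X U" "openin X V" "C (fst z) \<subseteq> U" "C (snd z) \<subseteq> V" "disjnt U V"
      using assms(1) C(1) True unfolding Hausdorff_space_compact_sets by metis
    then show ?thesis by (intro exI[of _ "(U, V)"]) simp
  qed auto
  then obtain U where U: "\<And>a b. a \<in> J \<Longrightarrow> b \<in> J \<Longrightarrow> a \<noteq> b \<Longrightarrow> openin X (fst (U (a, b))) \<and> openin X (snd (U (a, b))) \<and>
      C a \<subseteq> fst (U (a, b)) \<and> C b \<subseteq> snd (U (a, b)) \<and> disjnt (fst (U (a, b))) (snd (U (a, b)))"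
    by (metis fst_conv snd_conv)
  define T where "T a = topspace X \<inter> \<Inter>((\<lambda>b. fst (U (a, b)) \<inter> snd (U (b, a))) ` (J - {a}))" for a
  show thesis
  proof (rule that[of T])
    fix a assume a: "a \<in> J"
    show "openin X (T a)"
    proof (cases "J - {a} = {}")
      case False
      have "openin X (\<Inter>((\<lambda>b. fst (U (a, b)) \<inter> snd (U (b, a))) ` (J - {a})))"
        using False J U a by (intro openin_Inter) (auto intro!: openin_Int)
      then show ?thesis unfolding T_def by blast
    qed (simp only: T_def image_empty Inter_empty Int_UNIV_right openin_topspace)
    show "C a \<subseteq> T a"
    proof
      fix x assume x: "x \<in> C a"
      have "x \<in> fst (U (a, b)) \<inter> snd (U (b, a))" if "b \<in> J - {a}" for b
        using U[of a b] U[of b a] that a x by blast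
      moreover have "x \<in> topspace X" using x compactin_subset_topspace[OF C(1)[OF a]] by blast
      ultimately show "x \<in> T a" by (simp add: T_def)
    qed
  next
    show "disjoint_family_on T J" unfolding disjoint_family_on_def
    proof (intro ballI impI)
      fix a b assume ab: "a \<in> J" "b \<in> J" "a \<noteq> b"
      have "T a \<subseteq> fst (U (a, b))" "T b \<subseteq> snd (U (a, b))" using ab by (auto simp: T_def)
      then show "T a \<inter> T b = {}" using U[OF ab] unfolding disjnt_def by blast
    qed
  qed
qed

lemma disjoint_family_on_subset:
  assumes "disjoint_family_on P J" "\<And>a. a \<in> J \<Longrightarrow> C a \<subseteq> P a" shows "disjoint_family_on C J"
  unfolding disjoint_family_on_def
proof (intro ballI impI)
  fix a b assume ab: "a \<in> J" "b \<in> J" "a \<noteq> b"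
  have "P a \<inter> P b = {}" by (rule disjoint_family_onD[OF assms(1) ab])
  then show "C a \<inter> C b = {}" using Int_mono[OF assms(2)[OF ab(1)] assms(2)[OF ab(2)]] by simp
qed

context measured_suspension
begin

text \<open>Words of length \<open>2 l\<close> are the quotients of words of length \<open>l\<close>: the translates \<open>h a V\<close> with \<open>a \<in> S\<^sub>l\<close> are disjoint.\<close>

definition separated :: "nat \<Rightarrow> 'f set \<Rightarrow> bool" where
  "separated l V \<longleftrightarrow> (\<forall>a\<in>wb (2 * l). a \<noteq> \<one>\<^bsub>G\<^esub> \<longrightarrow> V \<inter> h a ` V = {})"

lemma separated_nbhd:
  assumes y: "y \<in> topspace F"
  shows "\<exists>V. openin F V \<and> y \<in> V \<and> separated l V"
proof -
  let ?J = "wb (2 * l) - {\<one>\<^bsub>G\<^esub>}"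
  have "\<exists>V. openin F V \<and> y \<in> V \<and> V \<inter> h a ` V = {}" if a: "a \<in> ?J" for a
  proof -
    have ac: "a \<in> carrier G" "a \<noteq> \<one>\<^bsub>G\<^esub>" using a wb_closed by auto
    then have "h a y \<noteq> y" using h_free y by blast
    then obtain U U' where U: "openin F U" "openin F U'" "y \<in> U" "h a y \<in> U'" "disjnt U U'"
      using F_Hausdorff y h_in[OF ac(1) y] unfolding Hausdorff_space_def by metis
    let ?V = "U \<inter> {z \<in> topspace F. h a z \<in> U'}"
    have "openin F ?V" using U(1) openin_continuous_map_preimage[OF h_cont[OF ac(1)] U(2)] by (rule openin_Int)
    moreover have "?V \<inter> h a ` ?V = {}" using U(5) by (auto simp: disjnt_def)
    ultimately show ?thesis using U(3,4) y by (intro exI[of _ ?V]) simp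
  qed
  then have "\<forall>a\<in>?J. \<exists>V. openin F V \<and> y \<in> V \<and> V \<inter> h a ` V = {}" by blast
  then obtain V where V: "\<forall>a\<in>?J. openin F (V a) \<and> y \<in> V a \<and> V a \<inter> h a ` V a = {}" by (rule bchoice[THEN exE])
  define Q where "Q = topspace F \<inter> \<Inter>(V ` ?J)"
  have "openin F Q"
  proof (cases "?J = {}")
    case False
    have "openin F (\<Inter>(V ` ?J))" using False V wb_finite by (intro openin_Inter) auto
    then show ?thesis unfolding Q_def by blast
  qed (simp only: Q_def image_empty Inter_empty Int_UNIV_right openin_topspace)
  moreover have "y \<in> Q" using V y by (auto simp: Q_def)
  moreover have "separated l Q" unfolding separated_def
  proof (intro ballI impI)
    fix a assume "a \<in> wb (2 * l)" "a \<noteq> \<one>\<^bsub>G\<^esub>"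
    then have a: "a \<in> ?J" by simp
    have "Q \<subseteq> V a" using a unfolding Q_def by blast
    then show "Q \<inter> h a ` Q = {}" using V a by blast
  qed
  ultimately show ?thesis by blast
qed

text \<open>A Borel set whose translates by words of length \<open>l\<close> are disjoint, maximal enough for its translates
  by words of length \<open>2 l\<close> to cover \<open>F\<close>: run through a finite cover by separated open sets and add the part
  of each that is not yet covered.\<close>

lemma marker_set:
  obtains V where "V \<in> sets \<Lambda>" "separated l V" "topspace F \<subseteq> (\<Union>a\<in>wb (2 * l). h a ` V)"
proof -
  obtain \<O> where O: "finite \<O>" "\<And>V. V \<in> \<O> \<Longrightarrow> openin F V" "\<And>V. V \<in> \<O> \<Longrightarrow> separated l V" "topspace F \<subseteq> \<Union>\<O>"
    using compact_space_subcover[OF F_compact separated_nbhd] by metis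
  have "\<exists>V. V \<in> sets \<Lambda> \<and> separated l V \<and> \<Union>\<O> \<subseteq> (\<Union>a\<in>wb (2 * l). h a ` V)"
    using O(1-3)
  proof (induction \<O> rule: finite_induct)
    case empty
    show ?case by (intro exI[of _ "{}"]) (simp add: separated_def)
  next
    case (insert Q \<O>)
    then obtain V where V: "V \<in> sets \<Lambda>" "separated l V" "\<Union>\<O> \<subseteq> (\<Union>a\<in>wb (2 * l). h a ` V)" by blast
    define Z where "Z = (\<Union>a\<in>wb (2 * l). h a ` V)"
    define V' where "V' = V \<union> (Q - Z)"
    have Q: "openin F Q" "separated l Q" using insert.prems by auto
    have QF: "Q \<subseteq> topspace F" using Q(1) openin_subset by blast
    have VF: "V \<subseteq> topspace F" using sets.sets_into_space[OF V(1)] space_\<Lambda> by simp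
    have Zm: "Z \<in> sets \<Lambda>" unfolding Z_def
      using wb_finite invariant[OF wb_closed V(1)] by (intro sets.finite_UN) auto
    have "V' \<in> sets \<Lambda>" unfolding V'_def using V(1) Zm open_\<Lambda>[OF Q(1)] by blast
    moreover have "separated l V'" unfolding separated_def
    proof (intro ballI impI, rule ccontr)
      fix a assume a: "a \<in> wb (2 * l)" "a \<noteq> \<one>\<^bsub>G\<^esub>" "V' \<inter> h a ` V' \<noteq> {}"
      have ac: "a \<in> carrier G" using wb_closed[OF a(1)] .
      obtain v where v: "v \<in> V'" "h a v \<in> V'" using a(3) by blast
      have vF: "v \<in> topspace F" using v(1) VF QF by (auto simp: V'_def)
      consider "v \<in> V" "h a v \<in> V" | "v \<in> V" "h a v \<notin> Z" | "h a v \<in> V" "v \<notin> Z" | "v \<in> Q" "h a v \<in> Q"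
        using v by (auto simp: V'_def)
      then show False
      proof cases
        case 1 then show ?thesis using V(2) a(1,2) unfolding separated_def by blast
      next
        case 2 then show ?thesis using a(1) by (auto simp: Z_def)
      next
        case 3
        have "v = h (inv\<^bsub>G\<^esub> a) (h a v)" using h_inv[OF ac vF] by simp
        then have "v \<in> Z" unfolding Z_def using 3(1) wb_inv[OF a(1)] by blast
        then show ?thesis using 3(2) by simp
      next
        case 4 then show ?thesis using Q(2) a(1,2) unfolding separated_def by blast
      qed
    qed
    moreover have "\<Union>(insert Q \<O>) \<subseteq> (\<Union>a\<in>wb (2 * l). h a ` V')"
    proof
      fix x assume x: "x \<in> \<Union>(insert Q \<O>)"
      show "x \<in> (\<Union>a\<in>wb (2 * l). h a ` V')"
      proof (cases "x \<in> Z")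
        case True
        then show ?thesis unfolding Z_def V'_def by blast
      next
        case False
        then have "x \<in> Q" using x V(3) unfolding Z_def by blast
        then have "x \<in> V'" "h \<one>\<^bsub>G\<^esub> x = x" using False QF h_one by (auto simp: V'_def)
        then have "x \<in> h \<one>\<^bsub>G\<^esub> ` V'" by (metis imageI)
        then show ?thesis using wb_one by blast
      qed
    qed
    ultimately show ?case by blast
  qed
  then show thesis using that O(4) by blast
qed

text \<open>The translates by words of length \<open>l\<close> are disjoint and have equal measures.\<close>

lemma marker_measure:
  assumes V: "V \<in> sets \<Lambda>" "separated l V"
  shows "measure \<Lambda> V \<le> 1 / card (wb l)"
proof -
  interpret prob_space \<Lambda> by (rule prob_\<Lambda>)
  have VF: "V \<subseteq> topspace F" using sets.sets_into_space[OF V(1)] space_\<Lambda> by simp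
  have disj: "disjoint_family_on (\<lambda>a. h a ` V) (wb l)"
    unfolding disjoint_family_on_def
  proof (intro ballI impI, rule ccontr)
    fix a b assume ab: "a \<in> wb l" "b \<in> wb l" "a \<noteq> b" "h a ` V \<inter> h b ` V \<noteq> {}"
    then obtain v w where vw: "v \<in> V" "w \<in> V" "h a v = h b w" by blast
    have c: "a \<in> carrier G" "b \<in> carrier G" "v \<in> topspace F" "w \<in> topspace F"
      using wb_closed[OF ab(1)] wb_closed[OF ab(2)] vw VF by auto
    have m: "inv\<^bsub>G\<^esub> b \<otimes>\<^bsub>G\<^esub> a \<in> wb (2 * l)" using wb_mult[OF wb_inv[OF ab(2)] ab(1)] by (simp add: mult_2)
    have "h (inv\<^bsub>G\<^esub> b \<otimes>\<^bsub>G\<^esub> a) v = w" using c vw(3) by (simp add: h_mult h_inv)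
    then have "V \<inter> h (inv\<^bsub>G\<^esub> b \<otimes>\<^bsub>G\<^esub> a) ` V \<noteq> {}" using vw(1,2) by blast
    then have "inv\<^bsub>G\<^esub> b \<otimes>\<^bsub>G\<^esub> a = \<one>\<^bsub>G\<^esub>" using V(2) m unfolding separated_def by blast
    then have "h b w = h b v" using \<open>h (inv\<^bsub>G\<^esub> b \<otimes>\<^bsub>G\<^esub> a) v = w\<close> h_one c(3) by simp
    then have "h a v = h b v" using vw(3) by simp
    then show False using h_inj[OF c(1,2,3)] ab(3) by simp
  qed
  have meas: "h a ` V \<in> sets \<Lambda>" "measure \<Lambda> (h a ` V) = measure \<Lambda> V" if "a \<in> wb l" for a
    using invariant[OF wb_closed[OF that] V(1)] by (auto simp: measure_def)
  have "measure \<Lambda> (\<Union>a\<in>wb l. h a ` V) = (\<Sum>a\<in>wb l. measure \<Lambda> (h a ` V))"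
    using meas(1) disj wb_finite by (intro finite_measure_finite_Union) auto
  also have "\<dots> = card (wb l) * measure \<Lambda> V" using meas(2) by simp
  finally have "card (wb l) * measure \<Lambda> V \<le> 1" using prob_le_1[of "\<Union>a\<in>wb l. h a ` V"] by simp
  moreover have "card (wb l) > 0" using wb_one wb_finite by (auto simp: card_gt_0_iff)
  ultimately show ?thesis by (simp add: field_simps)
qed

lemma inner_approximation:
  assumes B: "B \<in> sets \<Lambda>" and \<delta>: "\<delta> > 0"
  obtains C where "compactin F C" "C \<subseteq> B" "measure \<Lambda> B \<le> measure \<Lambda> C + \<delta>"
proof (cases "measure \<Lambda> B \<le> \<delta>")
  case True
  then show thesis using that[of "{}"] by simp
next
  case False
  note witness = that
  interpret prob_space \<Lambda> by (rule prob_\<Lambda>)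
  show thesis
  proof (rule ccontr)
    assume no: "\<not> thesis"
    have "emeasure \<Lambda> C \<le> ennreal (measure \<Lambda> B - \<delta>)" if "compactin F C" "C \<subseteq> B" for C
    proof -
      have "\<not> measure \<Lambda> B \<le> measure \<Lambda> C + \<delta>" using witness[OF that] no by blast
      then show ?thesis unfolding emeasure_eq_measure by (intro ennreal_leI) simp
    qed
    then have "(SUP K\<in>{K. compactin F K \<and> K \<subseteq> B}. emeasure \<Lambda> K) \<le> ennreal (measure \<Lambda> B - \<delta>)"
      by (intro SUP_least) blast
    moreover have "emeasure \<Lambda> B = (SUP K\<in>{K. compactin F K \<and> K \<subseteq> B}. emeasure \<Lambda> K)"
      using regular_\<Lambda> B unfolding regular_measure_def by blast
    ultimately have "ennreal (measure \<Lambda> B) \<le> ennreal (measure \<Lambda> B - \<delta>)" by (simp add: emeasure_eq_measure)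
    then have "measure \<Lambda> B \<le> measure \<Lambda> B - \<delta>" using False by (subst (asm) ennreal_le_iff) auto
    then show False using \<delta> by simp
  qed
qed

lemma outer_approximation:
  assumes B: "B \<in> sets \<Lambda>" and r: "measure \<Lambda> B < r"
  obtains U where "openin F U" "B \<subseteq> U" "measure \<Lambda> U < r"
proof -
  interpret prob_space \<Lambda> by (rule prob_\<Lambda>)
  have r0: "r > 0" using r measure_nonneg[of \<Lambda> B] by linarith
  have "emeasure \<Lambda> B = (INF U\<in>{U. openin F U \<and> B \<subseteq> U}. emeasure \<Lambda> U)"
    using regular_\<Lambda> B unfolding regular_measure_def by blast
  moreover have "emeasure \<Lambda> B < ennreal r" using r by (simp add: emeasure_eq_measure ennreal_lessI r0)
  ultimately obtain U where U: "openin F U" "B \<subseteq> U" "emeasure \<Lambda> U < ennreal r" by (auto simp: INF_less_iff)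
  then have "measure \<Lambda> U < r" by (simp add: emeasure_eq_measure ennreal_less_iff)
  then show thesis using that U by blast
qed

lemma h_inv_image:
  assumes "a \<in> carrier G" "T \<subseteq> topspace F"
  shows "h (inv\<^bsub>G\<^esub> a) ` T = {y \<in> topspace F. h a y \<in> T}"
proof (intro equalityI subsetI)
  fix y assume "y \<in> h (inv\<^bsub>G\<^esub> a) ` T"
  then obtain t where "t \<in> T" "y = h (inv\<^bsub>G\<^esub> a) t" by blast
  then show "y \<in> {y \<in> topspace F. h a y \<in> T}" using assms h_in[of "inv\<^bsub>G\<^esub> a" t] h_inv' by auto
next
  fix y assume y: "y \<in> {y \<in> topspace F. h a y \<in> T}"
  then have "y = h (inv\<^bsub>G\<^esub> a) (h a y)" using h_inv assms(1) by simp
  then show "y \<in> h (inv\<^bsub>G\<^esub> a) ` T" using y by blast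
qed

text \<open>The translates of a marker set by words of length \<open>2 l\<close> cover \<open>F\<close>. They are made disjoint by giving
  each point to the first translate that contains it, and shrunk to compact sets by regularity; these have disjoint
  open neighbourhoods \<open>T a\<close>, which can be chosen inside the translates of an open neighbourhood \<open>V\<close> of the marker.
  The points missed by the compact sets form the small open set \<open>O'\<close>.\<close>

lemma transversal_partition:
  obtains T O' V where "\<forall>a\<in>wb (2 * l). openin F (T a)" "disjoint_family_on T (wb (2 * l))"
    "openin F O'" "topspace F \<subseteq> O' \<union> (\<Union>a\<in>wb (2 * l). T a)" "openin F V"
    "(\<Union>a\<in>wb (2 * l). h (inv\<^bsub>G\<^esub> a) ` T a) \<subseteq> V"
    "measure \<Lambda> V \<le> 2 / card (wb l)" "measure \<Lambda> O' \<le> 2 / card (wb l)"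
proof -
  interpret prob_space \<Lambda> by (rule prob_\<Lambda>)
  define N where "N = card (wb l)"
  define J where "J = wb (2 * l)"
  have N: "N > 0" unfolding N_def using wb_one wb_finite by (auto simp: card_gt_0_iff)
  have J: "finite J" "\<one>\<^bsub>G\<^esub> \<in> J" "J \<subseteq> carrier G" unfolding J_def using wb_finite wb_one wb_closed by auto
  then have cJ: "card J > 0" by (auto simp: card_gt_0_iff)
  obtain V0 where V0: "V0 \<in> sets \<Lambda>" "separated l V0" "topspace F \<subseteq> (\<Union>a\<in>J. h a ` V0)"
    using marker_set unfolding J_def by metis
  have V0F: "V0 \<subseteq> topspace F" using sets.sets_into_space[OF V0(1)] space_\<Lambda> by simp
  have "measure \<Lambda> V0 \<le> 1 / N" using marker_measure[OF V0(1,2)] by (simp add: N_def)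
  also have "\<dots> < 2 / N" using N by (simp add: divide_strict_right_mono)
  finally obtain V where V: "openin F V" "V0 \<subseteq> V" "measure \<Lambda> V < 2 / N" using outer_approximation[OF V0(1)] by blast
  obtain idx :: "'g \<Rightarrow> nat" where idx: "inj_on idx J" using finite_imp_inj_to_nat_seg[OF J(1)] by blast
  define P where "P a = h a ` V0 - (\<Union>b\<in>{b \<in> J. idx b < idx a}. h b ` V0)" for a
  have hV: "h a ` V0 \<in> sets \<Lambda>" if "a \<in> J" for a using invariant V0(1) J(3) that by blast
  have Pm: "P a \<in> sets \<Lambda>" if "a \<in> J" for a
    unfolding P_def using hV that J(1) by (intro sets.Diff sets.finite_UN) auto
  have Pdisj: "disjoint_family_on P J" unfolding disjoint_family_on_def
  proof (intro ballI impI)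
    fix a b assume ab: "a \<in> J" "b \<in> J" "a \<noteq> b"
    then have "idx a < idx b \<or> idx b < idx a" using idx by (metis inj_onD linorder_neqE_nat)
    then show "P a \<inter> P b = {}" using ab by (auto simp: P_def)
  qed
  have Pcov: "topspace F \<subseteq> (\<Union>a\<in>J. P a)"
  proof
    fix y assume "y \<in> topspace F"
    then obtain a0 where a0: "a0 \<in> J" "y \<in> h a0 ` V0" using V0(3) by blast
    define hit where "hit a \<longleftrightarrow> a \<in> J \<and> y \<in> h a ` V0" for a
    have "hit a0" using a0 by (simp add: hit_def)
    from arg_min_nat_lemma[of hit, OF this, of idx] obtain a where a': "hit a" "\<And>b. hit b \<Longrightarrow> idx a \<le> idx b" by metis
    then have a: "a \<in> J \<and> y \<in> h a ` V0" "\<And>b. b \<in> J \<and> y \<in> h b ` V0 \<Longrightarrow> idx a \<le> idx b"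
      by (simp_all add: hit_def)
    have "\<not> idx b < idx a" if "b \<in> J" "y \<in> h b ` V0" for b using a(2)[of b] that by simp
    then have "y \<in> P a" unfolding P_def using a(1) by blast
    then show "y \<in> (\<Union>a\<in>J. P a)" using a(1) by blast
  qed
  \<comment> \<open>The losses of the \<open>card J\<close> inner approximations add up to \<open>1 / N\<close>.\<close>
  define \<delta> where "\<delta> = 1 / (N * card J)"
  have \<delta>: "\<delta> > 0" using N cJ by (simp add: \<delta>_def)
  have "\<forall>a\<in>J. \<exists>C. compactin F C \<and> C \<subseteq> P a \<and> measure \<Lambda> (P a) \<le> measure \<Lambda> C + \<delta>"
    using inner_approximation[OF Pm \<delta>] by metis
  then obtain C where "\<forall>a\<in>J. compactin F (C a) \<and> C a \<subseteq> P a \<and> measure \<Lambda> (P a) \<le> measure \<Lambda> (C a) + \<delta>"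
    by (rule bchoice[THEN exE])
  then have C: "\<And>a. a \<in> J \<Longrightarrow> compactin F (C a)" "\<And>a. a \<in> J \<Longrightarrow> C a \<subseteq> P a"
    "\<And>a. a \<in> J \<Longrightarrow> measure \<Lambda> (P a) \<le> measure \<Lambda> (C a) + \<delta>" by blast+
  have "disjoint_family_on C J" by (rule disjoint_family_on_subset[OF Pdisj C(2)])
  from separate_compact_sets[OF F_Hausdorff J(1) C(1) this] obtain T0 where
    T0: "\<And>a. a \<in> J \<Longrightarrow> openin F (T0 a)" "\<And>a. a \<in> J \<Longrightarrow> C a \<subseteq> T0 a" "disjoint_family_on T0 J"
    by blast
  define T where "T a = T0 a \<inter> {y \<in> topspace F. h (inv\<^bsub>G\<^esub> a) y \<in> V}" for a
  have To: "openin F (T a)" if "a \<in> J" for a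
  proof -
    have "inv\<^bsub>G\<^esub> a \<in> carrier G" using that J(3) by auto
    from openin_continuous_map_preimage[OF h_cont[OF this] V(1)] show ?thesis
      unfolding T_def using T0(1)[OF that] by (rule openin_Int[rotated])
  qed
  have CT: "C a \<subseteq> T a" if a: "a \<in> J" for a
  proof
    fix y assume y: "y \<in> C a"
    then obtain v where v: "v \<in> V0" "y = h a v" using C(2)[OF a] by (auto simp: P_def)
    have ac: "a \<in> carrier G" using a J(3) by blast
    have vF: "v \<in> topspace F" using v(1) V0F by blast
    then have "h (inv\<^bsub>G\<^esub> a) y \<in> V" "y \<in> topspace F" using v h_inv[OF ac vF] h_in[OF ac vF] V(2) by auto
    then show "y \<in> T a" using T0(2)[OF a] y by (auto simp: T_def)
  qed
  define O' where "O' = topspace F - (\<Union>a\<in>J. C a)"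
  have Ccl: "closedin F (C a)" if "a \<in> J" for a using compactin_imp_closedin[OF F_Hausdorff C(1)[OF that]] .
  have O'o: "openin F O'" unfolding O'_def using Ccl J(1) by (intro openin_diff closedin_Union) auto
  have Cm: "C a \<in> sets \<Lambda>" if "a \<in> J" for a
  proof -
    have "topspace F - C a \<in> sets \<Lambda>" using open_\<Lambda> Ccl[OF that] by (simp add: closedin_def)
    then have "space \<Lambda> - (topspace F - C a) \<in> sets \<Lambda>" by (rule sets.compl_sets)
    moreover have "space \<Lambda> - (topspace F - C a) = C a" using closedin_subset[OF Ccl[OF that]] by (auto simp: space_\<Lambda>)
    ultimately show ?thesis by simp
  qed
  have "O' \<subseteq> (\<Union>a\<in>J. P a - C a)"
  proof
    fix y assume y: "y \<in> O'"
    then obtain a where "a \<in> J" "y \<in> P a" using Pcov by (auto simp: O'_def)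
    then show "y \<in> (\<Union>a\<in>J. P a - C a)" using y by (auto simp: O'_def)
  qed
  then have "measure \<Lambda> O' \<le> measure \<Lambda> (\<Union>a\<in>J. P a - C a)"
    using Pm Cm J(1) by (intro finite_measure_mono) auto
  also have "\<dots> \<le> (\<Sum>a\<in>J. measure \<Lambda> (P a - C a))"
    using Pm Cm J(1) by (intro finite_measure_subadditive_finite) auto
  also have "\<dots> \<le> (\<Sum>a\<in>J. \<delta>)"
  proof (rule sum_mono)
    fix a assume a: "a \<in> J"
    have "measure \<Lambda> (P a - C a) = measure \<Lambda> (P a) - measure \<Lambda> (C a)"
      using Pm[OF a] Cm[OF a] C(2)[OF a] by (rule finite_measure_Diff)
    then show "measure \<Lambda> (P a - C a) \<le> \<delta>" using C(3)[OF a] by simp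
  qed
  also have "\<dots> = 1 / N" using cJ by (simp add: \<delta>_def)
  also have "\<dots> \<le> 2 / N" by (simp add: divide_right_mono)
  finally have O'm: "measure \<Lambda> O' \<le> 2 / N" .
  show thesis
  proof (rule that[of T O' V])
    show "disjoint_family_on T (wb (2 * l))"
      unfolding J_def[symmetric] by (rule disjoint_family_on_subset[OF T0(3)]) (auto simp: T_def)
    show "topspace F \<subseteq> O' \<union> (\<Union>a\<in>wb (2 * l). T a)" unfolding J_def[symmetric] O'_def using CT by blast
    show "(\<Union>a\<in>wb (2 * l). h (inv\<^bsub>G\<^esub> a) ` T a) \<subseteq> V" by (auto simp: T_def)
    show "measure \<Lambda> V \<le> 2 / card (wb l)" using V(3) by (simp add: N_def)
    show "measure \<Lambda> O' \<le> 2 / card (wb l)" using O'm by (simp add: N_def)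
  qed (use To O'o V(1) in \<open>auto simp: J_def\<close>)
qed

text \<open>\<open>X\<close> is covered by two tubes for each member \<open>W\<close> of a finite family of small sheets over \<open>M\<close>: one over the
  pieces of the transversal partition, contracted along words of length \<open>2 l\<close>, and one over the remaining small
  open set, contracted inside its own copy in the fibre. Their number depends on the atlas only.\<close>

lemma Cat_bounded_upper:
  assumes reg: "regular_atlas n X \<F> \<U>"
  obtains B and C :: real where "B \<ge> 1" "C > 0"
    "\<And>l. l \<ge> 1 \<Longrightarrow> Cat_bounded X \<F> \<mu> (B * l) \<U> \<le> ennreal (C / card (wb l))"
proof -
  interpret prob_space \<Lambda> by (rule prob_\<Lambda>)
  have UF: "\<U> \<subseteq> \<F>" and cov: "(\<Union>c\<in>\<U>. chart_dom c) = topspace X"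
    using reg by (auto simp: regular_atlas_def foliated_atlas_def)
  have "\<exists>V. openin M V \<and> x \<in> V \<and> (\<exists>W. V = p ` W \<and> ball_sheet W \<and> small \<U> W \<and> W \<noteq> {})"
    if x: "x \<in> topspace M" for x
  proof -
    obtain e where e: "e \<in> topspace E" "x = p e" using x p_surj by blast
    obtain A where A: "openin E A" "e \<in> A" "small \<U> A" using small_nbhd[OF UF cov e(1)] by blast
    obtain W where W: "ball_sheet W" "e \<in> W" "W \<subseteq> A" using small_ball_sheet[OF A(1,2)] by blast
    have "openin M (p ` W)" "x \<in> p ` W" "W \<noteq> {}" using p_open[OF ball_sheetD(1)[OF W(1)]] W(2) e by auto
    then show ?thesis using W(1) small_subset[OF A(3) W(3)] by blast
  qed
  from compact_space_subcover[OF M_compact this] obtain \<V> where V: "finite \<V>"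
    "\<And>V. V \<in> \<V> \<Longrightarrow> \<exists>W. V = p ` W \<and> ball_sheet W \<and> small \<U> W \<and> W \<noteq> {}" "topspace M \<subseteq> \<Union>\<V>" by metis
  from V(2) have "\<forall>V\<in>\<V>. \<exists>W. V = p ` W \<and> ball_sheet W \<and> small \<U> W \<and> W \<noteq> {}" by blast
  then obtain w where w: "\<forall>V\<in>\<V>. V = p ` w V \<and> ball_sheet (w V) \<and> small \<U> (w V) \<and> w V \<noteq> {}"
    by (rule bchoice[THEN exE])
  define \<W> where "\<W> = w ` \<V>"
  have W: "finite \<W>" "\<And>W. W \<in> \<W> \<Longrightarrow> ball_sheet W" "\<And>W. W \<in> \<W> \<Longrightarrow> small \<U> W" "\<And>W. W \<in> \<W> \<Longrightarrow> W \<noteq> {}"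
    using V(1) bspec[OF w] by (auto simp: \<W>_def)
  have Wcov: "\<exists>W\<in>\<W>. \<exists>x\<in>W. p e = p x" if "e \<in> topspace E" for e
  proof -
    obtain V where V': "V \<in> \<V>" "p e \<in> V" using V(3) p_in[OF \<open>e \<in> topspace E\<close>] by blast
    have "p e \<in> p ` w V" using bspec[OF w V'(1)] V'(2) by simp
    then show ?thesis using V'(1) unfolding \<W>_def by blast
  qed
  obtain R where R: "\<And>l a. a \<in> wb l \<Longrightarrow>
    \<exists>\<gamma>. pathin E \<gamma> \<and> \<gamma> 0 = e0 \<and> \<gamma> 1 = D a e0 \<and> covers \<U> \<gamma> 0 1 (R * (l + 1))"
    using word_paths[OF UF cov] by metis
  have "\<exists>L. \<forall>x\<in>W. \<exists>\<gamma>. pathin E \<gamma> \<and> \<gamma> 0 = x \<and> \<gamma> 1 = e0 \<and> covers \<U> \<gamma> 0 1 L" if WW: "W \<in> \<W>" for W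
  proof -
    note sW = ball_sheetD[OF W(2)[OF WW]]
    obtain x0 where x0: "x0 \<in> W" using W(4)[OF WW] by blast
    then have "x0 \<in> topspace E" using sW(2) by blast
    then obtain \<gamma> where g: "pathin E \<gamma>" "\<gamma> 0 = x0" "\<gamma> 1 = e0"
      using E_path_connected e0 unfolding path_connected_space_def by blast
    obtain L where L: "covers \<U> \<gamma> 0 1 L" using covers_path[OF UF cov g(1)] by blast
    obtain B \<kappa> where "coord_ball n E W B \<kappa>" using W(2)[OF WW] by (auto simp: ball_sheet_def)
    from coord_ball_path_connected[OF this] have pc: "path_connectedin E W" .
    have "\<exists>\<gamma>. pathin E \<gamma> \<and> \<gamma> 0 = x \<and> \<gamma> 1 = e0 \<and> covers \<U> \<gamma> 0 1 (1 + L)" if x: "x \<in> W" for x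
    proof -
      obtain r where r: "pathin E r" "r ` {0..1} \<subseteq> W" "r 0 = x" "r 1 = x0"
        using pc x x0 unfolding path_connectedin by (metis image_subset_iff_funcset)
      have "covers \<U> r 0 1 1" using r(2) by (intro covers_small[OF W(3)[OF WW]]) auto
      then have "covers \<U> (path_join r \<gamma>) 0 1 (1 + L)" using L r(4) g(2) by (intro covers_path_join) auto
      moreover have "pathin E (path_join r \<gamma>)" using r g by (intro pathin_join) auto
      ultimately show ?thesis using r(3) g(3) by (intro exI[of _ "path_join r \<gamma>"]) (simp add: path_join_def)
    qed
    then show ?thesis by blast
  qed
  then have "\<forall>W\<in>\<W>. \<exists>L. \<forall>x\<in>W. \<exists>\<gamma>. pathin E \<gamma> \<and> \<gamma> 0 = x \<and> \<gamma> 1 = e0 \<and> covers \<U> \<gamma> 0 1 L" by blast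
  then obtain L where L: "\<forall>W\<in>\<W>. \<forall>x\<in>W. \<exists>\<gamma>. pathin E \<gamma> \<and> \<gamma> 0 = x \<and> \<gamma> 1 = e0 \<and> covers \<U> \<gamma> 0 1 (L W)"
    by (rule bchoice[THEN exE])
  define L0 where "L0 = Max (insert 0 (L ` \<W>))"
  have L0: "L W \<le> L0" if "W \<in> \<W>" for W unfolding L0_def using W(1) that by (intro Max_ge) auto
  \<comment> \<open>Since \<open>l \<ge> 1\<close>, this gives \<open>B * l \<ge> L0 + R * (2 * l + 1) + 2\<close>, the length of the contractions below.\<close>
  define B where "B = L0 + 3 * R + 2"
  have paths: "\<exists>\<gamma>. pathin E \<gamma> \<and> \<gamma> 0 = x \<and> \<gamma> 1 = D a e0 \<and> covers \<U> \<gamma> 0 1 (L0 + R * (2 * l + 1))"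
    if "W \<in> \<W>" "x \<in> W" "a \<in> wb (2 * l)" for W x a l
  proof -
    obtain \<gamma> where g: "pathin E \<gamma>" "\<gamma> 0 = x" "\<gamma> 1 = e0" "covers \<U> \<gamma> 0 1 (L W)"
      using bspec[OF bspec[OF L \<open>W \<in> \<W>\<close>] \<open>x \<in> W\<close>] by blast
    obtain \<gamma>' where g': "pathin E \<gamma>'" "\<gamma>' 0 = e0" "\<gamma>' 1 = D a e0" "covers \<U> \<gamma>' 0 1 (R * (2 * l + 1))"
      using R[OF \<open>a \<in> wb (2 * l)\<close>] by blast
    have "covers \<U> (path_join \<gamma> \<gamma>') 0 1 (L W + R * (2 * l + 1))" using g g' by (intro covers_path_join) auto
    then have "covers \<U> (path_join \<gamma> \<gamma>') 0 1 (L0 + R * (2 * l + 1))"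
      using L0[OF \<open>W \<in> \<W>\<close>] by (elim covers_mono) simp
    moreover have "pathin E (path_join \<gamma> \<gamma>')" using g g' by (intro pathin_join) auto
    ultimately show ?thesis using g(2) g'(3) by (intro exI[of _ "path_join \<gamma> \<gamma>'"]) (simp add: path_join_def)
  qed
  define C where "C = 4 * real (card \<W>) + 1"
  have "Cat_bounded X \<F> \<mu> (B * l) \<U> \<le> ennreal (C / card (wb l))" if l: "l \<ge> 1" for l
  proof -
    define N where "N = card (wb l)"
    have N: "N > 0" unfolding N_def using wb_one wb_finite by (auto simp: card_gt_0_iff)
    define adm where "adm U = {H. tangential_contraction X \<F> U H \<and> deformation_length \<U> U H \<le> enat (B * l)}" for U
    define \<tau> where "\<tau> U = (INF H\<in>adm U. \<mu> (H ` (U \<times> {1})))" for U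
    have len: "L0 + R * (2 * l + 1) + 2 \<le> B * l"
    proof -
      have "B * l = L0 * l + 3 * (R * l) + 2 * l" "R * (2 * l + 1) = 2 * (R * l) + R"
        by (simp_all add: B_def algebra_simps)
      moreover have "R \<le> R * l" "L0 \<le> L0 * l" using l by auto
      ultimately show ?thesis using l by linarith
    qed
    obtain T O' V where To: "\<forall>a\<in>wb (2 * l). openin F (T a)" and Td: "disjoint_family_on T (wb (2 * l))"
      and O': "openin F O'" "topspace F \<subseteq> O' \<union> (\<Union>a\<in>wb (2 * l). T a)" and V: "openin F V"
      "(\<Union>a\<in>wb (2 * l). h (inv\<^bsub>G\<^esub> a) ` T a) \<subseteq> V" "measure \<Lambda> V \<le> 2 / card (wb l)" "measure \<Lambda> O' \<le> 2 / card (wb l)"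
      by (rule transversal_partition[of l])
    note T = bspec[OF To] Td
    have tube: "adm (q ` (W \<times> (\<Union>a\<in>J. S a))) \<noteq> {} \<and> \<tau> (q ` (W \<times> (\<Union>a\<in>J. S a))) \<le> ennreal (2 / N)"
      if W': "W \<in> \<W>" and S: "\<And>a. a \<in> J \<Longrightarrow> openin F (S a)" "disjoint_family_on S J" and J: "J \<subseteq> wb (2 * l)"
        and Q: "Q \<in> sets \<Lambda>" "(\<Union>a\<in>J. h (inv\<^bsub>G\<^esub> a) ` S a) \<subseteq> Q" "measure \<Lambda> Q \<le> 2 / N" for W J S Q
    proof -
      let ?U = "q ` (W \<times> (\<Union>a\<in>J. S a))"
      let ?Y = "\<Union>a\<in>J. h (inv\<^bsub>G\<^esub> a) ` S a"
      have Jc: "J \<subseteq> carrier G" using J wb_closed by blast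
      obtain H where H: "tangential_contraction X \<F> ?U H" "deformation_length \<U> ?U H \<le> enat (L0 + R * (2 * l + 1) + 2)"
        "H ` (?U \<times> {1}) = (\<lambda>y. q (e0, y)) ` ?Y"
      proof (rule tube_contraction[OF W(2)[OF W'] W(3)[OF W'] W(4)[OF W'] S Jc])
        show "\<exists>\<gamma>. pathin E \<gamma> \<and> \<gamma> 0 = x \<and> \<gamma> 1 = D a e0 \<and> covers \<U> \<gamma> 0 1 (L0 + R * (2 * l + 1))"
          if "a \<in> J" "x \<in> W" for a x using paths[OF W' \<open>x \<in> W\<close>] J \<open>a \<in> J\<close> by blast
      qed auto
      have Ha: "H \<in> adm ?U" using H(1,2) len unfolding adm_def by (auto intro: order_trans)
      have "openin F (h (inv\<^bsub>G\<^esub> a) ` S a)" if "a \<in> J" for a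
      proof -
        have a: "a \<in> carrier G" "S a \<subseteq> topspace F"
          using \<open>a \<in> J\<close> Jc openin_subset[OF S(1)[OF \<open>a \<in> J\<close>]] by blast+
        show ?thesis unfolding h_inv_image[OF a]
          by (rule openin_continuous_map_preimage[OF h_cont[OF a(1)] S(1)[OF \<open>a \<in> J\<close>]])
      qed
      then have Yo: "openin F ?Y" by (intro openin_Union) blast
      have "\<tau> ?U \<le> \<mu> (H ` (?U \<times> {1}))" unfolding \<tau>_def by (rule INF_lower[OF Ha])
      also have "\<dots> \<le> emeasure \<Lambda> ?Y" unfolding H(3) by (rule \<mu>_fibre_part[OF Yo])
      also have "\<dots> \<le> emeasure \<Lambda> Q" by (rule emeasure_mono[OF Q(2,1)])
      also have "\<dots> \<le> ennreal (2 / N)" unfolding emeasure_eq_measure by (rule ennreal_leI[OF Q(3)])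
      finally show ?thesis using Ha by blast
    qed
    define U1 where "U1 W = q ` (W \<times> (\<Union>a\<in>wb (2 * l). T a))" for W
    define U2 where "U2 W = q ` (W \<times> O')" for W
    define \<D> where "\<D> = U1 ` \<W> \<union> U2 ` \<W>"
    have t1: "adm (U1 W) \<noteq> {} \<and> \<tau> (U1 W) \<le> ennreal (2 / N)" if "W \<in> \<W>" for W
      unfolding U1_def
    proof (rule tube[OF that _ Td order_refl open_\<Lambda>[OF V(1)] V(2)])
      show "measure \<Lambda> V \<le> 2 / N" using V(3) by (simp add: N_def)
    qed (rule T(1))
    have t2: "adm (U2 W) \<noteq> {} \<and> \<tau> (U2 W) \<le> ennreal (2 / N)" if "W \<in> \<W>" for W
    proof -
      have O'F: "O' \<subseteq> topspace F" using O'(1) openin_subset by blast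
      have "h (inv\<^bsub>G\<^esub> \<one>\<^bsub>G\<^esub>) ` O' \<subseteq> O'" using h_one O'F by auto
      then have sub: "(\<Union>a\<in>{\<one>\<^bsub>G\<^esub>}. h (inv\<^bsub>G\<^esub> a) ` O') \<subseteq> O'" by simp
      have "measure \<Lambda> O' \<le> 2 / N" using V(4) by (simp add: N_def)
      moreover have "disjoint_family_on (\<lambda>_. O') {\<one>\<^bsub>G\<^esub>}" by (simp add: disjoint_family_on_def)
      moreover have "{\<one>\<^bsub>G\<^esub>} \<subseteq> wb (2 * l)" using wb_one by simp
      ultimately have "adm (q ` (W \<times> (\<Union>a\<in>{\<one>\<^bsub>G\<^esub>}. O'))) \<noteq> {} \<and>
          \<tau> (q ` (W \<times> (\<Union>a\<in>{\<one>\<^bsub>G\<^esub>}. O'))) \<le> ennreal (2 / N)"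
        using tube[OF that O'(1)] open_\<Lambda>[OF O'(1)] sub by blast
      then show ?thesis unfolding U2_def by simp
    qed
    have \<D>: "finite \<D>" "\<And>U. U \<in> \<D> \<Longrightarrow> adm U \<noteq> {} \<and> \<tau> U \<le> ennreal (2 / N)"
      using W(1) t1 t2 by (auto simp: \<D>_def)
    have "openin F (\<Union>a\<in>wb (2 * l). T a)" using T(1) by (intro openin_Union) blast
    then have \<D>o: "openin X U" if "U \<in> \<D>" for U
      using that O'(1) W(2) ball_sheetD(1) by (auto simp: \<D>_def U1_def U2_def intro!: q_open_Times)
    have \<D>c: "\<Union>\<D> = topspace X"
    proof (intro equalityI subsetI)
      fix u assume "u \<in> \<Union>\<D>"
      then show "u \<in> topspace X" using \<D>o openin_subset by blast
    next
      fix u assume "u \<in> topspace X"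
      then obtain e y where u: "u = q (e, y)" "e \<in> topspace E" "y \<in> topspace F" by (auto simp: topspace_X)
      obtain W x where x: "W \<in> \<W>" "x \<in> W" "p e = p x" using Wcov[OF u(2)] by blast
      have "x \<in> topspace E" using x ball_sheetD(2)[OF W(2)[OF x(1)]] by blast
      then obtain a where a: "a \<in> carrier G" "x = D a e" using D_transport[OF u(2) _ x(3)] by blast
      have ux: "u = q (x, h a y)" using a u q_action by simp
      have "h a y \<in> O' \<union> (\<Union>a\<in>wb (2 * l). T a)" using O'(2) h_in[OF a(1) u(3)] by blast
      then have "u \<in> U1 W \<or> u \<in> U2 W" using ux x(2) unfolding U1_def U2_def by blast
      then show "u \<in> \<Union>\<D>" using x(1) unfolding \<D>_def by blast
    qed
    have "card \<D> \<le> 2 * card \<W>"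
    proof -
      have "card \<D> \<le> card (U1 ` \<W>) + card (U2 ` \<W>)" unfolding \<D>_def by (rule card_Un_le)
      then show ?thesis using card_image_le[OF W(1), of U1] card_image_le[OF W(1), of U2] by linarith
    qed
    then have cD: "real (card \<D>) * (2 / N) \<le> C / N"
      unfolding C_def using N by (simp add: field_simps)
    have "Cat_bounded X \<F> \<mu> (B * l) \<U> \<le> (\<Sum>\<^sub>\<infinity>U\<in>\<D>. \<tau> U)"
      unfolding Cat_bounded_def category_of_def \<tau>_def adm_def
      using \<D>(2) \<D>o \<D>c by (intro INF_lower) (simp add: adm_def)
    also have "\<dots> = (\<Sum>U\<in>\<D>. \<tau> U)" using \<D>(1) by simp
    also have "\<dots> \<le> (\<Sum>U\<in>\<D>. ennreal (2 / N))" using \<D>(2) by (intro sum_mono) blast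
    also have "\<dots> = ennreal (real (card \<D>) * (2 / N))" by (simp add: ennreal_mult[symmetric] ennreal_of_nat_eq_real_of_nat)
    also have "\<dots> \<le> ennreal (C / N)" by (rule ennreal_leI[OF cD])
    finally show ?thesis by (simp add: N_def)
  qed
  then show thesis using that[of B C] by (simp add: B_def C_def)
qed

end

section \<open>Growth types\<close>

lemma growth_le_trans: assumes "growth_le f g" "growth_le g k" shows "growth_le f k"
proof -
  obtain B A where B: "B \<ge> 1" "A > 0" "\<And>m. m \<ge> 1 \<Longrightarrow> f m \<le> A * g (B * m)"
    using assms(1) unfolding growth_le_def by blast
  obtain B' A' where B': "B' \<ge> 1" "A' > 0" "\<And>m. m \<ge> 1 \<Longrightarrow> g m \<le> A' * k (B' * m)"
    using assms(2) unfolding growth_le_def by blast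
  have "f m \<le> (A * A') * k ((B' * B) * m)" if m: "m \<ge> 1" for m
  proof -
    have "f m \<le> A * g (B * m)" by (rule B(3)[OF m])
    also have "\<dots> \<le> A * (A' * k (B' * (B * m)))"
      using B(2) B(1) m by (intro mult_left_mono B'(3)) auto
    finally show ?thesis by (simp add: ac_simps)
  qed
  moreover have "B' * B \<ge> 1" "A * A' > 0" using B B' by auto
  ultimately show ?thesis unfolding growth_le_def by blast
qed

lemma growth_type_cong:
  assumes "growth_le f g" "growth_le g f" shows "growth_type f = growth_type g"
  unfolding growth_type_def using assms growth_le_trans by blast

context group
begin

lemma growth_le_generating_sets:
  assumes S: "symmetric_generating_set G S" and T: "symmetric_generating_set G T"
  shows "growth_le (\<lambda>m. real (card (products_up_to G T m))) (\<lambda>m. real (card (products_up_to G S m)))"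
proof -
  have T': "finite T" "T \<subseteq> carrier G" using T by (auto simp: symmetric_generating_set_def)
  have S': "finite S" "S \<subseteq> carrier G" using S by (auto simp: symmetric_generating_set_def)
  obtain l where l: "l \<ge> 1" "T \<subseteq> products_up_to G S l" by (rule finite_subset_products_up_to[OF S T'])
  have "card (products_up_to G T m) \<le> card (products_up_to G S (l * m))" for m
    by (rule card_mono[OF products_up_to_finite[OF S'(1)] products_up_to_power[OF l(2) S'(2)]])
  then show ?thesis unfolding growth_le_def using l(1) by (intro exI[of _ l] conjI exI[of _ 1]) auto
qed

lemma group_growth_eq:
  assumes S: "symmetric_generating_set G S"
  shows "group_growth G = growth_type (\<lambda>m. real (card (products_up_to G S m)))"
  unfolding group_growth_def
proof (rule the_equality)
  show "\<exists>S'. symmetric_generating_set G S' \<and>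
      growth_type (\<lambda>m. real (card (products_up_to G S m))) = growth_type (\<lambda>m. real (card (products_up_to G S' m)))"
    using S by blast
next
  fix c assume "\<exists>S'. symmetric_generating_set G S' \<and> c = growth_type (\<lambda>m. real (card (products_up_to G S' m)))"
  then obtain S' where S': "symmetric_generating_set G S'"
    and c: "c = growth_type (\<lambda>m. real (card (products_up_to G S' m)))" by blast
  show "c = growth_type (\<lambda>m. real (card (products_up_to G S m)))"
    unfolding c by (rule growth_type_cong[OF growth_le_generating_sets[OF S S'] growth_le_generating_sets[OF S' S]])
qed

end

lemma (in group_hom) image_foldr_mult:
  assumes "set xs \<subseteq> carrier G"
  shows "h (foldr (\<lambda>x y. x \<otimes>\<^bsub>G\<^esub> y) xs \<one>\<^bsub>G\<^esub>) = foldr (\<lambda>x y. x \<otimes>\<^bsub>H\<^esub> y) (map h xs) \<one>\<^bsub>H\<^esub>"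
  using assms by (induction xs) (simp_all add: G.foldr_mult_closed)

lemma (in group_hom) image_products_up_to:
  assumes S: "S \<subseteq> carrier G"
  shows "products_up_to H (h ` S) m = h ` products_up_to G S m"
proof (intro equalityI subsetI)
  fix x assume "x \<in> products_up_to H (h ` S) m"
  then obtain ys where ys: "x = foldr (\<lambda>x y. x \<otimes>\<^bsub>H\<^esub> y) ys \<one>\<^bsub>H\<^esub>" "set ys \<subseteq> h ` S" "length ys \<le> m"
    unfolding products_up_to_def by blast
  have "ys \<in> lists (h ` S)" using ys(2) by (simp add: lists_eq_set)
  then obtain xs where xs: "xs \<in> lists S" "ys = map h xs" unfolding lists_image by (rule imageE)
  have xS: "set xs \<subseteq> S" using xs(1) by (simp add: lists_eq_set)
  have "x = h (foldr (\<lambda>x y. x \<otimes>\<^bsub>G\<^esub> y) xs \<one>\<^bsub>G\<^esub>)"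
    unfolding ys(1) xs(2) by (rule image_foldr_mult[symmetric, OF order_trans[OF xS S]])
  moreover have "foldr (\<lambda>x y. x \<otimes>\<^bsub>G\<^esub> y) xs \<one>\<^bsub>G\<^esub> \<in> products_up_to G S m"
    unfolding products_up_to_def using xS ys(3) xs(2) by auto
  ultimately show "x \<in> h ` products_up_to G S m" by blast
next
  fix x assume "x \<in> h ` products_up_to G S m"
  then obtain xs where xs: "x = h (foldr (\<lambda>x y. x \<otimes>\<^bsub>G\<^esub> y) xs \<one>\<^bsub>G\<^esub>)" "set xs \<subseteq> S" "length xs \<le> m"
    unfolding products_up_to_def by blast
  have "x = foldr (\<lambda>x y. x \<otimes>\<^bsub>H\<^esub> y) (map h xs) \<one>\<^bsub>H\<^esub>"
    unfolding xs(1) by (rule image_foldr_mult[OF order_trans[OF xs(2) S]])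
  moreover have "set (map h xs) \<subseteq> h ` S" "length (map h xs) \<le> m" using xs by auto
  ultimately show "x \<in> products_up_to H (h ` S) m" unfolding products_up_to_def by blast
qed

text \<open>An isomorphism carries balls of a word metric to balls of the corresponding word metric.\<close>

lemma (in group_hom) group_growth_iso:
  assumes S: "symmetric_generating_set G S" and inj: "inj_on h (carrier G)" and surj: "h ` carrier G = carrier H"
  shows "group_growth H = growth_type (\<lambda>m. real (card (products_up_to G S m)))"
proof -
  have S': "finite S" "S \<subseteq> carrier G" "\<one>\<^bsub>G\<^esub> \<in> S" "\<And>s. s \<in> S \<Longrightarrow> inv\<^bsub>G\<^esub> s \<in> S" "generate G S = carrier G"
    using S by (auto simp: symmetric_generating_set_def)
  have "symmetric_generating_set H (h ` S)"
    unfolding symmetric_generating_set_def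
  proof (intro conjI ballI)
    show "finite (h ` S)" using S'(1) by simp
    show "h ` S \<subseteq> carrier H" using S'(2) by auto
    show "\<one>\<^bsub>H\<^esub> \<in> h ` S" using S'(3) hom_one by (metis imageI)
    show "inv\<^bsub>H\<^esub> t \<in> h ` S" if t: "t \<in> h ` S" for t
    proof -
      obtain s where s: "s \<in> S" "t = h s" using t by blast
      have "inv\<^bsub>H\<^esub> t = h (inv\<^bsub>G\<^esub> s)" using s S'(2) by auto
      then show ?thesis using S'(4)[OF s(1)] by blast
    qed
    show "generate H (h ` S) = carrier H" using generate_img[OF S'(2)] S'(5) surj by simp
  qed
  then have "group_growth H = growth_type (\<lambda>m. real (card (products_up_to H (h ` S) m)))"
    by (rule H.group_growth_eq)
  moreover have "card (products_up_to H (h ` S) m) = card (products_up_to G S m)" for m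
    unfolding image_products_up_to[OF S'(2)]
    by (rule card_image[OF inj_on_subset[OF inj G.products_up_to_closed[OF S'(2)]]])
  ultimately show ?thesis by simp
qed

section \<open>The secondary category of a suspension\<close>

context measured_suspension
begin

text \<open>The two estimates, inverted. Where \<open>Cat\<close> is infinite, \<open>1 / \<infinity> = 0\<close> satisfies the first trivially,
  and the upper estimate excludes this case in the second.\<close>

lemma growth_Cat_bounded:
  assumes fin: "finite \<U>" and reg: "regular_atlas n X \<F> \<U>"
  shows "growth_type (\<lambda>m. enn2real (1 / Cat_bounded X \<F> \<mu> m \<U>)) = growth_type (\<lambda>m. real (card (wb m)))"
proof -
  let ?C = "\<lambda>m. Cat_bounded X \<F> \<mu> m \<U>"
  have pos: "0 < card (wb m)" for m using wb_one wb_finite by (auto simp: card_gt_0_iff)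
  obtain K where K: "K \<ge> 1" "\<And>m. ennreal (1 / card (wb (K * m))) \<le> ?C m"
    using Cat_bounded_lower[OF fin reg] by metis
  obtain B and C :: real where B: "B \<ge> 1" "C > 0" "\<And>l. l \<ge> 1 \<Longrightarrow> ?C (B * l) \<le> ennreal (C / card (wb l))"
    using Cat_bounded_upper[OF reg] by metis
  have lower: "enn2real (1 / ?C m) \<le> card (wb (K * m))" for m
  proof (cases "?C m")
    case top then show ?thesis by (simp add: ennreal_divide_top)
  next
    case (real r)
    have "0 < 1 / real (card (wb (K * m)))" using pos by simp
    moreover have le: "1 / card (wb (K * m)) \<le> r" using K(2)[of m] real pos by (simp add: ennreal_le_iff)
    ultimately have r: "0 < r" by linarith
    then have "1 / ?C m = ennreal (1 / r)" unfolding real(2) ennreal_1[symmetric] by (subst divide_ennreal) auto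
    moreover have "1 / r \<le> card (wb (K * m))" using le r pos[of "K * m"] by (simp add: field_simps)
    ultimately show ?thesis using r by simp
  qed
  have upper: "card (wb l) \<le> C * enn2real (1 / ?C (B * l))" if l: "l \<ge> 1" for l
  proof (cases "?C (B * l)")
    case top then show ?thesis using B(3)[OF l] by (simp add: top_unique)
  next
    case (real r)
    have "0 < 1 / real (card (wb (K * (B * l))))" using pos by simp
    moreover have "1 / card (wb (K * (B * l))) \<le> r" using K(2)[of "B * l"] real pos by (simp add: ennreal_le_iff)
    ultimately have r: "0 < r" by linarith
    have "0 \<le> C / card (wb l)" using B(2) by simp
    then have le: "r \<le> C / card (wb l)" using B(3)[OF l] unfolding real(2) by (simp add: ennreal_le_iff)
    have "1 / ?C (B * l) = ennreal (1 / r)" unfolding real(2) ennreal_1[symmetric] using r by (subst divide_ennreal) auto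
    then have "enn2real (1 / ?C (B * l)) = 1 / r" using r by simp
    moreover have "card (wb l) \<le> C * (1 / r)" using le r pos[of l] by (simp add: field_simps)
    ultimately show ?thesis by simp
  qed
  show ?thesis
  proof (rule growth_type_cong)
    show "growth_le (\<lambda>m. enn2real (1 / ?C m)) (\<lambda>m. real (card (wb m)))"
      unfolding growth_le_def using K(1) lower by (intro exI[of _ K] conjI exI[of _ 1]) auto
    show "growth_le (\<lambda>m. real (card (wb m))) (\<lambda>m. enn2real (1 / ?C m))"
      unfolding growth_le_def using B(1,2) upper by (intro exI[of _ B] conjI exI[of _ C]) auto
  qed
qed

lemma Cat_II_eq: "Cat_II n X \<F> \<mu> = growth_type (\<lambda>m. real (card (wb m)))"
  unfolding Cat_II_def
proof (rule the_equality)
  obtain \<U> where "finite \<U>" "regular_atlas n X \<F> \<U>" using regular_atlas_exists by blast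
  then show "\<exists>\<U>. finite \<U> \<and> regular_atlas n X \<F> \<U> \<and>
      growth_type (\<lambda>m. real (card (wb m))) = growth_type (\<lambda>m. enn2real (1 / Cat_bounded X \<F> \<mu> m \<U>))"
    using growth_Cat_bounded by (intro exI[of _ \<U>]) simp
next
  fix c assume "\<exists>\<U>. finite \<U> \<and> regular_atlas n X \<F> \<U> \<and> c = growth_type (\<lambda>m. enn2real (1 / Cat_bounded X \<F> \<mu> m \<U>))"
  then show "c = growth_type (\<lambda>m. real (card (wb m)))" using growth_Cat_bounded by auto
qed

text \<open>Since the action is free and \<open>F\<close> is nonempty, \<open>h\<close> is an isomorphism onto its image.\<close>

lemma Cat_II_eq_group_growth:
  fixes \<Gamma> (structure)
  assumes hom: "group \<Gamma>" "h \<in> hom G \<Gamma>" "h ` carrier G = carrier \<Gamma>"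
  shows "Cat_II n X \<F> \<mu> = group_growth \<Gamma>"
proof -
  interpret \<Gamma>: group_hom G \<Gamma> h using group_G hom by (simp add: group_hom_def group_hom_axioms_def)
  have "topspace F \<noteq> {}" using prob_space.not_empty[OF prob_\<Lambda>] by (simp add: space_\<Lambda>)
  then obtain y where y: "y \<in> topspace F" by blast
  have "inj_on h (carrier G)"
  proof (rule inj_onI)
    fix a b assume ab: "a \<in> carrier G" "b \<in> carrier G" "h a = h b"
    have b': "inv\<^bsub>G\<^esub> b \<in> carrier G" using ab by simp
    have "h (inv\<^bsub>G\<^esub> b \<otimes>\<^bsub>G\<^esub> a) y = h (inv\<^bsub>G\<^esub> b) (h b y)" using h_mult[OF b' ab(1) y] ab(3) by simp
    also have "\<dots> = y" using h_mult[OF b' ab(2) y] h_one[OF y] ab(2) by simp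
    finally have "inv\<^bsub>G\<^esub> b \<otimes>\<^bsub>G\<^esub> a = \<one>\<^bsub>G\<^esub>" using h_free[OF G.m_closed[OF b' ab(1)] y] by blast
    then have "inv\<^bsub>G\<^esub> a = inv\<^bsub>G\<^esub> b" by (rule G.inv_equality[OF _ ab(1) b'])
    then show "a = b" using ab G.inv_inj by (auto dest: inj_onD)
  qed
  then show ?thesis unfolding Cat_II_eq
    using \<Gamma>.group_growth_iso[OF S_symmetric_generating _ hom(3)] by simp
qed

end

theorem proposition6p4:
  fixes n k :: nat
    and M :: "'a topology" and F :: "'f topology"
    and E :: "'e topology" and p :: "'e \<Rightarrow> 'a" and e0 :: 'e
    and h :: "(real \<Rightarrow> 'a) set \<Rightarrow> 'f \<Rightarrow> 'f"
    and \<Lambda> :: "'f measure"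
  defines "G \<equiv> fundamental_group M (p e0)"
  defines "D \<equiv> deck_action E p e0"
  defines "X \<equiv> suspension_space G D h E F"
  defines "\<F> \<equiv> suspension_lamination n G D h E p F"
  defines "\<mu> \<equiv> suspension_measure n G D h E p F e0 \<Lambda>"
  defines "\<Gamma> \<equiv> (homeo_group F)\<lparr>carrier := h ` carrier G\<rparr>"
  assumes M: "compact_manifold n M" "connected_space M"
    and F: "compact_manifold k F"
    and E: "universal_cover E M p" "e0 \<in> topspace E"
    and h: "h \<in> hom G (homeo_group F)"
    and rohlin: "rohlin_group \<Gamma> (discrete_topology (carrier \<Gamma>))"
    and free: "free_action G (topspace F) h"
    and \<Lambda>: "sets \<Lambda> = sets (borel_of F)" "prob_space \<Lambda>" "regular_measure F \<Lambda>"
      "invariant_measure G h \<Lambda>"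
    and cat_zero: "Cat X \<F> \<mu> = 0"
  shows "Cat_II n X \<F> \<mu> = group_growth \<Gamma>"
proof -
  have manM: "topological_manifold n M" using M(1) by (simp add: compact_manifold_def)
  have cov: "covering_projection E M p" and sc: "simply_connected_space E"
    using E(1) by (auto simp: universal_cover_def)
  have ball: "\<exists>W B \<kappa>. coord_ball n E W B \<kappa> \<and> e \<in> W \<and> W \<subseteq> N \<and> inj_on p W"
    if N: "openin E N" "e \<in> N" for e N
    using covering_coord_ball[OF manM cov N] by metis
  interpret pc: pointed_covering E M p e0
  proof
    fix e N assume N: "openin E N" "e \<in> N"
    obtain W B \<kappa> where W: "coord_ball n E W B \<kappa>" "e \<in> W" "W \<subseteq> N" using ball[OF N] by blast
    have "openin E W" using W(1) by (simp add: coord_ball_def)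
    then show "\<exists>V. openin E V \<and> e \<in> V \<and> V \<subseteq> N \<and> path_connectedin E V"
      using W coord_ball_path_connected[OF W(1)] by blast
  qed (use E in auto)
  have one_G: "\<one>\<^bsub>G\<^esub> \<in> carrier G" unfolding G_def using pc.group_pi1 by (simp add: group.is_monoid)
  have hD: "h a \<in> Bij (topspace F)" "homeomorphic_map F F (h a)" if "a \<in> carrier G" for a
    using h that by (auto simp: homeo_group_def hom_def Pi_iff)
  have h_mult': "h (a \<otimes>\<^bsub>G\<^esub> b) = compose (topspace F) (h a) (h b)" if "a \<in> carrier G" "b \<in> carrier G" for a b
    using hom_mult[OF h that] hD(1) that by (simp add: homeo_group_def BijGroup_def)
  have stab: "{a \<in> carrier G. h a y = y} = {\<one>\<^bsub>G\<^esub>}" if "y \<in> topspace F" for y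
    using free that by (simp add: free_action_def stabilizer_def)
  interpret measured_suspension n M E p F G D h e0 \<Lambda>
  proof (intro measured_suspension.intro suspension.intro measured_suspension_axioms.intro)
    show "group G" unfolding G_def by (rule pc.group_pi1)
    show "compact_space M" "Hausdorff_space M"
      using M(1) by (auto simp: compact_manifold_def topological_manifold_def)
    show "continuous_map E M p" "p ` topspace E = topspace M" using cov by (auto simp: covering_projection_def)
    show "openin M (p ` N)" if "openin E N" for N by (rule covering_open_map[OF cov that])
    show "path_connected_space E" using sc by (simp add: simply_connected_space_def)
    show "e0 \<in> topspace E" by (rule E(2))
    show "\<exists>W B \<kappa>. coord_ball n E W B \<kappa> \<and> e \<in> W \<and> W \<subseteq> N \<and> inj_on p W" if "openin E N" "e \<in> N" for e N
      by (rule ball[OF that])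
    show "continuous_map E E (D a)" if "a \<in> carrier G" for a
      using homeomorphic_imp_continuous_map pc.deck_action_homeomorphic(1) that by (auto simp: G_def D_def)
    show "p (D a e) = p e" if "a \<in> carrier G" "e \<in> topspace E" for a e
      using pc.deck_action_homeomorphic(2) that by (simp add: G_def D_def)
    show "D (a \<otimes>\<^bsub>G\<^esub> b) e = D a (D b e)" if "a \<in> carrier G" "b \<in> carrier G" "e \<in> topspace E" for a b e
      using pc.deck_action_mult that by (simp add: G_def D_def)
    show "\<exists>!a. a \<in> carrier G \<and> D a e = e'" if "e \<in> topspace E" "e' \<in> topspace E" "p e = p e'" for e e'
      using pc.deck_action_simply_transitive[OF that] by (simp add: G_def D_def)
    show "compact_space F" "Hausdorff_space F" "second_countable F"
      using F by (auto simp: compact_manifold_def topological_manifold_def)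
    show "continuous_map F F (h a)" if "a \<in> carrier G" for a
      by (rule homeomorphic_imp_continuous_map[OF hD(2)[OF that]])
    show "h (a \<otimes>\<^bsub>G\<^esub> b) y = h a (h b y)" if "a \<in> carrier G" "b \<in> carrier G" "y \<in> topspace F" for a b y
      unfolding h_mult'[OF that(1,2)] using that(3) by (simp add: compose_def)
    show "h \<one>\<^bsub>G\<^esub> y = y" if "y \<in> topspace F" for y using stab[OF that] by blast
    show "a = \<one>\<^bsub>G\<^esub>" if "a \<in> carrier G" "y \<in> topspace F" "h a y = y" for a y
      using stab[OF that(2)] that(1,3) by blast
    show "sets \<Lambda> = sets (borel_of F)" "prob_space \<Lambda>" "regular_measure F \<Lambda>" by (rule \<Lambda>(1-3))+
    show "h a ` B \<in> sets \<Lambda> \<and> emeasure \<Lambda> (h a ` B) = emeasure \<Lambda> B" if "a \<in> carrier G" "B \<in> sets \<Lambda>" for a B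
      using \<Lambda>(4) that unfolding invariant_measure_def by blast
  qed
  have "group \<Gamma>" using rohlin by (simp add: rohlin_group_def lcsc_group_def)
  moreover have "h \<in> hom G \<Gamma>" using h by (auto simp: hom_def \<Gamma>_def)
  moreover have "h ` carrier G = carrier \<Gamma>" by (simp add: \<Gamma>_def)
  ultimately show ?thesis unfolding X_def \<F>_def \<mu>_def by (rule Cat_II_eq_group_growth)
qed

end
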